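(* Let $C$ be a general curve (in the sense of Brill–Noether) of genus $g\ge 2$ over an algebraically closed field of characteristic zero, and let $L$ be a globally generated line bundle of degree $d$ on $C$ with $h^0(C,L)=r+1$, $r\ge 1$. Let $M_L=\ker(H^0(C,L)\otimes\mathcal O_C\to L)$. Then $M_L$ is semistable. Moreover, if there exists a nonzero proper subbundle $S\subset M_L$, of rank $s$, such that $\mu(S)=\mu(M_L)$, then: (1) $h^1(C,L)=0$; (2) $s=r-1$; (3) $d=g+r$ and $r$ divides $g$.
   Context: Curves are smooth, irreducible and projective. $C$ is general in the sense of Brill–Noether if for every line bundle $A$ on $C$ of degree $e$ with $h^0(C,A)\ge k+1$ (where $e\geq 1$ and $k\ge 1$) the Brill–Noether number is nonnegative: $g-(k+1)(g-e+k)\ge 0$. The slope of a nonzero vector bundle $E$ is $\mu(E)=\deg(E)/\operatorname{rk}(E)$; semistability means slope semistability. *)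

theory Defs
  imports
    "HOL-Library.Poly_Mapping"
    "HOL-Library.Extended_Nat"
    "HOL-Library.Cardinality"
    "HOL-Library.Function_Algebras"
    "HOL-Computational_Algebra.Polynomial"
    "HOL-Analysis.Function_Topology"
    "Jordan_Normal_Form.Determinant"
begin

section \<open>Projective space and the Zariski topology\<close>

text \<open>
  The homogeneous coordinates are indexed by a finite type \<open>'n\<close>, so the ambient space is the
  projective space of dimension \<open>CARD('n) - 1\<close>.  Polynomials in these coordinates are finitely
  supported maps from exponent vectors to coefficients.  A point is the set of all its vectors of
  homogeneous coordinates, that is, a line through the origin with the origin removed.
\<close>

type_synonym ('n, 'k) mpoly = "('n \<Rightarrow>\<^sub>0 nat) \<Rightarrow>\<^sub>0 'k"
type_synonym ('n, 'k) point = "('n \<Rightarrow> 'k) set"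

definition peval :: "('n::finite, 'k::field) mpoly \<Rightarrow> ('n \<Rightarrow> 'k) \<Rightarrow> 'k" where
  "peval F x =
     (\<Sum>m\<in>Poly_Mapping.keys F. Poly_Mapping.lookup F m * (\<Prod>i\<in>UNIV. x i ^ Poly_Mapping.lookup m i))"

text \<open>The value at \<open>x\<close> of the formal partial derivative of \<open>F\<close> in the \<open>i\<close>-th coordinate.\<close>

definition partial_eval :: "'n \<Rightarrow> ('n::finite, 'k::field) mpoly \<Rightarrow> ('n \<Rightarrow> 'k) \<Rightarrow> 'k" where
  "partial_eval i F x =
     (\<Sum>m\<in>Poly_Mapping.keys F. Poly_Mapping.lookup F m *
        of_nat (Poly_Mapping.lookup m i) * x i ^ (Poly_Mapping.lookup m i - 1)
        * (\<Prod>j\<in>UNIV - {i}. x j ^ Poly_Mapping.lookup m j))"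

definition homogeneous :: "nat \<Rightarrow> ('n::finite, 'k::field) mpoly \<Rightarrow> bool" where
  "homogeneous e F \<longleftrightarrow> (\<forall>m\<in>Poly_Mapping.keys F. (\<Sum>i\<in>UNIV. Poly_Mapping.lookup m i) = e)"

definition proj_space :: "('n::finite, 'k::field) point set" where
  "proj_space = {{\<lambda>i. c * x i |c. c \<noteq> 0} |x. \<exists>i. x i \<noteq> 0}"

definition basic_open :: "('n::finite, 'k::field) mpoly \<Rightarrow> ('n, 'k) point set" where
  "basic_open F = {p \<in> proj_space. \<forall>x\<in>p. peval F x \<noteq> 0}"

definition zariski :: "('n::finite, 'k::field) point topology" where
  "zariski = topology_generated_by {basic_open F |F. \<exists>e. homogeneous e F}"

abbreviation open_on :: "('n::finite, 'k::field) point set \<Rightarrow> ('n, 'k) point set \<Rightarrow> bool" where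
  "open_on C U \<equiv> openin (subtopology zariski C) U"

definition irreducible_closed :: "'a topology \<Rightarrow> 'a set \<Rightarrow> bool" where
  "irreducible_closed T Z \<longleftrightarrow> closedin T Z \<and> Z \<noteq> {} \<and>
     (\<forall>A B. closedin T A \<and> closedin T B \<and> Z = A \<union> B \<longrightarrow> Z = A \<or> Z = B)"

definition krull_dim :: "'a topology \<Rightarrow> enat" where
  "krull_dim T = Sup {enat m |m. \<exists>Z. (\<forall>i\<le>m. irreducible_closed T (Z i)) \<and>
                                     (\<forall>i<m. Z i \<subset> Z (Suc i))}"

section \<open>Smooth projective curves\<close>

definition vanishing_on :: "('n::finite, 'k::field) point set \<Rightarrow> ('n, 'k) mpoly \<Rightarrow> bool" where
  "vanishing_on C F \<longleftrightarrow> (\<exists>e. homogeneous e F) \<and> (\<forall>p\<in>C. \<forall>x\<in>p. peval F x = 0)"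

definition pointwise_scale :: "'k::field \<Rightarrow> ('a \<Rightarrow> 'k) \<Rightarrow> 'a \<Rightarrow> 'k" where
  "pointwise_scale c f = (\<lambda>x. c * f x)"

text \<open>
  Smoothness is the Jacobian criterion: at every point of \<open>C\<close> the gradients of the homogeneous
  equations of \<open>C\<close> have rank \<open>dim \<P> - dim C = (CARD('n) - 1) - 1\<close>.
\<close>

definition smooth_projective_curve :: "('n::finite, 'k::field) point set \<Rightarrow> bool" where
  "smooth_projective_curve C \<longleftrightarrow>
     irreducible_closed zariski C \<and>
     krull_dim (subtopology zariski C) = 1 \<and>
     (\<forall>p\<in>C. \<forall>x\<in>p. vector_space.dim pointwise_scale
        {(\<lambda>i. partial_eval i F x) |F. vanishing_on C F} + 2 = CARD('n))"

section \<open>Sheaves of functions and vector bundles\<close>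

text \<open>
  A vector bundle on \<open>C\<close> is a family of finite-dimensional vector spaces (its fibres)
  with a sheaf of regular sections that is locally free.  The fibres are taken
  inside one ambient vector space \<open>'v\<close> with scalar multiplication \<open>sc\<close>, and the bundle is given by
  its sheaf \<open>E\<close> of regular sections: \<open>E U\<close> is a set of functions sending each point of \<open>U\<close> to a
  vector of the fibre there.  As functions in HOL are total, sections over \<open>U\<close> are extended by 0
  outside \<open>U\<close>.  The values of \<open>E\<close> on sets that are not open are irrelevant.

  The fibres of an algebraic line bundle are one-dimensional, and after choosing a basis vector
  of each fibre (with no compatibility between different points) every line bundle becomes one
  whose fibres are all equal to \<open>'k\<close> itself; so line bundles are represented with \<open>'v = 'k\<close>
  without loss of generality.  The nontriviality of the bundle sits in its sheaf of regular
  sections, which need not consist of regular functions.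
\<close>

type_synonym ('n, 'k, 'v) fun_sheaf = "('n, 'k) point set \<Rightarrow> (('n, 'k) point \<Rightarrow> 'v) set"

definition restrict_to :: "'a set \<Rightarrow> ('a \<Rightarrow> 'v::zero) \<Rightarrow> 'a \<Rightarrow> 'v" where
  "restrict_to V f = (\<lambda>p. if p \<in> V then f p else 0)"

definition is_fun_sheaf ::
    "('n::finite, 'k::field) point set \<Rightarrow> ('n, 'k, 'v::zero) fun_sheaf \<Rightarrow> bool" where
  "is_fun_sheaf C E \<longleftrightarrow>
     (\<forall>U f. open_on C U \<and> f \<in> E U \<longrightarrow> (\<forall>p. p \<notin> U \<longrightarrow> f p = 0)) \<and>
     (\<forall>U V f. open_on C U \<and> open_on C V \<and> V \<subseteq> U \<and> f \<in> E U \<longrightarrow> restrict_to V f \<in> E V) \<and>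
     (\<forall>U f. open_on C U \<and> (\<forall>p. p \<notin> U \<longrightarrow> f p = 0) \<and>
        (\<forall>p\<in>U. \<exists>V. open_on C V \<and> p \<in> V \<and> V \<subseteq> U \<and> restrict_to V f \<in> E V) \<longrightarrow> f \<in> E U)"

text \<open>The structure sheaf.\<close>

definition regular :: "('n::finite, 'k::field) point set \<Rightarrow> ('n, 'k, 'k) fun_sheaf" where
  "regular C U = {f. (\<forall>p. p \<notin> U \<longrightarrow> f p = 0) \<and>
     (\<forall>p\<in>U. \<exists>V e F G. open_on C V \<and> p \<in> V \<and> V \<subseteq> U \<and> homogeneous e F \<and> homogeneous e G \<and>
        (\<forall>q\<in>V. \<forall>x\<in>q. peval G x \<noteq> 0 \<and> f q = peval F x / peval G x))}"

text \<open>
  A local frame over \<open>N\<close>: its values are linearly independent at each point, and the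
  sections over any open \<open>V \<subseteq> N\<close> are its combinations with regular coefficients.
\<close>

definition local_frame ::
    "('k::field \<Rightarrow> 'v::ab_group_add \<Rightarrow> 'v) \<Rightarrow> ('n::finite, 'k) point set \<Rightarrow> nat \<Rightarrow>
     ('n, 'k, 'v) fun_sheaf \<Rightarrow> ('n, 'k) point set \<Rightarrow> (nat \<Rightarrow> ('n, 'k) point \<Rightarrow> 'v) \<Rightarrow> bool" where
  "local_frame sc C n E N e \<longleftrightarrow>
     open_on C N \<and>
     (\<forall>q\<in>N. \<forall>c. (\<Sum>i<n. sc (c i) (e i q)) = 0 \<longrightarrow> (\<forall>i<n. c i = 0)) \<and>
     (\<forall>V. open_on C V \<and> V \<subseteq> N \<longrightarrow>
        E V = {(\<lambda>q. \<Sum>i<n. sc (f i q) (e i q)) |f. \<forall>i<n. f i \<in> regular C V})"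

definition vector_bundle ::
    "('k::field \<Rightarrow> 'v::ab_group_add \<Rightarrow> 'v) \<Rightarrow> ('n::finite, 'k) point set \<Rightarrow> nat \<Rightarrow>
     ('n, 'k, 'v) fun_sheaf \<Rightarrow> bool" where
  "vector_bundle sc C n E \<longleftrightarrow>
     is_fun_sheaf C E \<and> (\<forall>p\<in>C. \<exists>N e. p \<in> N \<and> local_frame sc C n E N e)"

definition vb_rank ::
    "('k::field \<Rightarrow> 'v::ab_group_add \<Rightarrow> 'v) \<Rightarrow> ('n::finite, 'k) point set \<Rightarrow>
     ('n, 'k, 'v) fun_sheaf \<Rightarrow> nat" where
  "vb_rank sc C E = (THE n. vector_bundle sc C n E)"

definition line_bundle ::
    "('n::finite, 'k::field) point set \<Rightarrow> ('n, 'k, 'k) fun_sheaf \<Rightarrow> bool" where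
  "line_bundle C A \<longleftrightarrow> vector_bundle (*) C 1 A"

text \<open>
  Since local frames of \<open>S\<close> and \<open>E\<close> are linearly independent at every point, the condition
  \<open>S U \<subseteq> E U\<close> makes the fibres of \<open>S\<close> linear subspaces of those of \<open>E\<close>; so \<open>S\<close> is
  a subbundle (with locally free quotient), not merely a locally free subsheaf.
\<close>

definition subbundle ::
    "('k::field \<Rightarrow> 'v::ab_group_add \<Rightarrow> 'v) \<Rightarrow> ('n::finite, 'k) point set \<Rightarrow>
     ('n, 'k, 'v) fun_sheaf \<Rightarrow> ('n, 'k, 'v) fun_sheaf \<Rightarrow> bool" where
  "subbundle sc C S E \<longleftrightarrow>
     (\<exists>s. vector_bundle sc C s S) \<and> (\<exists>n. vector_bundle sc C n E) \<and>
     (\<forall>U. open_on C U \<longrightarrow> S U \<subseteq> E U)"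

definition proper_subbundle ::
    "('k::field \<Rightarrow> 'v::ab_group_add \<Rightarrow> 'v) \<Rightarrow> ('n::finite, 'k) point set \<Rightarrow>
     ('n, 'k, 'v) fun_sheaf \<Rightarrow> ('n, 'k, 'v) fun_sheaf \<Rightarrow> bool" where
  "proper_subbundle sc C S E \<longleftrightarrow> subbundle sc C S E \<and> (\<exists>U. open_on C U \<and> S U \<noteq> E U)"

definition nonzero_bundle ::
    "('n::finite, 'k::field) point set \<Rightarrow> ('n, 'k, 'v::zero) fun_sheaf \<Rightarrow> bool" where
  "nonzero_bundle C E \<longleftrightarrow> (\<exists>U f p. open_on C U \<and> f \<in> E U \<and> f p \<noteq> 0)"

section \<open>Degree, slope and semistability\<close>

text \<open>\<open>t\<close> is regular on \<open>N\<close> and generates the maximal ideal of the local ring of \<open>C\<close> at \<open>p\<close>.\<close>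

definition uniformizer ::
    "('n::finite, 'k::field) point set \<Rightarrow> ('n, 'k) point \<Rightarrow> ('n, 'k) point set \<Rightarrow>
     (('n, 'k) point \<Rightarrow> 'k) \<Rightarrow> bool" where
  "uniformizer C p N t \<longleftrightarrow>
     open_on C N \<and> p \<in> N \<and> t \<in> regular C N \<and> t p = 0 \<and>
     (\<forall>V f. open_on C V \<and> p \<in> V \<and> f \<in> regular C V \<and> f p = 0 \<longrightarrow>
        (\<exists>W g. open_on C W \<and> p \<in> W \<and> W \<subseteq> V \<inter> N \<and> g \<in> regular C W \<and>
           (\<forall>q\<in>W. f q = t q * g q)))"

text \<open>
  A function \<open>h\<close> that is regular on a nonempty open set \<open>U\<close> (a rational function on \<open>C\<close>)
  has order \<open>m\<close> at \<open>p\<close>; \<open>p\<close> need not belong to \<open>U\<close>.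
\<close>

definition has_order ::
    "('n::finite, 'k::field) point set \<Rightarrow> ('n, 'k) point \<Rightarrow> ('n, 'k) point set \<Rightarrow>
     (('n, 'k) point \<Rightarrow> 'k) \<Rightarrow> int \<Rightarrow> bool" where
  "has_order C p U h m \<longleftrightarrow>
     (\<exists>N t u. uniformizer C p N t \<and> u \<in> regular C N \<and> (\<forall>q\<in>N. u q \<noteq> 0) \<and>
        (\<forall>q\<in>U \<inter> N - {p}. h q = t q powi m * u q))"

text \<open>
  For sections \<open>\<sigma> 0, \<dots>, \<sigma> (n - 1)\<close> over \<open>U\<close> of a bundle \<open>E\<close> of rank \<open>n\<close>: the order at \<open>p\<close> of
  \<open>\<sigma> 0 \<and> \<dots> \<and> \<sigma> (n - 1)\<close>, seen as a rational section of the line bundle \<open>det E\<close>, is the order of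
  the determinant of the coordinates with respect to a local frame at \<open>p\<close>.
\<close>

definition has_wedge_order ::
    "('k::field \<Rightarrow> 'v::ab_group_add \<Rightarrow> 'v) \<Rightarrow> ('n::finite, 'k) point set \<Rightarrow> nat \<Rightarrow>
     ('n, 'k, 'v) fun_sheaf \<Rightarrow> ('n, 'k) point \<Rightarrow> ('n, 'k) point set \<Rightarrow>
     (nat \<Rightarrow> ('n, 'k) point \<Rightarrow> 'v) \<Rightarrow> int \<Rightarrow> bool" where
  "has_wedge_order sc C n E p U \<sigma> m \<longleftrightarrow>
     (\<exists>N e a. p \<in> N \<and> local_frame sc C n E N e \<and>
        (\<forall>q\<in>U \<inter> N. \<forall>i<n. \<sigma> i q = (\<Sum>j<n. sc (a i j q) (e j q))) \<and>
        has_order C p (U \<inter> N) (\<lambda>q. det (mat n n (\<lambda>(i, j). a i j q))) m)"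

text \<open>
  \<open>deg E\<close> is the degree of \<open>det E\<close>, that is, the degree of the divisor of any
  nonzero rational section; here \<open>m\<close> is the divisor of \<open>\<sigma> 0 \<and> \<dots> \<and> \<sigma> (n - 1)\<close>.  No order
  exists if the wedge product vanishes identically.
\<close>

definition vb_degree ::
    "('k::field \<Rightarrow> 'v::ab_group_add \<Rightarrow> 'v) \<Rightarrow> ('n::finite, 'k) point set \<Rightarrow>
     ('n, 'k, 'v) fun_sheaf \<Rightarrow> int" where
  "vb_degree sc C E =
     (THE d. \<exists>U \<sigma> m. open_on C U \<and> U \<noteq> {} \<and> (\<forall>i<vb_rank sc C E. \<sigma> i \<in> E U) \<and>
        (\<forall>p\<in>C. has_wedge_order sc C (vb_rank sc C E) E p U \<sigma> (m p)) \<and>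
        finite {p\<in>C. m p \<noteq> 0} \<and> d = (\<Sum>p\<in>{p\<in>C. m p \<noteq> 0}. m p))"

definition slope ::
    "('k::field \<Rightarrow> 'v::ab_group_add \<Rightarrow> 'v) \<Rightarrow> ('n::finite, 'k) point set \<Rightarrow>
     ('n, 'k, 'v) fun_sheaf \<Rightarrow> rat" where
  "slope sc C E = of_int (vb_degree sc C E) / of_nat (vb_rank sc C E)"

definition semistable ::
    "('k::field \<Rightarrow> 'v::ab_group_add \<Rightarrow> 'v) \<Rightarrow> ('n::finite, 'k) point set \<Rightarrow>
     ('n, 'k, 'v) fun_sheaf \<Rightarrow> bool" where
  "semistable sc C E \<longleftrightarrow>
     (\<exists>n. vector_bundle sc C n E) \<and> nonzero_bundle C E \<and>
     (\<forall>S. subbundle sc C S E \<and> nonzero_bundle C S \<longrightarrow> slope sc C S \<le> slope sc C E)"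

section \<open>Cohomology\<close>

definition H0 :: "('n::finite, 'k::field) point set \<Rightarrow> ('n, 'k, 'k) fun_sheaf \<Rightarrow>
    (('n, 'k) point \<Rightarrow> 'k) set" where
  "H0 C A = A C"

definition h0 :: "('n::finite, 'k::field) point set \<Rightarrow> ('n, 'k, 'k) fun_sheaf \<Rightarrow> nat" where
  "h0 C A = vector_space.dim pointwise_scale (H0 C A)"

text \<open>
  \<open>H\<^sup>1\<close> is Cech cohomology, the direct limit of \<open>Z\<^sup>1(U, A) / B\<^sup>1(U, A)\<close> over all
  open covers \<open>U\<close>.  Following Godement, the covers are indexed by the points of \<open>C\<close> with
  \<open>p \<in> U p\<close>; every cover is refined by one of these, and refinement between them is inclusion at
  each index.
\<close>

definition open_cover ::
    "('n::finite, 'k::field) point set \<Rightarrow> (('n, 'k) point \<Rightarrow> ('n, 'k) point set) \<Rightarrow> bool" where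
  "open_cover C U \<longleftrightarrow> (\<forall>p\<in>C. open_on C (U p) \<and> p \<in> U p)"

definition cocycle ::
    "('n::finite, 'k::field) point set \<Rightarrow> ('n, 'k, 'k) fun_sheaf \<Rightarrow>
     (('n, 'k) point \<Rightarrow> ('n, 'k) point set) \<Rightarrow>
     (('n, 'k) point \<Rightarrow> ('n, 'k) point \<Rightarrow> ('n, 'k) point \<Rightarrow> 'k) \<Rightarrow> bool" where
  "cocycle C A U f \<longleftrightarrow>
     (\<forall>p\<in>C. \<forall>q\<in>C. f p q \<in> A (U p \<inter> U q)) \<and>
     (\<forall>p\<in>C. \<forall>q\<in>C. \<forall>r\<in>C. \<forall>x\<in>U p \<inter> U q \<inter> U r. f p q x + f q r x = f p r x)"

text \<open>The class of the cocycle \<open>f\<close> on the cover \<open>U\<close> is zero in the direct limit.\<close>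

definition zero_class ::
    "('n::finite, 'k::field) point set \<Rightarrow> ('n, 'k, 'k) fun_sheaf \<Rightarrow>
     (('n, 'k) point \<Rightarrow> ('n, 'k) point set) \<Rightarrow>
     (('n, 'k) point \<Rightarrow> ('n, 'k) point \<Rightarrow> ('n, 'k) point \<Rightarrow> 'k) \<Rightarrow> bool" where
  "zero_class C A U f \<longleftrightarrow>
     (\<exists>W g. open_cover C W \<and> (\<forall>p\<in>C. W p \<subseteq> U p \<and> g p \<in> A (W p)) \<and>
        (\<forall>p\<in>C. \<forall>q\<in>C. \<forall>x\<in>W p \<inter> W q. f p q x = g q x - g p x))"

text \<open>
  The dimension of \<open>H\<^sup>1\<close> is the largest number of linearly independent classes; finitely many
  classes are always represented by cocycles on a common cover.
\<close>

definition h1 :: "('n::finite, 'k::field) point set \<Rightarrow> ('n, 'k, 'k) fun_sheaf \<Rightarrow> enat" where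
  "h1 C A = Sup {enat (card T) |U T. open_cover C U \<and> finite T \<and> (\<forall>f\<in>T. cocycle C A U f) \<and>
     (\<forall>c. zero_class C A U (\<lambda>p q x. \<Sum>f\<in>T. c f * f p q x) \<longrightarrow> (\<forall>f\<in>T. c f = 0))}"

definition genus :: "('n::finite, 'k::field) point set \<Rightarrow> enat" where
  "genus C = h1 C (regular C)"

section \<open>Brill--Noether generality and kernel bundles\<close>

definition brill_noether_general :: "('n::finite, 'k::field) point set \<Rightarrow> bool" where
  "brill_noether_general C \<longleftrightarrow>
     (\<forall>(g::nat) A (e::int) (k::nat).
        genus C = enat g \<and> line_bundle C A \<and> vb_degree (*) C A = e \<and> e \<ge> 1 \<and> k \<ge> 1 \<and>
        h0 C A \<ge> k + 1 \<longrightarrow>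
        int g - (int k + 1) * (int g - e + int k) \<ge> 0)"

text \<open>
  The sheaf of sections of \<open>H\<^sup>0(C, L) \<otimes> \<O>\<close>, the trivial bundle with fibre \<open>H\<^sup>0(C, L)\<close>.  A section
  \<open>\<phi>\<close> sends a point to a global section of \<open>L\<close>, and its image in \<open>L\<close> under
  the evaluation map is \<open>\<lambda>p. \<phi> p p\<close>.
\<close>

definition H0_tensor_O :: "('n::finite, 'k::field) point set \<Rightarrow> ('n, 'k, 'k) fun_sheaf \<Rightarrow>
    ('n, 'k, ('n, 'k) point \<Rightarrow> 'k) fun_sheaf" where
  "H0_tensor_O C L U =
     {(\<lambda>p q. \<Sum>j<m. f j p * s j q) |(m::nat) f s. \<forall>j<m. f j \<in> regular C U \<and> s j \<in> H0 C L}"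

text \<open>The evaluation map \<open>H\<^sup>0(C, L) \<otimes> \<O> \<rightarrow> L\<close> is a surjective map of sheaves.\<close>

definition globally_generated ::
    "('n::finite, 'k::field) point set \<Rightarrow> ('n, 'k, 'k) fun_sheaf \<Rightarrow> bool" where
  "globally_generated C L \<longleftrightarrow>
     (\<forall>U \<sigma> p. open_on C U \<and> \<sigma> \<in> L U \<and> p \<in> U \<longrightarrow>
        (\<exists>V \<phi>. open_on C V \<and> p \<in> V \<and> V \<subseteq> U \<and> \<phi> \<in> H0_tensor_O C L V \<and>
           (\<forall>q\<in>V. \<phi> q q = \<sigma> q)))"

definition kernel_bundle :: "('n::finite, 'k::field) point set \<Rightarrow> ('n, 'k, 'k) fun_sheaf \<Rightarrow>
    ('n, 'k, ('n, 'k) point \<Rightarrow> 'k) fun_sheaf" where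
  "kernel_bundle C L U = {\<phi> \<in> H0_tensor_O C L U. \<forall>p\<in>U. \<phi> p p = 0}"

end

theory Submission
  imports Defs
begin

text \<open>
  The local rings of the curve are discrete valuation rings inside the field of rational functions,
  and the genus bounds the number of independent systems of principal parts.  Counting principal
  parts gives \<open>deg L + 1 + h\<^sup>1(L) \<le> h\<^sup>0(L) + g\<close>, which is all of Riemann--Roch that is needed.

  Let \<open>S\<close> be a subbundle of \<open>M = M\<^sub>L\<close> of rank \<open>s < r\<close> and let \<open>A\<close> be the dual of \<open>det S\<close>, so that
  \<open>deg A = - deg S\<close>.  Linear functionals \<open>\<Lambda> 0, \<dots>, \<Lambda> (s - 1)\<close> on \<open>H\<^sup>0(L)\<close> restrict to the fibres of
  \<open>S\<close>, and \<open>\<Lambda> 0 \<and> \<dots> \<and> \<Lambda> (s - 1)\<close> is a section of \<open>A\<close>.  As a nonzero section of \<open>L\<close> lies in the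
  fibre of \<open>M\<close> at finitely many points only, an argument of Paranjape and Ramanan produces \<open>s + 1\<close>
  independent sections of this form.  Brill--Noether generality for \<open>A\<close> then reads
  \<open>s g \<le> (s + 1) (deg A - s)\<close>; together with \<open>s + 1 \<le> r\<close> and \<open>deg L \<le> g + r - h\<^sup>1(L)\<close> it yields
  \<open>s deg L \<le> r deg A\<close>, and equality forces equality in all of these inequalities.
\<close>

text \<open>Bundles are given as sheaves of functions on points, so a function field has to be built
  first. Nonempty open sets of the curve turn out to be cofinite, which makes a rational function a
  function up to changes at finitely many points; \<open>rg p f\<close> stands for regularity of f
  at p, where the value at p counts. Two properties of complete curves are drawn from finiteness. A
  global regular function is constant because its powers times a section of L stay in a
  finite-dimensional space. A principal divisor has degree 0 because multiplication by
  \<open>h ^ n\<close> would otherwise violate dimension bounds for large n; this is also what gives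
  the definite description in \<open>vb_degree\<close> a value. The sections of A exist because all
  fibres of S lie in the one vector space H^0(L), so that a fixed functional restricts to each of
  them. A subbundle of rank r has the same slope as M whatever the curve is; it is dealt with by
  proving, through Cramer's rule, that it is all of M and hence not proper.\<close>

section \<open>Local rings and rational functions up to finitely many points\<close>

locale regular_germs =
  fixes X :: "'p set" and rg :: "'p \<Rightarrow> ('p \<Rightarrow> 'k::field) \<Rightarrow> bool"
  assumes infinite_X: "infinite X"
    and rg_cong: "\<lbrakk>p \<in> X; rg p f; finite {q \<in> X. f q \<noteq> g q}; f p = g p\<rbrakk> \<Longrightarrow> rg p g"
    and rg_near: "\<lbrakk>p \<in> X; rg p f\<rbrakk> \<Longrightarrow> finite {q \<in> X. \<not> rg q f}"
    and rg_const: "p \<in> X \<Longrightarrow> rg p (\<lambda>_. c)"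
    and rg_add: "\<lbrakk>p \<in> X; rg p f; rg p g\<rbrakk> \<Longrightarrow> rg p (\<lambda>q. f q + g q)"
    and rg_mult: "\<lbrakk>p \<in> X; rg p f; rg p g\<rbrakk> \<Longrightarrow> rg p (\<lambda>q. f q * g q)"
    and rg_inverse: "\<lbrakk>p \<in> X; rg p f; f p \<noteq> 0\<rbrakk> \<Longrightarrow> rg p (\<lambda>q. inverse (f q))"
    and rg_open: "\<lbrakk>p \<in> X; rg p f; f p \<noteq> 0\<rbrakk> \<Longrightarrow> finite {q \<in> X. f q = 0}"
begin

text \<open>The neighbourhood filter of the generic point: with cofinite nonempty open sets,
  \<open>eventually P gen\<close> means that \<open>P\<close> holds on a nonempty open set, and
  \<open>\<simeq>\<close> below is equality of rational functions.\<close>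

definition gen :: "'p filter" where "gen = inf cofinite (principal X)"

lemma eventually_gen: "eventually P gen \<longleftrightarrow> finite {q \<in> X. \<not> P q}"
proof -
  have "{x. \<not> (x \<in> X \<longrightarrow> P x)} = {q \<in> X. \<not> P q}" by auto
  then show ?thesis
    by (simp add: gen_def eventually_inf_principal eventually_cofinite)
qed

lemma gen_nonbot: "gen \<noteq> bot"
  using infinite_X eventually_gen[of "\<lambda>_. False"] by (auto simp: trivial_limit_def)

lemma gen_False [simp]: "\<not> eventually (\<lambda>_. False) gen"
  using gen_nonbot by (simp add: trivial_limit_def)

lemma gen_X: "eventually (\<lambda>q. q \<in> X) gen"
  by (simp add: eventually_gen)

lemma gen_const_iff [simp]: "eventually (\<lambda>_. P) gen \<longleftrightarrow> P"
  using gen_False by (cases P) auto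

definition aeq :: "('p \<Rightarrow> 'k) \<Rightarrow> ('p \<Rightarrow> 'k) \<Rightarrow> bool" (infix "\<simeq>" 50)
  where "f \<simeq> g \<longleftrightarrow> eventually (\<lambda>q. f q = g q) gen"

lemma aeq_refl [simp]: "f \<simeq> f" by (simp add: aeq_def)
lemma aeq_sym: "f \<simeq> g \<Longrightarrow> g \<simeq> f" by (simp add: aeq_def eq_commute)
lemma aeq_trans [trans]: "f \<simeq> g \<Longrightarrow> g \<simeq> h \<Longrightarrow> f \<simeq> h"
  unfolding aeq_def by (erule (1) eventually_elim2) simp
lemma aeq_eqI: "(\<And>q. f q = g q) \<Longrightarrow> f \<simeq> g" by (simp add: aeq_def)
lemma aeq_mult: "f \<simeq> g \<Longrightarrow> f' \<simeq> g' \<Longrightarrow> (\<lambda>q. f q * f' q) \<simeq> (\<lambda>q. g q * g' q)"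
  unfolding aeq_def by (erule (1) eventually_elim2) simp
lemma aeq_add: "f \<simeq> g \<Longrightarrow> f' \<simeq> g' \<Longrightarrow> (\<lambda>q. f q + f' q) \<simeq> (\<lambda>q. g q + g' q)"
  unfolding aeq_def by (erule (1) eventually_elim2) simp
lemma aeq_inverse: "f \<simeq> g \<Longrightarrow> (\<lambda>q. inverse (f q)) \<simeq> (\<lambda>q. inverse (g q))"
  unfolding aeq_def by (erule eventually_mono) simp
lemma aeq_const_iff: "(\<lambda>_. a) \<simeq> (\<lambda>_. b) \<longleftrightarrow> a = b"
  by (simp add: aeq_def)

lemma rg_cong': "\<lbrakk>p \<in> X; rg p f; f \<simeq> g; f p = g p\<rbrakk> \<Longrightarrow> rg p g"
  using rg_cong by (simp add: aeq_def eventually_gen)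

lemma rg_diff: "\<lbrakk>p \<in> X; rg p f; rg p g\<rbrakk> \<Longrightarrow> rg p (\<lambda>q. f q - g q)"
  using rg_add[of p f "\<lambda>q. (-1) * g q"] rg_mult[of p "\<lambda>_. -1" g] rg_const[of p "-1"] by simp

lemma rg_gen: "\<lbrakk>p \<in> X; rg p f\<rbrakk> \<Longrightarrow> eventually (\<lambda>q. rg q f) gen"
  using rg_near by (simp add: eventually_gen)

text \<open>A difference that is nonzero at p would, by \<open>rg_open\<close>, be nonzero at almost
  all points. So the value at p is determined by the values elsewhere, which makes
  \<open>val\<close> well defined.\<close>

lemma rg_unique: assumes "p \<in> X" "rg p f" "rg p g" "f \<simeq> g" shows "f p = g p"
proof (rule ccontr)
  assume "f p \<noteq> g p"
  then have "finite {q \<in> X. f q - g q = 0}"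
    using rg_open[OF assms(1) rg_diff[OF assms(1-3)]] by simp
  then have "eventually (\<lambda>q. f q \<noteq> g q) gen" by (simp add: eventually_gen)
  with assms(4) have "eventually (\<lambda>_. False) gen"
    unfolding aeq_def by eventually_elim simp
  then show False by simp
qed

end

text \<open>\<open>rg_uniformizer\<close> makes every local ring a discrete valuation ring.
  \<open>rg_quotient\<close> gives all of them the same field of fractions, so that a function
  regular at one point has an order at every other unless it vanishes.\<close>

locale function_germs = regular_germs X rg for X :: "'p set" and rg :: "'p \<Rightarrow> ('p \<Rightarrow> 'k::field) \<Rightarrow> bool" +
  assumes rg_uniformizer: "p \<in> X \<Longrightarrow> \<exists>t. rg p t \<and> t p = 0 \<and> finite {q \<in> X. t q = 0} \<and>
       (\<forall>f. rg p f \<longrightarrow> finite {q \<in> X. f q \<noteq> 0} \<or>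
         (\<exists>n u. rg p u \<and> u p \<noteq> 0 \<and> finite {q \<in> X. f q \<noteq> t q ^ n * u q}))"
    and rg_quotient: "\<lbrakk>p \<in> X; rg p f; p' \<in> X\<rbrakk> \<Longrightarrow> \<exists>a b. rg p' a \<and> rg p' b \<and>
       infinite {q \<in> X. b q \<noteq> 0} \<and> finite {q \<in> X. f q \<noteq> a q / b q}"
begin

subsection \<open>The local rings inside the function field\<close>

text \<open>Functions are compared up to finitely many points, so \<open>rgl p f\<close> ignores the value of \<open>f\<close> at
  \<open>p\<close>; \<open>val p f\<close> is the value at \<open>p\<close> of the regular function that \<open>f\<close> extends to.\<close>

definition rgl :: "'p \<Rightarrow> ('p \<Rightarrow> 'k) \<Rightarrow> bool" where
  "rgl p f \<longleftrightarrow> (\<exists>g. rg p g \<and> f \<simeq> g)"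

definition val :: "'p \<Rightarrow> ('p \<Rightarrow> 'k) \<Rightarrow> 'k" where
  "val p f = (SOME v. \<exists>g. rg p g \<and> f \<simeq> g \<and> g p = v)"

lemma val_eq: assumes "p \<in> X" "rg p g" "f \<simeq> g" shows "val p f = g p"
proof -
  have "\<exists>h. rg p h \<and> f \<simeq> h \<and> h p = val p f"
    unfolding val_def by (rule someI_ex) (use assms in blast)
  then obtain h where "rg p h" "f \<simeq> h" "h p = val p f" by blast
  moreover have "h \<simeq> g" using \<open>f \<simeq> h\<close> assms(3) aeq_sym aeq_trans by blast
  ultimately show ?thesis using rg_unique[of p h g] assms by simp
qed

lemma rgl_rg: "rg p f \<Longrightarrow> rgl p f" unfolding rgl_def using aeq_refl by blast
lemma val_rg: "p \<in> X \<Longrightarrow> rg p f \<Longrightarrow> val p f = f p" by (rule val_eq) auto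

lemma rglE: assumes "p \<in> X" "rgl p f" obtains g where "rg p g" "f \<simeq> g" "val p f = g p"
  using assms val_eq unfolding rgl_def by blast

lemma rgl_cong: "rgl p f \<Longrightarrow> f \<simeq> g \<Longrightarrow> rgl p g"
  unfolding rgl_def using aeq_sym aeq_trans by blast

lemma val_cong: assumes "p \<in> X" "rgl p f" "f \<simeq> g" shows "val p g = val p f"
proof -
  obtain h where h: "rg p h" "f \<simeq> h" "val p f = h p" using rglE assms by blast
  then have "g \<simeq> h" using assms(3) aeq_sym aeq_trans by blast
  then show ?thesis using val_eq assms h by simp
qed

lemma rgl_const: "p \<in> X \<Longrightarrow> rgl p (\<lambda>_. c)" using rg_const rgl_rg by blast
lemma val_const: "p \<in> X \<Longrightarrow> val p (\<lambda>_. c) = c" using rg_const val_rg by blast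

lemma assumes "p \<in> X" "rgl p f" "rgl p g"
  shows rgl_add: "rgl p (\<lambda>q. f q + g q)" and val_add: "val p (\<lambda>q. f q + g q) = val p f + val p g"
    and rgl_mult: "rgl p (\<lambda>q. f q * g q)" and val_mult: "val p (\<lambda>q. f q * g q) = val p f * val p g"
proof -
  obtain a where a: "rg p a" "f \<simeq> a" "val p f = a p" using rglE assms by blast
  obtain b where b: "rg p b" "g \<simeq> b" "val p g = b p" using rglE assms by blast
  show "rgl p (\<lambda>q. f q + g q)" "rgl p (\<lambda>q. f q * g q)"
    using rg_add[OF assms(1) a(1) b(1)] rg_mult[OF assms(1) a(1) b(1)] aeq_add[OF a(2) b(2)] aeq_mult[OF a(2) b(2)]
    unfolding rgl_def by blast+
  show "val p (\<lambda>q. f q + g q) = val p f + val p g"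
    using val_eq[OF assms(1) rg_add[OF assms(1) a(1) b(1)] aeq_add[OF a(2) b(2)]] a b by simp
  show "val p (\<lambda>q. f q * g q) = val p f * val p g"
    using val_eq[OF assms(1) rg_mult[OF assms(1) a(1) b(1)] aeq_mult[OF a(2) b(2)]] a b by simp
qed

lemma assumes "p \<in> X" "rgl p f" "val p f \<noteq> 0"
  shows rgl_inverse: "rgl p (\<lambda>q. inverse (f q))"
    and val_inverse: "val p (\<lambda>q. inverse (f q)) = inverse (val p f)"
    and val_nonzero: "eventually (\<lambda>q. f q \<noteq> 0) gen"
proof -
  obtain a where a: "rg p a" "f \<simeq> a" "val p f = a p" using rglE assms by blast
  have 1: "rg p (\<lambda>q. inverse (a q))" using rg_inverse a assms by simp
  show "rgl p (\<lambda>q. inverse (f q))" using 1 aeq_inverse[OF a(2)] unfolding rgl_def by blast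
  show "val p (\<lambda>q. inverse (f q)) = inverse (val p f)"
    using val_eq[OF assms(1) 1 aeq_inverse[OF a(2)]] a by simp
  have "eventually (\<lambda>q. a q \<noteq> 0) gen" using rg_open a assms by (simp add: eventually_gen)
  with a(2) show "eventually (\<lambda>q. f q \<noteq> 0) gen" unfolding aeq_def by eventually_elim simp
qed

lemma rgl_cmult: "p \<in> X \<Longrightarrow> rgl p f \<Longrightarrow> rgl p (\<lambda>q. c * f q)"
  using rgl_mult rgl_const by blast
lemma val_cmult: "p \<in> X \<Longrightarrow> rgl p f \<Longrightarrow> val p (\<lambda>q. c * f q) = c * val p f"
  using val_mult[of p "\<lambda>_. c" f] rgl_const val_const by simp
lemma rgl_sum: "p \<in> X \<Longrightarrow> (\<And>i. i \<in> I \<Longrightarrow> rgl p (f i)) \<Longrightarrow> rgl p (\<lambda>q. \<Sum>i\<in>I. f i q)"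
  by (induction I rule: infinite_finite_induct) (auto intro: rgl_const rgl_add)

lemma rgl_power: "p \<in> X \<Longrightarrow> rgl p f \<Longrightarrow> rgl p (\<lambda>q. f q ^ n)"
  by (induction n) (auto intro: rgl_const rgl_mult)
lemma val_power: "p \<in> X \<Longrightarrow> rgl p f \<Longrightarrow> val p (\<lambda>q. f q ^ n) = val p f ^ n"
  by (induction n) (auto simp: val_const val_mult rgl_power)

lemma rgl_gen: assumes "p \<in> X" "rgl p f" shows "eventually (\<lambda>q. rgl q f) gen"
proof -
  obtain a where a: "rg p a" "f \<simeq> a" using rglE assms by blast
  show ?thesis using rg_gen[OF assms(1) a(1)]
    by eventually_elim (use a rgl_def in blast)
qed

subsection \<open>Uniformizers and orders\<close>

definition unit :: "'p \<Rightarrow> ('p \<Rightarrow> 'k) \<Rightarrow> bool" where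
  "unit p f \<longleftrightarrow> rgl p f \<and> val p f \<noteq> 0"

lemma unit_mult: "p \<in> X \<Longrightarrow> unit p f \<Longrightarrow> unit p g \<Longrightarrow> unit p (\<lambda>q. f q * g q)"
  by (simp add: unit_def rgl_mult val_mult)
lemma unit_inverse: "p \<in> X \<Longrightarrow> unit p f \<Longrightarrow> unit p (\<lambda>q. inverse (f q))"
  by (simp add: unit_def rgl_inverse val_inverse)
lemma unit_const: "p \<in> X \<Longrightarrow> c \<noteq> 0 \<Longrightarrow> unit p (\<lambda>_. c)"
  by (simp add: unit_def rgl_const val_const)
lemma unit_nonzero: "p \<in> X \<Longrightarrow> unit p f \<Longrightarrow> eventually (\<lambda>q. f q \<noteq> 0) gen"
  by (simp add: unit_def val_nonzero)

definition unif :: "'p \<Rightarrow> 'p \<Rightarrow> 'k" where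
  "unif p = (SOME t. rgl p t \<and> val p t = 0 \<and> eventually (\<lambda>q. t q \<noteq> 0) gen \<and>
     (\<forall>f. rgl p f \<longrightarrow> f \<simeq> (\<lambda>_. 0) \<or> (\<exists>n u. unit p u \<and> f \<simeq> (\<lambda>q. t q ^ n * u q))))"

lemma unif:
  assumes "p \<in> X"
  shows rgl_unif: "rgl p (unif p)" and val_unif: "val p (unif p) = 0"
    and unif_nonzero: "eventually (\<lambda>q. unif p q \<noteq> 0) gen"
    and rgl_decomp: "rgl p f \<Longrightarrow> f \<simeq> (\<lambda>_. 0) \<or> (\<exists>n u. unit p u \<and> f \<simeq> (\<lambda>q. unif p q ^ n * u q))"
proof -
  obtain t where t: "rg p t" "t p = 0" "finite {q \<in> X. t q = 0}"
    "\<And>f. rg p f \<Longrightarrow> finite {q \<in> X. f q \<noteq> 0} \<or>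
         (\<exists>n u. rg p u \<and> u p \<noteq> 0 \<and> finite {q \<in> X. f q \<noteq> t q ^ n * u q})"
    using rg_uniformizer[OF assms] by blast
  have "f \<simeq> (\<lambda>_. 0) \<or> (\<exists>n u. unit p u \<and> f \<simeq> (\<lambda>q. t q ^ n * u q))" if f: "rgl p f" for f
  proof -
    obtain a where a: "rg p a" "f \<simeq> a" using rglE assms f by blast
    from t(4)[OF a(1)] show ?thesis
    proof (elim disjE exE conjE)
      assume "finite {q \<in> X. a q \<noteq> 0}"
      then have "a \<simeq> (\<lambda>_. 0)" by (simp add: aeq_def eventually_gen)
      then show ?thesis using a aeq_trans by blast
    next
      fix n u assume u: "rg p u" "u p \<noteq> 0" "finite {q \<in> X. a q \<noteq> t q ^ n * u q}"
      then have "a \<simeq> (\<lambda>q. t q ^ n * u q)" by (simp add: aeq_def eventually_gen)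
      moreover have "unit p u" using u assms by (simp add: unit_def rgl_rg val_rg)
      ultimately show ?thesis using a aeq_trans by blast
    qed
  qed
  then have "\<exists>t. rgl p t \<and> val p t = 0 \<and> eventually (\<lambda>q. t q \<noteq> 0) gen \<and>
     (\<forall>f. rgl p f \<longrightarrow> f \<simeq> (\<lambda>_. 0) \<or> (\<exists>n u. unit p u \<and> f \<simeq> (\<lambda>q. t q ^ n * u q)))"
    using t assms by (intro exI[of _ t]) (auto simp: rgl_rg val_rg eventually_gen)
  from someI_ex[OF this, folded unif_def]
  show "rgl p (unif p)" "val p (unif p) = 0" "eventually (\<lambda>q. unif p q \<noteq> 0) gen"
    "rgl p f \<Longrightarrow> f \<simeq> (\<lambda>_. 0) \<or> (\<exists>n u. unit p u \<and> f \<simeq> (\<lambda>q. unif p q ^ n * u q))"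
    by auto
qed

definition has_ord :: "'p \<Rightarrow> ('p \<Rightarrow> 'k) \<Rightarrow> int \<Rightarrow> bool" where
  "has_ord p f m \<longleftrightarrow> (\<exists>u. unit p u \<and> f \<simeq> (\<lambda>q. unif p q powi m * u q))"

lemma has_ord_cong: "has_ord p f m \<Longrightarrow> f \<simeq> g \<Longrightarrow> has_ord p g m"
  unfolding has_ord_def using aeq_sym aeq_trans by blast

lemma has_ord_mult: assumes "p \<in> X" "has_ord p f m" "has_ord p g n"
  shows "has_ord p (\<lambda>q. f q * g q) (m + n)"
proof -
  obtain u where u: "unit p u" "f \<simeq> (\<lambda>q. unif p q powi m * u q)" using assms has_ord_def by blast
  obtain v where v: "unit p v" "g \<simeq> (\<lambda>q. unif p q powi n * v q)" using assms has_ord_def by blast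
  have "(\<lambda>q. f q * g q) \<simeq> (\<lambda>q. unif p q powi (m+n) * (u q * v q))"
    using u(2) v(2) unif_nonzero[OF assms(1)] unfolding aeq_def
    by eventually_elim (simp add: power_int_add)
  then show ?thesis using unit_mult[OF assms(1) u(1) v(1)] unfolding has_ord_def by blast
qed

lemma has_ord_inverse: assumes "p \<in> X" "has_ord p f m"
  shows "has_ord p (\<lambda>q. inverse (f q)) (- m)"
proof -
  obtain u where u: "unit p u" "f \<simeq> (\<lambda>q. unif p q powi m * u q)" using assms has_ord_def by blast
  have "(\<lambda>q. inverse (f q)) \<simeq> (\<lambda>q. unif p q powi (-m) * inverse (u q))"
    using u(2) unfolding aeq_def
    by eventually_elim (simp add: power_int_minus)
  then show ?thesis using unit_inverse[OF assms(1) u(1)] unfolding has_ord_def by blast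
qed

lemma has_ord_nonzero: assumes "p \<in> X" "has_ord p f m" shows "eventually (\<lambda>q. f q \<noteq> 0) gen"
proof -
  obtain u where u: "unit p u" "f \<simeq> (\<lambda>q. unif p q powi m * u q)" using assms has_ord_def by blast
  show ?thesis using u(2) unit_nonzero[OF assms(1) u(1)] unif_nonzero[OF assms(1)] unfolding aeq_def
    by eventually_elim simp
qed

lemma has_ord_0: "p \<in> X \<Longrightarrow> has_ord p f 0 \<longleftrightarrow> unit p f"
proof
  assume p: "p \<in> X" and "has_ord p f 0"
  then obtain u where "unit p u" "f \<simeq> u" unfolding has_ord_def by auto
  then show "unit p f" using aeq_sym[of f u] rgl_cong[of p u f] val_cong[of p u f] p by (simp add: unit_def)
next
  assume "unit p f" then show "has_ord p f 0" unfolding has_ord_def by (intro exI[of _ f]) simp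
qed

lemma has_ord_unif: assumes "p \<in> X" shows "has_ord p (\<lambda>q. unif p q powi m) m"
  unfolding has_ord_def using unit_const[OF assms, of 1] by (intro exI[of _ "\<lambda>_. 1"]) simp

text \<open>If m < 0, the unit factor of f is f times a positive power of the uniformizer;
  regularity of f would force this unit to have value 0 at p.\<close>

lemma has_ord_rgl: assumes "p \<in> X" "has_ord p f m" shows "rgl p f \<longleftrightarrow> 0 \<le> m"
proof -
  obtain u where u: "unit p u" "f \<simeq> (\<lambda>q. unif p q powi m * u q)" using assms has_ord_def by blast
  show ?thesis
  proof
    assume "0 \<le> m"
    then have "f \<simeq> (\<lambda>q. unif p q ^ nat m * u q)" using u(2) by (simp add: power_int_def)
    moreover have "rgl p (\<lambda>q. unif p q ^ nat m * u q)"
      using u assms by (auto simp: unit_def intro!: rgl_mult rgl_power rgl_unif)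
    ultimately show "rgl p f" using rgl_cong aeq_sym by blast
  next
    assume f: "rgl p f"
    show "0 \<le> m"
    proof (rule ccontr)
      assume m: "\<not> 0 \<le> m"
      then obtain n where n: "nat (- m) = Suc n" by (metis Suc_pred' zero_less_nat_eq neg_0_less_iff_less not_le)
      have "u \<simeq> (\<lambda>q. f q * unif p q ^ nat (- m))"
        using u(2) unif_nonzero[OF assms(1)] unfolding aeq_def
        by eventually_elim (use m in \<open>simp add: power_int_def field_simps\<close>)
      moreover have "rgl p (\<lambda>q. f q * unif p q ^ nat (- m))"
        using f assms by (auto intro!: rgl_mult rgl_power rgl_unif)
      moreover have "val p (\<lambda>q. f q * unif p q ^ nat (- m)) = 0"
        using f assms n val_mult[OF assms(1) f, of "\<lambda>q. unif p q ^ nat (- m)"]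
          val_power[OF assms(1) rgl_unif[OF assms(1)], of "nat (- m)"]
        by (simp add: rgl_power rgl_unif val_unif del: power_Suc)
      ultimately show False using u(1) val_cong[OF assms(1)] aeq_sym unfolding unit_def by metis
    qed
  qed
qed

text \<open>If f has orders m and n, then f / f = 1 has order n - m. As 1 is regular, m \<le> n, and
  m and n can be exchanged.\<close>

lemma has_ord_unique: assumes "p \<in> X" "has_ord p f m" "has_ord p f n" shows "m = n"
proof -
  have *: "m \<le> n" if "has_ord p f m" "has_ord p f n" for m n
  proof -
    have "has_ord p (\<lambda>q. f q * inverse (f q)) (n + - m)"
      using that has_ord_mult has_ord_inverse assms(1) by blast
    moreover have "(\<lambda>q. f q * inverse (f q)) \<simeq> (\<lambda>_. 1)"
      using has_ord_nonzero[OF assms(1,2)] unfolding aeq_def by eventually_elim simp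
    ultimately have "has_ord p (\<lambda>_. 1) (n + - m)" using has_ord_cong by blast
    then show ?thesis using has_ord_rgl[OF assms(1)] rgl_const[OF assms(1)] by force
  qed
  show ?thesis using *[of m n] *[of n m] assms by simp
qed

text \<open>Regularity at one point propagates to almost all points by \<open>rg_near\<close>; hence
  two rational functions always have a common point of regularity, which is how sums and products
  are handled.\<close>

definition rat :: "('p \<Rightarrow> 'k) \<Rightarrow> bool" where "rat f \<longleftrightarrow> (\<exists>p\<in>X. rgl p f)"

definition nz :: "('p \<Rightarrow> 'k) \<Rightarrow> bool" where
  "nz f \<longleftrightarrow> rat f \<and> eventually (\<lambda>q. f q \<noteq> 0) gen"

definition ordr :: "'p \<Rightarrow> ('p \<Rightarrow> 'k) \<Rightarrow> int" where
  "ordr p f = (THE m. has_ord p f m)"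

lemma ordr_eq: "p \<in> X \<Longrightarrow> has_ord p f m \<Longrightarrow> ordr p f = m"
  unfolding ordr_def using has_ord_unique by blast

lemma rat_cases: assumes "p \<in> X" "rat f" shows "f \<simeq> (\<lambda>_. 0) \<or> (\<exists>m. has_ord p f m)"
proof -
  obtain p0 where p0: "p0 \<in> X" "rgl p0 f" using assms rat_def by blast
  obtain h where h: "rg p0 h" "f \<simeq> h" using rglE p0 by blast
  obtain a b where ab: "rg p a" "rg p b" "infinite {q \<in> X. b q \<noteq> 0}" "finite {q \<in> X. h q \<noteq> a q / b q}"
    using rg_quotient[OF p0(1) h(1) assms(1)] by blast
  have hab: "h \<simeq> (\<lambda>q. a q * inverse (b q))" using ab by (simp add: aeq_def eventually_gen divide_inverse)
  have ho: "has_ord p f (int n)" if "unit p u" "f \<simeq> (\<lambda>q. unif p q ^ n * u q)" for f n u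
    using that unfolding has_ord_def by auto
  have "\<not> b \<simeq> (\<lambda>_. 0)" using ab(3) by (simp add: aeq_def eventually_gen)
  then obtain m where m: "has_ord p b m" using rgl_decomp[OF assms(1) rgl_rg[OF ab(2)]] ho by blast
  show ?thesis
  proof (cases "a \<simeq> (\<lambda>_. 0)")
    case True
    with h(2) hab have "f \<simeq> (\<lambda>_. 0)" unfolding aeq_def by eventually_elim simp
    then show ?thesis by simp
  next
    case False
    then obtain n where n: "has_ord p a n" using rgl_decomp[OF assms(1) rgl_rg[OF ab(1)]] ho by blast
    have "(\<lambda>q. a q * inverse (b q)) \<simeq> f" using hab h(2) aeq_sym aeq_trans by blast
    then show ?thesis
      using has_ord_cong[OF has_ord_mult[OF assms(1) n has_ord_inverse[OF assms(1) m]]] by blast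
  qed
qed

lemma rat_rgl: "p \<in> X \<Longrightarrow> rgl p f \<Longrightarrow> rat f" using rat_def by blast
lemma rat_cong: "rat f \<Longrightarrow> f \<simeq> g \<Longrightarrow> rat g" using rat_def rgl_cong by blast

lemma X_ex: "\<exists>p. p \<in> X" using infinite_X by (metis ex_in_conv finite.emptyI)

lemma rat_const: "rat (\<lambda>_. c)" using X_ex rgl_const rat_def by blast

lemma rat_gen: assumes "rat f" shows "eventually (\<lambda>q. rgl q f) gen"
  using assms rgl_gen rat_def by blast

lemma rat_two: assumes "rat f" "rat g" obtains p where "p \<in> X" "rgl p f" "rgl p g"
proof -
  have "eventually (\<lambda>q. q \<in> X \<and> rgl q f \<and> rgl q g) gen"
    using rat_gen[OF assms(1)] rat_gen[OF assms(2)] gen_X by eventually_elim simp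
  then show ?thesis using that gen_nonbot eventually_happens by blast
qed

lemma rat_add: "rat f \<Longrightarrow> rat g \<Longrightarrow> rat (\<lambda>q. f q + g q)"
  by (erule (1) rat_two) (use rgl_add rat_def in blast)
lemma rat_mult: "rat f \<Longrightarrow> rat g \<Longrightarrow> rat (\<lambda>q. f q * g q)"
  by (erule (1) rat_two) (use rgl_mult rat_def in blast)
lemma rat_cmult: "rat f \<Longrightarrow> rat (\<lambda>q. c * f q)"
  by (rule rat_mult[OF rat_const])
lemma rat_diff: "rat f \<Longrightarrow> rat g \<Longrightarrow> rat (\<lambda>q. f q - g q)"
  using rat_add[of f "\<lambda>q. -1 * g q"] rat_cmult[of g "-1"] by simp
lemma rat_sum: "(\<And>i. i \<in> I \<Longrightarrow> rat (f i)) \<Longrightarrow> rat (\<lambda>q. \<Sum>i\<in>I. f i q)"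
  by (induction I rule: infinite_finite_induct) (auto intro: rat_const rat_add)

text \<open>For m < 0 the inverse of f is regular at p, hence regular and nonzero at a general
  point, and there f is regular.\<close>

lemma has_ord_rat: assumes "p \<in> X" "has_ord p f m" shows "rat f"
proof (cases "m \<ge> 0")
  case True then show ?thesis using has_ord_rgl assms rat_rgl by blast
next
  case False
  have "rgl p (\<lambda>q. inverse (f q))" "eventually (\<lambda>q. inverse (f q) \<noteq> 0) gen"
    using has_ord_rgl[OF assms(1) has_ord_inverse[OF assms]] False
      has_ord_nonzero[OF assms(1) has_ord_inverse[OF assms]] by auto
  then have "eventually (\<lambda>q. q \<in> X \<and> rg q (\<lambda>q. inverse (f q)) \<and> inverse (f q) \<noteq> 0) gen \<or> True" by simp
  obtain h where h: "rg p h" "(\<lambda>q. inverse (f q)) \<simeq> h" using \<open>rgl p _\<close> rglE assms by blast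
  have "eventually (\<lambda>q. h q \<noteq> 0) gen"
    using h(2) \<open>eventually (\<lambda>q. inverse (f q) \<noteq> 0) gen\<close> unfolding aeq_def by eventually_elim simp
  then have "eventually (\<lambda>q. q \<in> X \<and> rg q h \<and> h q \<noteq> 0) gen"
    using rg_gen[OF assms(1) h(1)] gen_X by eventually_elim simp
  then obtain q where q: "q \<in> X" "rg q h" "h q \<noteq> 0" using gen_nonbot eventually_happens by blast
  have "rgl q (\<lambda>x. inverse (h x))" using rg_inverse q rgl_rg by blast
  moreover have "(\<lambda>x. inverse (h x)) \<simeq> f" using aeq_sym[OF aeq_inverse[OF h(2)]] by simp
  ultimately show ?thesis using q rat_rgl rgl_cong by blast
qed

lemma has_ord_nz: "p \<in> X \<Longrightarrow> has_ord p f m \<Longrightarrow> nz f"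
  using has_ord_rat has_ord_nonzero nz_def by blast

lemma rat_zero_or_nz: "rat f \<Longrightarrow> f \<simeq> (\<lambda>_. 0) \<or> nz f"
  using X_ex rat_cases has_ord_nz by blast

lemma nz_has_ord: assumes "p \<in> X" "nz f" shows "has_ord p f (ordr p f)"
proof -
  have "\<not> f \<simeq> (\<lambda>_. 0)"
  proof
    assume "f \<simeq> (\<lambda>_. 0)"
    moreover have "eventually (\<lambda>q. f q \<noteq> 0) gen" using assms nz_def by blast
    ultimately have "eventually (\<lambda>_. False) gen" unfolding aeq_def by eventually_elim simp
    then show False by simp
  qed
  then show ?thesis using rat_cases[OF assms(1), of f] assms ordr_eq nz_def by blast
qed

lemma nz_const: "c \<noteq> 0 \<Longrightarrow> nz (\<lambda>_. c)" by (simp add: nz_def rat_const)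
lemma nz_mult: assumes "nz f" "nz g" shows "nz (\<lambda>q. f q * g q)"
proof -
  obtain p where p: "p \<in> X" using X_ex by blast
  show ?thesis by (rule has_ord_nz[OF p has_ord_mult[OF p nz_has_ord[OF p assms(1)] nz_has_ord[OF p assms(2)]]])
qed
lemma nz_inverse: assumes "nz f" shows "nz (\<lambda>q. inverse (f q))"
proof -
  obtain p where p: "p \<in> X" using X_ex by blast
  show ?thesis by (rule has_ord_nz[OF p has_ord_inverse[OF p nz_has_ord[OF p assms]]])
qed
lemma nz_power: "nz f \<Longrightarrow> nz (\<lambda>q. f q ^ n)"
  by (induction n) (auto intro: nz_const nz_mult)
lemma nz_unif: "p \<in> X \<Longrightarrow> nz (\<lambda>q. unif p q powi m)"
  using has_ord_unif has_ord_nz by blast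
lemma rat_inverse: assumes "rat f" shows "rat (\<lambda>q. inverse (f q))"
proof (cases "nz f")
  case True then show ?thesis using nz_inverse nz_def by blast
next
  case False
  then have "f \<simeq> (\<lambda>_. 0)" using assms rat_zero_or_nz by blast
  then have "(\<lambda>_. 0) \<simeq> (\<lambda>q. inverse (f q))" unfolding aeq_def by eventually_elim simp
  then show ?thesis using rat_cong rat_const by blast
qed
lemma rat_divide: "rat f \<Longrightarrow> rat g \<Longrightarrow> rat (\<lambda>q. f q / g q)"
  using rat_mult[OF _ rat_inverse] by (simp add: divide_inverse)

lemma ordr_mult: "p \<in> X \<Longrightarrow> nz f \<Longrightarrow> nz g \<Longrightarrow> ordr p (\<lambda>q. f q * g q) = ordr p f + ordr p g"
  by (intro ordr_eq has_ord_mult nz_has_ord)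
lemma ordr_inverse: "p \<in> X \<Longrightarrow> nz f \<Longrightarrow> ordr p (\<lambda>q. inverse (f q)) = - ordr p f"
  by (intro ordr_eq has_ord_inverse nz_has_ord)
lemma ordr_const: "p \<in> X \<Longrightarrow> c \<noteq> 0 \<Longrightarrow> ordr p (\<lambda>_. c) = 0"
  using ordr_eq has_ord_0 unit_const by blast
lemma ordr_power: "p \<in> X \<Longrightarrow> nz f \<Longrightarrow> ordr p (\<lambda>q. f q ^ n) = int n * ordr p f"
  by (induction n) (simp_all add: ordr_const ordr_mult nz_power algebra_simps)
lemma ordr_cong: "p \<in> X \<Longrightarrow> nz f \<Longrightarrow> f \<simeq> g \<Longrightarrow> ordr p g = ordr p f"
  using nz_has_ord has_ord_cong ordr_eq by blast
lemma ordr_unif: "p \<in> X \<Longrightarrow> ordr p (\<lambda>q. unif p q powi m) = m"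
  using has_ord_unif ordr_eq by blast
lemma rgl_iff_ordr: "p \<in> X \<Longrightarrow> nz f \<Longrightarrow> rgl p f \<longleftrightarrow> 0 \<le> ordr p f"
  using nz_has_ord has_ord_rgl by blast
lemma unit_iff_ordr: "p \<in> X \<Longrightarrow> nz f \<Longrightarrow> unit p f \<longleftrightarrow> ordr p f = 0"
  using nz_has_ord has_ord_0 ordr_eq by metis

text \<open>Both f and 1 / f are regular at almost every point, and where both are, the order is
  0.\<close>

lemma finite_ordr: assumes "nz f" shows "finite {p \<in> X. ordr p f \<noteq> 0}"
proof -
  have "rat f" "rat (\<lambda>q. inverse (f q))" using assms nz_inverse nz_def by auto
  then have "eventually (\<lambda>p. rgl p f) gen" "eventually (\<lambda>p. rgl p (\<lambda>q. inverse (f q))) gen"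
    using rat_gen by auto
  with gen_X have "eventually (\<lambda>p. ordr p f = 0) gen"
  proof eventually_elim
    case (elim p)
    then have "0 \<le> ordr p f" "0 \<le> ordr p (\<lambda>q. inverse (f q))"
      using rgl_iff_ordr assms nz_inverse by blast+
    then show ?case using elim assms by (simp add: ordr_inverse)
  qed
  then show ?thesis by (simp add: eventually_gen)
qed

lemma rgl_div_unif: assumes "p \<in> X" "rgl p f" "val p f = 0" shows "rgl p (\<lambda>q. f q * inverse (unif p q))"
proof (cases "f \<simeq> (\<lambda>_. 0)")
  case True
  then have "(\<lambda>_. 0) \<simeq> (\<lambda>q. f q * inverse (unif p q))" unfolding aeq_def by eventually_elim simp
  then show ?thesis using rgl_cong rgl_const assms by blast
next
  case False
  then have f: "nz f" using rat_zero_or_nz rat_rgl assms by blast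
  have "\<not> unit p f" using assms unit_def by blast
  then have "ordr p f \<ge> 1" using f assms unit_iff_ordr rgl_iff_ordr by force
  moreover have u: "nz (unif p)" "ordr p (unif p) = 1"
    using nz_unif[OF assms(1), of 1] ordr_unif[OF assms(1), of 1] by auto
  ultimately show ?thesis using assms f u
    by (subst rgl_iff_ordr) (auto simp: ordr_mult ordr_inverse nz_mult nz_inverse)
qed

end

context function_germs begin

subsection \<open>Riemann--Roch spaces\<close>

definition lin_indep :: "'i set \<Rightarrow> ('i \<Rightarrow> 'p \<Rightarrow> 'k) \<Rightarrow> bool" where
  "lin_indep I \<phi> \<longleftrightarrow> (\<forall>c. (\<lambda>q. \<Sum>i\<in>I. c i * \<phi> i q) \<simeq> (\<lambda>_. 0) \<longrightarrow> (\<forall>i\<in>I. c i = 0))"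

text \<open>The Riemann--Roch space L(D) of functions with poles bounded by D. The divisor is
  effective: it will consist of zeros, of poles, or of the zeros of a section.\<close>

definition Lsp :: "('p \<Rightarrow> nat) \<Rightarrow> ('p \<Rightarrow> 'k) \<Rightarrow> bool" where
  "Lsp D f \<longleftrightarrow> rat f \<and> (\<forall>p\<in>X. rgl p (\<lambda>q. f q * unif p q ^ D p))"

lemma Lsp_add: "Lsp D f \<Longrightarrow> Lsp D g \<Longrightarrow> Lsp D (\<lambda>q. f q + g q)"
  unfolding Lsp_def by (auto intro: rat_add rgl_add simp: distrib_right)

lemma Lsp_cmult: "Lsp D f \<Longrightarrow> Lsp D (\<lambda>q. c * f q)"
  unfolding Lsp_def by (auto intro: rat_cmult rgl_cmult simp: mult.assoc)

lemma lin_indepD: "lin_indep I \<phi> \<Longrightarrow> (\<lambda>q. \<Sum>i\<in>I. c i * \<phi> i q) \<simeq> (\<lambda>_. 0) \<Longrightarrow> i \<in> I \<Longrightarrow> c i = 0"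
  unfolding lin_indep_def by blast

text \<open>L(0) consists of constants, and passing from D to D - p0 costs at most one dimension:
  the coefficient of the pole of order \<open>D p0\<close> at p0 is a linear form on L(D) whose
  kernel lies in L(D - p0).\<close>

lemma card_indep_le:
  assumes const: "\<And>f. (\<And>p. p \<in> X \<Longrightarrow> rgl p f) \<Longrightarrow> \<exists>c. f \<simeq> (\<lambda>_. c)"
    and "finite {p \<in> X. D p \<noteq> 0}" "finite I" "lin_indep I \<phi>" "\<And>i. i \<in> I \<Longrightarrow> Lsp D (\<phi> i)"
  shows "card I \<le> (\<Sum>p\<in>{p \<in> X. D p \<noteq> 0}. D p) + 1"
  using assms(2-)
proof (induction "\<Sum>p\<in>{p \<in> X. D p \<noteq> 0}. D p" arbitrary: D I \<phi>)
  case 0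
  then have D: "\<And>p. p \<in> X \<Longrightarrow> D p = 0" by (auto simp: sum_eq_0_iff)
  have "\<exists>c. \<phi> i \<simeq> (\<lambda>_. c)" if "i \<in> I" for i
    using that 0 D by (intro const) (auto simp: Lsp_def)
  then obtain c where c: "\<And>i. i \<in> I \<Longrightarrow> \<phi> i \<simeq> (\<lambda>_. c i)" by metis
  have "card I \<le> 1"
  proof (rule ccontr)
    assume "\<not> card I \<le> 1"
    then obtain i j where ij: "i \<in> I" "j \<in> I" "i \<noteq> j"
      using card_le_Suc0_iff_eq[OF \<open>finite I\<close>] by auto
    define b where "b x = (if x = i then c j else if x = j then - c i else 0)" for x
    have s: "(\<Sum>x\<in>I. b x * \<phi> x q) = c j * \<phi> i q - c i * \<phi> j q" for q
    proof -
      have "(\<Sum>x\<in>I. b x * \<phi> x q) = (\<Sum>x\<in>{i,j}. b x * \<phi> x q)"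
        by (rule sum.mono_neutral_right) (use ij \<open>finite I\<close> in \<open>auto simp: b_def\<close>)
      then show ?thesis using ij by (simp add: b_def)
    qed
    have "(\<lambda>q. \<Sum>x\<in>I. b x * \<phi> x q) \<simeq> (\<lambda>_. 0)"
      unfolding s using c[OF ij(1)] c[OF ij(2)] unfolding aeq_def by eventually_elim simp
    then have "b i = 0" "b j = 0" using lin_indepD[OF \<open>lin_indep I \<phi>\<close>] ij by auto
    then have "c j = 0" using ij by (simp add: b_def)
    define b' where "b' x = (if x = j then 1 else 0 :: 'k)" for x
    have "(\<lambda>q. \<Sum>x\<in>I. b' x * \<phi> x q) \<simeq> (\<lambda>_. 0)"
      using c[OF ij(2)] \<open>c j = 0\<close> ij \<open>finite I\<close> by (simp add: b'_def if_distrib[of "\<lambda>x. x * _"] sum.delta cong: if_cong)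
    then have "b' j = 0" using lin_indepD[OF \<open>lin_indep I \<phi>\<close>] ij by blast
    then show False by (simp add: b'_def)
  qed
  then show ?case by simp
next
  case (Suc n)
  have "\<exists>p0\<in>{p \<in> X. D p \<noteq> 0}. D p0 \<noteq> 0"
    using Suc(2) by (metis (mono_tags, lifting) sum.neutral nat.distinct(1))
  then obtain p0 where p0: "p0 \<in> X" "D p0 \<noteq> 0" by blast
  define D' where "D' = D(p0 := D p0 - 1)"
  have fin': "finite {p \<in> X. D' p \<noteq> 0}"
    by (rule finite_subset[OF _ Suc.prems(1)]) (auto simp: D'_def)
  have sumD': "n = (\<Sum>p\<in>{p \<in> X. D' p \<noteq> 0}. D' p)"
  proof -
    let ?S = "{p \<in> X. D p \<noteq> 0}"
    have "(\<Sum>p\<in>{p \<in> X. D' p \<noteq> 0}. D' p) = (\<Sum>p\<in>?S. D' p)"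
      by (rule sum.mono_neutral_left) (use Suc.prems in \<open>auto simp: D'_def\<close>)
    also have "\<dots> = D' p0 + (\<Sum>p\<in>?S - {p0}. D' p)"
      by (rule sum.remove) (use Suc.prems p0 in auto)
    also have "(\<Sum>p\<in>?S - {p0}. D' p) = (\<Sum>p\<in>?S - {p0}. D p)"
      by (rule sum.cong) (auto simp: D'_def)
    also have "Suc n = D p0 + (\<Sum>p\<in>?S - {p0}. D p)"
      unfolding Suc(2) by (rule sum.remove) (use Suc.prems p0 in auto)
    then have "D' p0 + (\<Sum>p\<in>?S - {p0}. D p) = n" using p0 by (simp add: D'_def)
    finally show ?thesis by simp
  qed
  let ?w = "\<lambda>f q. f q * unif p0 q ^ D p0"
  define a where "a f = val p0 (?w f)" for f
  have rw: "rgl p0 (?w f)" if "Lsp D f" for f using that p0 by (simp add: Lsp_def)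
  have low: "Lsp D' f" if f: "Lsp D f" "a f = 0" for f
    unfolding Lsp_def
  proof (intro conjI ballI)
    show "rat f" using f Lsp_def by blast
    fix p assume p: "p \<in> X"
    show "rgl p (\<lambda>q. f q * unif p q ^ D' p)"
    proof (cases "p = p0")
      case True
      have "rgl p0 (\<lambda>q. ?w f q * inverse (unif p0 q))"
        using rgl_div_unif[OF p0(1) rw[OF f(1)]] f(2) by (simp add: a_def)
      moreover have "(\<lambda>q. ?w f q * inverse (unif p0 q)) \<simeq> (\<lambda>q. f q * unif p0 q ^ D' p0)"
        using unif_nonzero[OF p0(1)] unfolding aeq_def
        by eventually_elim (use p0(2) in \<open>cases "D p0"; simp add: D'_def\<close>)
      ultimately show ?thesis using True rgl_cong by blast
    next
      case False
      then show ?thesis using f p by (simp add: Lsp_def D'_def)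
    qed
  qed
  show ?case
  proof (cases "\<forall>i\<in>I. a (\<phi> i) = 0")
    case True
    then have "card I \<le> n + 1"
      using Suc.hyps(1)[OF sumD' fin' Suc.prems(2,3)] low Suc.prems(4) sumD' by simp
    then show ?thesis using Suc(2) by simp
  next
    case False
    then obtain k where k: "k \<in> I" "a (\<phi> k) \<noteq> 0" by blast
    \<comment> \<open>A function \<open>\<phi> k\<close> with nonzero leading coefficient serves as
      pivot; adding multiples of it moves all the others into L(D - p0).\<close>
    define r where "r i = - (a (\<phi> i) / a (\<phi> k))" for i
    define \<psi> where "\<psi> i q = \<phi> i q + r i * \<phi> k q" for i q
    have \<psi>D: "Lsp D (\<psi> i)" if "i \<in> I" for i
      unfolding \<psi>_def using Suc.prems(4) that k Lsp_add Lsp_cmult by blast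
    have a\<psi>: "a (\<psi> i) = 0" if "i \<in> I" for i
    proof -
      have "a (\<psi> i) = val p0 (\<lambda>q. ?w (\<phi> i) q + r i * ?w (\<phi> k) q)"
        by (simp add: a_def \<psi>_def algebra_simps)
      also have "\<dots> = a (\<phi> i) + r i * a (\<phi> k)"
        using rw Suc.prems(4) that k p0 by (simp add: val_add val_cmult rgl_cmult a_def)
      finally show ?thesis using k by (simp add: r_def)
    qed
    have "lin_indep (I - {k}) \<psi>"
      unfolding lin_indep_def
    proof (intro allI impI)
      fix c assume c: "(\<lambda>q. \<Sum>i\<in>I - {k}. c i * \<psi> i q) \<simeq> (\<lambda>_. 0)"
      define c' where "c' i = (if i = k then \<Sum>j\<in>I - {k}. c j * r j else c i)" for i
      have "(\<Sum>i\<in>I. c' i * \<phi> i q) = (\<Sum>i\<in>I - {k}. c i * \<psi> i q)" for q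
      proof -
        have "(\<Sum>i\<in>I. c' i * \<phi> i q) = c' k * \<phi> k q + (\<Sum>i\<in>I - {k}. c' i * \<phi> i q)"
          by (rule sum.remove) (use Suc.prems k in auto)
        also have "(\<Sum>i\<in>I - {k}. c' i * \<phi> i q) = (\<Sum>i\<in>I - {k}. c i * \<phi> i q)"
          by (rule sum.cong) (auto simp: c'_def)
        finally show ?thesis
          by (simp add: c'_def \<psi>_def sum.distrib distrib_left sum_distrib_right mult.assoc)
      qed
      with c have "(\<lambda>q. \<Sum>i\<in>I. c' i * \<phi> i q) \<simeq> (\<lambda>_. 0)" by simp
      then have "\<forall>i\<in>I. c' i = 0" using lin_indepD[OF Suc.prems(3)] by blast
      then show "\<forall>i\<in>I - {k}. c i = 0" by (auto simp: c'_def split: if_splits)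
    qed
    then have "card (I - {k}) \<le> n + 1"
      using Suc.hyps(1)[OF sumD' fin', of "I - {k}" \<psi>] low \<psi>D a\<psi> sumD' Suc.prems(2) by simp
    then show ?thesis using Suc(2) k Suc.prems(2) by simp
  qed
qed

text \<open>After multiplication by the n-th power of the uniformizer the value at p is the top
  coefficient, while regularity of the sum forces this value to be 0. So polar parts of different
  orders are independent modulo regular functions.\<close>

lemma pole_coeffs_zero:
  assumes "p \<in> X" "rgl p (\<lambda>q. \<Sum>k\<in>{1..n}. c k * inverse (unif p q ^ k))" "k \<in> {1..n}"
  shows "c k = (0::'k)"
  using assms(2,3)
proof (induction n)
  case 0 then show ?case by simp
next
  case (Suc n)
  let ?f = "\<lambda>q. \<Sum>k\<in>{1..Suc n}. c k * inverse (unif p q ^ k)"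
  have 1: "rgl p (\<lambda>q. ?f q * unif p q ^ Suc n)" "val p (\<lambda>q. ?f q * unif p q ^ Suc n) = 0"
    using Suc.prems(1) assms(1) rgl_power[OF assms(1) rgl_unif[OF assms(1)], of "Suc n"]
      val_power[OF assms(1) rgl_unif[OF assms(1)], of "Suc n"] val_unif[OF assms(1)]
    by (auto intro!: rgl_mult simp: val_mult simp del: power_Suc) 
  let ?g = "\<lambda>q. (\<Sum>k\<in>{1..n}. c k * unif p q ^ (Suc n - k))"
  have eq: "(\<lambda>q. ?f q * unif p q ^ Suc n) \<simeq> (\<lambda>q. ?g q + c (Suc n))"
    using unif_nonzero[OF assms(1)] unfolding aeq_def
  proof eventually_elim
    case (elim q)
    have "inverse (unif p q ^ k) * unif p q ^ Suc n = unif p q ^ (Suc n - k)" if "k \<le> Suc n" for k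
      using elim that by (simp add: power_diff field_simps del: power_Suc)
    then have "?f q * unif p q ^ Suc n = (\<Sum>k\<in>{1..Suc n}. c k * unif p q ^ (Suc n - k))"
      by (simp add: sum_distrib_right mult.assoc del: power_Suc sum.cl_ivl_Suc)
    also have "\<dots> = ?g q + c (Suc n)" by simp
    finally show ?case .
  qed
  have g: "rgl p ?g" "val p ?g = 0"
  proof -
    let ?h = "\<lambda>q. (\<Sum>k\<in>{1..n}. c k * unif p q ^ (n - k))"
    have h: "rgl p ?h" using assms(1) by (intro rgl_sum rgl_cmult rgl_power rgl_unif) auto
    have e: "?g = (\<lambda>q. unif p q * ?h q)"
      by (rule ext) (simp add: sum_distrib_left Suc_diff_le mult.left_commute)
    show "rgl p ?g" unfolding e using h assms(1) by (intro rgl_mult rgl_unif)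
    show "val p ?g = 0" unfolding e using h assms(1) by (subst val_mult) (auto intro: rgl_unif simp: val_unif)
  qed
  have "val p (\<lambda>q. ?g q + c (Suc n)) = 0" using val_cong[OF assms(1) 1(1) eq] 1(2) by simp
  then have cn: "c (Suc n) = 0" using val_add[OF assms(1) g(1) rgl_const[OF assms(1), of "c (Suc n)"]] g assms(1) by (simp add: val_const)
  then have "rgl p (\<lambda>q. \<Sum>k\<in>{1..n}. c k * inverse (unif p q ^ k))" using Suc.prems(1) by simp
  then show ?case using Suc.IH Suc.prems(2) cn by (cases "k = Suc n") auto
qed

text \<open>Systems of principal parts: \<open>H p\<close> prescribes a polar part at \<open>p\<close>.  Modulo the systems that come
  from global rational functions they form the first cohomology group.\<close>

definition pps :: "('p \<Rightarrow> 'p \<Rightarrow> 'k) \<Rightarrow> bool" where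
  "pps H \<longleftrightarrow> (\<forall>p\<in>X. rat (H p)) \<and> finite {p \<in> X. H p \<noteq> (\<lambda>_. 0)}"

text \<open>The system \<open>H\<close> and the one global function \<open>\<phi>\<close> agree
  modulo O(D) at every point. Systems modulo realizable ones form H^1 of O(D), and
  \<open>pps_indep D\<close> is linear independence in it.\<close>

definition realizable :: "('p \<Rightarrow> nat) \<Rightarrow> ('p \<Rightarrow> 'p \<Rightarrow> 'k) \<Rightarrow> ('p \<Rightarrow> 'k) \<Rightarrow> bool" where
  "realizable D H \<phi> \<longleftrightarrow> rat \<phi> \<and> (\<forall>p\<in>X. rgl p (\<lambda>q. (H p q - \<phi> q) * unif p q ^ D p))"

definition pps_indep :: "('p \<Rightarrow> nat) \<Rightarrow> 'i set \<Rightarrow> ('i \<Rightarrow> 'p \<Rightarrow> 'p \<Rightarrow> 'k) \<Rightarrow> bool" where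
  "pps_indep D I H \<longleftrightarrow> (\<forall>c. (\<exists>\<phi>. realizable D (\<lambda>p q. \<Sum>i\<in>I. c i * H i p q) \<phi>) \<longrightarrow> (\<forall>i\<in>I. c i = 0))"

lemma pps_indepD: "pps_indep D I H \<Longrightarrow> realizable D (\<lambda>p q. \<Sum>i\<in>I. c i * H i p q) \<phi> \<Longrightarrow> \<forall>i\<in>I. c i = 0"
  unfolding pps_indep_def by blast

lemma realizable_add: assumes "realizable D H \<phi>" "realizable D H' \<phi>'"
  shows "realizable D (\<lambda>p q. H p q + H' p q) (\<lambda>q. \<phi> q + \<phi>' q)"
  unfolding realizable_def
proof (intro conjI ballI)
  show "rat (\<lambda>q. \<phi> q + \<phi>' q)" using assms rat_add realizable_def by blast
  fix p assume p: "p \<in> X"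
  have "rgl p (\<lambda>q. (H p q - \<phi> q) * unif p q ^ D p + (H' p q - \<phi>' q) * unif p q ^ D p)"
    using assms p by (intro rgl_add) (auto simp: realizable_def)
  then show "rgl p (\<lambda>q. (H p q + H' p q - (\<phi> q + \<phi>' q)) * unif p q ^ D p)"
    by (simp add: algebra_simps)
qed

lemma realizable_cmult: assumes "realizable D H \<phi>"
  shows "realizable D (\<lambda>p q. c * H p q) (\<lambda>q. c * \<phi> q)"
  unfolding realizable_def
proof (intro conjI ballI)
  show "rat (\<lambda>q. c * \<phi> q)" using assms rat_cmult realizable_def by blast
  fix p assume p: "p \<in> X"
  have "rgl p (\<lambda>q. c * ((H p q - \<phi> q) * unif p q ^ D p))"
    using assms p by (intro rgl_cmult) (auto simp: realizable_def)
  then show "rgl p (\<lambda>q. (c * H p q - c * \<phi> q) * unif p q ^ D p)" by (simp add: algebra_simps)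
qed

lemma realizable_mono: assumes "realizable D H \<phi>" "\<And>p. D p \<le> D' p" shows "realizable D' H \<phi>"
  unfolding realizable_def
proof (intro conjI ballI)
  show "rat \<phi>" using assms realizable_def by blast
  fix p assume p: "p \<in> X"
  have "rgl p (\<lambda>q. (H p q - \<phi> q) * unif p q ^ D p)" using assms(1) p by (simp add: realizable_def)
  then have "rgl p (\<lambda>q. ((H p q - \<phi> q) * unif p q ^ D p) * unif p q ^ (D' p - D p))"
    using p by (intro rgl_mult[where f = "\<lambda>q. (H p q - \<phi> q) * unif p q ^ D p"] rgl_power rgl_unif)
  then show "rgl p (\<lambda>q. (H p q - \<phi> q) * unif p q ^ D' p)"
    using assms(2)[of p] by (simp add: mult.assoc power_add[symmetric])
qed

end

section \<open>The Riemann--Roch inequality and degrees of principal divisors\<close>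

locale curve_germs = function_germs X rg for X :: "'p set" and rg :: "'p \<Rightarrow> ('p \<Rightarrow> 'k::field) \<Rightarrow> bool" +
  fixes g :: nat
  assumes regular_const: "\<And>f. (\<And>p. p \<in> X \<Longrightarrow> rgl p f) \<Longrightarrow> \<exists>c. f \<simeq> (\<lambda>_. c)"
    and genus_bound: "\<And>(I :: nat set) H. finite I \<Longrightarrow> (\<And>i. i \<in> I \<Longrightarrow> pps (H i)) \<Longrightarrow>
       pps_indep (\<lambda>_. 0) I H \<Longrightarrow> card I \<le> g"
begin

text \<open>A locale assumption has one fixed type of indices, here \<open>nat\<close>. Enumerating
  I moves the bound to any index type, such as the sum type that occurs in
  \<open>riemann_roch_lower\<close>.\<close>

lemma genus_bound':
  assumes "finite I" "\<And>i. i \<in> I \<Longrightarrow> pps (H i)" "pps_indep (\<lambda>_. 0) I H"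
  shows "card I \<le> g"
proof -
  obtain f :: "nat \<Rightarrow> _" where f: "bij_betw f {0..<card I} I" using ex_bij_betw_nat_finite[OF assms(1)] by blast
  have inj: "inj_on f {0..<card I}" and im: "f ` {0..<card I} = I" using f by (auto simp: bij_betw_def)
  have "pps_indep (\<lambda>_. 0) {0..<card I} (\<lambda>i. H (f i))"
    unfolding pps_indep_def
  proof (intro allI impI)
    fix c assume ex: "\<exists>\<phi>. realizable (\<lambda>_. 0) (\<lambda>p q. \<Sum>i\<in>{0..<card I}. c i * H (f i) p q) \<phi>"
    define c' where "c' j = c (the_inv_into {0..<card I} f j)" for j
    have c': "c' (f i) = c i" if "i \<in> {0..<card I}" for i
      using the_inv_into_f_f[OF inj that] by (simp add: c'_def)
    have "(\<Sum>i\<in>{0..<card I}. c i * H (f i) p q) = (\<Sum>j\<in>I. c' j * H j p q)" for p q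
      unfolding sum.reindex_bij_betw[OF f, symmetric] by (rule sum.cong) (auto simp: c')
    with ex have "\<exists>\<phi>. realizable (\<lambda>_. 0) (\<lambda>p q. \<Sum>j\<in>I. c' j * H j p q) \<phi>" by simp
    then have "\<forall>j\<in>I. c' j = 0" using pps_indepD[OF assms(3)] by blast
    then show "\<forall>i\<in>{0..<card I}. c i = 0" using c' im by force
  qed
  then have "card {0..<card I} \<le> g" proof (intro genus_bound[of _ "\<lambda>i. H (f i)"])
    show "pps (H (f i))" if "i \<in> {0..<card I}" for i using that im assms(2) by blast
  qed auto
  then show ?thesis by simp
qed

text \<open>The polar parts \<open>unif p ^ - k\<close> with \<open>1 \<le> k \<le> D p\<close> together with \<open>Y\<close> are \<open>deg D + card J\<close> classes
  in a space of dimension at most \<open>g\<close>; each relation between them is witnessed by a new function in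
  \<open>Lsp D\<close>.\<close>

theorem riemann_roch_lower:
  fixes Y :: "'j \<Rightarrow> 'p \<Rightarrow> 'p \<Rightarrow> 'k"
  assumes finD: "finite {p \<in> X. D p \<noteq> 0}"
    and J: "finite J" "\<And>j. j \<in> J \<Longrightarrow> pps (Y j)" "pps_indep D J Y"
  shows "\<exists>(I :: ('j + 'p \<times> nat) option set) \<phi>. finite I \<and> lin_indep I \<phi> \<and> (\<forall>i\<in>I. Lsp D (\<phi> i)) \<and>
    card J + (\<Sum>p\<in>{p \<in> X. D p \<noteq> 0}. D p) + 1 \<le> card I + g"
proof -
  let ?S = "{p \<in> X. D p \<noteq> 0}"
  define Z where "Z = (SIGMA p:?S. {1..D p})"
  define W where "W z r q = (if r = fst z then inverse (unif r q ^ snd z) else (0::'k))" for z r q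
  define T where "T = Inl ` J \<union> Inr ` Z"
  define H where "H = case_sum Y W"
  have Hs [simp]: "H (Inl j) = Y j" "H (Inr z) = W z" for j z by (auto simp: H_def)
  have finZ: "finite Z" unfolding Z_def using finD by (intro finite_SigmaI) auto
  have finT: "finite T" unfolding T_def using finZ J by auto
  have cardT: "card T = card J + (\<Sum>p\<in>?S. D p)"
  proof -
    have "card T = card (Inl ` J :: ('j + 'p \<times> nat) set) + card (Inr ` Z :: ('j + 'p \<times> nat) set)"
      unfolding T_def by (rule card_Un_disjoint) (use finZ J in auto)
    also have "\<dots> = card J + card Z" by (simp add: card_image)
    also have "card Z = (\<Sum>p\<in>?S. D p)" unfolding Z_def using finD by (subst card_SigmaI) auto
    finally show ?thesis .
  qed
  have ratW: "rat (W z r)" if "r \<in> X" for z r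
  proof -
    have "rat (\<lambda>q. inverse (unif r q ^ snd z))"
      using nz_unif[OF that, of "- int (snd z)"] by (simp add: nz_def power_int_minus)
    then show ?thesis using rat_const[of 0] by (cases "r = fst z") (simp_all add: W_def[abs_def])
  qed
  have ppsH: "pps (H i)" if "i \<in> T" for i
  proof (cases i)
    case (Inl j) then show ?thesis using that J by (auto simp: T_def)
  next
    case (Inr z)
    have "{p \<in> X. W z p \<noteq> (\<lambda>_. 0)} \<subseteq> {fst z}" by (auto simp: W_def fun_eq_iff)
    then have "finite {p \<in> X. W z p \<noteq> (\<lambda>_. 0)}" by (rule finite_subset) simp
    then show ?thesis using Inr ratW by (simp add: pps_def)
  qed
  have WD: "realizable D (W z) (\<lambda>_. 0)" if "z \<in> Z" for z
    unfolding realizable_def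
  proof (intro conjI ballI)
    fix p assume p: "p \<in> X"
    show "rgl p (\<lambda>q. (W z p q - 0) * unif p q ^ D p)"
    proof (cases "p = fst z")
      case True
      have k: "snd z \<le> D p" using that True by (auto simp: Z_def)
      have "(\<lambda>q. unif p q ^ (D p - snd z)) \<simeq> (\<lambda>q. (W z p q - 0) * unif p q ^ D p)"
        using unif_nonzero[OF p] unfolding aeq_def
        by eventually_elim (use True k in \<open>simp add: W_def power_diff field_simps\<close>)
      then show ?thesis using rgl_cong rgl_power rgl_unif p by blast
    next
      case False
      then show ?thesis using rgl_const[OF p, of 0] by (simp add: W_def)
    qed
  qed (rule rat_const)
  \<comment> \<open>Realizability modulo O implies realizability modulo O(D), so classes that are
    independent in H^1(O(D)) come from independent ones in H^1(O).\<close>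
  have "pps_indep (\<lambda>_. 0) (Inl ` J) H"
    unfolding pps_indep_def
  proof (intro allI impI)
    fix c assume "\<exists>\<phi>. realizable (\<lambda>_. 0) (\<lambda>p q. \<Sum>i\<in>Inl ` J. c i * H i p q) \<phi>"
    then obtain \<phi> where "realizable (\<lambda>_. 0) (\<lambda>p q. \<Sum>j\<in>J. c (Inl j) * Y j p q) \<phi>"
      by (auto simp: sum.reindex)
    then have "realizable D (\<lambda>p q. \<Sum>j\<in>J. c (Inl j) * Y j p q) \<phi>"
      using realizable_mono by blast
    then have "\<forall>j\<in>J. c (Inl j) = 0" by (rule pps_indepD[OF J(3)])
    then show "\<forall>i\<in>Inl ` J. c i = 0" by simp
  qed
  \<comment> \<open>A maximal independent set A containing the classes of J has at most g elements.
    Each class i outside A then satisfies a relation with coefficient 1 at i, and the function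
    \<open>\<phi> i\<close> realizing this relation is a new element of L(D).\<close>
  define AA where "AA = {A. Inl ` J \<subseteq> A \<and> A \<subseteq> T \<and> pps_indep (\<lambda>_. 0) A H}"
  have "Inl ` J \<in> AA" using \<open>pps_indep (\<lambda>_. 0) (Inl ` J) H\<close> by (auto simp: T_def AA_def)
  moreover have "finite AA"
    by (rule finite_subset[of _ "Pow T"]) (use finT in \<open>auto simp: AA_def\<close>)
  ultimately have "\<exists>m\<in>AA. Inl ` J \<subseteq> m \<and> (\<forall>b\<in>AA. m \<subseteq> b \<longrightarrow> m = b)"
    by (rule finite_has_maximal2[rotated])
  then obtain A where A': "A \<in> AA" "\<forall>B\<in>AA. A \<subseteq> B \<longrightarrow> A = B"
    by (elim bexE conjE) (rule that)
  have A: "Inl ` J \<subseteq> A" "A \<subseteq> T" "pps_indep (\<lambda>_. 0) A H" using A'(1) by (auto simp: AA_def)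
  have maxA: "B = A" if "A \<subseteq> B" "B \<subseteq> T" "pps_indep (\<lambda>_. 0) B H" for B
    using bspec[OF A'(2), of B] that A(1) by (auto simp: AA_def)
  have finA: "finite A" using A finT finite_subset by blast
  have cardA: "card A \<le> g" using genus_bound'[OF finA _ A(3)] ppsH A(2) by blast
  have ex: "\<exists>x. realizable (\<lambda>_. 0) (\<lambda>p q. H i p q + (\<Sum>j\<in>A. fst x j * H j p q)) (snd x)" if i: "i \<in> T - A" for i
  proof -
    have "\<not> pps_indep (\<lambda>_. 0) (insert i A) H" using maxA[of "insert i A"] i A(2) by blast
    then obtain c \<phi> where c: "realizable (\<lambda>_. 0) (\<lambda>p q. \<Sum>j\<in>insert i A. c j * H j p q) \<phi>"
      "\<exists>j\<in>insert i A. c j \<noteq> 0" unfolding pps_indep_def by blast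
    have s: "(\<Sum>j\<in>insert i A. c j * H j p q) = c i * H i p q + (\<Sum>j\<in>A. c j * H j p q)" for p q
      using i finA by simp
    have ci: "c i \<noteq> 0"
    proof
      assume "c i = 0"
      then have "realizable (\<lambda>_. 0) (\<lambda>p q. \<Sum>j\<in>A. c j * H j p q) \<phi>" using c(1) s by simp
      then have "\<forall>j\<in>A. c j = 0" by (rule pps_indepD[OF A(3)])
      then show False using c(2) \<open>c i = 0\<close> by blast
    qed
    have "realizable (\<lambda>_. 0) (\<lambda>p q. inverse (c i) * (\<Sum>j\<in>insert i A. c j * H j p q)) (\<lambda>q. inverse (c i) * \<phi> q)"
      by (rule realizable_cmult[OF c(1)])
    moreover have "inverse (c i) * (\<Sum>j\<in>insert i A. c j * H j p q) =
       H i p q + (\<Sum>j\<in>A. (inverse (c i) * c j) * H j p q)" for p q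
      unfolding s using ci by (simp add: distrib_left mult.assoc[symmetric] sum_distrib_left)
    ultimately show ?thesis
      by (intro exI[of _ "(\<lambda>j. inverse (c i) * c j, \<lambda>q. inverse (c i) * \<phi> q)"]) simp
  qed
  then have "\<forall>i\<in>T - A. \<exists>x. realizable (\<lambda>_. 0) (\<lambda>p q. H i p q + (\<Sum>j\<in>A. fst x j * H j p q)) (snd x)"
    by (intro ballI ex)
  from bchoice[OF this] obtain x where
    x: "\<forall>i\<in>T - A. realizable (\<lambda>_. 0) (\<lambda>p q. H i p q + (\<Sum>j\<in>A. fst (x i) j * H j p q)) (snd (x i))" ..
  define b where "b i = fst (x i)" for i
  define \<phi> where "\<phi> i = snd (x i)" for i
  have b: "realizable (\<lambda>_. 0) (\<lambda>p q. H i p q + (\<Sum>j\<in>A. b i j * H j p q)) (\<phi> i)" if "i \<in> T - A" for i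
    using bspec[OF x that] unfolding b_def \<phi>_def .
  have iZ: "\<exists>z\<in>Z. i = Inr z" if "i \<in> T - A" for i using that A(1) by (auto simp: T_def)
  define AZ where "AZ = {z \<in> Z. Inr z \<in> A}"
  have Aeq: "A = Inl ` J \<union> Inr ` AZ" using A(1,2) by (auto simp: AZ_def T_def)
  have finAZ: "finite AZ" using finZ by (simp add: AZ_def)
  have sumA: "(\<Sum>j\<in>A. f j) = (\<Sum>j\<in>J. f (Inl j)) + (\<Sum>z\<in>AZ. f (Inr z))" for f :: "_ \<Rightarrow> 'k"
    unfolding Aeq by (subst sum.union_disjoint) (use J finAZ in \<open>auto simp: sum.reindex\<close>)
  have ZD: "realizable D (\<lambda>p q. \<Sum>z\<in>B. e z * W z p q) (\<lambda>_. 0)" if "B \<subseteq> Z" for B e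
    using finite_subset[OF that finZ] that
  proof (induction B rule: finite_induct)
    case empty then show ?case using rat_const rgl_const by (simp add: realizable_def)
  next
    case (insert z B)
    then show ?case using realizable_add[OF realizable_cmult[OF WD[of z], of "e z"] insert.IH] by simp
  qed
  \<comment> \<open>Modulo O(D) the polar parts \<open>W\<close> vanish, so the relation for i
    becomes one among the \<open>Y\<close>, which are independent there. The relation therefore
    involves polar parts only, and \<open>\<phi> i\<close> lies in L(D).\<close>
  have bJ: "b i (Inl j) = 0" if i: "i \<in> T - A" and j: "j \<in> J" for i j
  proof -
    obtain z where z: "z \<in> Z" "i = Inr z" using iZ i by blast
    have "realizable D (\<lambda>p q. H i p q + (\<Sum>j\<in>A. b i j * H j p q)) (\<phi> i)"
      using realizable_mono[OF b[OF i]] by blast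
    from realizable_add[OF this realizable_cmult[OF realizable_add[OF WD[OF z(1)] ZD[of AZ "\<lambda>z. b i (Inr z)"]], of "-1"]]
    have "realizable D (\<lambda>p q. \<Sum>j\<in>J. b i (Inl j) * Y j p q) (\<phi> i)"
      by (simp add: sumA z AZ_def)
    then have "\<forall>j\<in>J. b i (Inl j) = 0" by (rule pps_indepD[OF J(3)])
    then show ?thesis using j by blast
  qed
  have b': "realizable (\<lambda>_. 0) (\<lambda>p q. H i p q + (\<Sum>z\<in>AZ. b i (Inr z) * W z p q)) (\<phi> i)" if "i \<in> T - A" for i
    using b[OF that] bJ[OF that] by (simp add: sumA)
  have phiD: "Lsp D (\<phi> i)" if i: "i \<in> T - A" for i
  proof -
    obtain z where z: "z \<in> Z" "i = Inr z" using iZ i by blast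
    have "realizable D (\<lambda>p q. H i p q + (\<Sum>z\<in>AZ. b i (Inr z) * W z p q)) (\<phi> i)"
      using realizable_mono[OF b'[OF i]] by blast
    from realizable_add[OF realizable_add[OF WD[OF z(1)] ZD[of AZ "\<lambda>z. b i (Inr z)"]] realizable_cmult[OF this, of "-1"]]
    have "realizable D (\<lambda>p q. 0) (\<lambda>q. - \<phi> i q)"
      by (simp add: z AZ_def)
    then have r: "realizable D (\<lambda>p q. 0) (\<lambda>q. - \<phi> i q)" .
    show ?thesis
      unfolding Lsp_def
    proof (intro conjI ballI)
      show "rat (\<phi> i)" using b[OF i] by (simp add: realizable_def)
      show "rgl p (\<lambda>q. \<phi> i q * unif p q ^ D p)" if "p \<in> X" for p
        using r that by (simp add: realizable_def)
    qed
  qed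
  \<comment> \<open>\<open>None\<close> stands for the constant function 1, the source of the
    \<open>+ 1\<close> in the bound.\<close>
  define I where "I = insert None (Some ` (T - A))"
  define \<psi> where "\<psi> i = (case i of None \<Rightarrow> (\<lambda>_. 1) | Some i \<Rightarrow> \<phi> i)" for i
  have finI: "finite I" using finT by (simp add: I_def)
  have "lin_indep I \<psi>"
    unfolding lin_indep_def
  proof (intro allI impI)
    fix c assume c: "(\<lambda>q. \<Sum>i\<in>I. c i * \<psi> i q) \<simeq> (\<lambda>_. 0)"
    define TA where "TA = {z \<in> Z. Inr z \<notin> A}"
    have TA: "T - A = Inr ` TA" using A(1) by (auto simp: TA_def T_def)
    have sumI: "(\<Sum>i\<in>I. c i * \<psi> i q) = c None + (\<Sum>z\<in>TA. c (Some (Inr z)) * \<phi> (Inr z) q)" for q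
      unfolding I_def TA using finZ by (subst sum.insert) (auto simp: \<psi>_def TA_def sum.reindex)
    \<comment> \<open>\<open>\<gamma> z\<close> is the total coefficient of the polar part
      \<open>W z\<close> when the relations are added with weights c. On \<open>TA\<close> it is the
      weight itself, because the relation for an index outside A involves no other index outside
      A.\<close>
    define \<gamma> where "\<gamma> z = (if z \<in> TA then c (Some (Inr z)) else 0) +
       (if z \<in> AZ then \<Sum>y\<in>TA. c (Some (Inr y)) * b (Inr y) (Inr z) else 0)" for z
    define \<Phi> where "\<Phi> q = (\<Sum>z\<in>TA. c (Some (Inr z)) * \<phi> (Inr z) q)" for q
    have ZTA: "Z = TA \<union> AZ" "TA \<inter> AZ = {}" by (auto simp: TA_def AZ_def)
    have finTA: "finite TA" using finZ by (simp add: TA_def)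
    have sumW: "(\<Sum>y\<in>TA. c (Some (Inr y)) * (H (Inr y) p q + (\<Sum>z\<in>AZ. b (Inr y) (Inr z) * W z p q))) =
       (\<Sum>z\<in>Z. \<gamma> z * W z p q)" for p q
    proof -
      have "(\<Sum>z\<in>Z. \<gamma> z * W z p q) = (\<Sum>z\<in>TA. \<gamma> z * W z p q) + (\<Sum>z\<in>AZ. \<gamma> z * W z p q)"
        unfolding ZTA(1) using finTA finAZ ZTA(2) by (rule sum.union_disjoint)
      also have "(\<Sum>z\<in>TA. \<gamma> z * W z p q) = (\<Sum>z\<in>TA. c (Some (Inr z)) * W z p q)"
        by (rule sum.cong) (use ZTA(2) in \<open>auto simp: \<gamma>_def\<close>)
      also have "(\<Sum>z\<in>AZ. \<gamma> z * W z p q) = (\<Sum>z\<in>AZ. (\<Sum>y\<in>TA. c (Some (Inr y)) * b (Inr y) (Inr z)) * W z p q)"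
        by (rule sum.cong) (use ZTA(2) in \<open>auto simp: \<gamma>_def\<close>)
      also have "\<dots> = (\<Sum>y\<in>TA. \<Sum>z\<in>AZ. c (Some (Inr y)) * b (Inr y) (Inr z) * W z p q)"
        unfolding sum_distrib_right by (rule sum.swap)
      finally show ?thesis by (simp add: distrib_left sum.distrib sum_distrib_left mult.assoc)
    qed
    have "realizable (\<lambda>_. 0) (\<lambda>p q. \<Sum>y\<in>B. c (Some (Inr y)) * (H (Inr y) p q + (\<Sum>z\<in>AZ. b (Inr y) (Inr z) * W z p q)))
       (\<lambda>q. \<Sum>z\<in>B. c (Some (Inr z)) * \<phi> (Inr z) q)" if "B \<subseteq> TA" for B
      using finite_subset[OF that finTA] that
    proof (induction B rule: finite_induct)
      case empty then show ?case using rat_const rgl_const by (simp add: realizable_def)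
    next
      case (insert z B)
      then show ?case
        using realizable_add[OF realizable_cmult[OF b'[of "Inr z"], of "c (Some (Inr z))"] insert.IH] TA by auto
    qed
    from this[of TA] have r: "realizable (\<lambda>_. 0) (\<lambda>p q. \<Sum>z\<in>Z. \<gamma> z * W z p q) \<Phi>"
      unfolding sumW \<Phi>_def by simp
    have "(\<lambda>q. c None + \<Phi> q) \<simeq> (\<lambda>_. 0)" using c unfolding sumI \<Phi>_def .
    then have \<Phi>c: "(\<lambda>_. - c None) \<simeq> \<Phi>" unfolding aeq_def
      by eventually_elim (simp add: add_eq_0_iff2)
    \<comment> \<open>The assumed dependency makes \<open>\<Phi>\<close> constant, so the polar
      parts with coefficients \<open>\<gamma>\<close> add up to a regular function at each
      point.\<close>
    have \<gamma>0: "\<gamma> z = 0" if z: "z \<in> Z" for z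
    proof -
      obtain p k where pk: "z = (p, k)" "p \<in> X" "D p \<noteq> 0" "k \<in> {1..D p}" using z by (auto simp: Z_def)
      have "rgl p (\<lambda>q. ((\<Sum>z\<in>Z. \<gamma> z * W z p q) - \<Phi> q) + \<Phi> q)"
        using r pk rgl_cong[OF rgl_const \<Phi>c] by (intro rgl_add) (auto simp: realizable_def)
      then have "rgl p (\<lambda>q. \<Sum>z\<in>Z. \<gamma> z * W z p q)" by simp
      moreover have "(\<Sum>z\<in>Z. \<gamma> z * W z p q) = (\<Sum>k\<in>{1..D p}. \<gamma> (p, k) * inverse (unif p q ^ k))" for q
      proof -
        have "(\<Sum>z\<in>Z. \<gamma> z * W z p q) = (\<Sum>z\<in>{p} \<times> {1..D p}. \<gamma> z * W z p q)"
          by (rule sum.mono_neutral_right) (use finZ pk in \<open>auto simp: Z_def W_def\<close>)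
        also have "\<dots> = (\<Sum>k\<in>{1..D p}. \<gamma> (p, k) * inverse (unif p q ^ k))"
        proof -
          have "{p} \<times> {1..D p} = Pair p ` {1..D p}" by auto
          then show ?thesis by (simp add: sum.reindex inj_on_def W_def)
        qed
        finally show ?thesis .
      qed
      ultimately have "rgl p (\<lambda>q. \<Sum>k\<in>{1..D p}. \<gamma> (p, k) * inverse (unif p q ^ k))" by simp
      from pole_coeffs_zero[OF pk(2) this pk(4)] show ?thesis using pk(1) by simp
    qed
    have cz: "c (Some (Inr z)) = 0" if "z \<in> TA" for z
    proof -
      have "z \<in> Z" "z \<notin> AZ" using that ZTA by blast+
      then show ?thesis using \<gamma>0[of z] that by (simp add: \<gamma>_def)
    qed
    then have "\<Phi> = (\<lambda>_. 0)" unfolding \<Phi>_def by (intro ext sum.neutral ballI) simp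
    then have "c None = 0" using \<Phi>c by (simp add: aeq_const_iff)
    then show "\<forall>i\<in>I. c i = 0" using cz TA by (auto simp: I_def)
  qed
  moreover have "\<forall>i\<in>I. Lsp D (\<psi> i)"
  proof -
    have "Lsp D (\<lambda>_. 1)" unfolding Lsp_def using rat_const by (auto intro: rgl_power rgl_unif)
    then show ?thesis using phiD by (auto simp: I_def \<psi>_def)
  qed
  moreover have "card J + (\<Sum>p\<in>?S. D p) + 1 \<le> card I + g"
  proof -
    have "card I = Suc (card (T - A))" unfolding I_def using finT by (simp add: card_image)
    moreover have "card (T - A) = card T - card A" using A(2) finA by (simp add: card_Diff_subset)
    ultimately show ?thesis using cardA cardT card_mono[OF finT A(2)] by linarith
  qed
  ultimately show ?thesis using finI by blast
qed

text \<open>Let a and b be the degrees of zeros and poles. Multiplication by \<open>h ^ n\<close>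
  embeds L(n times the zeros) into L(n times the poles), whence n a + 1 - g \<le> n b + 1 for every
  n. The choice n = g + 1 rules out a > b.\<close>

lemma deg_zeros_le_deg_poles:
  assumes h: "nz h"
  shows "(\<Sum>p\<in>{p \<in> X. ordr p h \<noteq> 0}. nat (ordr p h)) \<le> (\<Sum>p\<in>{p \<in> X. ordr p h \<noteq> 0}. nat (- ordr p h))"
    (is "?a \<le> ?b")
proof -
  let ?S = "{p \<in> X. ordr p h \<noteq> 0}"
  have fin: "finite ?S" by (rule finite_ordr[OF h])
  have bound: "n * ?a \<le> n * ?b + g" for n
  proof -
    define D where "D p = n * nat (ordr p h)" for p
    define E where "E p = n * nat (- ordr p h)" for p
    have sD: "{p \<in> X. D p \<noteq> 0} \<subseteq> ?S" and sE: "{p \<in> X. E p \<noteq> 0} \<subseteq> ?S" by (auto simp: D_def E_def)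
    have finD: "finite {p \<in> X. D p \<noteq> 0}" "finite {p \<in> X. E p \<noteq> 0}" using finite_subset fin sD sE by blast+
    have sumD: "(\<Sum>p\<in>{p \<in> X. D p \<noteq> 0}. D p) = n * ?a"
    proof -
      have "(\<Sum>p\<in>{p \<in> X. D p \<noteq> 0}. D p) = (\<Sum>p\<in>?S. D p)"
        by (rule sum.mono_neutral_left) (use fin sD in auto)
      then show ?thesis by (simp add: D_def sum_distrib_left)
    qed
    have sumE: "(\<Sum>p\<in>{p \<in> X. E p \<noteq> 0}. E p) = n * ?b"
    proof -
      have "(\<Sum>p\<in>{p \<in> X. E p \<noteq> 0}. E p) = (\<Sum>p\<in>?S. E p)"
        by (rule sum.mono_neutral_left) (use fin sE in auto)
      then show ?thesis by (simp add: E_def sum_distrib_left)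
    qed
    obtain I :: "(nat + 'p \<times> nat) option set" and \<phi> where I: "finite I" "lin_indep I \<phi>" "\<forall>i\<in>I. Lsp D (\<phi> i)"
      "(\<Sum>p\<in>{p \<in> X. D p \<noteq> 0}. D p) + 1 \<le> card I + g"
      using riemann_roch_lower[of D "{}" "\<lambda>_. undefined"] finD by (auto simp: pps_indep_def)
    define \<psi> where "\<psi> i q = \<phi> i q * h q ^ n" for i q
    have "lin_indep I \<psi>"
      unfolding lin_indep_def
    proof (intro allI impI)
      fix c assume "(\<lambda>q. \<Sum>i\<in>I. c i * \<psi> i q) \<simeq> (\<lambda>_. 0)"
      moreover have "(\<Sum>i\<in>I. c i * \<psi> i q) = (\<Sum>i\<in>I. c i * \<phi> i q) * h q ^ n" for q
        by (simp add: \<psi>_def sum_distrib_right mult.assoc)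
      moreover have "eventually (\<lambda>q. h q \<noteq> 0) gen" using h by (simp add: nz_def)
      ultimately have "(\<lambda>q. \<Sum>i\<in>I. c i * \<phi> i q) \<simeq> (\<lambda>_. 0)" unfolding aeq_def
        by (auto elim: eventually_elim2)
      then show "\<forall>i\<in>I. c i = 0" using lin_indepD[OF I(2)] by blast
    qed
    moreover have "Lsp E (\<psi> i)" if i: "i \<in> I" for i
      unfolding Lsp_def
    proof (intro conjI ballI)
      have hn: "nz (\<lambda>q. h q ^ n)" using h nz_power by blast
      show "rat (\<psi> i)" unfolding \<psi>_def using I(3) i hn by (auto intro!: rat_mult simp: Lsp_def nz_def)
      fix p assume p: "p \<in> X"
      let ?u = "\<lambda>q. h q ^ n * unif p q powi (int (E p) - int (D p))"
      have "nz ?u" using hn nz_unif[OF p] nz_mult by blast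
      moreover have "ordr p ?u = 0"
        using p h hn by (simp add: ordr_mult nz_unif ordr_unif ordr_power D_def E_def)
      ultimately have "rgl p ?u" using rgl_iff_ordr p by simp
      then have "rgl p (\<lambda>q. (\<phi> i q * unif p q ^ D p) * ?u q)"
        using I(3) i p by (intro rgl_mult[where f = "\<lambda>q. \<phi> i q * unif p q ^ D p"]) (auto simp: Lsp_def)
      moreover have "(\<lambda>q. (\<phi> i q * unif p q ^ D p) * ?u q) \<simeq> (\<lambda>q. \<psi> i q * unif p q ^ E p)"
        using unif_nonzero[OF p] unfolding aeq_def
        by eventually_elim (simp add: \<psi>_def power_int_diff)
      ultimately show "rgl p (\<lambda>q. \<psi> i q * unif p q ^ E p)" using rgl_cong by blast
    qed
    ultimately have "card I \<le> n * ?b + 1"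
      using card_indep_le[OF regular_const finD(2) I(1), of \<psi>] sumE by simp
    then show ?thesis using I(4) sumD by linarith
  qed
  show ?thesis
  proof (rule ccontr)
    assume "\<not> ?a \<le> ?b"
    then have "?a = ?b + Suc (?a - ?b - 1)" by simp
    then obtain k where k: "?a = ?b + Suc k" ..
    have "Suc g * ?a \<le> Suc g * ?b + g" by (rule bound)
    then have "Suc g * Suc k \<le> g" unfolding k by (simp only: add_mult_distrib2)
    moreover have "Suc g * 1 \<le> Suc g * Suc k" by (intro mult_le_mono2) simp
    ultimately have "Suc g * 1 \<le> g" by (rule le_trans[rotated])
    then show False by simp
  qed
qed

text \<open>Apply the inequality to h and to 1 / h, whose zeros are the poles of h.\<close>

theorem degree_principal:
  assumes h: "nz h" shows "(\<Sum>p\<in>{p \<in> X. ordr p h \<noteq> 0}. ordr p h) = 0"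
proof -
  let ?S = "{p \<in> X. ordr p h \<noteq> 0}"
  let ?a = "\<Sum>p\<in>?S. nat (ordr p h)" and ?b = "\<Sum>p\<in>?S. nat (- ordr p h)"
  have i: "ordr p (\<lambda>q. inverse (h q)) = - ordr p h" if "p \<in> X" for p using ordr_inverse[OF that h] .
  have S: "{p \<in> X. ordr p (\<lambda>q. inverse (h q)) \<noteq> 0} = ?S" using i by auto
  have "(\<Sum>p\<in>?S. nat (ordr p (\<lambda>q. inverse (h q)))) = ?b" "(\<Sum>p\<in>?S. nat (- ordr p (\<lambda>q. inverse (h q)))) = ?a"
    by (rule sum.cong; simp add: i)+
  then have "?b \<le> ?a" using deg_zeros_le_deg_poles[OF nz_inverse[OF h]] unfolding S by simp
  with deg_zeros_le_deg_poles[OF h] have "?a = ?b" by simp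
  moreover have "(\<Sum>p\<in>?S. ordr p h) = int ?a - int ?b"
    unfolding of_nat_sum sum_subtractf[symmetric] by (rule sum.cong) auto
  ultimately show ?thesis by simp
qed

end

subsection \<open>Hilbert's basis theorem\<close>

text \<open>Rings are subsets of a type because the polynomial functions in the coordinates from a
  set \<open>I\<close> form a subset of all functions, and the induction below varies
  \<open>I\<close>.\<close>

definition subring_of :: "'a::comm_ring_1 set \<Rightarrow> bool" where
  "subring_of R \<longleftrightarrow> 1 \<in> R \<and> (\<forall>x\<in>R. \<forall>y\<in>R. x + y \<in> R \<and> x * y \<in> R \<and> - x \<in> R)"

lemma subring_ofD:
  assumes "subring_of R"
  shows "0 \<in> R" "1 \<in> R" "x \<in> R \<Longrightarrow> y \<in> R \<Longrightarrow> x + y \<in> R" "x \<in> R \<Longrightarrow> y \<in> R \<Longrightarrow> x * y \<in> R"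
    "x \<in> R \<Longrightarrow> - x \<in> R" "x \<in> R \<Longrightarrow> y \<in> R \<Longrightarrow> x - y \<in> R"
proof -
  show "1 \<in> R" using assms by (simp add: subring_of_def)
  then have "1 + - 1 \<in> R" using assms unfolding subring_of_def by blast
  then show "0 \<in> R" by simp
  show "x \<in> R \<Longrightarrow> y \<in> R \<Longrightarrow> x + y \<in> R" "x \<in> R \<Longrightarrow> y \<in> R \<Longrightarrow> x * y \<in> R" "x \<in> R \<Longrightarrow> - x \<in> R"
    using assms by (simp_all add: subring_of_def)
  assume "x \<in> R" "y \<in> R"
  then have "x + - y \<in> R" using assms unfolding subring_of_def by blast
  then show "x - y \<in> R" by simp
qed

lemma subring_of_sum: "subring_of R \<Longrightarrow> (\<And>i. i \<in> I \<Longrightarrow> f i \<in> R) \<Longrightarrow> sum f I \<in> R"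
  by (induction I rule: infinite_finite_induct) (auto simp: subring_ofD)

inductive_set ispan :: "'a::comm_ring_1 set \<Rightarrow> 'a set \<Rightarrow> 'a set" for R S where
  zero: "0 \<in> ispan R S"
| step: "x \<in> ispan R S \<Longrightarrow> c \<in> R \<Longrightarrow> s \<in> S \<Longrightarrow> x + c * s \<in> ispan R S"

lemma ispan_add: "y \<in> ispan R S \<Longrightarrow> x \<in> ispan R S \<Longrightarrow> x + y \<in> ispan R S"
proof (induction y rule: ispan.induct)
  case zero then show ?case by simp
next
  case (step y c s)
  then have "(x + y) + c * s \<in> ispan R S" by (intro ispan.step) auto
  then show ?case by (simp add: add.assoc)
qed

lemma ispan_mult: assumes "subring_of R" "x \<in> ispan R S" "a \<in> R" shows "a * x \<in> ispan R S"
  using assms(2,1,3)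
proof (induction x rule: ispan.induct)
  case zero then show ?case by (simp add: ispan.zero)
next
  case (step y c s)
  then have "a * y + (a * c) * s \<in> ispan R S" by (intro ispan.step) (auto simp: subring_ofD)
  then show ?case by (simp add: algebra_simps)
qed

lemma ispan_base: "subring_of R \<Longrightarrow> s \<in> S \<Longrightarrow> s \<in> ispan R S"
  using ispan.step[OF ispan.zero, of 1 R s S] by (simp add: subring_ofD)

lemma ispan_minus: "subring_of R \<Longrightarrow> x \<in> ispan R S \<Longrightarrow> - x \<in> ispan R S"
  using ispan_mult[of R x S "- 1"] by (simp add: subring_ofD)

lemma ispan_sum: "(\<And>i. i \<in> I \<Longrightarrow> f i \<in> ispan R S) \<Longrightarrow> sum f I \<in> ispan R S"
  by (induction I rule: infinite_finite_induct) (auto simp: ispan.zero intro: ispan_add)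

lemma ispan_subset: assumes "subring_of R" "x \<in> ispan R S" "S \<subseteq> ispan R T" shows "x \<in> ispan R T"
  using assms(2,1,3)
proof (induction x rule: ispan.induct)
  case zero then show ?case by (simp add: ispan.zero)
next
  case (step y c s)
  then show ?case by (auto intro: ispan_add ispan_mult)
qed

lemma ispan_mono: "x \<in> ispan R S \<Longrightarrow> S \<subseteq> T \<Longrightarrow> x \<in> ispan R T"
  by (induction x rule: ispan.induct) (auto intro: ispan.intros)

lemma ispan_in: assumes "subring_of R" "x \<in> ispan R S" "S \<subseteq> R" shows "x \<in> R"
  using assms(2,1,3) by (induction x rule: ispan.induct) (auto simp: subring_ofD)

lemma ispan_finite_stage:
  "x \<in> ispan R (range f) \<Longrightarrow> \<exists>N::nat. x \<in> ispan R (f ` {..<N})"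
proof (induction x rule: ispan.induct)
  case zero then show ?case using ispan.zero by blast
next
  case (step y c s)
  then obtain N k where N: "y \<in> ispan R (f ` {..<N})" "s = f k" by auto
  have "y \<in> ispan R (f ` {..<max N (Suc k)})" by (rule ispan_mono[OF N(1)]) auto
  then have "y + c * s \<in> ispan R (f ` {..<max N (Suc k)})"
    using step N by (intro ispan.step) auto
  then show ?case by blast
qed

lemma ispan_finite_stages:
  assumes "finite G" "G \<subseteq> ispan R (range f)"
  shows "\<exists>N::nat. G \<subseteq> ispan R (f ` {..<N})"
  using assms
proof (induction G)
  case empty then show ?case by blast
next
  case (insert x G)
  then obtain N where N: "G \<subseteq> ispan R (f ` {..<N})" by auto
  obtain M where M: "x \<in> ispan R (f ` {..<M})" using ispan_finite_stage insert.prems by blast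
  have "insert x G \<subseteq> ispan R (f ` {..<max M N})"
    using N ispan_mono[OF M, of "f ` {..<max M N}"] ispan_mono[of _ R "f ` {..<N}" "f ` {..<max M N}"]
    by fastforce
  then show ?case by blast
qed

lemma ispan_seq:
  assumes "subring_of R" "x \<in> ispan R (f ` {..<m::nat})"
  shows "\<exists>c. (\<forall>i. c i \<in> R) \<and> x = (\<Sum>i<m. c i * f i)"
  using assms(2,1)
proof (induction x rule: ispan.induct)
  case zero then show ?case by (intro exI[of _ "\<lambda>_. 0"]) (simp add: subring_ofD)
next
  case (step y b s)
  then obtain c k where c: "\<forall>i. c i \<in> R" "y = (\<Sum>i<m. c i * f i)" "k < m" "s = f k" by auto
  define c' where "c' = c(k := c k + b)"
  have "(\<Sum>i<m. c' i * f i) = (\<Sum>i<m. c i * f i + (if i = k then b * f k else 0))"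
    by (rule sum.cong) (auto simp: c'_def algebra_simps)
  then have "y + b * s = (\<Sum>i<m. c' i * f i)" using c by (simp add: sum.distrib)
  moreover have "\<forall>i. c' i \<in> R" using c step by (auto simp: c'_def subring_ofD)
  ultimately show ?case by blast
qed

text \<open>The ascending chain condition in sequential form. It will be applied to the equations of
  a descending chain of closed sets and to the numerators left after successive divisions by a
  uniformizer.\<close>

definition noeth :: "'a::comm_ring_1 set \<Rightarrow> bool" where
  "noeth R \<longleftrightarrow> (\<forall>f::nat \<Rightarrow> 'a. range f \<subseteq> R \<longrightarrow> (\<exists>m. f m \<in> ispan R (f ` {..<m})))"

definition polys_over :: "'a::comm_ring_1 set \<Rightarrow> 'a poly set" where
  "polys_over R = {p. \<forall>i. coeff p i \<in> R}"

lemma subring_polys_over: assumes "subring_of R" shows "subring_of (polys_over R)"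
  unfolding subring_of_def polys_over_def
  using assms by (auto simp: subring_ofD coeff_mult intro!: subring_of_sum)

text \<open>If the ideal generated by the sequence were not finitely generated, elements g n of
  least degree outside the span of their predecessors could be chosen forever. The leading
  coefficient of some g m is a combination of earlier ones, and cancelling it gives an element of
  smaller degree outside the same span.\<close>

theorem hilbert_basis:
  assumes R: "subring_of R" and "noeth R"
  shows "noeth (polys_over R)"
  unfolding noeth_def
proof (intro allI impI, rule ccontr)
  let ?P = "polys_over R"
  fix f :: "nat \<Rightarrow> 'a poly"
  assume f: "range f \<subseteq> ?P" and no: "\<not> (\<exists>m. f m \<in> ispan ?P (f ` {..<m}))"
  have P: "subring_of ?P" by (rule subring_polys_over[OF R])
  define I where "I = ispan ?P (range f)"
  have IP: "I \<subseteq> ?P" unfolding I_def using ispan_in[OF P _ f] by blast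
  have notfg: "\<exists>x\<in>I. x \<notin> ispan ?P G" if "finite G" "G \<subseteq> I" for G
  proof -
    obtain N where N: "G \<subseteq> ispan ?P (f ` {..<N})" using ispan_finite_stages \<open>finite G\<close> \<open>G \<subseteq> I\<close> I_def by blast
    have "f N \<notin> ispan ?P G" using ispan_subset[OF P _ N] no by blast
    moreover have "f N \<in> I" unfolding I_def by (rule ispan_base[OF P]) simp
    ultimately show ?thesis by blast
  qed
  define Q where "Q g n r \<longleftrightarrow> r \<in> I \<and> r \<notin> ispan ?P (g ` {..<n}) \<and>
      (\<forall>y\<in>I. y \<notin> ispan ?P (g ` {..<n}) \<longrightarrow> degree r \<le> degree y)" for g :: "nat \<Rightarrow> 'a poly" and n :: nat and r
  have "\<exists>g. \<forall>n. Q g n (g n)"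
  proof (rule dependent_wf_choice[OF wf_less_than])
    fix g h :: "nat \<Rightarrow> 'a poly" and n r assume "\<And>z. (z, n) \<in> less_than \<Longrightarrow> g z = h z"
    then have "g ` {..<n} = h ` {..<n}" by (intro image_cong) auto
    then show "Q g n r = Q h n r" by (simp add: Q_def)
  next
    fix n and g :: "nat \<Rightarrow> 'a poly" assume "\<And>y. (y, n) \<in> less_than \<Longrightarrow> Q g y (g y)"
    then have "g ` {..<n} \<subseteq> I" by (auto simp: Q_def)
    then obtain x where "x \<in> I \<and> x \<notin> ispan ?P (g ` {..<n})" using notfg[of "g ` {..<n}"] by auto
    from arg_min_natI[of "\<lambda>x. x \<in> I \<and> x \<notin> ispan ?P (g ` {..<n})", OF this, of degree]
      arg_min_nat_le[of "\<lambda>x. x \<in> I \<and> x \<notin> ispan ?P (g ` {..<n})", of _ degree]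
    show "\<exists>r. Q g n r" unfolding Q_def by blast
  qed
  then obtain g where g: "\<And>n. Q g n (g n)" by blast
  have gI: "g n \<in> I" and gn: "g n \<notin> ispan ?P (g ` {..<n})"
    and gmin: "\<And>y. y \<in> I \<Longrightarrow> y \<notin> ispan ?P (g ` {..<n}) \<Longrightarrow> degree (g n) \<le> degree y" for n
    using g[of n] by (auto simp: Q_def)
  have "lead_coeff (g n) \<in> R" for n using gI IP by (auto simp: polys_over_def)
  then obtain m where m: "lead_coeff (g m) \<in> ispan R ((\<lambda>n. lead_coeff (g n)) ` {..<m})"
    using \<open>noeth R\<close> unfolding noeth_def by (metis (no_types, lifting) image_subsetI)
  then obtain c where c: "\<forall>i. c i \<in> R" "lead_coeff (g m) = (\<Sum>i<m. c i * lead_coeff (g i))"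
    using ispan_seq[OF R] by blast
  let ?d = "degree (g m)"
  \<comment> \<open>\<open>g m\<close> was already a candidate when \<open>g i\<close> was chosen,
    so the exponents \<open>?d - degree (g i)\<close> below are not truncated.\<close>
  have deg: "degree (g i) \<le> ?d" if "i < m" for i
  proof (rule gmin[OF gI])
    show "g m \<notin> ispan ?P (g ` {..<i})" using gn[of m] ispan_mono[of "g m" ?P "g ` {..<i}" "g ` {..<m}"] image_mono[of "{..<i}" "{..<m}" g] that by auto
  qed
  define s where "s = (\<Sum>i<m. monom (c i) (?d - degree (g i)) * g i)"
  have monP: "monom (c i) k \<in> ?P" for i k using c R by (auto simp: polys_over_def subring_ofD)
  have s: "s \<in> ispan ?P (g ` {..<m})"
    unfolding s_def by (intro ispan_sum ispan_mult[OF P] ispan_base[OF P] monP) auto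
  have sI: "s \<in> I" unfolding s_def I_def
    by (intro ispan_sum ispan_mult[OF P] monP) (use gI I_def in auto)
  define h where "h = g m - s"
  have "g m + - s \<in> I" using gI[of m] sI ispan_minus[OF P] ispan_add unfolding I_def by blast
  then have hI: "h \<in> I" by (simp add: h_def)
  have hn: "h \<notin> ispan ?P (g ` {..<m})"
  proof
    assume "h \<in> ispan ?P (g ` {..<m})"
    then have "s + h \<in> ispan ?P (g ` {..<m})" using s ispan_add by blast
    then show False using gn by (simp add: h_def)
  qed
  have "degree s \<le> ?d" unfolding s_def
  proof (rule degree_sum_le)
    fix i assume i: "i \<in> {..<m}"
    have "degree (monom (c i) (?d - degree (g i)) * g i) \<le> degree (monom (c i) (?d - degree (g i))) + degree (g i)"
      by (rule degree_mult_le)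
    also have "\<dots> \<le> (?d - degree (g i)) + degree (g i)" using degree_monom_le by (rule add_right_mono)
    also have "\<dots> = ?d" using deg i by simp
    finally show "degree (monom (c i) (?d - degree (g i)) * g i) \<le> ?d" .
  qed simp
  then have dh: "degree h \<le> ?d" unfolding h_def by (intro degree_diff_le) auto
  have "coeff (monom (c i) (?d - degree (g i)) * g i) ?d = c i * lead_coeff (g i)" if "i < m" for i
    using deg[OF that] by (simp add: coeff_monom_mult)
  then have "coeff s ?d = (\<Sum>i<m. c i * lead_coeff (g i))"
    unfolding s_def coeff_sum by (intro sum.cong) auto
  then have ch: "coeff h ?d = 0" by (simp add: h_def c(2)[symmetric])
  have "h \<noteq> 0" using hn ispan.zero by blast
  then have "degree h < ?d" using dh ch by (metis le_neq_implies_less leading_coeff_0_iff)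
  then show False using gmin[OF hI hn] by simp
qed

lemma noeth_image:
  fixes h :: "'a::comm_ring_1 \<Rightarrow> 'b::comm_ring_1"
  assumes "noeth R" and hom: "\<And>x y. h (x + y) = h x + h y" "\<And>x y. h (x * y) = h x * h y" "h 0 = 0"
  shows "noeth (h ` R)"
  unfolding noeth_def
proof (intro allI impI)
  fix f :: "nat \<Rightarrow> 'b" assume "range f \<subseteq> h ` R"
  then have "\<forall>n. \<exists>x. x \<in> R \<and> f n = h x" by blast
  then obtain f' where f': "\<And>n. f' n \<in> R" "\<And>n. f n = h (f' n)" by metis
  then have "range f' \<subseteq> R" by blast
  then obtain m where m: "f' m \<in> ispan R (f' ` {..<m})" using assms(1) unfolding noeth_def by blast
  have "h x \<in> ispan (h ` R) (f ` {..<m})" if "x \<in> ispan R (f' ` {..<m})" for x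
    using that
  proof (induction x rule: ispan.induct)
    case zero then show ?case by (simp add: hom ispan.zero)
  next
    case (step y c s)
    then show ?case unfolding hom by (intro ispan.step) (auto simp: f')
  qed
  then show "\<exists>m. f m \<in> ispan (h ` R) (f ` {..<m})" using m f'(2) by metis
qed

subsection \<open>Polynomial functions\<close>

inductive_set polyfun :: "'n set \<Rightarrow> (('n \<Rightarrow> 'k::field) \<Rightarrow> 'k) set" for I where
  const: "(\<lambda>_. c) \<in> polyfun I"
| coord: "i \<in> I \<Longrightarrow> (\<lambda>x. x i) \<in> polyfun I"
| add: "f \<in> polyfun I \<Longrightarrow> g \<in> polyfun I \<Longrightarrow> (\<lambda>x. f x + g x) \<in> polyfun I"
| mult: "f \<in> polyfun I \<Longrightarrow> g \<in> polyfun I \<Longrightarrow> (\<lambda>x. f x * g x) \<in> polyfun I"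

lemma subring_polyfun: "subring_of (polyfun I :: (('n \<Rightarrow> 'k::field) \<Rightarrow> 'k) set)"
  unfolding subring_of_def
proof (intro conjI ballI)
  show "1 \<in> polyfun I" using polyfun.const[of 1 I] by (simp add: one_fun_def)
  fix f g :: "('n \<Rightarrow> 'k) \<Rightarrow> 'k" assume fg: "f \<in> polyfun I" "g \<in> polyfun I"
  show "f + g \<in> polyfun I" "f * g \<in> polyfun I"
    using polyfun.add[OF fg] polyfun.mult[OF fg] by (simp_all add: plus_fun_def times_fun_def)
  show "- f \<in> polyfun I"
    using polyfun.mult[OF polyfun.const[of "-1"] fg(1)] by (simp add: fun_Compl_def)
qed

lemma polyfun_mono: "f \<in> polyfun I \<Longrightarrow> I \<subseteq> J \<Longrightarrow> f \<in> polyfun J"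
  by (induction f rule: polyfun.induct) (auto intro: polyfun.intros)

lemma polyfun_empty: "f \<in> polyfun {} \<Longrightarrow> \<exists>c. f = (\<lambda>_. c)"
  by (induction f rule: polyfun.induct) auto

text \<open>Induction on the set of variables: evaluation at the coordinate i maps the polynomials
  over \<open>polyfun I\<close> onto \<open>polyfun (insert i I)\<close>. The base case is the field
  of constants, where f 0 is 0 or has f 1 as a multiple.\<close>

lemma noeth_polyfun: assumes "finite I" shows "noeth (polyfun I :: (('n \<Rightarrow> 'k::field) \<Rightarrow> 'k) set)"
  using assms
proof (induction I)
  case empty
  show ?case unfolding noeth_def
  proof (intro allI impI)
    fix f :: "nat \<Rightarrow> ('n \<Rightarrow> 'k) \<Rightarrow> 'k" assume f: "range f \<subseteq> polyfun {}"
    obtain a where a: "f 0 = (\<lambda>_. a)" using f polyfun_empty by blast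
    obtain b where b: "f 1 = (\<lambda>_. b)" using f polyfun_empty by blast
    show "\<exists>m. f m \<in> ispan (polyfun {}) (f ` {..<m})"
    proof (cases "a = 0")
      case True
      then have "f 0 = 0" using a by (simp add: zero_fun_def)
      then show ?thesis using ispan.zero by metis
    next
      case False
      have "0 + (\<lambda>_. b / a) * f 0 \<in> ispan (polyfun {}) (f ` {..<1})"
        by (intro ispan.step ispan.zero polyfun.const) auto
      moreover have "0 + (\<lambda>_. b / a) * f 0 = f 1" using False by (simp add: a b[unfolded One_nat_def] fun_eq_iff)
      ultimately show ?thesis by metis
    qed
  qed
next
  case (insert i I)
  let ?ev = "\<lambda>p :: (('n \<Rightarrow> 'k) \<Rightarrow> 'k) poly. poly p (\<lambda>x. x i)"
  let ?P = "polys_over (polyfun I)"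
  have P: "subring_of ?P" by (rule subring_polys_over[OF subring_polyfun])
  have "polyfun (insert i I) = ?ev ` ?P"
  proof (intro equalityI subsetI)
    fix f :: "('n \<Rightarrow> 'k) \<Rightarrow> 'k" assume "f \<in> polyfun (insert i I)"
    then show "f \<in> ?ev ` ?P"
    proof (induction f rule: polyfun.induct)
      case (const c)
      have "[:\<lambda>_. c:] \<in> ?P" by (auto simp: polys_over_def coeff_pCons polyfun.const subring_ofD[OF subring_polyfun] split: nat.splits)
      then show ?case by (intro image_eqI[of _ _ "[:\<lambda>_. c:]"]) auto
    next
      case (coord j)
      show ?case
      proof (cases "j = i")
        case True
        have "[:0, 1:] \<in> ?P"
          by (auto simp: polys_over_def coeff_pCons subring_ofD[OF subring_polyfun] split: nat.splits)
        then show ?thesis using True by (intro image_eqI[of _ _ "[:0, 1:]"]) auto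
      next
        case False
        then have "[:\<lambda>x. x j:] \<in> ?P" using coord
          by (auto simp: polys_over_def coeff_pCons polyfun.coord subring_ofD[OF subring_polyfun] split: nat.splits)
        then show ?thesis by (intro image_eqI[of _ _ "[:\<lambda>x. x j:]"]) auto
      qed
    next
      case (add f g)
      then obtain p q where "p \<in> ?P" "q \<in> ?P" "f = ?ev p" "g = ?ev q" by blast
      then show ?case using subring_ofD(3)[OF P]
        by (intro image_eqI[of _ _ "p + q"]) (auto simp: fun_eq_iff)
    next
      case (mult f g)
      then obtain p q where "p \<in> ?P" "q \<in> ?P" "f = ?ev p" "g = ?ev q" by blast
      then show ?case using subring_ofD(4)[OF P]
        by (intro image_eqI[of _ _ "p * q"]) (auto simp: fun_eq_iff)
    qed
  next
    fix f assume "f \<in> ?ev ` ?P"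
    then obtain p where p: "p \<in> ?P" "f = ?ev p" by blast
    have S: "subring_of (polyfun (insert i I) :: (('n \<Rightarrow> 'k) \<Rightarrow> 'k) set)" by (rule subring_polyfun)
    have pw: "(\<lambda>x. x i) ^ n \<in> (polyfun (insert i I) :: (('n \<Rightarrow> 'k) \<Rightarrow> 'k) set)" for n
      by (induction n) (simp_all only: power_0 power_Suc subring_ofD(2)[OF S] subring_ofD(4)[OF S] polyfun.coord insertI1)
    have "coeff p n \<in> polyfun (insert i I)" for n using p polyfun_mono[of _ I "insert i I"] by (auto simp: polys_over_def)
    then show "f \<in> polyfun (insert i I)" unfolding p(2) poly_altdef
      using pw by (intro subring_of_sum[OF S] subring_ofD(4)[OF S]) auto
  qed
  then show ?case
    using noeth_image[OF hilbert_basis[OF subring_polyfun insert.IH], of ?ev] by simp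
qed

lemma polyfun_noetherian:
  fixes f :: "nat \<Rightarrow> ('n::finite \<Rightarrow> 'k::field) \<Rightarrow> 'k"
  assumes "\<And>i. f i \<in> polyfun UNIV"
  shows "\<exists>m c. (\<forall>i. c i \<in> polyfun UNIV) \<and> (\<forall>x. f m x = (\<Sum>i<m. c i x * f i x))"
proof -
  have "range f \<subseteq> polyfun UNIV" using assms by blast
  then obtain m where "f m \<in> ispan (polyfun UNIV) (f ` {..<m})"
    using noeth_polyfun[OF finite[of UNIV]] unfolding noeth_def by blast
  then obtain c where c: "\<forall>i. c i \<in> polyfun UNIV" "f m = (\<Sum>i<m. c i * f i)"
    using ispan_seq[OF subring_polyfun] by blast
  have "(\<Sum>i<m. c i * f i) x = (\<Sum>i<m. c i x * f i x)" for m x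
    by (induction m) auto
  then have "f m x = (\<Sum>i<m. c i x * f i x)" for x using c(2) by simp
  then show ?thesis using c(1) by blast
qed

lemma polyfun_sum: "(\<And>i. i \<in> A \<Longrightarrow> f i \<in> polyfun I) \<Longrightarrow> (\<lambda>x. \<Sum>i\<in>A. f i x) \<in> polyfun I"
  by (induction A rule: infinite_finite_induct) (auto intro: polyfun.intros)
lemma polyfun_prod: "(\<And>i. i \<in> A \<Longrightarrow> f i \<in> polyfun I) \<Longrightarrow> (\<lambda>x. \<Prod>i\<in>A. f i x) \<in> polyfun I"
  by (induction A rule: infinite_finite_induct) (auto intro: polyfun.intros)
lemma polyfun_power: "f \<in> polyfun I \<Longrightarrow> (\<lambda>x. f x ^ n) \<in> polyfun I"
  by (induction n) (auto intro: polyfun.intros)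

lemma polyfun_peval: "peval F \<in> polyfun UNIV"
  unfolding peval_def[abs_def]
  by (intro polyfun_sum polyfun.mult polyfun.const polyfun_prod polyfun_power polyfun.coord) auto

lemma peval_superset:
  assumes "finite A" "Poly_Mapping.keys F \<subseteq> A"
  shows "peval F x = (\<Sum>m\<in>A. Poly_Mapping.lookup F m * (\<Prod>i\<in>UNIV. x i ^ Poly_Mapping.lookup m i))"
  unfolding peval_def by (rule sum.mono_neutral_left) (use assms in \<open>auto simp: in_keys_iff\<close>)

lemma peval_add: "peval (F + G) x = peval F x + peval G x"
proof -
  let ?A = "Poly_Mapping.keys F \<union> Poly_Mapping.keys G"
  have "Poly_Mapping.keys (F + G) \<subseteq> ?A" by (rule Poly_Mapping.keys_add)
  then show ?thesis
    by (simp add: peval_superset[of ?A] lookup_add distrib_right sum.distrib)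
qed

lemma peval_single: "peval (Poly_Mapping.single m c) x = c * (\<Prod>i\<in>UNIV. x i ^ Poly_Mapping.lookup m i)"
  by (simp add: peval_superset[of "{m}"] keys_single)

lemma peval_zero: "peval 0 x = 0" by (simp add: peval_def)

lemma poly_mapping_sum_induct:
  fixes F :: "'a \<Rightarrow>\<^sub>0 'b::comm_monoid_add"
  assumes "P 0" "\<And>m c F. P F \<Longrightarrow> P (Poly_Mapping.single m c + F)"
  shows "P F"
proof -
  have "P (\<Sum>m\<in>A. Poly_Mapping.single m (Poly_Mapping.lookup F m))" if "finite A" for A
    using that by (induction A) (auto intro: assms)
  then have "P (\<Sum>m\<in>Poly_Mapping.keys F. Poly_Mapping.single m (Poly_Mapping.lookup F m))" by simp
  moreover have "(\<Sum>m\<in>Poly_Mapping.keys F. Poly_Mapping.single m (Poly_Mapping.lookup F m)) = F"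
    by (rule poly_mapping_eqI)
      (auto simp: lookup_sum lookup_single when_def in_keys_iff)
  ultimately show ?thesis by simp
qed

lemma peval_mult: "peval (F * G) x = peval F x * peval G x"
proof (induction F rule: poly_mapping_sum_induct)
  case 1 then show ?case by (simp add: peval_zero)
next
  case (2 m c F)
  have "peval (Poly_Mapping.single m c * G) x = peval (Poly_Mapping.single m c) x * peval G x"
  proof (induction G rule: poly_mapping_sum_induct)
    case 1 then show ?case by (simp add: peval_zero)
  next
    case (2 m' c' G)
    then show ?case
      by (simp add: distrib_left peval_add mult_single peval_single lookup_add power_add prod.distrib algebra_simps)
  qed
  with 2 show ?case by (simp add: distrib_right peval_add)
qed

lemma homogeneous_add: "homogeneous e F \<Longrightarrow> homogeneous e G \<Longrightarrow> homogeneous e (F + G)"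
  unfolding homogeneous_def using Poly_Mapping.keys_add[of F G] by blast

lemma homogeneous_mult: assumes "homogeneous e F" "homogeneous e' G" shows "homogeneous (e + e') (F * G)"
  unfolding homogeneous_def
proof
  fix m assume "m \<in> Poly_Mapping.keys (F * G)"
  then obtain a b where "m = a + b" "a \<in> Poly_Mapping.keys F" "b \<in> Poly_Mapping.keys G"
    using Poly_Mapping.keys_mult[of F G] by auto
  then show "(\<Sum>i\<in>UNIV. Poly_Mapping.lookup m i) = e + e'"
    using assms by (simp add: homogeneous_def lookup_add sum.distrib)
qed

definition hom_fun :: "nat \<Rightarrow> (('n::finite \<Rightarrow> 'k::field) \<Rightarrow> 'k) set" where
  "hom_fun e = {peval F |F. homogeneous e F}"

lemma hom_fun_add: assumes "f \<in> hom_fun e" "g \<in> hom_fun e" shows "(\<lambda>x. f x + g x) \<in> hom_fun e"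
proof -
  obtain F G where "f = peval F" "homogeneous e F" "g = peval G" "homogeneous e G"
    using assms by (auto simp: hom_fun_def)
  then show ?thesis unfolding hom_fun_def mem_Collect_eq
    by (intro exI[of _ "F + G"]) (simp add: homogeneous_add peval_add fun_eq_iff)
qed

lemma hom_fun_mult: assumes "f \<in> hom_fun e" "g \<in> hom_fun e'" shows "(\<lambda>x. f x * g x) \<in> hom_fun (e + e')"
proof -
  obtain F G where "f = peval F" "homogeneous e F" "g = peval G" "homogeneous e' G"
    using assms by (auto simp: hom_fun_def)
  then show ?thesis unfolding hom_fun_def mem_Collect_eq
    by (intro exI[of _ "F * G"]) (simp add: homogeneous_mult peval_mult fun_eq_iff)
qed

lemma hom_fun_const: "(\<lambda>_ :: 'n::finite \<Rightarrow> 'k::field. c) \<in> hom_fun 0"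
proof -
  have "homogeneous 0 (Poly_Mapping.single 0 c :: ('n, 'k) mpoly)" by (auto simp: homogeneous_def)
  moreover have "peval (Poly_Mapping.single 0 c :: ('n, 'k) mpoly) = (\<lambda>_. c)"
    by (rule ext) (simp add: peval_single)
  ultimately show ?thesis unfolding hom_fun_def by (metis (mono_tags, lifting) mem_Collect_eq)
qed

lemma hom_fun_coord: "(\<lambda>x :: 'n::finite \<Rightarrow> 'k::field. x i) \<in> hom_fun 1"
proof -
  let ?F = "Poly_Mapping.single (Poly_Mapping.single i 1) 1 :: ('n, 'k) mpoly"
  have "homogeneous 1 ?F" by (auto simp: homogeneous_def lookup_single when_def)
  moreover have "(\<Prod>j\<in>UNIV. x j ^ Poly_Mapping.lookup (Poly_Mapping.single i (1::nat)) j) = x i" for x :: "'n \<Rightarrow> 'k"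
  proof -
    have "(\<Prod>j\<in>UNIV. x j ^ Poly_Mapping.lookup (Poly_Mapping.single i (1::nat)) j) = (\<Prod>j\<in>UNIV. if j = i then x j else 1)"
      by (rule prod.cong) (auto simp: lookup_single when_def)
    then show ?thesis by simp
  qed
  then have "peval ?F = (\<lambda>x. x i)" by (intro ext) (simp add: peval_single)
  ultimately show ?thesis unfolding hom_fun_def by (metis (mono_tags, lifting) mem_Collect_eq)
qed

lemma hom_fun_cmult: "f \<in> hom_fun e \<Longrightarrow> (\<lambda>x. c * f x) \<in> hom_fun e"
  using hom_fun_mult[OF hom_fun_const] by fastforce

lemma hom_fun_diff: "f \<in> hom_fun e \<Longrightarrow> g \<in> hom_fun e \<Longrightarrow> (\<lambda>x. f x - g x) \<in> hom_fun e"
  using hom_fun_add[OF _ hom_fun_cmult[of g e "-1"], of f] by simp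

lemma hom_fun_polyfun: "f \<in> hom_fun e \<Longrightarrow> f \<in> polyfun UNIV"
  by (auto simp: hom_fun_def polyfun_peval)

lemma hom_fun_scale: assumes "f \<in> hom_fun e" shows "f (\<lambda>i. c * x i) = c ^ e * f x"
proof -
  obtain F where F: "homogeneous e F" "f = peval F" using assms by (auto simp: hom_fun_def)
  have "(\<Prod>i\<in>UNIV. (c * x i) ^ Poly_Mapping.lookup m i) = c ^ e * (\<Prod>i\<in>UNIV. x i ^ Poly_Mapping.lookup m i)"
    if "m \<in> Poly_Mapping.keys F" for m
    using F(1) that by (simp add: homogeneous_def power_mult_distrib prod.distrib power_sum[symmetric])
  then show ?thesis by (simp add: F(2) peval_def sum_distrib_left mult.left_commute)
qed

text \<open>\<open>D\<close> is the gradient of \<open>f\<close> at \<open>a\<close>.\<close>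

definition taylor1 :: "('n::finite \<Rightarrow> 'k::field) \<Rightarrow> (('n \<Rightarrow> 'k) \<Rightarrow> 'k) \<Rightarrow> ('n \<Rightarrow> 'k) \<Rightarrow> bool" where
  "taylor1 a f D \<longleftrightarrow> (\<exists>H. (\<forall>i. H i \<in> polyfun UNIV \<and> H i a = 0) \<and>
     (\<forall>x. f x = f a + (\<Sum>i\<in>UNIV. (D i + H i x) * (x i - a i))))"

lemma taylor1_const: "taylor1 a (\<lambda>_. c) (\<lambda>_. 0)"
  unfolding taylor1_def by (intro exI[of _ "\<lambda>_ _. 0"]) (simp add: polyfun.const)

lemma taylor1_coord: "taylor1 a (\<lambda>x. x j) (\<lambda>i. if i = j then 1 else 0)"
  unfolding taylor1_def
  by (intro exI[of _ "\<lambda>_ _. 0"]) (simp add: polyfun.const if_distrib[of "\<lambda>x. x * _"] cong: if_cong)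

lemma taylor1_add: assumes "taylor1 a f D" "taylor1 a g E" shows "taylor1 a (\<lambda>x. f x + g x) (\<lambda>i. D i + E i)"
proof -
  from assms(1) obtain H where H0: "(\<forall>i. H i \<in> polyfun UNIV \<and> H i a = 0) \<and>
     (\<forall>x. f x = f a + (\<Sum>i\<in>UNIV. (D i + H i x) * (x i - a i)))" unfolding taylor1_def ..
  have H: "H i \<in> polyfun UNIV" "H i a = 0" "f x = f a + (\<Sum>i\<in>UNIV. (D i + H i x) * (x i - a i))" for i x
    using H0 by blast+
  from assms(2) obtain K where K0: "(\<forall>i. K i \<in> polyfun UNIV \<and> K i a = 0) \<and>
     (\<forall>x. g x = g a + (\<Sum>i\<in>UNIV. (E i + K i x) * (x i - a i)))" unfolding taylor1_def ..
  have K: "K i \<in> polyfun UNIV" "K i a = 0" "g x = g a + (\<Sum>i\<in>UNIV. (E i + K i x) * (x i - a i))" for i x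
    using K0 by blast+
  show ?thesis unfolding taylor1_def
  proof (intro exI[of _ "\<lambda>i x. H i x + K i x"] conjI allI)
    fix i show "(\<lambda>x. H i x + K i x) \<in> polyfun UNIV" by (intro polyfun.add H(1) K(1))
    show "H i a + K i a = 0" by (simp add: H(2) K(2))
  next
    fix x
    show "f x + g x = f a + g a + (\<Sum>i\<in>UNIV. (D i + E i + (H i x + K i x)) * (x i - a i))"
    proof -
      have "(\<Sum>i\<in>UNIV. (D i + E i + (H i x + K i x)) * (x i - a i)) =
        (\<Sum>i\<in>UNIV. (D i + H i x) * (x i - a i)) + (\<Sum>i\<in>UNIV. (E i + K i x) * (x i - a i))"
        unfolding sum.distrib[symmetric] by (rule sum.cong) (simp_all add: algebra_simps)
      then show ?thesis using H(3)[of x] K(3)[of x] by simp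
    qed
  qed
qed

lemma taylor1_mult: assumes "taylor1 a f D" "taylor1 a g E" "f \<in> polyfun UNIV"
  shows "taylor1 a (\<lambda>x. f x * g x) (\<lambda>i. D i * g a + f a * E i)"
proof -
  from assms(1) obtain H where H0: "(\<forall>i. H i \<in> polyfun UNIV \<and> H i a = 0) \<and>
     (\<forall>x. f x = f a + (\<Sum>i\<in>UNIV. (D i + H i x) * (x i - a i)))" unfolding taylor1_def ..
  have H: "H i \<in> polyfun UNIV" "H i a = 0" "f x = f a + (\<Sum>i\<in>UNIV. (D i + H i x) * (x i - a i))" for i x
    using H0 by blast+
  from assms(2) obtain K where K0: "(\<forall>i. K i \<in> polyfun UNIV \<and> K i a = 0) \<and>
     (\<forall>x. g x = g a + (\<Sum>i\<in>UNIV. (E i + K i x) * (x i - a i)))" unfolding taylor1_def ..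
  have K: "K i \<in> polyfun UNIV" "K i a = 0" "g x = g a + (\<Sum>i\<in>UNIV. (E i + K i x) * (x i - a i))" for i x
    using K0 by blast+
  \<comment> \<open>The remainder comes from f g - f(a) g(a) = (f - f(a)) g(a) + f (g - g(a)), with
    the factor f of the linear part of g split as f(a) + (f - f(a)).\<close>
  show ?thesis unfolding taylor1_def
  proof (intro exI[of _ "\<lambda>i x. H i x * g a + f x * K i x + (f x + - f a) * E i"] conjI allI)
    fix i show "(\<lambda>x. H i x * g a + f x * K i x + (f x + - f a) * E i) \<in> polyfun UNIV"
      by (intro polyfun.add polyfun.mult polyfun.const H(1) K(1) assms(3))
    show "H i a * g a + f a * K i a + (f a + - f a) * E i = 0" by (simp add: H(2) K(2))
  next
    fix x
    have "f x * g x - f a * g a = (f x - f a) * g a + f x * (g x - g a)" by (simp add: algebra_simps)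
    also have "f x - f a = (\<Sum>i\<in>UNIV. (D i + H i x) * (x i - a i))" using H(3)[of x] by simp
    also have "g x - g a = (\<Sum>i\<in>UNIV. (E i + K i x) * (x i - a i))" using K(3)[of x] by simp
    also have "(\<Sum>i\<in>UNIV. (D i + H i x) * (x i - a i)) * g a + f x * (\<Sum>i\<in>UNIV. (E i + K i x) * (x i - a i))
      = (\<Sum>i\<in>UNIV. (D i * g a + f a * E i + (H i x * g a + f x * K i x + (f x + - f a) * E i)) * (x i - a i))"
      unfolding sum_distrib_left sum_distrib_right sum.distrib[symmetric]
      by (rule sum.cong) (simp_all add: algebra_simps)
    finally show "f x * g x = f a * g a + (\<Sum>i\<in>UNIV. (D i * g a + f a * E i + (H i x * g a + f x * K i x + (f x + - f a) * E i)) * (x i - a i))"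
      by (simp add: diff_eq_eq add.commute)
  qed
qed

lemma taylor1_power: "taylor1 a (\<lambda>x. x j ^ n) (\<lambda>i. if i = j then of_nat n * a j ^ (n - 1) else 0)"
proof (induction n)
  case 0 then show ?case using taylor1_const[of a 1] by (simp cong: if_cong)
next
  case (Suc n)
  have "(\<lambda>i. (if i = j then 1 else 0) * a j ^ n + a j * (if i = j then of_nat n * a j ^ (n - 1) else 0)) =
    (\<lambda>i. if i = j then of_nat (Suc n) * a j ^ (Suc n - 1) else 0)"
    by (rule ext, cases n) (auto simp: algebra_simps)
  with taylor1_mult[OF taylor1_coord Suc, of j] show ?case by (simp add: polyfun.coord)
qed

lemma taylor1_prod:
  fixes A :: "'n::finite set"
  shows "taylor1 a (\<lambda>x. \<Prod>j\<in>A. x j ^ m j)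
    (\<lambda>i. if i \<in> A then of_nat (m i) * a i ^ (m i - 1) * (\<Prod>j\<in>A - {i}. a j ^ m j) else 0)"
  using finite[of A]
proof (induction A rule: finite_induct)
  case empty then show ?case using taylor1_const[of a 1] by simp
next
  case (insert k A)
  have "(if i = k then of_nat (m k) * a k ^ (m k - 1) else 0) * (\<Prod>j\<in>A. a j ^ m j) +
      a k ^ m k * (if i \<in> A then of_nat (m i) * a i ^ (m i - 1) * (\<Prod>j\<in>A - {i}. a j ^ m j) else 0) =
    (if i \<in> insert k A then of_nat (m i) * a i ^ (m i - 1) * (\<Prod>j\<in>insert k A - {i}. a j ^ m j) else 0)" for i
  proof (cases "i = k")
    case True then show ?thesis using insert by simp
  next
    case False
    then have "insert k A - {i} = insert k (A - {i})" by auto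
    then show ?thesis using False insert by (simp add: algebra_simps)
  qed
  with taylor1_mult[OF taylor1_power[where j = k and n = "m k"] insert.IH] insert.hyps show ?case
    by (simp add: polyfun_power polyfun.coord)
qed

text \<open>Links the formal partial derivatives of the Jacobian criterion to first-order expansions
  at a.\<close>

lemma taylor1_peval: "taylor1 a (peval F) (\<lambda>i. partial_eval i F a)"
proof -
  have *: "taylor1 a (\<lambda>x. \<Sum>m\<in>A. c m * (\<Prod>i\<in>UNIV. x i ^ e m i))
     (\<lambda>i. \<Sum>m\<in>A. c m * (of_nat (e m i) * a i ^ (e m i - 1) * (\<Prod>j\<in>UNIV - {i}. a j ^ e m j)))"
    if "finite A" for A :: "('n \<Rightarrow>\<^sub>0 nat) set" and c e
    using that
  proof (induction A)
    case empty then show ?case using taylor1_const[of a 0] by simp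
  next
    case (insert m A)
    show ?case
      using taylor1_add[OF taylor1_mult[OF taylor1_const[of a "c m"] taylor1_prod[where A = UNIV and m = "e m"] polyfun.const] insert.IH]
        insert.hyps by simp
  qed
  show ?thesis
    using *[of "Poly_Mapping.keys F" "Poly_Mapping.lookup F" "\<lambda>m. Poly_Mapping.lookup m"]
    unfolding peval_def[abs_def] partial_eval_def by (simp add: mult.assoc)
qed

text \<open>At a vector a representing a point of the curve, Euler's relation makes the gradients of
  all equations orthogonal to a. This later separates them from a coordinate vector.\<close>

lemma euler_identity: assumes "homogeneous e F"
  shows "(\<Sum>i\<in>UNIV. a i * partial_eval i F a) = of_nat e * peval F a"
proof -
  have 1: "a i * (of_nat (k i) * a i ^ (k i - 1) * (\<Prod>j\<in>UNIV - {i}. a j ^ k j)) = of_nat (k i) * (\<Prod>j\<in>UNIV. a j ^ k j)"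
    for i and k :: "'a \<Rightarrow> nat"
    by (cases "k i") (simp_all add: prod.remove[of UNIV i "\<lambda>j. a j ^ k j"] algebra_simps)
  have "(\<Sum>i\<in>UNIV. a i * partial_eval i F a) =
     (\<Sum>i\<in>UNIV. \<Sum>m\<in>Poly_Mapping.keys F. Poly_Mapping.lookup F m * (of_nat (Poly_Mapping.lookup m i) * (\<Prod>j\<in>UNIV. a j ^ Poly_Mapping.lookup m j)))"
    unfolding partial_eval_def sum_distrib_left 1[symmetric] by (simp add: algebra_simps)
  also have "\<dots> = (\<Sum>m\<in>Poly_Mapping.keys F. \<Sum>i\<in>UNIV. Poly_Mapping.lookup F m * (of_nat (Poly_Mapping.lookup m i) * (\<Prod>j\<in>UNIV. a j ^ Poly_Mapping.lookup m j)))"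
    by (rule sum.swap)
  also have "\<dots> = (\<Sum>m\<in>Poly_Mapping.keys F. of_nat e * (Poly_Mapping.lookup F m * (\<Prod>j\<in>UNIV. a j ^ Poly_Mapping.lookup m j)))"
  proof (rule sum.cong[OF refl])
    fix m assume "m \<in> Poly_Mapping.keys F"
    then have e: "e = (\<Sum>i\<in>UNIV. Poly_Mapping.lookup m i)" using assms by (simp add: homogeneous_def)
    show "(\<Sum>i\<in>UNIV. Poly_Mapping.lookup F m * (of_nat (Poly_Mapping.lookup m i) * (\<Prod>j\<in>UNIV. a j ^ Poly_Mapping.lookup m j))) =
      of_nat e * (Poly_Mapping.lookup F m * (\<Prod>j\<in>UNIV. a j ^ Poly_Mapping.lookup m j))"
      unfolding e of_nat_sum sum_distrib_right by (rule sum.cong) (auto simp: algebra_simps)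
  qed
  finally show ?thesis by (simp add: peval_def sum_distrib_left)
qed

subsection \<open>The Zariski topology of a curve\<close>

definition rep :: "('n::finite, 'k::field) point \<Rightarrow> 'n \<Rightarrow> 'k" where
  "rep p = (SOME x. x \<in> p)"

lemma rep:
  assumes "p \<in> proj_space"
  shows rep_nonzero: "\<exists>i. rep p i \<noteq> 0" and rep_span: "p = {\<lambda>i. c * rep p i |c. c \<noteq> 0}" and rep_in: "rep p \<in> p"
proof -
  obtain x where x: "p = {\<lambda>i. c * x i |c. c \<noteq> 0}" "\<exists>i. x i \<noteq> 0" using assms by (auto simp: proj_space_def)
  have mem: "z \<in> p \<longleftrightarrow> (\<exists>c. c \<noteq> 0 \<and> z = (\<lambda>i. c * x i))" for z by (subst x(1)) auto
  have "(\<lambda>i. 1 * x i) \<in> p" unfolding mem by (intro exI[of _ 1]) simp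
  then show r: "rep p \<in> p" unfolding rep_def by (rule someI[where P = "\<lambda>z. z \<in> p"])
  then obtain c where c: "c \<noteq> 0" "rep p = (\<lambda>i. c * x i)" unfolding mem by (elim exE conjE)
  show "\<exists>i. rep p i \<noteq> 0" using x(2) c by simp
  have "z \<in> p \<longleftrightarrow> (\<exists>b. b \<noteq> 0 \<and> z = (\<lambda>i. b * rep p i))" for z
  proof
    assume "z \<in> p"
    then obtain b where b: "b \<noteq> 0" "z = (\<lambda>i. b * x i)" unfolding mem by (elim exE conjE)
    then show "\<exists>b. b \<noteq> 0 \<and> z = (\<lambda>i. b * rep p i)" using c by (intro exI[of _ "b / c"]) simp
  next
    assume "\<exists>b. b \<noteq> 0 \<and> z = (\<lambda>i. b * rep p i)"
    then obtain b where b: "b \<noteq> 0" "z = (\<lambda>i. b * rep p i)" by (elim exE conjE)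
    then show "z \<in> p" unfolding mem using c by (intro exI[of _ "b * c"]) (simp add: mult.assoc)
  qed
  then show "p = {\<lambda>i. c * rep p i |c. c \<noteq> 0}" by auto
qed

lemma in_point_iff: "p \<in> proj_space \<Longrightarrow> z \<in> p \<longleftrightarrow> (\<exists>b. b \<noteq> 0 \<and> z = (\<lambda>i. b * rep p i))"
  by (subst rep_span) auto

lemma hom_fun_at_point:
  assumes "p \<in> proj_space" "x \<in> p" "f \<in> hom_fun e"
  obtains c where "c \<noteq> 0" "f x = c ^ e * f (rep p)" "x = (\<lambda>i. c * rep p i)"
proof -
  obtain c where c: "c \<noteq> 0" "x = (\<lambda>i. c * rep p i)"
    using assms(2) unfolding in_point_iff[OF assms(1)] by (elim exE conjE)
  show ?thesis by (rule that[of c]) (simp_all add: c hom_fun_scale[OF assms(3)])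
qed

definition bopen :: "(('n::finite \<Rightarrow> 'k::field) \<Rightarrow> 'k) \<Rightarrow> ('n, 'k) point set" where
  "bopen f = {p \<in> proj_space. f (rep p) \<noteq> 0}"

lemma basic_open_eq: assumes "homogeneous e F" shows "basic_open F = bopen (peval F)"
proof -
  have f: "peval F \<in> hom_fun e" using assms by (auto simp: hom_fun_def)
  have "(\<forall>x\<in>p. peval F x \<noteq> 0) \<longleftrightarrow> peval F (rep p) \<noteq> 0" if p: "p \<in> proj_space" for p
  proof
    assume "\<forall>x\<in>p. peval F x \<noteq> 0" then show "peval F (rep p) \<noteq> 0" using rep_in[OF p] by blast
  next
    assume nz: "peval F (rep p) \<noteq> 0"
    show "\<forall>x\<in>p. peval F x \<noteq> 0"
    proof
      fix x assume "x \<in> p"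
      then obtain c where "c \<noteq> 0" "peval F x = c ^ e * peval F (rep p)" by (rule hom_fun_at_point[OF p _ f])
      then show "peval F x \<noteq> 0" using nz by simp
    qed
  qed
  then show ?thesis by (auto simp: basic_open_def bopen_def)
qed

lemma zariski_subbasis: "{basic_open F |F :: ('n::finite, 'k::field) mpoly. \<exists>e. homogeneous e F} = {bopen f |f e. f \<in> hom_fun e}"
proof (intro equalityI subsetI)
  fix U assume "U \<in> {basic_open F |F :: ('n, 'k) mpoly. \<exists>e. homogeneous e F}"
  then obtain F :: "('n, 'k) mpoly" and e where F: "U = basic_open F" "homogeneous e F" by blast
  then have "U = bopen (peval F)" "peval F \<in> hom_fun e" using basic_open_eq by (auto simp: hom_fun_def)
  then show "U \<in> {bopen f |f e. f \<in> hom_fun e}" by blast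
next
  fix U :: "('n, 'k) point set" assume "U \<in> {bopen f |f e. f \<in> hom_fun e}"
  then obtain F :: "('n, 'k) mpoly" and e where F: "U = bopen (peval F)" "homogeneous e F" by (auto simp: hom_fun_def)
  then have "U = basic_open F" using basic_open_eq by blast
  then show "U \<in> {basic_open F |F :: ('n, 'k) mpoly. \<exists>e. homogeneous e F}" using F(2) by blast
qed

lemma openin_bopen: assumes "f \<in> hom_fun e" shows "openin zariski (bopen f)"
  unfolding zariski_def zariski_subbasis by (rule topology_generated_by_Basis) (use assms in blast)

lemma topspace_zariski: "topspace (zariski :: ('n::finite, 'k::field) point topology) = proj_space"
proof -
  have "p \<in> \<Union>{bopen f |f e. f \<in> hom_fun e}" if p: "p \<in> proj_space" for p :: "('n, 'k) point"
  proof -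
    obtain i where "rep p i \<noteq> 0" using rep_nonzero[OF p] by blast
    then have "p \<in> bopen (\<lambda>x. x i)" using p by (simp add: bopen_def)
    then show ?thesis using hom_fun_coord[of i] by blast
  qed
  then show ?thesis unfolding zariski_def zariski_subbasis topology_generated_by_topspace
    by (auto simp: bopen_def)
qed

lemma zariski_base:
  assumes "openin zariski U" "p \<in> U"
  shows "\<exists>e f. f \<in> hom_fun e \<and> p \<in> bopen f \<and> bopen f \<subseteq> U"
proof -
  have "generate_topology_on {bopen f |f e. f \<in> hom_fun e} U"
    using assms(1) unfolding zariski_def zariski_subbasis by (rule openin_topology_generated_by)
  then show ?thesis using assms(2)
  proof (induction U rule: generate_topology_on.induct)
    case Empty then show ?case by simp
  next
    case (Int a b)
    then obtain e f e' f' where f: "f \<in> hom_fun e" "p \<in> bopen f" "bopen f \<subseteq> a"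
      and f': "f' \<in> hom_fun e'" "p \<in> bopen f'" "bopen f' \<subseteq> b" by blast
    have "bopen (\<lambda>x. f x * f' x) = bopen f \<inter> bopen f'" by (auto simp: bopen_def)
    then show ?case using hom_fun_mult[OF f(1) f'(1)] f f'
      by (intro exI[of _ "e + e'"] exI[of _ "\<lambda>x. f x * f' x"]) auto
  next
    case (UN K)
    then obtain k where k: "k \<in> K" "p \<in> k" by blast
    from UN.IH[OF k] obtain e f where "f \<in> hom_fun e" "p \<in> bopen f" "bopen f \<subseteq> k" by blast
    then show ?case using k by blast
  next
    case (Basis s) then show ?case by blast
  qed
qed

lemma closed_separate:
  assumes "closedin zariski Z" "p \<in> proj_space" "p \<notin> Z"
  shows "\<exists>e f. f \<in> hom_fun e \<and> f (rep p) \<noteq> 0 \<and> (\<forall>q\<in>Z. f (rep q) = 0)"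
proof -
  have "openin zariski (proj_space - Z)" using assms(1) topspace_zariski by (metis closedin_def)
  from zariski_base[OF this, of p] obtain e f where f: "f \<in> hom_fun e" "p \<in> bopen f" "bopen f \<subseteq> proj_space - Z"
    using assms by blast
  have "f (rep q) = 0" if "q \<in> Z" for q
  proof (rule ccontr)
    assume "f (rep q) \<noteq> 0"
    moreover have "q \<in> proj_space" using that closedin_subset[OF assms(1)] topspace_zariski by blast
    ultimately have "q \<in> bopen f" by (simp add: bopen_def)
    then show False using f(3) that by blast
  qed
  then show ?thesis using f by (auto simp: bopen_def)
qed

text \<open>The point with representative a is cut out by the equations
  \<open>a i * x j = a j * x i\<close>, and any other point violates one of them.\<close>

lemma closedin_point: assumes "p \<in> proj_space" shows "closedin zariski {p}"
  unfolding closedin_def topspace_zariski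
proof (intro conjI)
  show "{p} \<subseteq> proj_space" using assms by simp
  show "openin zariski (proj_space - {p})"
    unfolding openin_subopen[of zariski "proj_space - {p}"]
  proof
    fix q assume q: "q \<in> proj_space - {p}"
    let ?a = "rep p" and ?y = "rep q"
    have "\<exists>i j. ?a i * ?y j - ?a j * ?y i \<noteq> 0"
    proof (rule ccontr)
      assume "\<not> ?thesis"
      then have eq: "?a i * ?y j = ?a j * ?y i" for i j by simp
      obtain i where i: "?a i \<noteq> 0" using rep_nonzero[OF assms] by blast
      define c where "c = ?y i / ?a i"
      have y: "?y = (\<lambda>j. c * ?a j)"
        using eq[of i] i by (auto simp: c_def fun_eq_iff field_simps)
      obtain j where "?y j \<noteq> 0" using rep_nonzero q by blast
      then have c: "c \<noteq> 0" using y by (metis mult_zero_left)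
      have qs: "q \<in> proj_space" using q by blast
      have "z \<in> q \<longleftrightarrow> z \<in> p" for z
        unfolding in_point_iff[OF assms] in_point_iff[OF qs]
      proof
        assume "\<exists>b. b \<noteq> 0 \<and> z = (\<lambda>i. b * ?y i)"
        then obtain b where b: "b \<noteq> 0" "z = (\<lambda>i. b * ?y i)" by (elim exE conjE)
        then show "\<exists>b. b \<noteq> 0 \<and> z = (\<lambda>i. b * ?a i)"
          using c by (intro exI[of _ "b * c"]) (simp add: y mult.assoc)
      next
        assume "\<exists>b. b \<noteq> 0 \<and> z = (\<lambda>i. b * ?a i)"
        then obtain b where b: "b \<noteq> 0" "z = (\<lambda>i. b * ?a i)" by (elim exE conjE)
        then show "\<exists>b. b \<noteq> 0 \<and> z = (\<lambda>i. b * ?y i)"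
          using c by (intro exI[of _ "b / c"]) (simp add: y)
      qed
      then have "q = p" by blast
      then show False using q by simp
    qed
    then obtain i j where ij: "?a i * ?y j - ?a j * ?y i \<noteq> 0" by blast
    define f where "f x = ?a i * x j - ?a j * x i" for x
    have f: "f \<in> hom_fun 1" unfolding f_def[abs_def] by (intro hom_fun_diff hom_fun_cmult hom_fun_coord)
    have "q \<in> bopen f" using ij q by (simp add: bopen_def f_def)
    moreover have "bopen f \<subseteq> proj_space - {p}" by (auto simp: bopen_def f_def mult.commute)
    ultimately show "\<exists>T. openin zariski T \<and> q \<in> T \<and> T \<subseteq> proj_space - {p}"
      using openin_bopen[OF f] by blast
  qed
qed

text \<open>In an infinite descending chain choose \<open>x i\<close> in \<open>Z i\<close> outside
  the next set, and an equation \<open>f i\<close> of the next set that is nonzero at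
  \<open>x i\<close>. Some \<open>f m\<close> is a combination of earlier \<open>f i\<close>, all of
  which vanish at \<open>x m\<close>.\<close>

lemma closed_noetherian:
  "wf {(Z', Z). closedin zariski Z' \<and> closedin zariski Z \<and> Z' \<subset> (Z :: ('n::finite, 'k::field) point set)}"
  unfolding wf_iff_no_infinite_down_chain
proof
  assume "\<exists>Z. \<forall>i. (Z (Suc i), Z i) \<in> {(Z', Z). closedin zariski Z' \<and> closedin zariski Z \<and> Z' \<subset> (Z :: ('n, 'k) point set)}"
  then obtain Z :: "nat \<Rightarrow> ('n, 'k) point set" where
    Z0: "\<forall>i. (Z (Suc i), Z i) \<in> {(Z', Z). closedin zariski Z' \<and> closedin zariski Z \<and> Z' \<subset> Z}" ..
  have Z: "closedin zariski (Z i)" "Z (Suc i) \<subset> Z i" for i using spec[OF Z0, of i] by simp_all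
  have mono: "Z j \<subseteq> Z i" if "i \<le> j" for i j using lift_Suc_antimono_le[of Z, OF _ that] Z(2) by blast
  have "\<forall>i. \<exists>x. x \<in> Z i \<and> x \<notin> Z (Suc i)" using Z(2) by blast
  then obtain x where x: "\<And>i. x i \<in> Z i" "\<And>i. x i \<notin> Z (Suc i)" by metis
  have xp: "x i \<in> proj_space" for i using x(1) Z(1) closedin_subset topspace_zariski by blast
  have "\<forall>i. \<exists>f. (\<exists>e. f \<in> hom_fun e) \<and> f (rep (x i)) \<noteq> 0 \<and> (\<forall>q\<in>Z (Suc i). f (rep q) = 0)"
    using closed_separate[OF Z(1) xp x(2)] by blast
  then obtain f where f: "\<And>i. \<exists>e. f i \<in> hom_fun e" "\<And>i. f i (rep (x i)) \<noteq> 0" "\<And>i q. q \<in> Z (Suc i) \<Longrightarrow> f i (rep q) = 0"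
    by metis
  have "f i \<in> polyfun UNIV" for i using f(1) hom_fun_polyfun by blast
  then obtain m c where mc: "\<forall>y. f m y = (\<Sum>i<m. c i y * f i y)" using polyfun_noetherian[of f] by blast
  have "f i (rep (x m)) = 0" if "i < m" for i
    using f(3)[of "x m" i] x(1)[of m] mono[of "Suc i" m] that by auto
  then have "f m (rep (x m)) = 0" using mc by simp
  then show False using f(2) by blast
qed

locale smooth_curve =
  fixes C :: "('n::finite, 'k::field) point set"
  assumes smooth: "smooth_projective_curve C"
begin

lemma C_closed: "closedin zariski C" and C_irred: "irreducible_closed zariski C"
  and C_dim: "krull_dim (subtopology zariski C) = 1"
  using smooth by (auto simp: smooth_projective_curve_def irreducible_closed_def)

lemma C_proj: "C \<subseteq> proj_space"
  using closedin_subset[OF C_closed] topspace_zariski by blast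

lemma irreducible_sub:
  assumes "irreducible_closed zariski Z" "Z \<subseteq> C"
  shows "irreducible_closed (subtopology zariski C) Z"
  using assms unfolding irreducible_closed_def closedin_closed_subtopology[OF C_closed] by blast

lemma irreducible_point: "p \<in> proj_space \<Longrightarrow> irreducible_closed zariski {p}"
  unfolding irreducible_closed_def using closedin_point by blast

text \<open>A minimal infinite proper closed subset Y is irreducible, since its proper closed
  subsets are finite. A point, Y and C would then form a chain of length 2, against dimension
  1.\<close>

lemma closed_finite:
  assumes "closedin zariski Z" "Z \<subset> C"
  shows "finite Z"
proof (rule ccontr)
  assume "infinite Z"
  define Q where "Q = {Z. closedin zariski Z \<and> Z \<subset> C \<and> infinite Z}"
  have "Z \<in> Q" using assms \<open>infinite Z\<close> by (simp add: Q_def)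
  then obtain Y where Y: "Y \<in> Q"
    and Ymin: "\<forall>W. (W, Y) \<in> {(Z', Z). closedin zariski Z' \<and> closedin zariski Z \<and> Z' \<subset> Z} \<longrightarrow> W \<notin> Q"
    using closed_noetherian unfolding wf_eq_minimal by blast
  have Yc: "closedin zariski Y" "Y \<subset> C" "infinite Y" using Y by (auto simp: Q_def)
  have fin: "finite W" if "closedin zariski W" "W \<subset> Y" for W
    using spec[OF Ymin, of W] that Yc by (auto simp: Q_def)
  have irr: "irreducible_closed zariski Y"
    unfolding irreducible_closed_def
  proof (intro conjI allI impI)
    show "closedin zariski Y" "Y \<noteq> {}" using Yc by auto
    fix A B assume AB: "closedin zariski A \<and> closedin zariski B \<and> Y = A \<union> B"
    then have "A = Y \<or> finite A" "B = Y \<or> finite B" using fin by blast+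
    then show "Y = A \<or> Y = B" using AB Yc(3) by auto
  qed
  obtain p where p: "p \<in> Y" using Yc(3) by fastforce
  then have pp: "p \<in> proj_space" using Yc C_proj by blast
  have "{p} \<noteq> Y" using Yc(3) by auto
  define W where "W i = (if i = 0 then {p} else if i = 1 then Y else C)" for i :: nat
  have "\<forall>i\<le>2. irreducible_closed (subtopology zariski C) (W i)"
    using irreducible_sub[OF irreducible_point[OF pp]] irreducible_sub[OF irr] irreducible_sub[OF C_irred] p Yc
    by (auto simp: W_def)
  moreover have "\<forall>i<2. W i \<subset> W (Suc i)" using p \<open>{p} \<noteq> Y\<close> Yc by (auto simp: W_def less_2_cases_iff)
  ultimately have "enat 2 \<le> krull_dim (subtopology zariski C)"
    unfolding krull_dim_def by (intro Sup_upper) blast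
  then show False unfolding C_dim by (simp add: one_enat_def)
qed

text \<open>In a finite C every subset is closed, so irreducible closed sets are points and none is
  strictly contained in another, against dimension 1.\<close>

lemma C_infinite: "infinite C"
proof
  assume fin: "finite C"
  have "\<exists>m\<ge>1. \<exists>Z. (\<forall>i\<le>m. irreducible_closed (subtopology zariski C) (Z i)) \<and> (\<forall>i<m. Z i \<subset> Z (Suc i))"
  proof (rule ccontr)
    assume no: "\<not> ?thesis"
    have "krull_dim (subtopology zariski C) \<le> 0"
      unfolding krull_dim_def
    proof (intro Sup_least)
      fix e assume "e \<in> {enat m |m. \<exists>Z. (\<forall>i\<le>m. irreducible_closed (subtopology zariski C) (Z i)) \<and> (\<forall>i<m. Z i \<subset> Z (Suc i))}"
      then obtain m where "e = enat m" "\<exists>Z. (\<forall>i\<le>m. irreducible_closed (subtopology zariski C) (Z i)) \<and> (\<forall>i<m. Z i \<subset> Z (Suc i))" by blast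
      moreover from this have "\<not> m \<ge> 1" using no by blast
      ultimately show "e \<le> 0" by (simp add: zero_enat_def)
    qed
    then show False unfolding C_dim by simp
  qed
  then obtain m Z where m: "m \<ge> (1::nat)" and Z: "\<forall>i\<le>m. irreducible_closed (subtopology zariski C) (Z i)" "\<forall>i<m. Z i \<subset> Z (Suc i)" by blast
  have Z0: "irreducible_closed (subtopology zariski C) (Z 0)" and Z1: "irreducible_closed (subtopology zariski C) (Z 1)" and lt: "Z 0 \<subset> Z 1"
    using m Z by auto
  obtain p where p: "p \<in> Z 0" using Z0 by (auto simp: irreducible_closed_def)
  have sub: "Z 1 \<subseteq> C" using Z1 closedin_closed_subtopology[OF C_closed] by (auto simp: irreducible_closed_def)
  have cl: "closedin (subtopology zariski C) A" if "A \<subseteq> C" for A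
  proof -
    have "finite A" using that fin finite_subset by blast
    then have "closedin zariski (\<Union>x\<in>A. {x})" using that C_proj closedin_point
      by (intro closedin_Union) auto
    then show ?thesis using that closedin_closed_subtopology[OF C_closed] by simp
  qed
  have "{p} \<subseteq> C" "Z 1 - {p} \<subseteq> C" "Z 1 = {p} \<union> (Z 1 - {p})" using p lt sub by auto
  moreover have "closedin (subtopology zariski C) A \<Longrightarrow> closedin (subtopology zariski C) B \<Longrightarrow> Z 1 = A \<union> B \<Longrightarrow> Z 1 = A \<or> Z 1 = B" for A B
    using Z1 unfolding irreducible_closed_def by metis
  ultimately have "Z 1 = {p} \<or> Z 1 = Z 1 - {p}" using cl by metis
  then show False using p lt by auto
qed

text \<open>Turns the Zariski topology of the curve into statements about finite sets; this is why
  the filter \<open>gen\<close> can take over from neighbourhoods.\<close>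

lemma open_on_iff: "open_on C U \<longleftrightarrow> U \<subseteq> C \<and> (U = {} \<or> finite (C - U))"
proof
  assume U: "open_on C U"
  then have sub: "U \<subseteq> C" using openin_subset by fastforce
  have top: "topspace (subtopology zariski C) = C" using C_closed C_proj topspace_zariski by auto
  have "closedin (subtopology zariski C) (C - U)" using closedin_diff[OF closedin_topspace U] top by simp
  then have "closedin zariski (C - U)" using closedin_closed_subtopology[OF C_closed] by blast
  then show "U \<subseteq> C \<and> (U = {} \<or> finite (C - U))" using closed_finite[of "C - U"] sub by blast
next
  assume U: "U \<subseteq> C \<and> (U = {} \<or> finite (C - U))"
  have top: "topspace (subtopology zariski C) = C" using C_closed C_proj topspace_zariski by auto
  show "open_on C U"
  proof (cases "U = {}")
    case False
    then have "finite (C - U)" using U by blast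
    then have "closedin zariski (\<Union>x\<in>C - U. {x})" using C_proj closedin_point
      by (intro closedin_Union) auto
    then have "closedin (subtopology zariski C) (C - U)" using closedin_closed_subtopology[OF C_closed] by simp
    then have "open_on C (C - (C - U))" using openin_diff[OF openin_topspace] top by metis
    then show ?thesis using U by (simp add: double_diff)
  qed simp
qed

subsection \<open>Germs of regular functions\<close>

text \<open>The neighbourhood is given as a cofinite set. Evaluation at the chosen representative
  \<open>rep q\<close> is legitimate because numerator and denominator have the same degree.\<close>

definition reg_at :: "('n, 'k) point \<Rightarrow> (('n, 'k) point \<Rightarrow> 'k) \<Rightarrow> bool" where
  "reg_at p f \<longleftrightarrow> (\<exists>V e a b. V \<subseteq> C \<and> finite (C - V) \<and> p \<in> V \<and> a \<in> hom_fun e \<and> b \<in> hom_fun e \<and>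
     (\<forall>q\<in>V. b (rep q) \<noteq> 0 \<and> f q = a (rep q) / b (rep q)))"

lemma reg_atI: "\<lbrakk>V \<subseteq> C; finite (C - V); p \<in> V; a \<in> hom_fun e; b \<in> hom_fun e;
    \<And>q. q \<in> V \<Longrightarrow> b (rep q) \<noteq> 0; \<And>q. q \<in> V \<Longrightarrow> f q = a (rep q) / b (rep q)\<rbrakk> \<Longrightarrow> reg_at p f"
  unfolding reg_at_def by blast

lemma regular_iff:
  assumes U: "open_on C U"
  shows "f \<in> regular C U \<longleftrightarrow> (\<forall>p. p \<notin> U \<longrightarrow> f p = 0) \<and> (\<forall>p\<in>U. reg_at p f)"
proof -
  have "(\<exists>V e F G. open_on C V \<and> p \<in> V \<and> V \<subseteq> U \<and> homogeneous e F \<and> homogeneous e G \<and>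
        (\<forall>q\<in>V. \<forall>x\<in>q. peval G x \<noteq> 0 \<and> f q = peval F x / peval G x)) \<longleftrightarrow> reg_at p f" (is "?L \<longleftrightarrow> ?R")
    if p: "p \<in> U" for p
  proof
    assume ?L
    then obtain V e F G where V: "open_on C V" "p \<in> V" "V \<subseteq> U" "homogeneous e F" "homogeneous e G"
      "\<And>q x. q \<in> V \<Longrightarrow> x \<in> q \<Longrightarrow> peval G x \<noteq> 0 \<and> f q = peval F x / peval G x" by blast
    have VC: "V \<subseteq> C" "finite (C - V)" using V(1,2) unfolding open_on_iff by auto
    have r: "rep q \<in> q" if "q \<in> V" for q using that VC C_proj rep_in by blast
    show ?R
      by (rule reg_atI[OF VC V(2), of "peval F" e "peval G"]) (use V r in \<open>auto simp: hom_fun_def\<close>)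
  next
    assume ?R
    then obtain V e a b where V: "V \<subseteq> C" "finite (C - V)" "p \<in> V" "a \<in> hom_fun e" "b \<in> hom_fun e"
      and ab0: "\<forall>q\<in>V. b (rep q) \<noteq> 0 \<and> f q = a (rep q) / b (rep q)" unfolding reg_at_def by blast
    have ab: "b (rep q) \<noteq> 0" "f q = a (rep q) / b (rep q)" if "q \<in> V" for q using ab0 that by blast+
    obtain F G where FG: "homogeneous e F" "a = peval F" "homogeneous e G" "b = peval G" using V(4,5) by (auto simp: hom_fun_def)
    have UC: "U \<subseteq> C" "finite (C - U)" using U p unfolding open_on_iff by auto
    have "C - (V \<inter> U) = (C - V) \<union> (C - U)" by blast
    then have "open_on C (V \<inter> U)" unfolding open_on_iff using V UC by auto
    moreover have "peval G x \<noteq> 0 \<and> f q = peval F x / peval G x" if q: "q \<in> V \<inter> U" and x: "x \<in> q" for q x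
    proof -
      have "q \<in> proj_space" using q V C_proj by blast
      then obtain c where c: "c \<noteq> 0" "x = (\<lambda>i. c * rep q i)" using hom_fun_at_point[OF _ x V(4)] by metis
      show ?thesis using ab[of q] q c hom_fun_scale[OF V(4), of c "rep q"] hom_fun_scale[OF V(5), of c "rep q"] FG by simp
    qed
    ultimately show ?L using V(3) p FG by (intro exI[of _ "V \<inter> U"] exI[of _ e] exI[of _ F] exI[of _ G]) auto
  qed
  then show ?thesis unfolding regular_def by auto
qed

lemma reg_at_regular_germs: "regular_germs C reg_at"
proof
  show "infinite C" by (rule C_infinite)
next
  fix p and f g :: "('n, 'k) point \<Rightarrow> 'k"
  assume p: "p \<in> C" "reg_at p f" and fin: "finite {q \<in> C. f q \<noteq> g q}" and fg: "f p = g p"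
  from p(2) obtain V e a b where V: "V \<subseteq> C" "finite (C - V)" "p \<in> V" "a \<in> hom_fun e" "b \<in> hom_fun e"
      and ab0: "\<forall>q\<in>V. b (rep q) \<noteq> 0 \<and> f q = a (rep q) / b (rep q)" unfolding reg_at_def by blast
  have ab: "b (rep q) \<noteq> 0" "f q = a (rep q) / b (rep q)" if "q \<in> V" for q using ab0 that by blast+
  show "reg_at p g"
  proof (rule reg_atI[OF _ _ _ V(4,5)])
    show "V - {q \<in> C. f q \<noteq> g q} \<subseteq> C" using V by blast
    have "C - (V - {q \<in> C. f q \<noteq> g q}) \<subseteq> (C - V) \<union> {q \<in> C. f q \<noteq> g q}" by blast
    then show "finite (C - (V - {q \<in> C. f q \<noteq> g q}))" using fin V finite_subset by blast
    show "p \<in> V - {q \<in> C. f q \<noteq> g q}" using V fg by simp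
    fix q assume q: "q \<in> V - {q \<in> C. f q \<noteq> g q}"
    show "b (rep q) \<noteq> 0" using ab q by blast
    show "g q = a (rep q) / b (rep q)" using ab(2)[of q] q V by auto
  qed
next
  fix p f assume p: "p \<in> C" "reg_at p f"
  from p(2) obtain V e a b where V: "V \<subseteq> C" "finite (C - V)" "p \<in> V" "a \<in> hom_fun e" "b \<in> hom_fun e"
      and ab0: "\<forall>q\<in>V. b (rep q) \<noteq> 0 \<and> f q = a (rep q) / b (rep q)" unfolding reg_at_def by blast
  have ab: "b (rep q) \<noteq> 0" "f q = a (rep q) / b (rep q)" if "q \<in> V" for q using ab0 that by blast+
  have "reg_at q f" if "q \<in> V" for q by (rule reg_atI[OF V(1,2) that V(4,5) ab])
  then have "{q \<in> C. \<not> reg_at q f} \<subseteq> C - V" by blast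
  then show "finite {q \<in> C. \<not> reg_at q f}" using V finite_subset by blast
  assume "f p \<noteq> 0"
  then have pa: "a (rep p) \<noteq> 0" using ab V by fastforce
  have op: "open_on C (bopen a \<inter> C)" using openin_subtopology_Int[OF openin_bopen[OF V(4)]] by blast
  have pin: "p \<in> bopen a \<inter> C" using pa p C_proj by (auto simp: bopen_def)
  have fin: "finite (C - (bopen a \<inter> C))" using op pin unfolding open_on_iff by blast
  have "{q \<in> C. f q = 0} \<subseteq> (C - V) \<union> (C - (bopen a \<inter> C))"
    using ab C_proj by (auto simp: bopen_def)
  then show "finite {q \<in> C. f q = 0}" by (rule finite_subset) (use fin V in simp)
  show "reg_at p (\<lambda>q. inverse (f q))"
  proof (rule reg_atI[OF _ _ _ V(5,4)])
    show "V \<inter> bopen a \<subseteq> C" using V by blast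
    have "C - (V \<inter> bopen a) \<subseteq> (C - V) \<union> (C - (bopen a \<inter> C))" by blast
    then show "finite (C - (V \<inter> bopen a))" by (rule finite_subset) (use fin V in simp)
    show "p \<in> V \<inter> bopen a" using V pin by blast
    fix q assume q: "q \<in> V \<inter> bopen a"
    then show "a (rep q) \<noteq> 0" by (simp add: bopen_def)
    show "inverse (f q) = b (rep q) / a (rep q)" using ab(2)[of q] q by simp
  qed
next
  fix p and c :: 'k assume "p \<in> C"
  then show "reg_at p (\<lambda>_. c)"
    by (intro reg_atI[of C p "\<lambda>_. c" 0 "\<lambda>_. 1"]) (auto intro: hom_fun_const)
next
  fix p and f g :: "('n, 'k) point \<Rightarrow> 'k"
  assume p: "p \<in> C" "reg_at p f" "reg_at p g"
  from p(2) obtain V e a b where V: "V \<subseteq> C" "finite (C - V)" "p \<in> V" "a \<in> hom_fun e" "b \<in> hom_fun e"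
      and ab0: "\<forall>q\<in>V. b (rep q) \<noteq> 0 \<and> f q = a (rep q) / b (rep q)" unfolding reg_at_def by blast
  have ab: "b (rep q) \<noteq> 0" "f q = a (rep q) / b (rep q)" if "q \<in> V" for q using ab0 that by blast+
  from p(3) obtain V' e' a' b' where V': "V' \<subseteq> C" "finite (C - V')" "p \<in> V'" "a' \<in> hom_fun e'" "b' \<in> hom_fun e'"
      and ab0': "\<forall>q\<in>V'. b' (rep q) \<noteq> 0 \<and> g q = a' (rep q) / b' (rep q)" unfolding reg_at_def by blast
  have ab': "b' (rep q) \<noteq> 0" "g q = a' (rep q) / b' (rep q)" if "q \<in> V'" for q using ab0' that by blast+
  have W: "V \<inter> V' \<subseteq> C" "p \<in> V \<inter> V'" using V V' by auto
  have "C - (V \<inter> V') = (C - V) \<union> (C - V')" by blast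
  then have finW: "finite (C - (V \<inter> V'))" using V V' by simp
  have "(\<lambda>x. b' x * a x) \<in> hom_fun (e' + e)" "(\<lambda>x. a' x * b x) \<in> hom_fun (e' + e)" "(\<lambda>x. b' x * b x) \<in> hom_fun (e' + e)"
     "(\<lambda>x. a' x * a x) \<in> hom_fun (e' + e)" using V V' hom_fun_mult by blast+
  then have h: "(\<lambda>x. b' x * a x + a' x * b x) \<in> hom_fun (e' + e)" "(\<lambda>x. b' x * b x) \<in> hom_fun (e' + e)"
     "(\<lambda>x. a' x * a x) \<in> hom_fun (e' + e)" using hom_fun_add by blast+
  show "reg_at p (\<lambda>q. f q + g q)"
    by (rule reg_atI[OF W(1) finW W(2) h(1,2)]) (use ab ab' in \<open>auto simp: field_simps\<close>)
  show "reg_at p (\<lambda>q. f q * g q)"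
    by (rule reg_atI[OF W(1) finW W(2) h(3,2)]) (use ab ab' in \<open>auto simp: mult.commute\<close>)
qed

end

lemma sum_fun_app: "(\<Sum>i\<in>A. f i) x = (\<Sum>i\<in>A. f i x)"
  by (induction A rule: infinite_finite_induct) auto

section \<open>Linear algebra of coordinate vectors and Nakayama's lemma\<close>

interpretation pw: vector_space "pointwise_scale :: 'k::field \<Rightarrow> ('a \<Rightarrow> 'k) \<Rightarrow> 'a \<Rightarrow> 'k"
  by unfold_locales (auto simp: pointwise_scale_def fun_eq_iff algebra_simps)

definition unitv :: "'n \<Rightarrow> 'n \<Rightarrow> 'k::field" where "unitv i = (\<lambda>j. if j = i then 1 else 0)"

lemma unitv_apply: "unitv i j = (if j = i then 1 else 0)" by (simp add: unitv_def)

lemma inj_unitv: "inj (unitv :: 'n \<Rightarrow> 'n \<Rightarrow> 'k::field)"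
proof (rule injI)
  fix i j :: 'n assume "(unitv i :: 'n \<Rightarrow> 'k) = unitv j"
  then have "(unitv i :: 'n \<Rightarrow> 'k) i = unitv j i" by simp
  then show "i = j" by (simp add: unitv_def split: if_splits)
qed

interpretation fd: finite_dimensional_vector_space "pointwise_scale :: 'k::field \<Rightarrow> ('n::finite \<Rightarrow> 'k) \<Rightarrow> 'n \<Rightarrow> 'k"
  "range (unitv :: 'n \<Rightarrow> 'n \<Rightarrow> 'k)"
proof
  show "finite (range (unitv :: 'n \<Rightarrow> 'n \<Rightarrow> 'k))" by simp
  show "pw.independent (range (unitv :: 'n \<Rightarrow> 'n \<Rightarrow> 'k))"
    unfolding pw.independent_explicit_module
  proof (intro allI impI)
    fix T u and v :: "'n \<Rightarrow> 'k"
    assume T: "finite T" "T \<subseteq> range unitv" "(\<Sum>v\<in>T. pointwise_scale (u v) v) = 0" "v \<in> T"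
    then obtain i where v: "v = unitv i" by blast
    have "(\<Sum>v\<in>T. pointwise_scale (u v) v) i = (\<Sum>w\<in>T. if w = v then u v else 0)"
      unfolding sum_fun_app
    proof (rule sum.cong[OF refl])
      fix w assume "w \<in> T"
      then obtain j where "w = unitv j" using T by blast
      then show "pointwise_scale (u w) w i = (if w = v then u v else 0)"
        using v inj_eq[OF inj_unitv[where 'k = 'k], of j i] by (auto simp: pointwise_scale_def unitv_apply)
    qed
    then show "u v = 0" using T by simp
  qed
  show "pw.span (range (unitv :: 'n \<Rightarrow> 'n \<Rightarrow> 'k)) = UNIV"
  proof (intro equalityI subsetI UNIV_I)
    fix f :: "'n \<Rightarrow> 'k"
    have "f = (\<Sum>i\<in>UNIV. pointwise_scale (f i) (unitv i))"
      by (rule ext) (simp add: sum_fun_app pointwise_scale_def unitv_apply if_distrib[of "\<lambda>x. _ * x"] cong: if_cong)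
    also have "\<dots> \<in> pw.span (range (unitv :: 'n \<Rightarrow> 'n \<Rightarrow> 'k))"
      by (intro pw.span_sum pw.span_scale pw.span_base) simp
    finally show "f \<in> pw.span (range unitv)" .
  qed
qed

context regular_germs begin

lemma rg_sum: "p \<in> X \<Longrightarrow> (\<And>i. i \<in> A \<Longrightarrow> rg p (f i)) \<Longrightarrow> rg p (\<lambda>q. \<Sum>i\<in>A. f i q)"
  by (induction A rule: infinite_finite_induct) (auto intro: rg_const rg_add)

lemma rg_power: "p \<in> X \<Longrightarrow> rg p f \<Longrightarrow> rg p (\<lambda>q. f q ^ n)"
  by (induction n) (auto intro: rg_const rg_mult)

lemma rg_zero_or_nonzero: assumes "p \<in> X" "rg p f" "\<not> f \<simeq> (\<lambda>_. 0)"
  shows "finite {q \<in> X. f q = 0}"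
proof -
  have "infinite {q \<in> X. f q \<noteq> 0}" using assms(3) by (simp add: aeq_def eventually_gen)
  moreover have "finite {q \<in> X. \<not> rg q f}" by (rule rg_near[OF assms(1,2)])
  ultimately have "infinite ({q \<in> X. f q \<noteq> 0} - {q \<in> X. \<not> rg q f})" by (rule Diff_infinite_finite[rotated])
  then have "{q \<in> X. f q \<noteq> 0} - {q \<in> X. \<not> rg q f} \<noteq> {}" by (rule infinite_imp_nonempty)
  then obtain q where "q \<in> {q \<in> X. f q \<noteq> 0} - {q \<in> X. \<not> rg q f}" by blast
  then show ?thesis using rg_open[of q f] by blast
qed

text \<open>Nakayama's lemma by elimination: \<open>1 - h k k\<close> is a unit at p, so the k-th
  relation can be solved for \<open>u k\<close> and substituted into the others. The new
  coefficients \<open>h'\<close> again vanish at p.\<close>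

lemma nakayama:
  assumes "finite J" and p: "p \<in> X"
    and "\<And>i. i \<in> J \<Longrightarrow> rg p (\<alpha> i)" "\<And>i j. i \<in> J \<Longrightarrow> j \<in> J \<Longrightarrow> rg p (h i j)"
    "\<And>i j. i \<in> J \<Longrightarrow> j \<in> J \<Longrightarrow> h i j p = 0"
    "\<And>i. i \<in> J \<Longrightarrow> u i \<simeq> (\<lambda>q. \<alpha> i q * t q + (\<Sum>j\<in>J. h i j q * u j q))"
  shows "\<forall>i\<in>J. \<exists>g. rg p g \<and> u i \<simeq> (\<lambda>q. g q * t q)"
  using assms(1,3-)
proof (induction J arbitrary: \<alpha> h rule: finite_induct)
  case empty then show ?case by simp
next
  case (insert k J)
  define w where "w q = inverse (1 - h k k q)" for q
  have hk: "rg p (\<lambda>q. 1 - h k k q)" "1 - h k k p \<noteq> 0"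
    using insert.prems(2)[of k k] insert.prems(3)[of k k] rg_diff[OF p rg_const[OF p]] by auto
  have w: "rg p w" unfolding w_def[abs_def] by (rule rg_inverse[OF p hk])
  have nz: "eventually (\<lambda>q. 1 - h k k q \<noteq> 0) gen" using rg_open[OF p hk] by (simp add: eventually_gen)
  have uk: "eventually (\<lambda>q. u k q = w q * (\<alpha> k q * t q + (\<Sum>j\<in>J. h k j q * u j q))) gen"
    using insert.prems(4)[of k, OF insertI1] nz unfolding aeq_def
  proof eventually_elim
    case (elim q)
    then have "(1 - h k k q) * u k q = \<alpha> k q * t q + (\<Sum>j\<in>J. h k j q * u j q)"
      using insert.hyps by (simp add: algebra_simps)
    then show ?case using elim(2) by (simp add: w_def field_simps)
  qed
  define \<alpha>' where "\<alpha>' i q = \<alpha> i q + h i k q * (w q * \<alpha> k q)" for i q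
  define h' where "h' i j q = h i j q + h i k q * (w q * h k j q)" for i j q
  have "\<forall>i\<in>J. \<exists>g. rg p g \<and> u i \<simeq> (\<lambda>q. g q * t q)"
  proof (rule insert.IH)
    fix i assume i: "i \<in> J"
    show "rg p (\<alpha>' i)" unfolding \<alpha>'_def[abs_def] using i insert.prems(1,2) w p by (intro rg_add rg_mult) auto
    show "u i \<simeq> (\<lambda>q. \<alpha>' i q * t q + (\<Sum>j\<in>J. h' i j q * u j q))"
      using uk insert.prems(4)[of i, OF insertI2[OF i]] unfolding aeq_def
    proof eventually_elim
      case (elim q)
      have "u i q = \<alpha> i q * t q + h i k q * u k q + (\<Sum>j\<in>J. h i j q * u j q)"
        using elim(2) insert.hyps by (simp add: algebra_simps)
      also have "h i k q * u k q = h i k q * (w q * \<alpha> k q) * t q + (\<Sum>j\<in>J. h i k q * (w q * h k j q) * u j q)"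
        by (subst elim(1)) (simp add: distrib_left sum_distrib_left mult.assoc)
      finally show ?case by (simp add: \<alpha>'_def h'_def sum.distrib distrib_right)
    qed
    fix j assume j: "j \<in> J"
    show "rg p (h' i j)" unfolding h'_def[abs_def] using i j insert.prems(2) w p by (intro rg_add rg_mult) auto
    show "h' i j p = 0" using i j insert.prems(3) by (simp add: h'_def)
  qed
  from bchoice[OF this] obtain g where g: "\<forall>i\<in>J. rg p (g i) \<and> u i \<simeq> (\<lambda>q. g i q * t q)" ..
  define gk where "gk q = w q * (\<alpha> k q + (\<Sum>j\<in>J. h k j q * g j q))" for q
  have "rg p gk" unfolding gk_def[abs_def] using w insert.prems(1,2) g p by (intro rg_mult rg_add rg_sum) auto
  moreover have "u k \<simeq> (\<lambda>q. gk q * t q)"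
  proof -
    have "eventually (\<lambda>q. \<forall>j\<in>J. u j q = g j q * t q) gen"
      using g insert.hyps(1) by (intro eventually_ball_finite) (auto simp: aeq_def)
    with uk show ?thesis unfolding aeq_def
    proof eventually_elim
      case (elim q)
      have "(\<Sum>j\<in>J. h k j q * u j q) = (\<Sum>j\<in>J. h k j q * g j q) * t q"
        unfolding sum_distrib_right using elim(2) by (intro sum.cong) auto
      then show ?case using elim(1) by (simp add: gk_def algebra_simps)
    qed
  qed
  ultimately show ?case using g by blast
qed

end

section \<open>Smooth points have discrete valuation rings\<close>

context smooth_curve begin

sublocale regular_germs C reg_at by (rule reg_at_regular_germs)

notation aeq (infix "\<simeq>" 50)

definition chart :: "'n \<Rightarrow> ('n, 'k) point \<Rightarrow> 'n \<Rightarrow> 'k" where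
  "chart i0 q = (\<lambda>i. rep q i / rep q i0)"

lemma chart_domain: assumes "p \<in> C" "rep p i0 \<noteq> 0" shows "finite {q \<in> C. rep q i0 = 0}"
proof -
  have op: "open_on C (bopen (\<lambda>x. x i0) \<inter> C)" using openin_subtopology_Int[OF openin_bopen[OF hom_fun_coord]] by blast
  have "p \<in> bopen (\<lambda>x. x i0) \<inter> C" using assms C_proj by (auto simp: bopen_def)
  then have "finite (C - (bopen (\<lambda>x. x i0) \<inter> C))" using op unfolding open_on_iff by blast
  moreover have "{q \<in> C. rep q i0 = 0} = C - (bopen (\<lambda>x. x i0) \<inter> C)" using C_proj by (auto simp: bopen_def)
  ultimately show ?thesis by simp
qed

lemma chart_gen: assumes "p \<in> C" "rep p i0 \<noteq> 0" shows "eventually (\<lambda>q. q \<in> C \<and> rep q i0 \<noteq> 0) gen"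
proof -
  have "{q \<in> C. \<not> (q \<in> C \<and> rep q i0 \<noteq> 0)} = {q \<in> C. rep q i0 = 0}" by auto
  then show ?thesis using chart_domain[OF assms] by (simp add: eventually_gen)
qed

lemma chart_ex: "p \<in> C \<Longrightarrow> \<exists>i0. rep p i0 \<noteq> 0"
  using rep_nonzero C_proj by blast

lemma reg_coord: assumes "p \<in> C" "rep p i0 \<noteq> 0" shows "reg_at p (\<lambda>q. chart i0 q i)"
proof (rule reg_atI[OF _ _ _ hom_fun_coord[of i] hom_fun_coord[of i0]])
  show "{q \<in> C. rep q i0 \<noteq> 0} \<subseteq> C" by blast
  have "C - {q \<in> C. rep q i0 \<noteq> 0} = {q \<in> C. rep q i0 = 0}" by blast
  then show "finite (C - {q \<in> C. rep q i0 \<noteq> 0})" using chart_domain[OF assms] by simp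
qed (use assms in \<open>auto simp: chart_def\<close>)

lemma reg_polyfun: assumes "P \<in> polyfun UNIV" "p \<in> C" "rep p i0 \<noteq> 0" shows "reg_at p (\<lambda>q. P (chart i0 q))"
  using assms(1)
  by (induction P rule: polyfun.induct) (auto intro: rg_const[OF assms(2)] rg_add[OF assms(2)] rg_mult[OF assms(2)] reg_coord[OF assms(2,3)])

lemma hom_chart: assumes "f \<in> hom_fun e" "rep q i0 \<noteq> 0" shows "f (rep q) = rep q i0 ^ e * f (chart i0 q)"
proof -
  have "rep q = (\<lambda>i. rep q i0 * chart i0 q i)" using assms(2) by (auto simp: chart_def)
  then show ?thesis using hom_fun_scale[OF assms(1), of "rep q i0" "chart i0 q"] by simp
qed

lemma chart_in: assumes "q \<in> C" "rep q i0 \<noteq> 0" shows "chart i0 q \<in> q"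
proof -
  have "chart i0 q = (\<lambda>i. inverse (rep q i0) * rep q i)" by (simp add: chart_def field_simps)
  moreover have "q \<in> proj_space" using assms C_proj by blast
  ultimately show ?thesis unfolding in_point_iff[OF \<open>q \<in> proj_space\<close>]
    using assms(2) by (intro exI[of _ "inverse (rep q i0)"]) simp
qed

lemma chart_inj: assumes "q \<in> C" "p \<in> C" "rep q i0 \<noteq> 0" "rep p i0 \<noteq> 0" "chart i0 q = chart i0 p" shows "q = p"
proof -
  define c where "c = rep q i0 / rep p i0"
  have c: "c \<noteq> 0" using assms by (simp add: c_def)
  have eq: "rep q = (\<lambda>i. c * rep p i)"
  proof
    fix i show "rep q i = c * rep p i"
      using fun_cong[OF assms(5), of i] assms(3,4) by (simp add: chart_def c_def field_simps)
  qed
  have qp: "q \<in> proj_space" "p \<in> proj_space" using assms C_proj by auto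
  have "z \<in> q \<longleftrightarrow> z \<in> p" for z
    unfolding in_point_iff[OF qp(1)] in_point_iff[OF qp(2)] eq
  proof
    assume "\<exists>b. b \<noteq> 0 \<and> z = (\<lambda>i. b * (c * rep p i))"
    then obtain b where "b \<noteq> 0" "z = (\<lambda>i. b * (c * rep p i))" by (elim exE conjE)
    then show "\<exists>b. b \<noteq> 0 \<and> z = (\<lambda>i. b * rep p i)"
      using c by (intro exI[of _ "b * c"]) (simp add: mult.assoc)
  next
    assume "\<exists>b. b \<noteq> 0 \<and> z = (\<lambda>i. b * rep p i)"
    then obtain b where "b \<noteq> 0" "z = (\<lambda>i. b * rep p i)" by (elim exE conjE)
    then show "\<exists>b. b \<noteq> 0 \<and> z = (\<lambda>i. b * (c * rep p i))"
      using c by (intro exI[of _ "b / c"]) simp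
  qed
  then show ?thesis by blast
qed

text \<open>One statement for two uses: with \<open>p' = p\<close> the denominator is nonzero at p,
  and for other p' the function f becomes a quotient of functions regular at p', which is the common
  field of fractions.\<close>

lemma reg_quotient:
  assumes "reg_at p f" "p' \<in> C" "rep p' i0 \<noteq> 0"
  shows "\<exists>e a b. a \<in> hom_fun e \<and> b \<in> hom_fun e \<and>
     eventually (\<lambda>q. b (chart i0 q) \<noteq> 0 \<and> f q = a (chart i0 q) / b (chart i0 q)) gen \<and>
     (p' = p \<longrightarrow> b (chart i0 p) \<noteq> 0 \<and> f p = a (chart i0 p) / b (chart i0 p))"
proof -
  from assms(1) obtain V e a b where V: "V \<subseteq> C" "finite (C - V)" "p \<in> V" "a \<in> hom_fun e" "b \<in> hom_fun e"
    and ab: "\<forall>q\<in>V. b (rep q) \<noteq> 0 \<and> f q = a (rep q) / b (rep q)" unfolding reg_at_def by blast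
  have *: "b (chart i0 q) \<noteq> 0 \<and> f q = a (chart i0 q) / b (chart i0 q)" if "q \<in> V" "rep q i0 \<noteq> 0" for q
    using bspec[OF ab that(1)] that(2) hom_chart[OF V(4) that(2)] hom_chart[OF V(5) that(2)] by auto
  have "C - V = {q \<in> C. q \<notin> V}" by blast
  then have "eventually (\<lambda>q. q \<in> V) gen" using V(2) by (simp add: eventually_gen)
  with chart_gen[OF assms(2,3)]
  have "eventually (\<lambda>q. b (chart i0 q) \<noteq> 0 \<and> f q = a (chart i0 q) / b (chart i0 q)) gen"
    by eventually_elim (use * in blast)
  moreover have "p' = p \<longrightarrow> b (chart i0 p) \<noteq> 0 \<and> f p = a (chart i0 p) / b (chart i0 p)"
    using * V(3) assms(3) by blast
  ultimately show ?thesis using V(4,5) by blast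
qed

text \<open>Write f = a / b on a chart. The numerator vanishes at p, so its Taylor expansion is a
  combination of coordinate differences.\<close>

lemma maximal_ideal_coords:
  assumes p: "p \<in> C" "rep p i0 \<noteq> 0" and f: "reg_at p f" "f p = 0"
  shows "\<exists>g. (\<forall>i. reg_at p (g i)) \<and> f \<simeq> (\<lambda>q. \<Sum>i\<in>UNIV. g i q * (chart i0 q i - chart i0 p i))"
proof -
  obtain e a b where ab: "a \<in> hom_fun e" "b \<in> hom_fun e"
    and ev: "eventually (\<lambda>q. b (chart i0 q) \<noteq> 0 \<and> f q = a (chart i0 q) / b (chart i0 q)) gen"
    and bp: "b (chart i0 p) \<noteq> 0" "f p = a (chart i0 p) / b (chart i0 p)"
    using reg_quotient[OF f(1) p] by blast
  obtain F where F: "a = peval F" using ab(1) by (auto simp: hom_fun_def)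
  from taylor1_peval[of "chart i0 p" F] obtain H where
    H0: "(\<forall>i. H i \<in> polyfun UNIV \<and> H i (chart i0 p) = 0) \<and>
     (\<forall>x. peval F x = peval F (chart i0 p) + (\<Sum>i\<in>UNIV. (partial_eval i F (chart i0 p) + H i x) * (x i - chart i0 p i)))"
    unfolding taylor1_def ..
  have ap: "peval F (chart i0 p) = 0" using bp f(2) F by simp
  define g where "g i q = (partial_eval i F (chart i0 p) + H i (chart i0 q)) * inverse (b (chart i0 q))" for i q
  have "reg_at p (g i)" for i
    unfolding g_def[abs_def] using H0 ab(2) p bp
    by (intro rg_mult rg_add rg_const rg_inverse reg_polyfun) (auto simp: hom_fun_polyfun)
  moreover have "f \<simeq> (\<lambda>q. \<Sum>i\<in>UNIV. g i q * (chart i0 q i - chart i0 p i))"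
    using ev unfolding aeq_def
  proof eventually_elim
    case (elim q)
    have "a (chart i0 q) = (\<Sum>i\<in>UNIV. (partial_eval i F (chart i0 p) + H i (chart i0 q)) * (chart i0 q i - chart i0 p i))"
      unfolding F using conjunct2[OF H0, THEN spec, of "chart i0 q"] ap by simp
    moreover have "f q = a (chart i0 q) * inverse (b (chart i0 q))" using elim by (simp add: divide_inverse)
    ultimately show ?case by (simp add: g_def sum_distrib_left mult_ac)
  qed
  ultimately show ?thesis by blast
qed

text \<open>Here smoothness enters. A linear form with the gradient of an equation of C as
  coefficients lies in the square of the maximal ideal. The gradients have rank
  \<open>CARD('n) - 2\<close>, so together with \<open>unitv i0\<close>, whose form is 0, and one
  further vector \<open>c0\<close> they span everything. Hence all coordinate differences are
  multiples of \<open>lin c0\<close> modulo the square, and Nakayama's lemma removes the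
  error.\<close>

lemma maximal_ideal_principal:
  assumes p: "p \<in> C"
  shows "\<exists>t. reg_at p t \<and> t p = 0 \<and> (\<forall>f. reg_at p f \<longrightarrow> f p = 0 \<longrightarrow> (\<exists>g. reg_at p g \<and> f \<simeq> (\<lambda>q. g q * t q)))"
proof -
  obtain i0 where i0: "rep p i0 \<noteq> 0" using chart_ex p by blast
  define a where "a = chart i0 p"
  have a0: "a i0 = 1" using i0 by (simp add: a_def chart_def)
  have ap: "a \<in> p" unfolding a_def by (rule chart_in[OF p i0])
  define G where "G = {(\<lambda>i. partial_eval i F a) |F. vanishing_on C F}"
  have dimG: "pw.dim G + 2 = CARD('n)" using smooth p ap unfolding smooth_projective_curve_def G_def by blast
  define lin where "lin c q = (\<Sum>i\<in>UNIV. c i * (chart i0 q i - a i))" for c :: "'n \<Rightarrow> 'k" and q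
  have reglin: "reg_at p (lin c)" for c unfolding lin_def[abs_def]
    using p i0 by (intro rg_sum rg_mult rg_const rg_diff reg_coord)
  \<comment> \<open>Membership of \<open>lin c\<close> in the square of the maximal ideal: the
    coefficients of the coordinate differences themselves vanish at p.\<close>
  define small where "small c \<longleftrightarrow> (\<exists>h. (\<forall>i. reg_at p (h i) \<and> h i p = 0) \<and>
     lin c \<simeq> (\<lambda>q. \<Sum>i\<in>UNIV. h i q * (chart i0 q i - a i)))" for c
  have small_G: "small c" if cG: "c \<in> G" for c
  proof -
    obtain F where c: "c = (\<lambda>i. partial_eval i F a)" and F: "vanishing_on C F" using cG by (auto simp: G_def)
    from taylor1_peval[of a F] obtain H where
      H0: "(\<forall>i. H i \<in> polyfun UNIV \<and> H i a = 0) \<and>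
       (\<forall>x. peval F x = peval F a + (\<Sum>i\<in>UNIV. (partial_eval i F a + H i x) * (x i - a i)))"
      unfolding taylor1_def ..
    define h where "h i q = 0 - H i (chart i0 q)" for i q
    have "reg_at p (h i)" for i
      unfolding h_def[abs_def] using H0 by (intro rg_diff rg_const reg_polyfun p i0) blast
    moreover have "h i p = 0" for i using H0 by (simp add: h_def a_def)
    ultimately have "\<forall>i. reg_at p (h i) \<and> h i p = 0" by blast
    moreover have "lin c \<simeq> (\<lambda>q. \<Sum>i\<in>UNIV. h i q * (chart i0 q i - a i))"
      using chart_gen[OF p i0] unfolding aeq_def
    proof eventually_elim
      case (elim q)
      have "peval F (chart i0 q) = 0" "peval F a = 0"
        using F chart_in[of q i0] elim ap p unfolding vanishing_on_def by blast+
      then have "0 = (\<Sum>i\<in>UNIV. (partial_eval i F a + H i (chart i0 q)) * (chart i0 q i - a i))"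
        using conjunct2[OF H0, THEN spec, of "chart i0 q"] by simp
      also have "\<dots> = lin c q - (\<Sum>i\<in>UNIV. h i q * (chart i0 q i - a i))"
        by (simp add: lin_def c h_def distrib_right sum.distrib sum_negf)
      finally show ?case by simp
    qed
    ultimately show ?thesis unfolding small_def by blast
  qed
  have lin_add: "lin (c + c') q = lin c q + lin c' q" for c c' q
    by (simp add: lin_def distrib_right sum.distrib)
  have lin_scale: "lin (pointwise_scale k c) q = k * lin c q" for k c q
    by (simp add: lin_def pointwise_scale_def sum_distrib_left mult.assoc)
  have "pw.subspace {c. small c}"
    unfolding pw.subspace_def
  proof (intro conjI allI ballI)
    have "lin 0 \<simeq> (\<lambda>q. \<Sum>i\<in>UNIV. 0 * (chart i0 q i - a i))" by (rule aeq_eqI) (simp add: lin_def)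
    then show "0 \<in> {c. small c}" unfolding small_def mem_Collect_eq
      by (intro exI[of _ "\<lambda>_ _. 0"]) (auto intro: rg_const p)
  next
    fix c c' assume "c \<in> {c. small c}" "c' \<in> {c. small c}"
    then obtain h h' where h: "\<forall>i. reg_at p (h i) \<and> h i p = 0" "lin c \<simeq> (\<lambda>q. \<Sum>i\<in>UNIV. h i q * (chart i0 q i - a i))"
      and h': "\<forall>i. reg_at p (h' i) \<and> h' i p = 0" "lin c' \<simeq> (\<lambda>q. \<Sum>i\<in>UNIV. h' i q * (chart i0 q i - a i))"
      unfolding small_def by blast
    have "lin (c + c') \<simeq> (\<lambda>q. \<Sum>i\<in>UNIV. (h i q + h' i q) * (chart i0 q i - a i))"
      using h(2) h'(2) unfolding aeq_def
      by eventually_elim (simp add: lin_add distrib_right sum.distrib)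
    then show "c + c' \<in> {c. small c}" unfolding small_def mem_Collect_eq using h(1) h'(1) p
      by (intro exI[of _ "\<lambda>i q. h i q + h' i q"]) (auto intro: rg_add)
  next
    fix k c assume "c \<in> {c. small c}"
    then obtain h where h: "\<forall>i. reg_at p (h i) \<and> h i p = 0" "lin c \<simeq> (\<lambda>q. \<Sum>i\<in>UNIV. h i q * (chart i0 q i - a i))"
      unfolding small_def by blast
    have "lin (pointwise_scale k c) \<simeq> (\<lambda>q. \<Sum>i\<in>UNIV. (k * h i q) * (chart i0 q i - a i))"
      using h(2) unfolding aeq_def
      by eventually_elim (simp add: lin_scale sum_distrib_left mult.assoc)
    then show "pointwise_scale k c \<in> {c. small c}" unfolding small_def mem_Collect_eq using h(1) p
      by (intro exI[of _ "\<lambda>i q. k * h i q"]) (auto intro: rg_mult rg_const)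
  qed
  then have small_span: "small c" if "c \<in> pw.span G" for c
    using pw.span_induct[OF that, of small] small_G by blast
  let ?e0 = "unitv i0 :: 'n \<Rightarrow> 'k"
  \<comment> \<open>By Euler's relation the gradients are orthogonal to a, whereas
    \<open>unitv i0\<close> pairs with a to \<open>a i0 = 1\<close>.\<close>
  have e0: "?e0 \<notin> pw.span G"
  proof
    assume "?e0 \<in> pw.span G"
    moreover have "pw.subspace {c. (\<Sum>i\<in>UNIV. a i * c i) = 0}"
      unfolding pw.subspace_def
      by (auto simp: distrib_left sum.distrib pointwise_scale_def mult.left_commute sum_distrib_left[symmetric])
    moreover have "(\<Sum>i\<in>UNIV. a i * c i) = 0" if cG: "c \<in> G" for c
    proof -
      obtain F where c: "c = (\<lambda>i. partial_eval i F a)" and F: "vanishing_on C F" using cG by (auto simp: G_def)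
      obtain e where "homogeneous e F" using F by (auto simp: vanishing_on_def)
      moreover have "peval F a = 0" using F p ap unfolding vanishing_on_def by blast
      ultimately show ?thesis using euler_identity[of e F a] by (simp add: c)
    qed
    ultimately have "(\<Sum>i\<in>UNIV. a i * ?e0 i) = 0" using pw.span_induct[of ?e0 G "\<lambda>c. (\<Sum>i\<in>UNIV. a i * c i) = 0"] by blast
    moreover have "(\<Sum>i\<in>UNIV. a i * ?e0 i) = a i0"
      by (simp add: unitv_apply if_distrib[of "\<lambda>x. _ * x"] cong: if_cong)
    ultimately show False using a0 by simp
  qed
  have cardB: "card (range (unitv :: 'n \<Rightarrow> 'n \<Rightarrow> 'k)) = CARD('n)" using card_image[OF inj_unitv] by simp
  have dim1: "pw.dim (insert ?e0 G) + 1 = CARD('n)" using fd.dim_insert[of ?e0 G] e0 dimG by simp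
  have "pw.span (insert ?e0 G) \<noteq> UNIV"
  proof
    assume "pw.span (insert ?e0 G) = UNIV"
    then have "pw.dim (insert ?e0 G) = pw.dim (UNIV :: ('n \<Rightarrow> 'k) set)" using pw.dim_span by metis
    then show False using dim1 cardB fd.dim_UNIV by simp
  qed
  then obtain c0 where c0: "c0 \<notin> pw.span (insert ?e0 G)" by blast
  have dim2: "pw.dim (insert c0 (insert ?e0 G)) = CARD('n)" using fd.dim_insert[of c0 "insert ?e0 G"] c0 dim1 by simp
  have full: "x \<in> pw.span (insert c0 (insert ?e0 G))" for x
  proof (rule ccontr)
    assume "x \<notin> pw.span (insert c0 (insert ?e0 G))"
    then have "pw.dim (insert x (insert c0 (insert ?e0 G))) = CARD('n) + 1" using fd.dim_insert dim2 by metis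
    moreover have "pw.dim (insert x (insert c0 (insert ?e0 G))) \<le> pw.dim (UNIV :: ('n \<Rightarrow> 'k) set)"
      by (rule fd.dim_subset) simp
    ultimately show False using cardB fd.dim_UNIV by simp
  qed
  have "\<exists>\<alpha> \<beta> w. small w \<and> unitv i = pointwise_scale \<alpha> c0 + pointwise_scale \<beta> ?e0 + w" for i
  proof -
    obtain \<alpha> where "unitv i - pointwise_scale \<alpha> c0 \<in> pw.span (insert ?e0 G)"
      using full[of "unitv i"] unfolding pw.span_breakdown_eq[of _ c0] by blast
    then obtain \<beta> where "unitv i - pointwise_scale \<alpha> c0 - pointwise_scale \<beta> ?e0 \<in> pw.span G"
      unfolding pw.span_breakdown_eq[of _ ?e0] by blast
    from small_span[OF this] show ?thesis
      by (intro exI[of _ \<alpha>] exI[of _ \<beta>] exI[of _ "unitv i - pointwise_scale \<alpha> c0 - pointwise_scale \<beta> ?e0"]) simp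
  qed
  then have "\<forall>i. \<exists>x. small (snd (snd x)) \<and> unitv i = pointwise_scale (fst x) c0 + pointwise_scale (fst (snd x)) ?e0 + snd (snd x)"
    by simp
  from choice[OF this] obtain x where x: "\<forall>i. small (snd (snd (x i))) \<and>
    unitv i = pointwise_scale (fst (x i)) c0 + pointwise_scale (fst (snd (x i))) ?e0 + snd (snd (x i))" ..
  define \<alpha> where "\<alpha> i = fst (x i)" for i
  define \<beta> where "\<beta> i = fst (snd (x i))" for i
  define w where "w i = snd (snd (x i))" for i
  have w: "small (w i)" "unitv i = pointwise_scale (\<alpha> i) c0 + pointwise_scale (\<beta> i) ?e0 + w i" for i
    using x unfolding \<alpha>_def \<beta>_def w_def by blast+
  have "\<forall>i. \<exists>h. (\<forall>j. reg_at p (h j) \<and> h j p = 0) \<and> lin (w i) \<simeq> (\<lambda>q. \<Sum>j\<in>UNIV. h j q * (chart i0 q j - a j))"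
    using w(1) unfolding small_def by blast
  from choice[OF this] obtain h where h0: "\<forall>i. (\<forall>j. reg_at p (h i j) \<and> h i j p = 0) \<and>
    lin (w i) \<simeq> (\<lambda>q. \<Sum>j\<in>UNIV. h i j q * (chart i0 q j - a j))" ..
  have h: "reg_at p (h i j)" "h i j p = 0" "lin (w i) \<simeq> (\<lambda>q. \<Sum>j\<in>UNIV. h i j q * (chart i0 q j - a j))" for i j
    using h0 by blast+
  have lin_unit: "lin (unitv i) q = chart i0 q i - a i" for i q
    by (simp add: lin_def unitv_apply if_distrib[of "\<lambda>x. x * _"] cong: if_cong)
  have eqs: "(\<lambda>q. chart i0 q i - a i) \<simeq> (\<lambda>q. \<alpha> i * lin c0 q + (\<Sum>j\<in>UNIV. h i j q * (chart i0 q j - a j)))" for i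
    using h(3)[of i] chart_gen[OF p i0] unfolding aeq_def
  proof eventually_elim
    case (elim q)
    \<comment> \<open>The coordinate i0 is identically 1 on the chart.\<close>
    have "lin ?e0 q = 0" unfolding lin_unit using elim(2) a0 by (simp add: chart_def)
    moreover have "chart i0 q i - a i = lin (pointwise_scale (\<alpha> i) c0 + pointwise_scale (\<beta> i) ?e0 + w i) q"
      by (simp only: w(2)[symmetric] lin_unit)
    ultimately show ?case using elim(1) by (simp add: lin_add lin_scale)
  qed
  have "\<forall>i\<in>UNIV. \<exists>g. reg_at p g \<and> (\<lambda>q. chart i0 q i - a i) \<simeq> (\<lambda>q. g q * lin c0 q)"
    by (rule nakayama[OF finite p, where \<alpha> = "\<lambda>i _. \<alpha> i" and h = h and u = "\<lambda>i q. chart i0 q i - a i"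
        and t = "lin c0"]) (rule rg_const[OF p] h eqs)+
  from bchoice[OF this] obtain g where
    g0: "\<forall>i\<in>UNIV. reg_at p (g i) \<and> (\<lambda>q. chart i0 q i - a i) \<simeq> (\<lambda>q. g i q * lin c0 q)" ..
  have g: "reg_at p (g i)" "(\<lambda>q. chart i0 q i - a i) \<simeq> (\<lambda>q. g i q * lin c0 q)" for i using g0 by blast+
  have allg: "eventually (\<lambda>q. \<forall>i\<in>UNIV. chart i0 q i - a i = g i q * lin c0 q) gen"
    using g(2) by (intro eventually_ball_finite) (auto simp: aeq_def)
  show ?thesis
  proof (rule exI[of _ "lin c0"], intro conjI allI impI)
    show "reg_at p (lin c0)" by (rule reglin)
    show "lin c0 p = 0" by (simp add: lin_def a_def)
    fix f assume f: "reg_at p f" "f p = 0"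
    obtain g' where g': "\<forall>i. reg_at p (g' i)" "f \<simeq> (\<lambda>q. \<Sum>i\<in>UNIV. g' i q * (chart i0 q i - a i))"
      using maximal_ideal_coords[OF p i0 f] unfolding a_def by blast
    have "f \<simeq> (\<lambda>q. (\<Sum>i\<in>UNIV. g' i q * g i q) * lin c0 q)"
      using g'(2) allg unfolding aeq_def
      by eventually_elim (simp add: sum_distrib_right mult.assoc)
    moreover have "reg_at p (\<lambda>q. \<Sum>i\<in>UNIV. g' i q * g i q)" using g' g p by (intro rg_sum rg_mult) auto
    ultimately show "\<exists>g. reg_at p g \<and> f \<simeq> (\<lambda>q. g q * lin c0 q)" by blast
  qed
qed

text \<open>Otherwise all affine coordinates would be constant at almost all points, and
  \<open>chart_inj\<close> would leave only the point p.\<close>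

lemma uniformizer_nonzero:
  assumes p: "p \<in> C" and t: "reg_at p t"
    and tm: "\<forall>f. reg_at p f \<longrightarrow> f p = 0 \<longrightarrow> (\<exists>g. reg_at p g \<and> f \<simeq> (\<lambda>q. g q * t q))"
  shows "\<not> t \<simeq> (\<lambda>_. 0)"
proof
  assume t0: "t \<simeq> (\<lambda>_. 0)"
  obtain i0 where i0: "rep p i0 \<noteq> 0" using chart_ex p by blast
  have "eventually (\<lambda>q. chart i0 q i = chart i0 p i) gen" for i
  proof -
    have "reg_at p (\<lambda>q. chart i0 q i - chart i0 p i)" using p i0 by (intro rg_diff rg_const reg_coord)
    then obtain g where "(\<lambda>q. chart i0 q i - chart i0 p i) \<simeq> (\<lambda>q. g q * t q)" using tm by force
    then show ?thesis using t0 unfolding aeq_def by eventually_elim simp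
  qed
  then have "eventually (\<lambda>q. \<forall>i\<in>UNIV. chart i0 q i = chart i0 p i) gen"
    by (intro eventually_ball_finite) auto
  moreover have "eventually (\<lambda>q. q \<noteq> p) gen"
    using finite_subset[of "{q \<in> C. \<not> q \<noteq> p}" "{p}"] by (auto simp: eventually_gen)
  ultimately have "eventually (\<lambda>q. False) gen" using chart_gen[OF p i0]
  proof eventually_elim
    case (elim q)
    then show ?case using chart_inj[of q p i0] p i0 by auto
  qed
  then show False by simp
qed

text \<open>Krull's intersection theorem with explicit denominators. If division by t never stopped,
  f would be \<open>t ^ n * a n / b n\<close> for all n, with \<open>b n\<close> nonzero at p. A
  relation expressing some \<open>a m\<close> by earlier \<open>a i\<close> becomes f W = 0 with W
  nonzero at p.\<close>

lemma dvr_decomposition: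
  assumes p: "p \<in> C" and t: "reg_at p t" "t p = 0"
    and tm: "\<forall>f. reg_at p f \<longrightarrow> f p = 0 \<longrightarrow> (\<exists>g. reg_at p g \<and> f \<simeq> (\<lambda>q. g q * t q))"
    and f: "reg_at p f" "\<not> f \<simeq> (\<lambda>_. 0)"
  shows "\<exists>n u. reg_at p u \<and> u p \<noteq> 0 \<and> f \<simeq> (\<lambda>q. t q ^ n * u q)"
proof (rule ccontr)
  assume no: "\<not> ?thesis"
  obtain i0 where i0: "rep p i0 \<noteq> 0" using chart_ex p by blast
  have "finite {q \<in> C. t q = 0}" by (rule rg_zero_or_nonzero[OF p t(1) uniformizer_nonzero[OF p t(1) tm]])
  then have tnz: "eventually (\<lambda>q. t q \<noteq> 0) gen" by (simp add: eventually_gen)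
  have "\<exists>g. reg_at p g \<and> f \<simeq> (\<lambda>q. t q ^ n * g q)" for n
  proof (induction n)
    case 0 then show ?case using f(1) by (intro exI[of _ f]) simp
  next
    case (Suc n)
    then obtain g where g: "reg_at p g" "f \<simeq> (\<lambda>q. t q ^ n * g q)" by blast
    then have "g p = 0" using no by blast
    then obtain g' where g': "reg_at p g'" "g \<simeq> (\<lambda>q. g' q * t q)" using tm g(1) by blast
    have "f \<simeq> (\<lambda>q. t q ^ Suc n * g' q)" using g(2) g'(2) unfolding aeq_def
      by eventually_elim (simp add: mult_ac)
    then show ?case using g'(1) by blast
  qed
  then have "\<forall>n. \<exists>x. fst x \<in> polyfun UNIV \<and> snd x \<in> polyfun UNIV \<and> snd x (chart i0 p) \<noteq> 0 \<and>
      eventually (\<lambda>q. t q ^ n * fst x (chart i0 q) = f q * snd x (chart i0 q)) gen"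
  proof (intro allI)
    fix n
    assume "\<And>n. \<exists>g. reg_at p g \<and> f \<simeq> (\<lambda>q. t q ^ n * g q)"
    then obtain g where g: "reg_at p g" "f \<simeq> (\<lambda>q. t q ^ n * g q)" by blast
    obtain e a b where ab: "a \<in> hom_fun e" "b \<in> hom_fun e"
      and ev: "eventually (\<lambda>q. b (chart i0 q) \<noteq> 0 \<and> g q = a (chart i0 q) / b (chart i0 q)) gen"
      and bp: "b (chart i0 p) \<noteq> 0"
      using reg_quotient[OF g(1) p i0] by blast
    have "eventually (\<lambda>q. t q ^ n * a (chart i0 q) = f q * b (chart i0 q)) gen"
      using ev g(2) unfolding aeq_def by eventually_elim simp
    then show "\<exists>x. fst x \<in> polyfun UNIV \<and> snd x \<in> polyfun UNIV \<and> snd x (chart i0 p) \<noteq> 0 \<and>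
      eventually (\<lambda>q. t q ^ n * fst x (chart i0 q) = f q * snd x (chart i0 q)) gen"
      using ab bp hom_fun_polyfun by (intro exI[of _ "(a, b)"]) auto
  qed
  from choice[OF this] obtain x where x: "\<forall>n. fst (x n) \<in> polyfun UNIV \<and> snd (x n) \<in> polyfun UNIV \<and>
      snd (x n) (chart i0 p) \<noteq> 0 \<and>
      eventually (\<lambda>q. t q ^ n * fst (x n) (chart i0 q) = f q * snd (x n) (chart i0 q)) gen" ..
  define a where "a n = fst (x n)" for n
  define b where "b n = snd (x n)" for n
  have ab: "a n \<in> polyfun UNIV" "b n \<in> polyfun UNIV" "b n (chart i0 p) \<noteq> 0"
    "eventually (\<lambda>q. t q ^ n * a n (chart i0 q) = f q * b n (chart i0 q)) gen" for n
    using x by (simp_all add: a_def b_def)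
  obtain m c where c: "\<forall>i. c i \<in> polyfun UNIV" "\<forall>x. a m x = (\<Sum>i<m. c i x * a i x)"
    using polyfun_noetherian[of a] ab(1) by blast
  \<comment> \<open>At p only \<open>b m\<close> survives, because \<open>t p = 0\<close> and the
    exponents \<open>m - i\<close> are positive.\<close>
  define W where "W q = b m (chart i0 q) - (\<Sum>i<m. c i (chart i0 q) * b i (chart i0 q) * t q ^ (m - i))" for q
  have "reg_at p W" unfolding W_def[abs_def] using ab(2) c(1) p i0 t(1)
    by (intro rg_diff rg_sum rg_mult rg_power reg_polyfun) auto
  moreover have "W p \<noteq> 0" using ab(3)[of m] t(2) by (simp add: W_def power_0_left)
  ultimately have Wnz: "eventually (\<lambda>q. W q \<noteq> 0) gen" using rg_open[OF p] by (simp add: eventually_gen)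
  have "eventually (\<lambda>q. \<forall>n\<in>{..m}. t q ^ n * a n (chart i0 q) = f q * b n (chart i0 q)) gen"
    using ab(4) by (intro eventually_ball_finite) auto
  then have "f \<simeq> (\<lambda>_. 0)" using Wnz unfolding aeq_def
  proof eventually_elim
    case (elim q)
    let ?y = "chart i0 q"
    have "f q * b m ?y = t q ^ m * (\<Sum>i<m. c i ?y * a i ?y)" using bspec[OF elim(1), of m] spec[OF c(2), of ?y] by simp
    also have "\<dots> = (\<Sum>i<m. c i ?y * t q ^ (m - i) * (t q ^ i * a i ?y))"
      unfolding sum_distrib_left
    proof (rule sum.cong[OF refl])
      fix i assume i: "i \<in> {..<m}"
      then have "t q ^ m = t q ^ (m - i) * t q ^ i" by (simp add: power_add[symmetric])
      then show "t q ^ m * (c i ?y * a i ?y) = c i ?y * t q ^ (m - i) * (t q ^ i * a i ?y)" by simp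
    qed
    also have "\<dots> = (\<Sum>i<m. c i ?y * t q ^ (m - i) * (f q * b i ?y))" using elim(1) by (intro sum.cong) auto
    also have "\<dots> = f q * (\<Sum>i<m. c i ?y * b i ?y * t q ^ (m - i))"
      unfolding sum_distrib_left by (intro sum.cong) auto
    finally have "f q * W q = 0" by (simp add: W_def right_diff_distrib)
    then show ?case using elim(2) by simp
  qed
  then show False using f(2) by blast
qed

lemma reg_at_function_germs: "function_germs C reg_at"
proof
  fix p assume p: "p \<in> C"
  obtain t where t: "reg_at p t" "t p = 0"
    and tm: "\<forall>f. reg_at p f \<longrightarrow> f p = 0 \<longrightarrow> (\<exists>g. reg_at p g \<and> f \<simeq> (\<lambda>q. g q * t q))"
    using maximal_ideal_principal[OF p] by blast
  have "finite {q \<in> C. t q = 0}" by (rule rg_zero_or_nonzero[OF p t(1) uniformizer_nonzero[OF p t(1) tm]])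
  moreover have "finite {q \<in> C. f q \<noteq> 0} \<or> (\<exists>n u. reg_at p u \<and> u p \<noteq> 0 \<and> finite {q \<in> C. f q \<noteq> t q ^ n * u q})"
    if rf: "reg_at p f" for f
  proof (cases "f \<simeq> (\<lambda>_. 0)")
    case True then show ?thesis by (simp add: aeq_def eventually_gen)
  next
    case False
    then obtain n u where "reg_at p u" "u p \<noteq> 0" "f \<simeq> (\<lambda>q. t q ^ n * u q)"
      using dvr_decomposition[OF p t tm rf False] by blast
    then show ?thesis by (auto simp: aeq_def eventually_gen)
  qed
  ultimately show "\<exists>t. reg_at p t \<and> t p = 0 \<and> finite {q \<in> C. t q = 0} \<and>
       (\<forall>f. reg_at p f \<longrightarrow> finite {q \<in> C. f q \<noteq> 0} \<or>
         (\<exists>n u. reg_at p u \<and> u p \<noteq> 0 \<and> finite {q \<in> C. f q \<noteq> t q ^ n * u q}))"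
    using t by blast
next
  fix p f p' assume p: "p \<in> C" "reg_at p f" "p' \<in> C"
  obtain i0 where i0: "rep p' i0 \<noteq> 0" using chart_ex p(3) by blast
  obtain e a b where ab: "a \<in> hom_fun e" "b \<in> hom_fun e"
    and ev: "eventually (\<lambda>q. b (chart i0 q) \<noteq> 0 \<and> f q = a (chart i0 q) / b (chart i0 q)) gen"
    using reg_quotient[OF p(2,3) i0] by blast
  have r: "reg_at p' (\<lambda>q. a (chart i0 q))" "reg_at p' (\<lambda>q. b (chart i0 q))"
    using ab hom_fun_polyfun p(3) i0 by (auto intro: reg_polyfun)
  have "eventually (\<lambda>q. b (chart i0 q) \<noteq> 0) gen" using ev by eventually_elim blast
  then have "\<not> (\<lambda>q. b (chart i0 q)) \<simeq> (\<lambda>_. 0)"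
  proof -
    assume 1: "eventually (\<lambda>q. b (chart i0 q) \<noteq> 0) gen"
    show ?thesis
    proof
      assume "(\<lambda>q. b (chart i0 q)) \<simeq> (\<lambda>_. 0)"
      with 1 have "eventually (\<lambda>_. False) gen" unfolding aeq_def by eventually_elim simp
      then show False by simp
    qed
  qed
  then have inf: "infinite {q \<in> C. b (chart i0 q) \<noteq> 0}" by (simp add: aeq_def eventually_gen)
  have "f \<simeq> (\<lambda>q. a (chart i0 q) / b (chart i0 q))" using ev unfolding aeq_def by eventually_elim blast
  then have "finite {q \<in> C. f q \<noteq> a (chart i0 q) / b (chart i0 q)}" by (simp add: aeq_def eventually_gen)
  then show "\<exists>a b. reg_at p' a \<and> reg_at p' b \<and> infinite {q \<in> C. b q \<noteq> 0} \<and> finite {q \<in> C. f q \<noteq> a q / b q}"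
    using r inf by blast
qed

sublocale function_germs C reg_at by (rule reg_at_function_germs)

end

subsection \<open>Coordinates and base change determinants\<close>

definition vindep :: "('k::field \<Rightarrow> 'v::ab_group_add \<Rightarrow> 'v) \<Rightarrow> nat \<Rightarrow> (nat \<Rightarrow> 'v) \<Rightarrow> bool" where
  "vindep sc n b \<longleftrightarrow> (\<forall>c. (\<Sum>i<n. sc (c i) (b i)) = 0 \<longrightarrow> (\<forall>i<n. c i = 0))"

definition vspan :: "('k::field \<Rightarrow> 'v::ab_group_add \<Rightarrow> 'v) \<Rightarrow> nat \<Rightarrow> (nat \<Rightarrow> 'v) \<Rightarrow> 'v set" where
  "vspan sc n b = {\<Sum>j<n. sc (c j) (b j) |c. True}"

definition crd :: "('k::field \<Rightarrow> 'v::ab_group_add \<Rightarrow> 'v) \<Rightarrow> nat \<Rightarrow> (nat \<Rightarrow> 'v) \<Rightarrow> 'v \<Rightarrow> nat \<Rightarrow> 'k" where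
  "crd sc n b v = (SOME c. v = (\<Sum>j<n. sc (c j) (b j)))"

text \<open>The factor between wedge products: formally b 0 \<and> ... \<and> b (n - 1) is
  \<open>fdet\<close> times b' 0 \<and> ... \<and> b' (n - 1). Thus \<open>fdet_mult\<close> is the
  cocycle relation of a determinant bundle.\<close>

definition fdet :: "('k::field \<Rightarrow> 'v::ab_group_add \<Rightarrow> 'v) \<Rightarrow> nat \<Rightarrow> (nat \<Rightarrow> 'v) \<Rightarrow> (nat \<Rightarrow> 'v) \<Rightarrow> 'k" where
  "fdet sc n b b' = det (mat n n (\<lambda>(i, j). crd sc n b' (b i) j))"

lemma crd_sum: assumes "v \<in> vspan sc n b" shows "v = (\<Sum>j<n. sc (crd sc n b v j) (b j))"
  unfolding crd_def by (rule someI_ex[where P = "\<lambda>c. v = (\<Sum>j<n. sc (c j) (b j))"]) (use assms in \<open>auto simp: vspan_def\<close>)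

lemma vspanI: "v = (\<Sum>j<n. sc (c j) (b j)) \<Longrightarrow> v \<in> vspan sc n b"
  by (auto simp: vspan_def)

lemma vindepD: "vindep sc n b \<Longrightarrow> (\<Sum>i<n. sc (c i) (b i)) = 0 \<Longrightarrow> i < n \<Longrightarrow> c i = 0"
  unfolding vindep_def by blast

lemma crd_eq:
  assumes "vector_space sc" "vindep sc n b" "v = (\<Sum>j<n. sc (c j) (b j))" "j < n"
  shows "crd sc n b v j = c j"
proof -
  interpret vs: vector_space sc by fact
  have "(\<Sum>j<n. sc (crd sc n b v j) (b j)) = (\<Sum>j<n. sc (c j) (b j))"
  proof -
    have "v \<in> vspan sc n b" unfolding vspan_def using assms(3) by blast
    from crd_sum[OF this] show ?thesis using assms(3) by simp
  qed
  then have "(\<Sum>j<n. sc (crd sc n b v j - c j) (b j)) = 0"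
    by (simp add: vs.scale_left_diff_distrib sum_subtractf)
  from vindepD[OF assms(2) this assms(4)] show ?thesis by simp
qed

lemma vspan_base: assumes "vector_space sc" "i < n" shows "b i \<in> vspan sc n b"
proof -
  interpret vs: vector_space sc by fact
  have "(\<Sum>j<n. sc (if j = i then 1 else 0) (b j)) = (\<Sum>j<n. if j = i then b j else 0)"
    by (rule sum.cong) auto
  then have "b i = (\<Sum>j<n. sc (if j = i then 1 else 0) (b j))" using assms by simp
  then show ?thesis by (rule vspanI)
qed

lemma crd_base:
  assumes "vector_space sc" "vindep sc n b" "i < n" "j < n"
  shows "crd sc n b (b i) j = (if j = i then 1 else 0)"
proof -
  interpret vs: vector_space sc by fact
  have "(\<Sum>j<n. sc (if j = i then 1 else 0) (b j)) = (\<Sum>j<n. if j = i then b j else 0)"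
    by (rule sum.cong) auto
  then have "b i = (\<Sum>j<n. sc (if j = i then 1 else 0) (b j))" using assms by simp
  then show ?thesis by (rule crd_eq[OF assms(1,2) _ assms(4)])
qed

lemma fdet_self: assumes "vector_space sc" "vindep sc n b" shows "fdet sc n b b = 1"
proof -
  have "mat n n (\<lambda>(i, j). crd sc n b (b i) j) = 1\<^sub>m n"
    by (rule eq_matI) (auto simp: crd_base[OF assms])
  then show ?thesis by (simp add: fdet_def)
qed

lemma crd_trans:
  assumes vs: "vector_space sc" and b'': "vindep sc n b''"
    and v: "v \<in> vspan sc m b'" and b': "\<And>i. i < m \<Longrightarrow> b' i \<in> vspan sc n b''" and j: "j < n"
  shows "crd sc n b'' v j = (\<Sum>k<m. crd sc m b' v k * crd sc n b'' (b' k) j)"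
proof (rule crd_eq[OF vs b'' _ j])
  interpret vs: vector_space sc by fact
  have "v = (\<Sum>k<m. sc (crd sc m b' v k) (b' k))" by (rule crd_sum[OF v])
  also have "\<dots> = (\<Sum>k<m. sc (crd sc m b' v k) (\<Sum>j<n. sc (crd sc n b'' (b' k) j) (b'' j)))"
    by (rule sum.cong[OF refl]) (use crd_sum[OF b'] in simp)
  also have "\<dots> = (\<Sum>k<m. \<Sum>j<n. sc (crd sc m b' v k * crd sc n b'' (b' k) j) (b'' j))"
    by (simp add: vs.scale_sum_right)
  also have "\<dots> = (\<Sum>j<n. \<Sum>k<m. sc (crd sc m b' v k * crd sc n b'' (b' k) j) (b'' j))"
    by (rule sum.swap)
  finally show "v = (\<Sum>j<n. sc (\<Sum>k<m. crd sc m b' v k * crd sc n b'' (b' k) j) (b'' j))"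
    by (simp add: vs.scale_sum_left)
qed

lemma fdet_mult:
  assumes "vector_space sc" "vindep sc n b''"
    and "\<And>i. i < n \<Longrightarrow> b i \<in> vspan sc n b'" "\<And>i. i < n \<Longrightarrow> b' i \<in> vspan sc n b''"
  shows "fdet sc n b b'' = fdet sc n b b' * fdet sc n b' b''"
proof -
  let ?A = "mat n n (\<lambda>(i, j). crd sc n b' (b i) j)" and ?B = "mat n n (\<lambda>(i, j). crd sc n b'' (b' i) j)"
  have "mat n n (\<lambda>(i, j). crd sc n b'' (b i) j) = ?A * ?B"
  proof (rule eq_matI)
    fix i j assume "i < dim_row (?A * ?B)" "j < dim_col (?A * ?B)"
    then have ij: "i < n" "j < n" by auto
    then show "mat n n (\<lambda>(i, j). crd sc n b'' (b i) j) $$ (i, j) = (?A * ?B) $$ (i, j)"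
      using crd_trans[OF assms(1,2) assms(3)[OF ij(1)] assms(4) ij(2)]
      by (simp add: scalar_prod_def lessThan_atLeast0)
  qed auto
  then show ?thesis unfolding fdet_def by (simp add: det_mult[of ?A n ?B])
qed

lemma vindep_card_le:
  assumes vs: "vector_space sc" and b: "vindep sc n b" and s: "\<And>i. i < n \<Longrightarrow> b i \<in> vspan sc m b'"
  shows "n \<le> m"
proof -
  interpret vs: vector_space sc by fact
  have inj: "inj_on b {..<n}"
  proof (rule inj_onI, rule ccontr)
    fix i j assume ij: "i \<in> {..<n}" "j \<in> {..<n}" "b i = b j" "i \<noteq> j"
    define c where "c k = (if k = i then 1 else if k = j then - 1 else 0 :: 'a)" for k
    have "(\<Sum>k<n. sc (c k) (b k)) = (\<Sum>k\<in>{i, j}. sc (c k) (b k))"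
      by (rule sum.mono_neutral_right) (use ij in \<open>auto simp: c_def\<close>)
    then have "(\<Sum>k<n. sc (c k) (b k)) = 0" using ij by (simp add: c_def)
    from vindepD[OF b this, of i] show False using ij by (simp add: c_def)
  qed
  have ind: "vs.independent (b ` {..<n})"
    unfolding vs.independent_explicit_finite_subsets
  proof (intro allI impI ballI)
    fix A u v assume A: "A \<subseteq> b ` {..<n}" "finite A" "(\<Sum>v\<in>A. sc (u v) v) = 0" "v \<in> A"
    define c where "c i = (if b i \<in> A then u (b i) else 0)" for i
    have "(\<Sum>i<n. sc (c i) (b i)) = (\<Sum>w\<in>b ` {..<n}. sc (if w \<in> A then u w else 0) w)"
      by (subst sum.reindex[OF inj]) (simp add: c_def)
    also have "\<dots> = (\<Sum>w\<in>A. sc (u w) w)"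
      by (rule sum.mono_neutral_cong_right) (use A in auto)
    finally have "(\<Sum>i<n. sc (c i) (b i)) = 0" using A by simp
    moreover obtain i where "i < n" "v = b i" using A by blast
    ultimately show "u v = 0" using vindepD[OF b, of c i] A(4) by (simp add: c_def)
  qed
  have "b ` {..<n} \<subseteq> vs.span (b' ` {..<m})"
  proof
    fix v assume "v \<in> b ` {..<n}"
    then obtain i where i: "i < n" "v = b i" by blast
    then have "v = (\<Sum>j<m. sc (crd sc m b' v j) (b' j))" using crd_sum[OF s] by blast
    also have "\<dots> \<in> vs.span (b' ` {..<m})" by (intro vs.span_sum vs.span_scale vs.span_base) auto
    finally show "v \<in> vs.span (b' ` {..<m})" .
  qed
  from vs.independent_span_bound[OF _ ind this] have "card (b ` {..<n}) \<le> card (b' ` {..<m})" by simp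
  also have "\<dots> \<le> m" using card_image_le[of "{..<m}" b'] by simp
  finally show ?thesis by (simp add: card_image[OF inj])
qed

context function_germs begin

lemma has_ord_powi: assumes "p \<in> X" "has_ord p f m" shows "has_ord p (\<lambda>q. f q powi k) (k * m)"
proof -
  have nat: "has_ord p (\<lambda>q. f q ^ n) (int n * m)" for n
  proof (induction n)
    case 0 show ?case using has_ord_0[OF assms(1), of "\<lambda>_. 1"] unit_const[OF assms(1), of 1] by simp
  next
    case (Suc n)
    from has_ord_mult[OF assms Suc] show ?case by (simp add: algebra_simps)
  qed
  show ?thesis
  proof (cases "k \<ge> 0")
    case True then show ?thesis using nat[of "nat k"] by (simp add: power_int_def)
  next
    case False
    then show ?thesis using has_ord_inverse[OF assms(1) nat[of "nat (- k)"]] by (simp add: power_int_def power_inverse)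
  qed
qed

end

section \<open>Orders of rational functions at points of the curve\<close>

context smooth_curve begin

lemma open_cofinite: "open_on C U \<Longrightarrow> p \<in> U \<Longrightarrow> U \<subseteq> C \<and> finite (C - U)"
  unfolding open_on_iff by blast

lemma cofinite_open: "U \<subseteq> C \<Longrightarrow> finite (C - U) \<Longrightarrow> open_on C U"
  unfolding open_on_iff by blast

lemma open_Int: "open_on C U \<Longrightarrow> open_on C V \<Longrightarrow> open_on C (U \<inter> V)"
  by (rule openin_Int)

lemma open_gen: assumes "open_on C U" "p \<in> U" shows "eventually (\<lambda>q. q \<in> U) gen"
proof -
  have "C - U = {q \<in> C. q \<notin> U}" by blast
  then show ?thesis using open_cofinite[OF assms] by (simp add: eventually_gen)
qed

lemma gen_open: "eventually P gen \<Longrightarrow> open_on C (insert p {q \<in> C. P q})" if "p \<in> C"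
proof (rule cofinite_open)
  assume "eventually P gen"
  then have "finite {q \<in> C. \<not> P q}" by (simp add: eventually_gen)
  moreover have "C - insert p {q \<in> C. P q} \<subseteq> {q \<in> C. \<not> P q}" by blast
  ultimately show "finite (C - insert p {q \<in> C. P q})" by (rule rev_finite_subset)
qed (use that in auto)

lemma reg_at_cong: "p \<in> C \<Longrightarrow> reg_at p f \<Longrightarrow> f \<simeq> g \<Longrightarrow> f p = g p \<Longrightarrow> reg_at p g"
  by (rule rg_cong')

lemma reg_at_cong_on:
  assumes "open_on C V" "p \<in> V" "\<And>q. q \<in> V \<Longrightarrow> f q = g q" "reg_at p f" shows "reg_at p g"
proof (rule reg_at_cong[OF _ assms(4)])
  show "p \<in> C" using open_cofinite[OF assms(1,2)] assms(2) by blast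
  show "f \<simeq> g" unfolding aeq_def using open_gen[OF assms(1,2)] by eventually_elim (use assms(3) in blast)
  show "f p = g p" using assms by blast
qed

lemma restrict_regular:
  assumes "open_on C V" "\<And>q. q \<in> V \<Longrightarrow> reg_at q f" shows "restrict_to V f \<in> regular C V"
  unfolding regular_iff[OF assms(1)]
proof (intro conjI ballI allI impI)
  fix p assume p: "p \<in> V"
  show "reg_at p (restrict_to V f)"
    by (rule reg_at_cong_on[OF assms(1) p _ assms(2)[OF p]]) (simp add: restrict_to_def)
qed (simp add: restrict_to_def)

lemma regular_reg_at: "open_on C V \<Longrightarrow> f \<in> regular C V \<Longrightarrow> p \<in> V \<Longrightarrow> reg_at p f"
  using regular_iff by blast

lemma reg_divide_unit:
  assumes "p \<in> C" "reg_at p f" "f p = 0" "reg_at p t" "t p = 0" "has_ord p t 1"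
  shows "\<exists>g. reg_at p g \<and> f \<simeq> (\<lambda>q. t q * g q)"
proof -
  obtain u where u: "unit p u" "t \<simeq> (\<lambda>q. unif p q powi 1 * u q)" using assms(6) has_ord_def by blast
  have "rgl p (\<lambda>q. f q * inverse (unif p q))"
    using rgl_div_unif[OF assms(1) rgl_rg[OF assms(2)]] val_rg[OF assms(1,2)] assms(3) by simp
  then have "rgl p (\<lambda>q. (f q * inverse (unif p q)) * inverse (u q))"
    using u(1) assms(1) unit_inverse[OF assms(1) u(1)] by (intro rgl_mult[where g = "\<lambda>q. inverse (u q)"]) (auto simp: unit_def)
  then obtain g where g: "reg_at p g" "(\<lambda>q. (f q * inverse (unif p q)) * inverse (u q)) \<simeq> g" using rglE[OF assms(1)] by blast
  have "f \<simeq> (\<lambda>q. t q * g q)"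
    using g(2) u(2) unif_nonzero[OF assms(1)] unit_nonzero[OF assms(1) u(1)] unfolding aeq_def
    by eventually_elim (auto simp: field_simps)
  then show ?thesis using g(1) by blast
qed

text \<open>The defining property, applied to a regular representative of \<open>unif p\<close>,
  gives \<open>unif p\<close> = t g up to finitely many points. So 1 = ord t + ord g with ord t
  \<ge> 1 and ord g \<ge> 0.\<close>

lemma uniformizer_has_ord:
  assumes p: "p \<in> C" and t: "uniformizer C p N t" shows "has_ord p t 1" "reg_at p t"
proof -
  have N: "open_on C N" "p \<in> N" and tN: "t \<in> regular C N" "t p = 0" using t by (auto simp: uniformizer_def)
  show rt: "reg_at p t" using regular_reg_at[OF N(1) tN(1) N(2)] .
  obtain \<tau> where \<tau>: "reg_at p \<tau>" "unif p \<simeq> \<tau>" "val p (unif p) = \<tau> p" using rglE[OF p rgl_unif[OF p]] by blast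
  define V where "V = insert p {q \<in> C. reg_at q \<tau>}"
  have V: "open_on C V" unfolding V_def by (rule gen_open[OF p rg_gen[OF p \<tau>(1)]])
  have "restrict_to V \<tau> \<in> regular C V" by (rule restrict_regular[OF V]) (use \<tau>(1) in \<open>auto simp: V_def\<close>)
  moreover have "restrict_to V \<tau> p = 0" using \<tau>(3) val_unif[OF p] by (simp add: restrict_to_def)
  moreover have "p \<in> V" by (simp add: V_def)
  ultimately obtain W g where W: "open_on C W" "p \<in> W" "W \<subseteq> V \<inter> N" "g \<in> regular C W" "\<forall>q\<in>W. restrict_to V \<tau> q = t q * g q"
    using t V unfolding uniformizer_def by blast
  have g: "reg_at p g" using regular_reg_at[OF W(1,4,2)] .
  have "\<tau> q = t q * g q" if "q \<in> W" for q
    using bspec[OF W(5) that] subsetD[OF W(3) that] by (simp add: restrict_to_def)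
  then have eq: "unif p \<simeq> (\<lambda>q. t q * g q)"
    using \<tau>(2) open_gen[OF W(1,2)] unfolding aeq_def
    by (auto elim: eventually_elim2)
  have "eventually (\<lambda>q. t q \<noteq> 0) gen" "eventually (\<lambda>q. g q \<noteq> 0) gen"
    using eq unif_nonzero[OF p] unfolding aeq_def by (eventually_elim, auto)+
  then have nz: "nz t" "nz g" using rt g p rgl_rg rat_rgl by (auto simp: nz_def)
  have "ordr p (unif p) = 1" using ordr_unif[OF p, of 1] by simp
  moreover have "ordr p (unif p) = ordr p t + ordr p g"
    using ordr_cong[OF p nz_mult[OF nz] aeq_sym[OF eq]] ordr_mult[OF p nz] by simp
  moreover have "ordr p g \<ge> 0" using rgl_iff_ordr[OF p nz(2)] rgl_rg g by blast
  moreover have "ordr p t \<ge> 0" using rgl_iff_ordr[OF p nz(1)] rgl_rg rt by blast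
  moreover have "ordr p t \<noteq> 0" using unit_iff_ordr[OF p nz(1)] val_rg[OF p rt] tN(2) by (simp add: unit_def)
  ultimately have "ordr p t = 1" by linarith
  then show "has_ord p t 1" using nz_has_ord[OF p nz(1)] by simp
qed

text \<open>Translates orders with respect to any local uniformizer into the valuation defined by
  the fixed \<open>unif p\<close>, for which uniqueness and additivity are known.\<close>

lemma has_order_iff:
  assumes p: "p \<in> C" and U: "open_on C U" "U \<noteq> {}"
  shows "has_order C p U h m \<longleftrightarrow> has_ord p h m"
proof
  assume "has_order C p U h m"
  then obtain N t u where t: "uniformizer C p N t" and u: "u \<in> regular C N" "\<forall>q\<in>N. u q \<noteq> 0"
    and h: "\<forall>q\<in>U \<inter> N - {p}. h q = t q powi m * u q" unfolding has_order_def by blast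
  have N: "open_on C N" "p \<in> N" using t by (auto simp: uniformizer_def)
  have ru: "reg_at p u" using regular_reg_at[OF N(1) u(1) N(2)] .
  have "unit p u" unfolding unit_def using rgl_rg[OF ru] val_rg[OF p ru] u(2) N(2) by auto
  then have "has_ord p u 0" using has_ord_0 p by blast
  from has_ord_mult[OF p has_ord_powi[OF p uniformizer_has_ord(1)[OF p t]] this]
  have "has_ord p (\<lambda>q. t q powi m * u q) m" by simp
  moreover obtain x where "x \<in> U" using U by blast
  have np: "eventually (\<lambda>q. q \<noteq> p) gen"
    using finite_subset[of "{q \<in> C. \<not> q \<noteq> p}" "{p}"] by (auto simp: eventually_gen)
  have "(\<lambda>q. t q powi m * u q) \<simeq> h" unfolding aeq_def
    using open_gen[OF N] open_gen[OF U(1) \<open>x \<in> U\<close>] np by eventually_elim (use h in auto)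
  ultimately show "has_ord p h m" using has_ord_cong by blast
next
  assume "has_ord p h m"
  then obtain u0 where u0: "unit p u0" "h \<simeq> (\<lambda>q. unif p q powi m * u0 q)" using has_ord_def by blast
  obtain \<tau> where \<tau>: "reg_at p \<tau>" "unif p \<simeq> \<tau>" "val p (unif p) = \<tau> p" using rglE[OF p rgl_unif[OF p]] by blast
  obtain u where u: "reg_at p u" "u0 \<simeq> u" "val p u0 = u p" using rglE[OF p] u0(1) unit_def by blast
  have up: "u p \<noteq> 0" using u0(1) u(3) by (simp add: unit_def)
  have \<tau>p: "\<tau> p = 0" using \<tau>(3) val_unif[OF p] by simp
  have unz: "eventually (\<lambda>q. u q \<noteq> 0) gen" using rg_open[OF p u(1) up] by (simp add: eventually_gen)
  have hu: "eventually (\<lambda>q. h q = \<tau> q powi m * u q) gen"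
    using u0(2) u(2) \<tau>(2) unfolding aeq_def by eventually_elim simp
  \<comment> \<open>N will consist of p and the points with property \<open>Q\<close>; almost all
    points have it, so N is open.\<close>
  define Q where "Q q \<longleftrightarrow> reg_at q \<tau> \<and> reg_at q u \<and> u q \<noteq> 0 \<and> h q = \<tau> q powi m * u q" for q
  define N where "N = insert p {q \<in> C. Q q}"
  have "eventually Q gen" unfolding Q_def using rg_gen[OF p \<tau>(1)] rg_gen[OF p u(1)] unz hu
    by eventually_elim simp
  then have N: "open_on C N" unfolding N_def by (rule gen_open[OF p])
  have pN: "p \<in> N" by (simp add: N_def)
  have rN\<tau>: "restrict_to N \<tau> \<in> regular C N"
    by (rule restrict_regular[OF N]) (use \<tau>(1) in \<open>auto simp: N_def Q_def\<close>)
  have rNu: "restrict_to N u \<in> regular C N"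
    by (rule restrict_regular[OF N]) (use u(1) in \<open>auto simp: N_def Q_def\<close>)
  note rN = rN\<tau> rNu
  have ht: "has_ord p \<tau> 1" using has_ord_cong[OF has_ord_unif[OF p, of 1]] \<tau>(2) by simp
  have "uniformizer C p N (restrict_to N \<tau>)"
    unfolding uniformizer_def
  proof (intro conjI allI impI)
    show "restrict_to N \<tau> p = 0" using \<tau>p by (simp add: restrict_to_def)
    fix V f assume "open_on C V \<and> p \<in> V \<and> f \<in> regular C V \<and> f p = 0"
    then have V: "open_on C V" "p \<in> V" and f: "f \<in> regular C V" "f p = 0" by auto
    obtain g where g: "reg_at p g" "f \<simeq> (\<lambda>q. \<tau> q * g q)"
      using reg_divide_unit[OF p regular_reg_at[OF V(1) f(1) V(2)] f(2) \<tau>(1) \<tau>p ht] by blast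
    define R where "R q \<longleftrightarrow> q \<in> V \<and> q \<in> N \<and> reg_at q g \<and> f q = \<tau> q * g q" for q
    define W where "W = insert p {q \<in> C. R q}"
    have "eventually R gen" unfolding R_def
      using rg_gen[OF p g(1)] g(2) open_gen[OF V] open_gen[OF N pN] unfolding aeq_def by eventually_elim simp
    then have W: "open_on C W" unfolding W_def by (rule gen_open[OF p])
    have "restrict_to W g \<in> regular C W" by (rule restrict_regular[OF W]) (use g(1) in \<open>auto simp: W_def R_def\<close>)
    moreover have "W \<subseteq> V \<inter> N" "p \<in> W" using V pN by (auto simp: W_def R_def)
    moreover have "\<forall>q\<in>W. f q = restrict_to N \<tau> q * restrict_to W g q"
      using f(2) \<tau>p pN by (auto simp: W_def R_def restrict_to_def)
    ultimately show "\<exists>W g. open_on C W \<and> p \<in> W \<and> W \<subseteq> V \<inter> N \<and> g \<in> regular C W \<and> (\<forall>q\<in>W. f q = restrict_to N \<tau> q * g q)"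
      using W by blast
  qed (use N pN rN in auto)
  moreover have "\<forall>q\<in>N. restrict_to N u q \<noteq> 0" using up by (auto simp: N_def Q_def restrict_to_def)
  moreover have "\<forall>q\<in>U \<inter> N - {p}. h q = restrict_to N \<tau> q powi m * restrict_to N u q"
    by (auto simp: N_def Q_def restrict_to_def)
  ultimately show "has_order C p U h m" unfolding has_order_def using rN(2) by blast
qed

lemma reg_det:
  assumes "p \<in> C" "\<And>i j. i < n \<Longrightarrow> j < n \<Longrightarrow> reg_at p (a i j)"
  shows "reg_at p (\<lambda>q. det (mat n n (\<lambda>(i, j). a i j q)))"
proof -
  have prod: "reg_at p (\<lambda>q. \<Prod>i\<in>A. f i q)" if "\<And>i. i \<in> A \<Longrightarrow> reg_at p (f i)" for A :: "nat set" and f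
    using that by (induction A rule: infinite_finite_induct) (auto intro: rg_const[OF assms(1)] rg_mult[OF assms(1)])
  have eq: "det (mat n n (\<lambda>(i, j). a i j q)) = (\<Sum>\<pi>\<in>{\<pi>. \<pi> permutes {0..<n}}. signof \<pi> * (\<Prod>i\<in>{0..<n}. a i (\<pi> i) q))" for q
  proof -
    have "(\<Prod>i = 0..<n. mat n n (\<lambda>(i, j). a i j q) $$ (i, \<pi> i)) = (\<Prod>i\<in>{0..<n}. a i (\<pi> i) q)"
      if "\<pi> permutes {0..<n}" for \<pi>
      by (rule prod.cong) (use permutes_in_image[OF that] in auto)
    then show ?thesis by (subst det_def'[of _ n]) auto
  qed
  show ?thesis unfolding eq
  proof (intro rg_sum[OF assms(1)] rg_mult[OF assms(1)] rg_const[OF assms(1)] prod)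
    fix \<pi> i assume "\<pi> \<in> {\<pi>. \<pi> permutes {0..<n}}" "i \<in> {0..<n}"
    then show "reg_at p (a i (\<pi> i))" using permutes_in_image[of \<pi> "{0..<n}" i] assms(2) by auto
  qed
qed

subsection \<open>Local frames\<close>

lemma frame_open: "local_frame sc C n E N e \<Longrightarrow> open_on C N" by (simp add: local_frame_def)

lemma frame_indep: "local_frame sc C n E N e \<Longrightarrow> q \<in> N \<Longrightarrow> vindep sc n (\<lambda>i. e i q)"
  by (simp add: local_frame_def vindep_def)

lemma frame_sections:
  "local_frame sc C n E N e \<Longrightarrow> open_on C V \<Longrightarrow> V \<subseteq> N \<Longrightarrow>
    E V = {(\<lambda>q. \<Sum>i<n. sc (f i q) (e i q)) |f. \<forall>i<n. f i \<in> regular C V}"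
  by (simp add: local_frame_def)

lemma frame_combination:
  assumes vs: "vector_space sc" and F: "local_frame sc C n E N e" and V: "open_on C V" "V \<subseteq> N"
    and f: "\<And>i q. i < n \<Longrightarrow> q \<in> V \<Longrightarrow> reg_at q (f i)"
  shows "(\<lambda>q. if q \<in> V then \<Sum>i<n. sc (f i q) (e i q) else 0) \<in> E V"
proof -
  interpret vs: vector_space sc by fact
  have "(\<lambda>q. if q \<in> V then \<Sum>i<n. sc (f i q) (e i q) else 0) = (\<lambda>q. \<Sum>i<n. sc (restrict_to V (f i) q) (e i q))"
    by (auto simp: restrict_to_def)
  moreover have "\<forall>i<n. restrict_to V (f i) \<in> regular C V" by (intro allI impI restrict_regular[OF V(1)] f)
  ultimately show ?thesis unfolding frame_sections[OF F V] mem_Collect_eq by (intro exI[of _ "\<lambda>i. restrict_to V (f i)"] conjI)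
qed

lemma frame_elem:
  assumes vs: "vector_space sc" and F: "local_frame sc C n E N e" and V: "open_on C V" "V \<subseteq> N" and i: "i < n"
  shows "(\<lambda>q. if q \<in> V then e i q else 0) \<in> E V"
proof -
  interpret vs: vector_space sc by fact
  have "(\<Sum>k<n. sc (if k = i then 1 else 0) (e k q)) = (\<Sum>k<n. if k = i then e k q else 0)" for q
    by (rule sum.cong) auto
  then have eq: "(\<Sum>k<n. sc (if k = i then 1 else 0) (e k q)) = e i q" for q using i by simp
  have com: "(\<lambda>q. if q \<in> V then \<Sum>k<n. sc (if k = i then 1 else 0) (e k q) else 0) \<in> E V"
    using V by (intro frame_combination[OF vs F V, of "\<lambda>k q. if k = i then 1 else 0"] rg_const) (auto simp: open_on_iff)
  show ?thesis using com unfolding eq .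
qed

lemma section_coords:
  assumes vs: "vector_space sc" and F: "local_frame sc C n E N e" and V: "open_on C V" "V \<subseteq> N"
    and s: "s \<in> E V" and p: "p \<in> V"
  shows "s p \<in> vspan sc n (\<lambda>j. e j p)"
    and "i < n \<Longrightarrow> reg_at p (\<lambda>q. crd sc n (\<lambda>j. e j q) (s q) i)"
proof -
  obtain f where f: "s = (\<lambda>q. \<Sum>i<n. sc (f i q) (e i q))" "\<forall>i<n. f i \<in> regular C V"
    using s unfolding frame_sections[OF F V] by blast
  show "s p \<in> vspan sc n (\<lambda>j. e j p)" by (rule vspanI[of _ sc "\<lambda>i. f i p"]) (simp add: f(1))
  assume i: "i < n"
  show "reg_at p (\<lambda>q. crd sc n (\<lambda>j. e j q) (s q) i)"
  proof (rule reg_at_cong_on[OF V(1) p])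
    show "reg_at p (f i)" using regular_reg_at[OF V(1) _ p] f(2) i by blast
    fix q assume "q \<in> V"
    then have "vindep sc n (\<lambda>j. e j q)" using frame_indep[OF F] V by blast
    from crd_eq[OF vs this _ i, of "s q" "\<lambda>i. f i q"] show "f i q = crd sc n (\<lambda>j. e j q) (s q) i" by (simp add: f(1))
  qed
qed

lemma frames_span:
  assumes vs: "vector_space sc" and F: "local_frame sc C n E N e" and F': "local_frame sc C n' E N' e'"
    and p: "p \<in> N" "p \<in> N'" and i: "i < n"
  shows "e i p \<in> vspan sc n' (\<lambda>j. e' j p)"
    and "j < n' \<Longrightarrow> reg_at p (\<lambda>q. crd sc n' (\<lambda>j. e' j q) (e i q) j)"
proof -
  let ?V = "N \<inter> N'"
  have V: "open_on C ?V" "?V \<subseteq> N" "?V \<subseteq> N'" "p \<in> ?V" using frame_open[OF F] frame_open[OF F'] open_Int p by auto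
  have s: "(\<lambda>q. if q \<in> ?V then e i q else 0) \<in> E ?V" by (rule frame_elem[OF vs F V(1,2) i])
  show "e i p \<in> vspan sc n' (\<lambda>j. e' j p)" using section_coords(1)[OF vs F' V(1,3) s V(4)] V(4) p by simp
  assume j: "j < n'"
  show "reg_at p (\<lambda>q. crd sc n' (\<lambda>j. e' j q) (e i q) j)"
    by (rule reg_at_cong_on[OF V(1,4) _ section_coords(2)[OF vs F' V(1,3) s V(4) j]]) auto
qed

text \<open>The transition matrices in the two directions are inverse to each other, so their
  determinants are units.\<close>

lemma frames_fdet:
  assumes vs: "vector_space sc" and F: "local_frame sc C n E N e" and F': "local_frame sc C n E N' e'"
    and p: "p \<in> N" "p \<in> N'"
  shows "reg_at p (\<lambda>q. fdet sc n (\<lambda>i. e i q) (\<lambda>i. e' i q))"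
    and "fdet sc n (\<lambda>i. e i p) (\<lambda>i. e' i p) \<noteq> 0"
proof -
  have pC: "p \<in> C" using open_cofinite[OF frame_open[OF F] p(1)] p(1) by blast
  show "reg_at p (\<lambda>q. fdet sc n (\<lambda>i. e i q) (\<lambda>i. e' i q))"
    unfolding fdet_def by (rule reg_det[OF pC]) (rule frames_span(2)[OF vs F F' p])
  have "fdet sc n (\<lambda>i. e i p) (\<lambda>i. e' i p) * fdet sc n (\<lambda>i. e' i p) (\<lambda>i. e i p) = fdet sc n (\<lambda>i. e i p) (\<lambda>i. e i p)"
    using fdet_mult[OF vs frame_indep[OF F p(1)], of "\<lambda>i. e i p" "\<lambda>i. e' i p"]
      frames_span(1)[OF vs F F' p] frames_span(1)[OF vs F' F p(2,1)] by simp
  also have "\<dots> = 1" by (rule fdet_self[OF vs frame_indep[OF F p(1)]])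
  finally show "fdet sc n (\<lambda>i. e i p) (\<lambda>i. e' i p) \<noteq> 0" by auto
qed

lemma rank_unique:
  assumes vs: "vector_space sc" and n: "vector_bundle sc C n E" and m: "vector_bundle sc C m E"
  shows "n = m"
proof -
  obtain p where p: "p \<in> C" using C_infinite by fastforce
  obtain N e where F: "p \<in> N" "local_frame sc C n E N e" using n p unfolding vector_bundle_def by blast
  obtain N' e' where F': "p \<in> N'" "local_frame sc C m E N' e'" using m p unfolding vector_bundle_def by blast
  show ?thesis
    using vindep_card_le[OF vs frame_indep[OF F(2,1)], of m "\<lambda>i. e' i p"] frames_span(1)[OF vs F(2) F'(2) F(1) F'(1)]
      vindep_card_le[OF vs frame_indep[OF F'(2,1)], of n "\<lambda>i. e i p"] frames_span(1)[OF vs F'(2) F(2) F'(1) F(1)] by force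
qed

lemma vb_rank_eq:
  assumes "vector_space sc" "vector_bundle sc C n E" shows "vb_rank sc C E = n"
  unfolding vb_rank_def using rank_unique[OF assms(1)] assms(2) by blast

end

context smooth_curve begin

lemma
  assumes "vector_bundle sc C n E" and U: "open_on C U"
  shows bundle_support: "s \<in> E U \<Longrightarrow> p \<notin> U \<Longrightarrow> s p = 0"
    and bundle_restrict: "s \<in> E U \<Longrightarrow> open_on C V \<Longrightarrow> V \<subseteq> U \<Longrightarrow> restrict_to V s \<in> E V"
    and bundle_glue: "(\<And>p. p \<notin> U \<Longrightarrow> f p = 0) \<Longrightarrow>
      (\<And>p. p \<in> U \<Longrightarrow> \<exists>V. open_on C V \<and> p \<in> V \<and> V \<subseteq> U \<and> restrict_to V f \<in> E V) \<Longrightarrow> f \<in> E U"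
proof -
  have 1: "\<forall>U f. open_on C U \<and> f \<in> E U \<longrightarrow> (\<forall>p. p \<notin> U \<longrightarrow> f p = 0)"
    and 2: "\<forall>U V f. open_on C U \<and> open_on C V \<and> V \<subseteq> U \<and> f \<in> E U \<longrightarrow> restrict_to V f \<in> E V"
    and 3: "\<forall>U f. open_on C U \<and> (\<forall>p. p \<notin> U \<longrightarrow> f p = 0) \<and>
        (\<forall>p\<in>U. \<exists>V. open_on C V \<and> p \<in> V \<and> V \<subseteq> U \<and> restrict_to V f \<in> E V) \<longrightarrow> f \<in> E U"
    using assms(1)[unfolded vector_bundle_def is_fun_sheaf_def]
    by - (drule conjunct1, drule conjunct1, assumption,
      drule conjunct1, drule conjunct2, drule conjunct1, assumption,
      drule conjunct1, drule conjunct2, drule conjunct2, assumption)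
  show "s \<in> E U \<Longrightarrow> p \<notin> U \<Longrightarrow> s p = 0" using 1[rule_format, of U s p] U by simp
  show "s \<in> E U \<Longrightarrow> open_on C V \<Longrightarrow> V \<subseteq> U \<Longrightarrow> restrict_to V s \<in> E V"
    using 2[rule_format, of U V s] U by simp
  assume "\<And>p. p \<notin> U \<Longrightarrow> f p = 0" "\<And>p. p \<in> U \<Longrightarrow> \<exists>V. open_on C V \<and> p \<in> V \<and> V \<subseteq> U \<and> restrict_to V f \<in> E V"
  then have "open_on C U \<and> (\<forall>p. p \<notin> U \<longrightarrow> f p = 0) \<and>
        (\<forall>p\<in>U. \<exists>V. open_on C V \<and> p \<in> V \<and> V \<subseteq> U \<and> restrict_to V f \<in> E V)" using U by simp
  from 3[rule_format, OF this] show "f \<in> E U" .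
qed

lemma rat_regular_rep:
  assumes "rat f" shows "\<exists>f'. f \<simeq> f' \<and> finite {x \<in> C. \<not> reg_at x f'}"
proof -
  obtain p where p: "p \<in> C" "rgl p f" using assms rat_def by blast
  obtain f' where "reg_at p f'" "f \<simeq> f'" using rglE p by blast
  then show ?thesis using rg_near[OF p(1)] by blast
qed

end

section \<open>The genus as a bound on systems of principal parts\<close>

locale good_curve = smooth_curve C for C :: "('n::finite, 'k::field) point set" +
  fixes g :: nat
  assumes genus: "genus C = enat g"
    and const: "\<And>f. (\<And>p. p \<in> C \<Longrightarrow> rgl p f) \<Longrightarrow> \<exists>c. f \<simeq> (\<lambda>_. c)"
begin

text \<open>A system of principal parts becomes the Cech cocycle of differences
  \<open>K i q - K i p\<close>. If a combination of these cocycles is the coboundary of \<gamma>,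
  the local functions \<open>S p - \<gamma> p\<close> agree for all p and give one rational function
  with the prescribed principal parts.\<close>

lemma genus_bound_cech:
  fixes I :: "nat set"
  assumes I: "finite I" and H: "\<And>i. i \<in> I \<Longrightarrow> pps (H i)" and ind: "pps_indep (\<lambda>_. 0) I H"
  shows "card I \<le> g"
proof -
  define K where "K i b = (if H i b = (\<lambda>_. 0) then (\<lambda>_. 0) else SOME f'. H i b \<simeq> f' \<and> finite {x \<in> C. \<not> reg_at x f'})" for i b
  have K: "H i b \<simeq> K i b" "finite {x \<in> C. \<not> reg_at x (K i b)}" if "i \<in> I" "b \<in> C" for i b
  proof -
    have "rat (H i b)" using H[OF that(1)] that(2) by (simp add: pps_def)
    from someI_ex[OF rat_regular_rep[OF this]]
    have "H i b \<simeq> K i b \<and> finite {x \<in> C. \<not> reg_at x (K i b)}"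
    proof (cases "H i b = (\<lambda>_. 0)")
      case True
      have "finite {x \<in> C. \<not> reg_at x (\<lambda>_. 0)}" using rg_near[OF that(2) rg_const[OF that(2)]] .
      then show ?thesis using True by (simp add: K_def)
    qed (simp add: K_def)
    then show "H i b \<simeq> K i b" "finite {x \<in> C. \<not> reg_at x (K i b)}" by auto
  qed
  define B where "B = {p \<in> C. \<exists>i\<in>I. H i p \<noteq> (\<lambda>_. 0)}"
  have "B = (\<Union>i\<in>I. {p \<in> C. H i p \<noteq> (\<lambda>_. 0)})" by (auto simp: B_def)
  then have finB: "finite B" using I H by (auto simp: pps_def)
  have K0: "K i p = (\<lambda>_. 0)" if "p \<in> C" "p \<notin> B" "i \<in> I" for i p using that by (auto simp: K_def B_def)
  define G where "G = {x \<in> C. x \<notin> B \<and> (\<forall>i\<in>I. \<forall>b\<in>B. reg_at x (K i b))}"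
  have finG: "finite (C - G)"
  proof (rule finite_subset)
    show "C - G \<subseteq> B \<union> (\<Union>i\<in>I. \<Union>b\<in>B. {x \<in> C. \<not> reg_at x (K i b)})" by (auto simp: G_def)
    show "finite (B \<union> (\<Union>i\<in>I. \<Union>b\<in>B. {x \<in> C. \<not> reg_at x (K i b)}))"
      using finB I K(2) by (auto simp: B_def)
  qed
  \<comment> \<open>Each member adds a single point to \<open>G\<close>, so members for different
    points meet inside \<open>G\<close>, where all \<open>K i b\<close> are regular.\<close>
  define U where "U p = insert p G" for p
  have GC: "G \<subseteq> C" by (auto simp: G_def)
  have Uopen: "open_on C (U p)" if "p \<in> C" for p
    by (rule cofinite_open) (use that GC finG in \<open>auto simp: U_def intro: finite_subset[of _ "C - G"]\<close>)
  have cover: "open_cover C U" using Uopen by (simp add: open_cover_def U_def)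
  define f where "f i p q = restrict_to (U p \<inter> U q) (\<lambda>x. K i q x - K i p x)" for i p q
  have Kreg: "reg_at x (K i p)" if "x \<in> G" "i \<in> I" "p \<in> C" for x i p
  proof (cases "p \<in> B")
    case True then show ?thesis using that by (auto simp: G_def)
  next
    case False
    then show ?thesis using K0[OF that(3) False that(2)] rg_const[of x 0] that(1) GC by auto
  qed
  have freg: "f i p q \<in> regular C (U p \<inter> U q)" if i: "i \<in> I" and p: "p \<in> C" and q: "q \<in> C" for i p q
    unfolding f_def
  proof (rule restrict_regular[OF open_Int[OF Uopen[OF p] Uopen[OF q]]])
    fix x assume x: "x \<in> U p \<inter> U q"
    then have xC: "x \<in> C" using p GC by (auto simp: U_def)
    show "reg_at x (\<lambda>x. K i q x - K i p x)"
    proof (cases "p = q")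
      case True then show ?thesis using rg_const[OF xC, of 0] by simp
    next
      case False
      have "x \<in> G \<or> x = p \<and> p \<in> G \<or> x = q \<and> q \<in> G" using x False by (auto simp: U_def)
      then have "x \<in> G" by blast
      then show ?thesis using Kreg i p q xC by (intro rg_diff) auto
    qed
  qed
  have fcoc: "cocycle C (regular C) U (f i)" if i: "i \<in> I" for i
    unfolding cocycle_def
  proof (intro conjI ballI)
    show "f i p q \<in> regular C (U p \<inter> U q)" if "p \<in> C" "q \<in> C" for p q using freg i that by blast
    show "f i p q x + f i q r x = f i p r x" if "x \<in> U p \<inter> U q \<inter> U r" for p q r x
      using that by (simp add: f_def restrict_to_def)
  qed
  have key: "\<forall>i\<in>I. c i = 0"
    if W: "open_cover C W" "\<And>p. p \<in> C \<Longrightarrow> W p \<subseteq> U p" "\<And>p. p \<in> C \<Longrightarrow> \<gamma> p \<in> regular C (W p)"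
      and eq: "\<And>p q x. p \<in> C \<Longrightarrow> q \<in> C \<Longrightarrow> x \<in> W p \<inter> W q \<Longrightarrow> (\<Sum>i\<in>I. c i * f i p q x) = \<gamma> q x - \<gamma> p x" for W \<gamma> c
  proof -
    obtain p0 where p0: "p0 \<in> C" using X_ex by blast
    define S where "S p x = (\<Sum>i\<in>I. c i * K i p x)" for p x
    have Wo: "open_on C (W p)" "p \<in> W p" if "p \<in> C" for p using W(1) that by (auto simp: open_cover_def)
    have \<gamma>r: "reg_at p (\<gamma> p)" if "p \<in> C" for p using regular_reg_at Wo[OF that] W(3)[OF that] by blast
    define \<phi> where "\<phi> x = S p0 x - \<gamma> p0 x" for x
    have ratS: "rat (S p)" if "p \<in> C" for p
    proof -
      have "rat (K i p)" if "i \<in> I" for i using K(1)[OF that \<open>p \<in> C\<close>] H[OF that] \<open>p \<in> C\<close> rat_cong by (auto simp: pps_def)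
      then show ?thesis unfolding S_def[abs_def] by (intro rat_sum rat_cmult)
    qed
    have rat\<phi>: "rat \<phi>" unfolding \<phi>_def[abs_def] using ratS[OF p0] rat_rgl[OF p0 rgl_rg[OF \<gamma>r[OF p0]]] by (rule rat_diff)
    have "realizable (\<lambda>_. 0) (\<lambda>p q. \<Sum>i\<in>I. c i * H i p q) \<phi>"
      unfolding realizable_def
    proof (intro conjI ballI rat\<phi>)
      fix p assume p: "p \<in> C"
      have "eventually (\<lambda>q. \<forall>i\<in>I. H i p q = K i p q) gen"
        using K(1) p I by (intro eventually_ball_finite) (auto simp: aeq_def)
      then have "\<gamma> p \<simeq> (\<lambda>q. ((\<Sum>i\<in>I. c i * H i p q) - \<phi> q) * unif p q ^ 0)"
        using open_gen[OF Wo[OF p]] open_gen[OF Wo[OF p0]] unfolding aeq_def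
      proof eventually_elim
        case (elim x)
        have x: "x \<in> W p0 \<inter> W p" "x \<in> U p0 \<inter> U p" using elim W(2) p p0 by auto
        have "(\<Sum>i\<in>I. c i * f i p0 p x) = S p x - S p0 x"
          using x(2) by (simp add: f_def restrict_to_def S_def right_diff_distrib sum_subtractf)
        then have "S p x - S p0 x = \<gamma> p x - \<gamma> p0 x" using eq[OF p0 p x(1)] by simp
        moreover have "(\<Sum>i\<in>I. c i * H i p x) = S p x" unfolding S_def using elim(1) by (intro sum.cong) auto
        ultimately show ?case by (simp add: \<phi>_def algebra_simps)
      qed
      then show "rgl p (\<lambda>q. ((\<Sum>i\<in>I. c i * H i p q) - \<phi> q) * unif p q ^ 0)"
        using rgl_cong[OF rgl_rg[OF \<gamma>r[OF p]]] by blast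
    qed
    then show ?thesis by (rule pps_indepD[OF ind])
  qed
  \<comment> \<open>\<open>h1\<close> counts sets of cocycles, so different systems must give
    different cocycles; two equal ones would satisfy the relation with coefficients 1 and
    -1.\<close>
  have injf: "inj_on f I"
  proof (rule inj_onI, rule ccontr)
    fix i j assume ij: "i \<in> I" "j \<in> I" "f i = f j" "i \<noteq> j"
    define c where "c k = (if k = i then 1 else if k = j then - 1 else 0 :: 'k)" for k
    have "(\<Sum>k\<in>I. c k * f k p q x) = 0" for p q x
    proof -
      have "(\<Sum>k\<in>I. c k * f k p q x) = (\<Sum>k\<in>{i, j}. c k * f k p q x)"
        by (rule sum.mono_neutral_right) (use ij I in \<open>auto simp: c_def\<close>)
      then show ?thesis using ij by (simp add: c_def)
    qed
    moreover have "(\<lambda>_. 0) \<in> regular C (U p)" if "p \<in> C" for p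
      using rg_const[of _ 0] Uopen[OF that] by (auto simp: regular_iff open_on_iff)
    ultimately have "\<forall>k\<in>I. c k = 0" by (intro key[of U "\<lambda>_ _. 0"]) (auto intro: cover)
    then show False using ij by (auto simp: c_def)
  qed
  let ?T = "f ` I"
  have "enat (card ?T) \<le> h1 C (regular C)"
    unfolding h1_def
  proof (intro Sup_upper CollectI exI[of _ U] exI[of _ ?T] conjI allI impI refl)
    show "open_cover C U" by (rule cover)
    show "finite ?T" using I by simp
    show "\<forall>f\<in>?T. cocycle C (regular C) U f" using fcoc by blast
    fix c assume "zero_class C (regular C) U (\<lambda>p q x. \<Sum>f\<in>?T. c f * f p q x)"
    then obtain W \<gamma> where W: "open_cover C W" "\<forall>p\<in>C. W p \<subseteq> U p \<and> \<gamma> p \<in> regular C (W p)"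
      "\<forall>p\<in>C. \<forall>q\<in>C. \<forall>x\<in>W p \<inter> W q. (\<Sum>f\<in>?T. c f * f p q x) = \<gamma> q x - \<gamma> p x" unfolding zero_class_def by blast
    have "\<forall>i\<in>I. c (f i) = 0"
    proof (rule key[OF W(1)])
      show "W p \<subseteq> U p" "\<gamma> p \<in> regular C (W p)" if "p \<in> C" for p using W(2) that by auto
      show "(\<Sum>i\<in>I. c (f i) * f i p q x) = \<gamma> q x - \<gamma> p x" if "p \<in> C" "q \<in> C" "x \<in> W p \<inter> W q" for p q x
        using W(3) that sum.reindex[OF injf, of "\<lambda>f. c f * f p q x"] by simp
    qed
    then show "\<forall>f\<in>?T. c f = 0" by blast
  qed
  then show ?thesis using genus card_image[OF injf] unfolding genus_def by simp
qed

sublocale curve_germs C reg_at g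
  by unfold_locales (fact const, fact genus_bound_cech)

subsection \<open>The degree of a vector bundle\<close>

text \<open>The frame at p0 is a rational section of the determinant with order \<open>D p\<close>
  at p. For any other choice of sections the orders differ from D by those of one rational function
  h, and a principal divisor has degree 0; so the definite description has exactly one
  solution.\<close>

lemma degree_formula:
  assumes vs: "vector_space sc" and E: "vector_bundle sc C n E"
    and F: "\<And>p. p \<in> C \<Longrightarrow> p \<in> N p \<and> local_frame sc C n E (N p) (e p)" and p0: "p0 \<in> C"
  defines "D \<equiv> \<lambda>p. ordr p (\<lambda>q. fdet sc n (\<lambda>i. e p0 i q) (\<lambda>i. e p i q))"
  shows "finite {p \<in> C. D p \<noteq> 0}" and "vb_degree sc C E = (\<Sum>p\<in>{p \<in> C. D p \<noteq> 0}. D p)"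
proof -
  have pN: "p \<in> N p" and F': "local_frame sc C n E (N p) (e p)" if "p \<in> C" for p using F[OF that] by auto
  note No = frame_open[OF F']
  define T where "T p q = fdet sc n (\<lambda>i. e p0 i q) (\<lambda>i. e p i q)" for p q
  have DT: "D p = ordr p (T p)" for p by (simp add: D_def T_def[abs_def])
  have nzT: "nz (T p)" if p: "p \<in> C" for p
  proof -
    have ev: "eventually (\<lambda>q. q \<in> C \<and> q \<in> N p0 \<and> q \<in> N p) gen"
      using open_gen[OF No[OF p0] pN[OF p0]] open_gen[OF No[OF p] pN[OF p]] gen_X by eventually_elim simp
    then obtain q where q: "q \<in> C" "q \<in> N p0" "q \<in> N p" using gen_nonbot eventually_happens by blast
    have "reg_at q (T p)" unfolding T_def[abs_def] by (rule frames_fdet(1)[OF vs F'[OF p0] F'[OF p] q(2,3)])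
    moreover have "eventually (\<lambda>q. T p q \<noteq> 0) gen" using ev
      by eventually_elim (use frames_fdet(2)[OF vs F'[OF p0] F'[OF p]] in \<open>simp add: T_def\<close>)
    ultimately show ?thesis using q(1) rat_rgl rgl_rg by (auto simp: nz_def)
  qed
  have D0: "D p = 0" if p: "p \<in> C" "p \<in> N p0" for p
  proof -
    have r: "reg_at p (T p)" "T p p \<noteq> 0"
      unfolding T_def[abs_def] using frames_fdet[OF vs F'[OF p0] F'[OF p(1)] p(2) pN[OF p(1)]] by auto
    then have "unit p (T p)" using rgl_rg val_rg[OF p(1)] by (simp add: unit_def)
    then show ?thesis using unit_iff_ordr[OF p(1) nzT[OF p(1)]] DT by simp
  qed
  have "{p \<in> C. D p \<noteq> 0} \<subseteq> C - N p0" using D0 by blast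
  then show finD: "finite {p \<in> C. D p \<noteq> 0}" using open_cofinite[OF No[OF p0] pN[OF p0]] finite_subset by blast
  have rk: "vb_rank sc C E = n" by (rule vb_rank_eq[OF vs E])
  define P where "P U \<sigma> m \<longleftrightarrow> open_on C U \<and> U \<noteq> {} \<and> (\<forall>i<n. \<sigma> i \<in> E U) \<and>
        (\<forall>p\<in>C. has_wedge_order sc C n E p U \<sigma> (m p)) \<and> finite {p \<in> C. m p \<noteq> 0}" for U \<sigma> m
  define \<sigma>0 where "\<sigma>0 i q = (if q \<in> N p0 then e p0 i q else 0)" for i q
  have ex: "P (N p0) \<sigma>0 D"
    unfolding P_def
  proof (intro conjI allI impI ballI finD)
    show "open_on C (N p0)" "N p0 \<noteq> {}" using No[OF p0] pN[OF p0] by auto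
    show "\<sigma>0 i \<in> E (N p0)" if "i < n" for i
      using frame_elem[OF vs F'[OF p0] No[OF p0] order_refl that] by (simp add: \<sigma>0_def[abs_def])
    fix p assume p: "p \<in> C"
    define a where "a i j q = crd sc n (\<lambda>k. e p k q) (\<sigma>0 i q) j" for i j q
    have Vo: "open_on C (N p0 \<inter> N p)" by (rule open_Int[OF No[OF p0] No[OF p]])
    have ev: "eventually (\<lambda>q. q \<in> N p0 \<and> q \<in> N p) gen"
      using open_gen[OF No[OF p0] pN[OF p0]] open_gen[OF No[OF p] pN[OF p]] by eventually_elim simp
    have ne: "N p0 \<inter> N p \<noteq> {}" using eventually_happens[OF ev] gen_nonbot by blast
    have "T p \<simeq> (\<lambda>q. det (mat n n (\<lambda>(i, j). a i j q)))"
      unfolding aeq_def using ev by eventually_elim (simp add: T_def fdet_def a_def \<sigma>0_def)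
    then have "has_ord p (\<lambda>q. det (mat n n (\<lambda>(i, j). a i j q))) (D p)"
      using has_ord_cong[OF nz_has_ord[OF p nzT[OF p]]] DT by simp
    then have "has_order C p (N p0 \<inter> N p) (\<lambda>q. det (mat n n (\<lambda>(i, j). a i j q))) (D p)"
      using has_order_iff[OF p Vo ne] by simp
    moreover have "\<forall>q\<in>N p0 \<inter> N p. \<forall>i<n. \<sigma>0 i q = (\<Sum>j<n. sc (a i j q) (e p j q))"
      using crd_sum[OF frames_span(1)[OF vs F'[OF p0] F'[OF p]]] by (simp add: a_def \<sigma>0_def)
    ultimately show "has_wedge_order sc C n E p (N p0) \<sigma>0 (D p)"
      unfolding has_wedge_order_def using pN[OF p] F'[OF p]
      by (intro exI[of _ "N p"] exI[of _ "e p"] exI[of _ a] conjI)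
  qed
  have uniq: "(\<Sum>p\<in>{p \<in> C. m p \<noteq> 0}. m p) = (\<Sum>p\<in>{p \<in> C. D p \<noteq> 0}. D p)" if Pm: "P U \<sigma> m" for U \<sigma> m
  proof -
    have U: "open_on C U" "U \<noteq> {}" and \<sigma>: "\<forall>i<n. \<sigma> i \<in> E U"
      and w: "\<forall>p\<in>C. has_wedge_order sc C n E p U \<sigma> (m p)" and finm: "finite {p \<in> C. m p \<noteq> 0}"
      using Pm by (auto simp: P_def)
    obtain x where x: "x \<in> U" using U by blast
    define h where "h q = fdet sc n (\<lambda>i. \<sigma> i q) (\<lambda>i. e p0 i q)" for q
    have span0: "\<sigma> i q \<in> vspan sc n (\<lambda>j. e p0 j q)" if i: "i < n" and q: "q \<in> U \<inter> N p0" for i q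
    proof -
      have V: "open_on C (U \<inter> N p0)" by (rule open_Int[OF U(1) No[OF p0]])
      have s: "restrict_to (U \<inter> N p0) (\<sigma> i) \<in> E (U \<inter> N p0)" by (rule bundle_restrict[OF E U(1) _ V]) (use \<sigma> i in auto)
      show ?thesis using section_coords(1)[OF vs F'[OF p0] V _ s q] q by (simp add: restrict_to_def)
    qed
    have ho: "has_ord p h (m p - D p)" if p: "p \<in> C" for p
    proof -
      from bspec[OF w p] obtain N' e' a where W: "p \<in> N' \<and> local_frame sc C n E N' e' \<and>
        (\<forall>q\<in>U \<inter> N'. \<forall>i<n. \<sigma> i q = (\<Sum>j<n. sc (a i j q) (e' j q))) \<and>
        has_order C p (U \<inter> N') (\<lambda>q. det (mat n n (\<lambda>(i, j). a i j q))) (m p)"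
        unfolding has_wedge_order_def by (elim exE)
      have N': "p \<in> N'" "local_frame sc C n E N' e'"
        and a: "\<forall>q\<in>U \<inter> N'. \<forall>i<n. \<sigma> i q = (\<Sum>j<n. sc (a i j q) (e' j q))"
        and ord: "has_order C p (U \<inter> N') (\<lambda>q. det (mat n n (\<lambda>(i, j). a i j q))) (m p)"
        using W[THEN conjunct1] W[THEN conjunct2, THEN conjunct1]
          W[THEN conjunct2, THEN conjunct2, THEN conjunct1] W[THEN conjunct2, THEN conjunct2, THEN conjunct2] .
      have N'o: "open_on C N'" by (rule frame_open[OF N'(2)])
      have evN': "eventually (\<lambda>q. q \<in> U \<and> q \<in> N') gen"
        using open_gen[OF U(1) x] open_gen[OF N'o N'(1)] by eventually_elim simp
      have ne: "U \<inter> N' \<noteq> {}" using eventually_happens[OF evN'] gen_nonbot by blast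
      have da: "has_ord p (\<lambda>q. det (mat n n (\<lambda>(i, j). a i j q))) (m p)"
        using ord has_order_iff[OF p open_Int[OF U(1) N'o] ne] by simp
      define R where "R q = fdet sc n (\<lambda>i. e' i q) (\<lambda>i. e p i q)" for q
      have r: "reg_at p R" "R p \<noteq> 0"
        unfolding R_def[abs_def] using frames_fdet[OF vs N'(2) F'[OF p] N'(1) pN[OF p]] by auto
      then have "unit p R" using rgl_rg val_rg[OF p] by (simp add: unit_def)
      then have "has_ord p R 0" using has_ord_0[OF p] by simp
      from has_ord_mult[OF p has_ord_mult[OF p da this] has_ord_inverse[OF p nz_has_ord[OF p nzT[OF p]]]]
      have "has_ord p (\<lambda>q. det (mat n n (\<lambda>(i, j). a i j q)) * R q * inverse (T p q)) (m p - D p)" by (simp add: DT)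
      moreover have "(\<lambda>q. det (mat n n (\<lambda>(i, j). a i j q)) * R q * inverse (T p q)) \<simeq> h"
        unfolding aeq_def using evN' open_gen[OF No[OF p0] pN[OF p0]] open_gen[OF No[OF p] pN[OF p]]
      proof eventually_elim
        case (elim q)
        have spane': "\<sigma> i q \<in> vspan sc n (\<lambda>j. e' j q)" if "i < n" for i
          by (rule vspanI[where c = "\<lambda>j. a i j q"]) (use a elim that in blast)
        have ie': "vindep sc n (\<lambda>i. e' i q)" using frame_indep[OF N'(2)] elim by blast
        have ie: "vindep sc n (\<lambda>i. e p i q)" using frame_indep[OF F'[OF p]] elim by blast
        have "crd sc n (\<lambda>j. e' j q) (\<sigma> i q) j = a i j q" if "i < n" "j < n" for i j
          by (rule crd_eq[OF vs ie' _ that(2)]) (use a elim that in blast)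
        then have "fdet sc n (\<lambda>i. \<sigma> i q) (\<lambda>i. e' i q) = det (mat n n (\<lambda>(i, j). a i j q))"
          unfolding fdet_def by (intro arg_cong[where f = det] eq_matI) auto
        moreover have "fdet sc n (\<lambda>i. \<sigma> i q) (\<lambda>i. e p i q) = fdet sc n (\<lambda>i. \<sigma> i q) (\<lambda>i. e' i q) * R q"
          unfolding R_def by (rule fdet_mult[OF vs ie spane' frames_span(1)[OF vs N'(2) F'[OF p]]]) (use elim in auto)
        moreover have "fdet sc n (\<lambda>i. \<sigma> i q) (\<lambda>i. e p i q) = h q * T p q"
          unfolding h_def T_def by (rule fdet_mult[OF vs ie span0 frames_span(1)[OF vs F'[OF p0] F'[OF p]]]) (use elim in auto)
        moreover have "T p q \<noteq> 0" unfolding T_def by (rule frames_fdet(2)[OF vs F'[OF p0] F'[OF p]]) (use elim in auto)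
        ultimately show ?case by (simp add: field_simps)
      qed
      ultimately show ?thesis by (rule has_ord_cong)
    qed
    have nzh: "nz h" using has_ord_nz[OF p0 ho[OF p0]] .
    have oh: "ordr p h = m p - D p" if "p \<in> C" for p using ordr_eq[OF that ho[OF that]] .
    let ?S = "{p \<in> C. m p \<noteq> 0} \<union> {p \<in> C. D p \<noteq> 0}"
    have finS: "finite ?S" using finm finD by simp
    have "0 = (\<Sum>p\<in>{p \<in> C. ordr p h \<noteq> 0}. ordr p h)" using degree_principal[OF nzh] by simp
    also have "\<dots> = (\<Sum>p\<in>?S. ordr p h)"
      by (rule sum.mono_neutral_left) (use finS oh in auto)
    also have "\<dots> = (\<Sum>p\<in>?S. m p - D p)" by (rule sum.cong) (use oh in auto)
    also have "\<dots> = (\<Sum>p\<in>?S. m p) - (\<Sum>p\<in>?S. D p)" by (rule sum_subtractf)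
    also have "(\<Sum>p\<in>?S. m p) = (\<Sum>p\<in>{p \<in> C. m p \<noteq> 0}. m p)"
      by (rule sum.mono_neutral_right) (use finS in auto)
    also have "(\<Sum>p\<in>?S. D p) = (\<Sum>p\<in>{p \<in> C. D p \<noteq> 0}. D p)"
      by (rule sum.mono_neutral_right) (use finS in auto)
    finally show ?thesis by simp
  qed
  show "vb_degree sc C E = (\<Sum>p\<in>{p \<in> C. D p \<noteq> 0}. D p)"
    unfolding vb_degree_def rk
  proof (rule the_equality)
    show "\<exists>U \<sigma> m. open_on C U \<and> U \<noteq> {} \<and> (\<forall>i<n. \<sigma> i \<in> E U) \<and>
        (\<forall>p\<in>C. has_wedge_order sc C n E p U \<sigma> (m p)) \<and> finite {p \<in> C. m p \<noteq> 0} \<and>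
        (\<Sum>p\<in>{p \<in> C. D p \<noteq> 0}. D p) = (\<Sum>p\<in>{p \<in> C. m p \<noteq> 0}. m p)"
      using ex unfolding P_def by (intro exI[of _ "N p0"] exI[of _ \<sigma>0] exI[of _ D]) simp
  next
    fix d assume "\<exists>U \<sigma> m. open_on C U \<and> U \<noteq> {} \<and> (\<forall>i<n. \<sigma> i \<in> E U) \<and>
        (\<forall>p\<in>C. has_wedge_order sc C n E p U \<sigma> (m p)) \<and> finite {p \<in> C. m p \<noteq> 0} \<and>
        d = (\<Sum>p\<in>{p \<in> C. m p \<noteq> 0}. m p)"
    then obtain U \<sigma> m where "P U \<sigma> m" "d = (\<Sum>p\<in>{p \<in> C. m p \<noteq> 0}. m p)" unfolding P_def by blast
    then show "d = (\<Sum>p\<in>{p \<in> C. D p \<noteq> 0}. D p)" using uniq by simp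
  qed
qed

end

subsection \<open>Line bundles and their sections\<close>

lemma vector_space_mult: "vector_space ((*) :: 'k::field \<Rightarrow> 'k \<Rightarrow> 'k)"
  by unfold_locales (auto simp: algebra_simps)

lemma pw_vs: "vector_space (pointwise_scale :: 'k::field \<Rightarrow> ('a \<Rightarrow> 'k) \<Rightarrow> 'a \<Rightarrow> 'k)"
  by unfold_locales

lemma span_finite_vspan:
  assumes "bij_betw b {..<n} B" "v \<in> pw.span B"
  shows "v \<in> vspan pointwise_scale n b"
proof -
  have "finite B" using assms(1) bij_betw_finite by blast
  then obtain u where "v = (\<Sum>w\<in>B. pointwise_scale (u w) w)"
    using assms(2) by (auto simp: pw.span_finite)
  then have "v = (\<Sum>i<n. pointwise_scale (u (b i)) (b i))"
    using sum.reindex_bij_betw[OF assms(1), of "\<lambda>w. pointwise_scale (u w) w"] by simp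
  then show ?thesis by (rule vspanI)
qed

lemma finite_bij_nat: assumes "finite B" shows "\<exists>b. bij_betw b {..<card B} B"
  using ex_bij_betw_nat_finite[OF assms] by (simp add: lessThan_atLeast0)

lemma independent_lessThan:
  assumes b: "bij_betw b {..<n} B" and ind: "pw.independent B"
  shows "vindep pointwise_scale n b"
  unfolding vindep_def
proof (intro allI impI)
  fix c i assume s: "(\<Sum>i<n. pointwise_scale (c i) (b i)) = 0" and i: "i < n"
  have fin: "finite B" using b bij_betw_finite by blast
  define u where "u w = c (the_inv_into {..<n} b w)" for w
  have ub: "u (b i) = c i" if "i < n" for i
    using the_inv_into_f_f[OF bij_betw_imp_inj_on[OF b]] that by (simp add: u_def)
  have "(\<Sum>w\<in>B. pointwise_scale (u w) w) = (\<Sum>i<n. pointwise_scale (u (b i)) (b i))"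
    by (rule sum.reindex_bij_betw[OF b, symmetric])
  also have "\<dots> = (\<Sum>i<n. pointwise_scale (c i) (b i))" by (rule sum.cong) (auto simp: ub)
  also note s
  finally have "u (b i) = 0"
    using ind[unfolded pw.independent_explicit_module, rule_format, of B u "b i"] fin i bij_betwE[OF b] by auto
  then show "c i = 0" using ub i by simp
qed

locale line_data = smooth_curve C for C :: "('n::finite, 'k::field) point set" +
  fixes L :: "('n, 'k, 'k) fun_sheaf" and N :: "('n, 'k) point \<Rightarrow> ('n, 'k) point set"
    and e :: "('n, 'k) point \<Rightarrow> nat \<Rightarrow> ('n, 'k) point \<Rightarrow> 'k"
  assumes L: "line_bundle C L"
    and F: "\<And>p. p \<in> C \<Longrightarrow> p \<in> N p \<and> local_frame (*) C 1 L (N p) (e p)"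
begin

text \<open>The local generator of L at p. Its single values depend on the identification of the
  fibres with \<open>'k\<close>; only quotients such as \<open>\<l> p / \<l> p'\<close> are regular
  functions.\<close>

definition \<l> :: "('n, 'k) point \<Rightarrow> ('n, 'k) point \<Rightarrow> 'k" where "\<l> p q = e p 0 q"

lemma VB: "vector_bundle (*) C 1 L" using L by (simp add: line_bundle_def)

lemma pN: "p \<in> C \<Longrightarrow> p \<in> N p" and Fr: "p \<in> C \<Longrightarrow> local_frame (*) C 1 L (N p) (e p)"
  using F by auto

lemma No: "p \<in> C \<Longrightarrow> open_on C (N p)" using frame_open[OF Fr] .

lemma l_nonzero: assumes "p \<in> C" "q \<in> N p" shows "\<l> p q \<noteq> 0"
proof
  assume "\<l> p q = 0"
  then have "(\<Sum>i<1. 1 * e p i q) = 0" by (simp add: \<l>_def)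
  from vindepD[OF frame_indep[OF Fr[OF assms(1)] assms(2)] this] show False by simp
qed

lemma l_gen: assumes "p \<in> C" shows "eventually (\<lambda>q. \<l> p q \<noteq> 0) gen"
  using open_gen[OF No[OF assms] pN[OF assms]] by eventually_elim (rule l_nonzero[OF assms])

lemma crd_l: assumes "p \<in> C" "q \<in> N p" shows "crd (*) 1 (\<lambda>j. e p j q) v 0 = v / \<l> p q"
  by (rule crd_eq[OF vector_space_mult frame_indep[OF Fr[OF assms(1)] assms(2)]])
    (use l_nonzero[OF assms] in \<open>auto simp: \<l>_def\<close>)

lemma l_quotient: assumes "p \<in> C" "p' \<in> C" "q \<in> N p" "q \<in> N p'" shows "reg_at q (\<lambda>x. \<l> p x / \<l> p' x)"
proof (rule reg_at_cong_on[OF open_Int[OF No[OF assms(1)] No[OF assms(2)]]])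
  show "q \<in> N p \<inter> N p'" using assms by simp
  show "reg_at q (\<lambda>q. crd (*) 1 (\<lambda>j. e p' j q) (e p 0 q) 0)"
    by (rule frames_span(2)[OF vector_space_mult Fr[OF assms(1)] Fr[OF assms(2)] assms(3,4)]) auto
  show "crd (*) 1 (\<lambda>j. e p' j x) (e p 0 x) 0 = \<l> p x / \<l> p' x" if "x \<in> N p \<inter> N p'" for x
    using crd_l[OF assms(2), of x "e p 0 x"] that by (simp add: \<l>_def)
qed

text \<open>Testing at p against the generator chosen for p is enough: the quotient is then regular
  at the neighbouring points too and is the coordinate in the frame at p, and the sheaf property
  glues.\<close>

lemma section_iff:
  assumes U: "open_on C U"
  shows "s \<in> L U \<longleftrightarrow> (\<forall>q. q \<notin> U \<longrightarrow> s q = 0) \<and> (\<forall>p\<in>U. reg_at p (\<lambda>q. s q / \<l> p q))"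
proof
  assume s: "s \<in> L U"
  have "reg_at p (\<lambda>q. s q / \<l> p q)" if p: "p \<in> U" for p
  proof -
    have pC: "p \<in> C" using open_cofinite[OF U p] p by blast
    let ?V = "U \<inter> N p"
    have V: "open_on C ?V" "?V \<subseteq> N p" "p \<in> ?V" using open_Int[OF U No[OF pC]] pN[OF pC] p by auto
    have r: "restrict_to ?V s \<in> L ?V" by (rule bundle_restrict[OF VB U s V(1)]) simp
    show ?thesis
    proof (rule reg_at_cong_on[OF V(1,3)])
      show "reg_at p (\<lambda>q. crd (*) 1 (\<lambda>j. e p j q) (restrict_to ?V s q) 0)"
        by (rule section_coords(2)[OF vector_space_mult Fr[OF pC] V(1,2) r V(3)]) simp
      show "crd (*) 1 (\<lambda>j. e p j q) (restrict_to ?V s q) 0 = s q / \<l> p q" if "q \<in> ?V" for q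
        using crd_l[OF pC, of q] that by (simp add: restrict_to_def)
    qed
  qed
  then show "(\<forall>q. q \<notin> U \<longrightarrow> s q = 0) \<and> (\<forall>p\<in>U. reg_at p (\<lambda>q. s q / \<l> p q))"
    using bundle_support[OF VB U s] by blast
next
  assume s: "(\<forall>q. q \<notin> U \<longrightarrow> s q = 0) \<and> (\<forall>p\<in>U. reg_at p (\<lambda>q. s q / \<l> p q))"
  have "\<exists>V. open_on C V \<and> p \<in> V \<and> V \<subseteq> U \<and> restrict_to V s \<in> L V" if p: "p \<in> U" for p
  proof -
    have pC: "p \<in> C" using open_cofinite[OF U p] p by blast
    define V where "V = insert p {q \<in> C. q \<in> U \<and> q \<in> N p \<and> reg_at q (\<lambda>q. s q / \<l> p q)}"
    have rp: "reg_at p (\<lambda>q. s q / \<l> p q)" using s p by blast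
    have V: "open_on C V" unfolding V_def
      by (rule gen_open[OF pC]) (use open_gen[OF U p] open_gen[OF No[OF pC] pN[OF pC]] rg_gen[OF pC rp] in \<open>eventually_elim, simp\<close>)
    have VN: "V \<subseteq> N p" "V \<subseteq> U" using pN[OF pC] p by (auto simp: V_def)
    have "(\<lambda>q. if q \<in> V then \<Sum>i<1. (s q / \<l> p q) * e p i q else 0) \<in> L V"
      by (rule frame_combination[OF vector_space_mult Fr[OF pC] V VN(1), of "\<lambda>i q. s q / \<l> p q"]) (use rp in \<open>auto simp: V_def\<close>)
    moreover have "(\<lambda>q. if q \<in> V then \<Sum>i<1. (s q / \<l> p q) * e p i q else 0) = restrict_to V s"
      using l_nonzero[OF pC] VN by (auto simp: restrict_to_def \<l>_def fun_eq_iff)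
    ultimately show ?thesis using V VN(2) by (intro exI[of _ V]) (simp add: V_def)
  qed
  with s show "s \<in> L U" by (intro bundle_glue[OF VB U]) blast+
qed

lemma section_zero:
  assumes U: "open_on C U" and s: "s \<in> L U" "s \<simeq> (\<lambda>_. 0)" shows "s q = 0"
proof (cases "q \<in> U")
  case False then show ?thesis using bundle_support[OF VB U s(1)] by blast
next
  case True
  then have qC: "q \<in> C" using open_cofinite[OF U] by blast
  have "(\<lambda>x. s x / \<l> q x) \<simeq> (\<lambda>_. 0)" using s(2) unfolding aeq_def by eventually_elim simp
  then have "s q / \<l> q q = 0"
    using rg_unique[OF qC _ rg_const[OF qC, of 0]] section_iff[OF U] s(1) True by blast
  then show ?thesis using l_nonzero[OF qC pN[OF qC]] by simp
qed

lemma C_open: "open_on C C" by (rule cofinite_open) auto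

lemma global_subspace: "pw.subspace (L C)"
  unfolding pw.subspace_def
proof (intro conjI ballI allI)
  show "0 \<in> L C" unfolding section_iff[OF C_open] by (auto intro: rg_const)
next
  fix x y assume xy: "x \<in> L C" "y \<in> L C"
  then have "reg_at p (\<lambda>q. x q / \<l> p q + y q / \<l> p q)" if "p \<in> C" for p
    using section_iff[OF C_open] that by (intro rg_add) auto
  then show "x + y \<in> L C" using xy unfolding section_iff[OF C_open] by (simp add: add_divide_distrib)
next
  fix c x assume x: "x \<in> L C"
  then have "reg_at p (\<lambda>q. c * (x q / \<l> p q))" if "p \<in> C" for p
    using section_iff[OF C_open] that by (intro rg_mult rg_const) auto
  then show "pointwise_scale c x \<in> L C" using x unfolding section_iff[OF C_open] by (simp add: pointwise_scale_def)
qed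

text \<open>At q the section takes the value that \<open>val\<close> prescribes for the quotient by
  the generator at q; this repairs the finitely many wrong values of \<phi>.\<close>

lemma section_extend:
  assumes \<phi>: "\<And>p. p \<in> C \<Longrightarrow> rgl p (\<lambda>q. \<phi> q / \<l> p q)"
  shows "\<exists>s\<in>L C. s \<simeq> \<phi>"
proof -
  define s where "s q = (if q \<in> C then \<l> q q * val q (\<lambda>x. \<phi> x / \<l> q x) else 0)" for q
  have loc: "\<exists>g. reg_at p g \<and> (\<lambda>q. \<phi> q / \<l> p q) \<simeq> g \<and> reg_at p (\<lambda>q. s q / \<l> p q) \<and> (\<lambda>q. s q / \<l> p q) \<simeq> g" if p: "p \<in> C" for p
  proof -
    obtain g where g: "reg_at p g" "(\<lambda>q. \<phi> q / \<l> p q) \<simeq> g" using rglE[OF p \<phi>[OF p]] by blast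
    define V where "V = insert p {q \<in> C. q \<in> N p \<and> reg_at q g}"
    have V: "open_on C V" unfolding V_def
      by (rule gen_open[OF p]) (use open_gen[OF No[OF p] pN[OF p]] rg_gen[OF p g(1)] in \<open>eventually_elim, simp\<close>)
    have sg: "g q = s q / \<l> p q" if q: "q \<in> V" for q
    proof -
      have qq: "q \<in> C" "q \<in> N p" "reg_at q g" using q p g(1) pN[OF p] by (auto simp: V_def)
      have "reg_at q (\<lambda>x. g x * (\<l> p x / \<l> q x))"
        using qq pN[OF qq(1)] by (intro rg_mult l_quotient p) auto
      moreover have "(\<lambda>x. \<phi> x / \<l> q x) \<simeq> (\<lambda>x. g x * (\<l> p x / \<l> q x))"
        using g(2) l_gen[OF p] unfolding aeq_def
      proof eventually_elim
        case (elim x)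
        then show ?case by (simp add: elim(1)[symmetric])
      qed
      ultimately have "val q (\<lambda>x. \<phi> x / \<l> q x) = g q * (\<l> p q / \<l> q q)" by (rule val_eq[OF qq(1)])
      then have "s q = g q * \<l> p q" using qq(1) l_nonzero[OF qq(1) pN[OF qq(1)]] by (simp add: s_def)
      then show ?thesis using l_nonzero[OF p qq(2)] by simp
    qed
    have pV: "p \<in> V" by (simp add: V_def)
    have "reg_at p (\<lambda>q. s q / \<l> p q)" by (rule reg_at_cong_on[OF V pV sg g(1)])
    moreover have "(\<lambda>q. s q / \<l> p q) \<simeq> g" unfolding aeq_def
      using open_gen[OF V pV] by eventually_elim (simp add: sg)
    ultimately show ?thesis using g by blast
  qed
  have "s \<in> L C" unfolding section_iff[OF C_open] using loc by (auto simp: s_def)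
  moreover have "s \<simeq> \<phi>"
  proof -
    obtain p where p: "p \<in> C" using X_ex by blast
    obtain g where g: "(\<lambda>q. \<phi> q / \<l> p q) \<simeq> g" "(\<lambda>q. s q / \<l> p q) \<simeq> g" using loc[OF p] by blast
    show ?thesis using g l_gen[OF p] unfolding aeq_def
    proof eventually_elim
      case (elim q)
      then have "s q / \<l> p q = \<phi> q / \<l> p q" by simp
      then show ?case using elim(3) by simp
    qed
  qed
  ultimately show ?thesis by blast
qed

lemma section_reg: "s \<in> L C \<Longrightarrow> p \<in> C \<Longrightarrow> reg_at p (\<lambda>q. s q / \<l> p q)"
  using section_iff[OF C_open] by blast

lemma section_nz: assumes s: "s \<in> L C" "s \<noteq> 0" and p: "p \<in> C" shows "nz (\<lambda>q. s q / \<l> p q)"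
proof -
  have r: "rat (\<lambda>q. s q / \<l> p q)" using rat_rgl[OF p rgl_rg[OF section_reg[OF s(1) p]]] .
  have "\<not> (\<lambda>q. s q / \<l> p q) \<simeq> (\<lambda>_. 0)"
  proof
    assume "(\<lambda>q. s q / \<l> p q) \<simeq> (\<lambda>_. 0)"
    then have "s \<simeq> (\<lambda>_. 0)" using l_gen[OF p] unfolding aeq_def by eventually_elim simp
    then have "s = 0" using section_zero[OF C_open s(1)] by (auto simp: fun_eq_iff)
    then show False using s(2) by simp
  qed
  then show ?thesis using rat_zero_or_nz[OF r] by blast
qed

lemma section_gen: assumes s: "s \<in> L C" "s \<noteq> 0" shows "eventually (\<lambda>q. s q \<noteq> 0) gen"
proof -
  obtain p where p: "p \<in> C" using X_ex by blast
  have "eventually (\<lambda>q. s q / \<l> p q \<noteq> 0) gen" using section_nz[OF s p] by (simp add: nz_def)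
  then show ?thesis by eventually_elim auto
qed

text \<open>A positive dimension excludes an infinite basis, since \<open>card\<close> of an
  infinite set is 0.\<close>

lemma basis_finite_of_dim:
  assumes "h0 C L > 0"
  obtains B where "B \<subseteq> L C" "pw.independent B" "L C \<subseteq> pw.span B" "card B = h0 C L" "finite B"
proof -
  obtain B where B: "B \<subseteq> L C" "pw.independent B" "L C \<subseteq> pw.span B" "card B = pw.dim (L C)"
    using pw.basis_exists[of "L C"] by blast
  then have "card B = h0 C L" by (simp add: h0_def H0_def)
  moreover from this assms have "finite B" using card.infinite by fastforce
  ultimately show ?thesis using that B by blast
qed

lemma nonzero_section: assumes "h0 C L > 0" shows "\<exists>s\<in>L C. s \<noteq> 0"
proof -
  obtain B where B: "B \<subseteq> L C" "pw.independent B" "L C \<subseteq> pw.span B" "card B = h0 C L" "finite B"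
    by (rule basis_finite_of_dim[OF assms])
  then obtain s where "s \<in> B" using assms by (metis card.empty ex_in_conv less_irrefl)
  moreover from this have "s \<noteq> 0" using B(2) pw.dependent_zero[of B] by blast
  ultimately show ?thesis using B(1) by blast
qed

text \<open>For a nonzero section \<sigma> the products \<open>f ^ k * \<sigma>\<close> are sections
  again. As \<open>L C\<close> is finite-dimensional, f satisfies a nonzero polynomial equation at
  almost all points. If f agreed with no constant, it would avoid each of the finitely many roots at
  almost all points.\<close>

lemma constants:
  assumes "h0 C L > 0" and f: "\<And>p. p \<in> C \<Longrightarrow> rgl p f"
  shows "\<exists>c. f \<simeq> (\<lambda>_. c)"
proof -
  obtain B where B: "B \<subseteq> L C" "pw.independent B" "L C \<subseteq> pw.span B" "card B = h0 C L" "finite B"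
    by (rule basis_finite_of_dim[OF assms(1)])
  obtain \<sigma> where \<sigma>: "\<sigma> \<in> L C" "\<sigma> \<noteq> 0" using nonzero_section[OF assms(1)] by blast
  obtain b where b: "bij_betw b {..<card B} B" using finite_bij_nat[OF B(5)] by blast
  have "\<forall>k. \<exists>s. s \<in> L C \<and> s \<simeq> (\<lambda>q. f q ^ k * \<sigma> q)"
  proof
    fix k :: nat
    have "rgl p (\<lambda>q. f q ^ k * \<sigma> q / \<l> p q)" if p: "p \<in> C" for p
      using rgl_mult[OF p rgl_power[OF p f[OF p], of k] rgl_rg[OF section_reg[OF \<sigma>(1) p]]] by simp
    from section_extend[OF this] show "\<exists>s. s \<in> L C \<and> s \<simeq> (\<lambda>q. f q ^ k * \<sigma> q)" by blast
  qed
  from choice[OF this] obtain s where s: "\<forall>k. s k \<in> L C \<and> s k \<simeq> (\<lambda>q. f q ^ k * \<sigma> q)" ..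
  let ?n = "card B"
  have "\<not> vindep pointwise_scale (Suc ?n) s"
  proof
    assume v: "vindep pointwise_scale (Suc ?n) s"
    have "Suc ?n \<le> ?n"
      by (rule vindep_card_le[OF pw_vs v, of ?n b]) (use s B(3) span_finite_vspan[OF b] in blast)
    then show False by simp
  qed
  then obtain c i where c: "(\<Sum>k<Suc ?n. pointwise_scale (c k) (s k)) = 0" "i < Suc ?n" "c i \<noteq> 0"
    unfolding vindep_def by blast
  define P where "P = (\<Sum>k<Suc ?n. monom (c k) k)"
  have "coeff P i = c i" unfolding P_def coeff_sum using c(2) by (simp add: coeff_monom del: sum.lessThan_Suc)
  then have P0: "P \<noteq> 0" using c(3) by auto
  have "eventually (\<lambda>q. \<forall>k\<in>{..<Suc ?n}. s k q = f q ^ k * \<sigma> q) gen"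
    using s by (intro eventually_ball_finite) (auto simp: aeq_def)
  then have evP: "eventually (\<lambda>q. poly P (f q) = 0) gen" using section_gen[OF \<sigma>]
  proof eventually_elim
    case (elim q)
    have "0 = (\<Sum>k<Suc ?n. pointwise_scale (c k) (s k)) q" using c(1) by simp
    also have "\<dots> = (\<Sum>k<Suc ?n. c k * s k q)" by (simp only: sum_fun_app pointwise_scale_def)
    also have "\<dots> = (\<Sum>k<Suc ?n. c k * f q ^ k * \<sigma> q)" using elim(1) by (intro sum.cong) auto
    also have "\<dots> = poly P (f q) * \<sigma> q"
      by (simp add: P_def poly_sum poly_monom sum_distrib_right del: sum.lessThan_Suc)
    finally show ?case using elim(2) by simp
  qed
  let ?R = "{x. poly P x = 0}"
  have finR: "finite ?R" by (rule poly_roots_finite[OF P0])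
  have ratf: "rat f" using X_ex f rat_rgl by blast
  show ?thesis
  proof (rule ccontr)
    assume no: "\<nexists>c. f \<simeq> (\<lambda>_. c)"
    have "eventually (\<lambda>q. f q \<noteq> a) gen" for a
    proof -
      have "\<not> (\<lambda>q. f q - a) \<simeq> (\<lambda>_. 0)"
      proof
        assume "(\<lambda>q. f q - a) \<simeq> (\<lambda>_. 0)"
        then have "f \<simeq> (\<lambda>_. a)" unfolding aeq_def by eventually_elim simp
        then show False using no by blast
      qed
      then have "nz (\<lambda>q. f q - a)" using rat_zero_or_nz[OF rat_diff[OF ratf rat_const]] by blast
      then have "eventually (\<lambda>q. f q - a \<noteq> 0) gen" by (simp add: nz_def)
      then show ?thesis by eventually_elim auto
    qed
    then have "eventually (\<lambda>q. \<forall>a\<in>?R. f q \<noteq> a) gen" using finR by (intro eventually_ball_finite) auto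
    with evP have "eventually (\<lambda>q. False) gen" by eventually_elim auto
    then show False by simp
  qed
qed

end

section \<open>Divisors of sections and the Riemann--Roch inequality for line bundles\<close>

locale good_line = good_curve C g + line_data C L N e
  for C :: "('n::finite, 'k::field) point set" and g L N e
begin

text \<open>The conversion to \<open>nat\<close> is exact for a nonzero global section, whose orders
  are nonnegative; it produces divisors of the kind used in \<open>Lsp\<close>.\<close>

definition sdiv :: "(('n, 'k) point \<Rightarrow> 'k) \<Rightarrow> ('n, 'k) point \<Rightarrow> nat" where
  "sdiv \<sigma> p = nat (ordr p (\<lambda>q. \<sigma> q / \<l> p q))"

lemma sdiv: assumes "\<sigma> \<in> L C" "\<sigma> \<noteq> 0" "p \<in> C" shows "int (sdiv \<sigma> p) = ordr p (\<lambda>q. \<sigma> q / \<l> p q)"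
  using rgl_iff_ordr[OF assms(3) section_nz[OF assms]] rgl_rg[OF section_reg[OF assms(1,3)]] by (simp add: sdiv_def)

lemma l_quotient_nz: assumes "p \<in> C" "p' \<in> C" shows "nz (\<lambda>x. \<l> p x / \<l> p' x)"
proof -
  have "eventually (\<lambda>q. q \<in> C \<and> q \<in> N p \<and> q \<in> N p') gen"
    using gen_X open_gen[OF No[OF assms(1)] pN[OF assms(1)]] open_gen[OF No[OF assms(2)] pN[OF assms(2)]]
    by eventually_elim simp
  then obtain q where q: "q \<in> C" "q \<in> N p" "q \<in> N p'" using gen_nonbot eventually_happens by blast
  have "rat (\<lambda>x. \<l> p x / \<l> p' x)" using rat_rgl[OF q(1) rgl_rg[OF l_quotient[OF assms q(2,3)]]] .
  moreover have "eventually (\<lambda>x. \<l> p x / \<l> p' x \<noteq> 0) gen" using l_gen[OF assms(1)] l_gen[OF assms(2)]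
    by eventually_elim simp
  ultimately show ?thesis by (simp add: nz_def)
qed

lemma line_degree:
  assumes p0: "p0 \<in> C"
  shows "finite {p \<in> C. ordr p (\<lambda>q. \<l> p0 q / \<l> p q) \<noteq> 0}"
    and "vb_degree (*) C L = (\<Sum>p\<in>{p \<in> C. ordr p (\<lambda>q. \<l> p0 q / \<l> p q) \<noteq> 0}. ordr p (\<lambda>q. \<l> p0 q / \<l> p q))"
proof -
  have eq: "ordr p (\<lambda>q. fdet (*) 1 (\<lambda>i. e p0 i q) (\<lambda>i. e p i q)) = ordr p (\<lambda>q. \<l> p0 q / \<l> p q)" if p: "p \<in> C" for p
  proof (rule ordr_cong[OF p l_quotient_nz[OF p0 p]])
    show "(\<lambda>q. \<l> p0 q / \<l> p q) \<simeq> (\<lambda>q. fdet (*) 1 (\<lambda>i. e p0 i q) (\<lambda>i. e p i q))"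
      unfolding aeq_def using open_gen[OF No[OF p] pN[OF p]]
    proof eventually_elim
      case (elim q)
      have "fdet (*) 1 (\<lambda>i. e p0 i q) (\<lambda>i. e p i q) = crd (*) 1 (\<lambda>j. e p j q) (e p0 0 q) 0"
        unfolding fdet_def by (subst det_single) auto
      then show ?case using crd_l[OF p elim] by (simp add: \<l>_def)
    qed
  qed
  have S: "{p \<in> C. ordr p (\<lambda>q. fdet (*) 1 (\<lambda>i. e p0 i q) (\<lambda>i. e p i q)) \<noteq> 0} = {p \<in> C. ordr p (\<lambda>q. \<l> p0 q / \<l> p q) \<noteq> 0}"
    using eq by auto
  note df = degree_formula[OF vector_space_mult VB F p0]
  show "finite {p \<in> C. ordr p (\<lambda>q. \<l> p0 q / \<l> p q) \<noteq> 0}" using df(1) unfolding S .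
  show "vb_degree (*) C L = (\<Sum>p\<in>{p \<in> C. ordr p (\<lambda>q. \<l> p0 q / \<l> p q) \<noteq> 0}. ordr p (\<lambda>q. \<l> p0 q / \<l> p q))"
  proof -
    have "vb_degree (*) C L = (\<Sum>p\<in>{p \<in> C. ordr p (\<lambda>q. \<l> p0 q / \<l> p q) \<noteq> 0}. ordr p (\<lambda>q. fdet (*) 1 (\<lambda>i. e p0 i q) (\<lambda>i. e p i q)))"
      using df(2) unfolding S .
    also have "\<dots> = (\<Sum>p\<in>{p \<in> C. ordr p (\<lambda>q. \<l> p0 q / \<l> p q) \<noteq> 0}. ordr p (\<lambda>q. \<l> p0 q / \<l> p q))"
      by (rule sum.cong) (use eq in auto)
    finally show ?thesis .
  qed
qed

text \<open>The order at p is the order of the rational function \<open>\<sigma> / \<l> p0\<close>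
  plus that of the transition function from p0 to p. The first contribution has degree 0 in total,
  the second gives \<open>vb_degree\<close>.\<close>

lemma section_degree:
  assumes s: "\<sigma> \<in> L C" "\<sigma> \<noteq> 0"
  shows "finite {p \<in> C. sdiv \<sigma> p \<noteq> 0}" and "vb_degree (*) C L = int (\<Sum>p\<in>{p \<in> C. sdiv \<sigma> p \<noteq> 0}. sdiv \<sigma> p)"
proof -
  obtain p0 where p0: "p0 \<in> C" using X_ex by blast
  let ?h = "\<lambda>q. \<sigma> q / \<l> p0 q" and ?D = "\<lambda>p. ordr p (\<lambda>q. \<l> p0 q / \<l> p q)"
  have nzh: "nz ?h" by (rule section_nz[OF s p0])
  have eq: "int (sdiv \<sigma> p) = ordr p ?h + ?D p" if p: "p \<in> C" for p
  proof -
    have c: "(\<lambda>q. ?h q * (\<l> p0 q / \<l> p q)) \<simeq> (\<lambda>q. \<sigma> q / \<l> p q)"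
      using l_gen[OF p0] unfolding aeq_def by eventually_elim simp
    have "int (sdiv \<sigma> p) = ordr p (\<lambda>q. \<sigma> q / \<l> p q)" by (rule sdiv[OF s p])
    also have "\<dots> = ordr p (\<lambda>q. ?h q * (\<l> p0 q / \<l> p q))"
      by (rule ordr_cong[OF p nz_mult[OF nzh l_quotient_nz[OF p0 p]] c])
    also have "\<dots> = ordr p ?h + ?D p" by (rule ordr_mult[OF p nzh l_quotient_nz[OF p0 p]])
    finally show ?thesis .
  qed
  let ?S = "{p \<in> C. ordr p ?h \<noteq> 0} \<union> {p \<in> C. ?D p \<noteq> 0}"
  have finS: "finite ?S" using finite_ordr[OF nzh] line_degree(1)[OF p0] by simp
  have sub: "{p \<in> C. sdiv \<sigma> p \<noteq> 0} \<subseteq> ?S" using eq by force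
  then show "finite {p \<in> C. sdiv \<sigma> p \<noteq> 0}" using finS finite_subset by blast
  have "int (\<Sum>p\<in>{p \<in> C. sdiv \<sigma> p \<noteq> 0}. sdiv \<sigma> p) = (\<Sum>p\<in>{p \<in> C. sdiv \<sigma> p \<noteq> 0}. int (sdiv \<sigma> p))" by simp
  also have "\<dots> = (\<Sum>p\<in>?S. int (sdiv \<sigma> p))" by (rule sum.mono_neutral_left[OF finS sub]) auto
  also have "\<dots> = (\<Sum>p\<in>?S. ordr p ?h + ?D p)" by (rule sum.cong) (use eq in auto)
  also have "\<dots> = (\<Sum>p\<in>?S. ordr p ?h) + (\<Sum>p\<in>?S. ?D p)" by (rule sum.distrib)
  also have "(\<Sum>p\<in>?S. ordr p ?h) = (\<Sum>p\<in>{p \<in> C. ordr p ?h \<noteq> 0}. ordr p ?h)"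
    by (rule sum.mono_neutral_right[OF finS]) auto
  also have "\<dots> = 0" by (rule degree_principal[OF nzh])
  also have "(\<Sum>p\<in>?S. ?D p) = (\<Sum>p\<in>{p \<in> C. ?D p \<noteq> 0}. ?D p)"
    by (rule sum.mono_neutral_right[OF finS]) auto
  finally show "vb_degree (*) C L = int (\<Sum>p\<in>{p \<in> C. sdiv \<sigma> p \<noteq> 0}. sdiv \<sigma> p)" using line_degree(2)[OF p0] by simp
qed

lemma sdiv_unit:
  assumes s: "\<sigma> \<in> L C" "\<sigma> \<noteq> 0" and p: "p \<in> C"
  shows "unit p (\<lambda>q. (\<sigma> q / \<l> p q) * unif p q powi (- int (sdiv \<sigma> p)))"
proof -
  have "ordr p (\<lambda>q. (\<sigma> q / \<l> p q) * unif p q powi (- int (sdiv \<sigma> p))) = 0"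
    using ordr_mult[OF p section_nz[OF s p] nz_unif[OF p, of "- int (sdiv \<sigma> p)"]] ordr_unif[OF p] sdiv[OF s p] by simp
  then show ?thesis using unit_iff_ordr[OF p nz_mult[OF section_nz[OF s p] nz_unif[OF p]]] by blast
qed

text \<open>Multiplication by \<sigma> identifies O(div \<sigma>) with L; this is the identification
  at the point p.\<close>

lemma rgl_sdiv_iff:
  assumes s: "\<sigma> \<in> L C" "\<sigma> \<noteq> 0" and p: "p \<in> C"
  shows "rgl p (\<lambda>q. \<phi> q * unif p q ^ sdiv \<sigma> p) \<longleftrightarrow> rgl p (\<lambda>q. \<phi> q * \<sigma> q / \<l> p q)"
proof -
  let ?u = "\<lambda>q. (\<sigma> q / \<l> p q) * unif p q powi (- int (sdiv \<sigma> p))"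
  have u: "unit p ?u" by (rule sdiv_unit[OF s p])
  have u': "unit p (\<lambda>q. inverse (?u q))" by (rule unit_inverse[OF p u])
  have 1: "(\<lambda>q. (\<phi> q * unif p q ^ sdiv \<sigma> p) * ?u q) \<simeq> (\<lambda>q. \<phi> q * \<sigma> q / \<l> p q)"
    using unif_nonzero[OF p] unfolding aeq_def
    by eventually_elim (simp add: power_int_minus field_simps)
  have 2: "(\<lambda>q. (\<phi> q * \<sigma> q / \<l> p q) * inverse (?u q)) \<simeq> (\<lambda>q. \<phi> q * unif p q ^ sdiv \<sigma> p)"
    using unif_nonzero[OF p] section_gen[OF s] l_gen[OF p] unfolding aeq_def
    by eventually_elim (simp add: power_int_minus field_simps)
  show ?thesis
  proof
    assume r: "rgl p (\<lambda>q. \<phi> q * unif p q ^ sdiv \<sigma> p)"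
    have "rgl p (\<lambda>q. (\<phi> q * unif p q ^ sdiv \<sigma> p) * ?u q)"
      by (rule rgl_mult[OF p r]) (use u in \<open>simp add: unit_def\<close>)
    then show "rgl p (\<lambda>q. \<phi> q * \<sigma> q / \<l> p q)" using 1 by (rule rgl_cong)
  next
    assume r: "rgl p (\<lambda>q. \<phi> q * \<sigma> q / \<l> p q)"
    have "rgl p (\<lambda>q. (\<phi> q * \<sigma> q / \<l> p q) * inverse (?u q))"
      by (rule rgl_mult[OF p r]) (use u' in \<open>simp add: unit_def\<close>)
    then show "rgl p (\<lambda>q. \<phi> q * unif p q ^ sdiv \<sigma> p)" using 2 by (rule rgl_cong)
  qed
qed

lemma section_ratio:
  assumes s: "\<sigma> \<in> L C" "\<sigma> \<noteq> 0" and t: "\<tau> \<in> L C"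
  shows "Lsp (sdiv \<sigma>) (\<lambda>q. \<tau> q / \<sigma> q)"
proof -
  have r: "rgl p (\<lambda>q. (\<tau> q / \<sigma> q) * \<sigma> q / \<l> p q)" if p: "p \<in> C" for p
  proof (rule rgl_cong[OF rgl_rg[OF section_reg[OF t p]]])
    show "(\<lambda>q. \<tau> q / \<l> p q) \<simeq> (\<lambda>q. (\<tau> q / \<sigma> q) * \<sigma> q / \<l> p q)"
      using section_gen[OF s] unfolding aeq_def by eventually_elim simp
  qed
  obtain p where p: "p \<in> C" using X_ex by blast
  have "rat (\<lambda>q. (\<tau> q / \<l> p q) / (\<sigma> q / \<l> p q))"
    using rat_divide rat_rgl[OF p rgl_rg[OF section_reg[OF t p]]] rat_rgl[OF p rgl_rg[OF section_reg[OF s(1) p]]] by blast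
  moreover have "(\<lambda>q. (\<tau> q / \<l> p q) / (\<sigma> q / \<l> p q)) \<simeq> (\<lambda>q. \<tau> q / \<sigma> q)"
    using l_gen[OF p] unfolding aeq_def by eventually_elim simp
  ultimately have "rat (\<lambda>q. \<tau> q / \<sigma> q)" by (rule rat_cong)
  then show ?thesis unfolding Lsp_def by (intro conjI ballI iffD2[OF rgl_sdiv_iff[OF s]] r)
qed

lemma independent_card:
  assumes s: "\<sigma> \<in> L C" "\<sigma> \<noteq> 0" and B: "finite B" "B \<subseteq> L C" "pw.independent B"
  shows "int (card B) \<le> vb_degree (*) C L + 1"
proof -
  have "lin_indep B (\<lambda>b q. b q / \<sigma> q)"
    unfolding lin_indep_def
  proof (intro allI impI)
    fix c assume "(\<lambda>q. \<Sum>b\<in>B. c b * (b q / \<sigma> q)) \<simeq> (\<lambda>_. 0)"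
    then have "(\<Sum>b\<in>B. pointwise_scale (c b) b) \<simeq> (\<lambda>_. 0)"
      using section_gen[OF s] unfolding aeq_def
      by eventually_elim (simp add: sum_fun_app pointwise_scale_def sum_divide_distrib[symmetric])
    moreover have "(\<Sum>b\<in>B. pointwise_scale (c b) b) \<in> L C"
      by (intro pw.subspace_sum[OF global_subspace] pw.subspace_scale[OF global_subspace]) (use B in auto)
    ultimately have "(\<Sum>b\<in>B. pointwise_scale (c b) b) = 0" using section_zero[OF C_open] by (auto simp: fun_eq_iff)
    then show "\<forall>b\<in>B. c b = 0" using B(1,3) unfolding pw.independent_explicit_module by blast
  qed
  then have "card B \<le> (\<Sum>p\<in>{p \<in> C. sdiv \<sigma> p \<noteq> 0}. sdiv \<sigma> p) + 1"
    using card_indep_le[OF regular_const section_degree(1)[OF s] B(1), of "\<lambda>b q. b q / \<sigma> q"] section_ratio[OF s] B(2) by blast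
  then show ?thesis using section_degree(2)[OF s] by linarith
qed

text \<open>\<open>h0\<close> is the cardinality of a basis, and as such would be 0 for an infinite
  one. The degree bound on independent sections excludes that case.\<close>

lemma h0_basis:
  assumes s: "\<sigma> \<in> L C" "\<sigma> \<noteq> 0"
  obtains B where "B \<subseteq> L C" "pw.independent B" "L C \<subseteq> pw.span B" "card B = h0 C L" "finite B"
proof -
  obtain B where B: "B \<subseteq> L C" "pw.independent B" "L C \<subseteq> pw.span B" "card B = pw.dim (L C)"
    using pw.basis_exists[of "L C"] by blast
  have "finite B"
  proof (rule ccontr)
    assume "infinite B"
    then obtain A where A: "A \<subseteq> B" "finite A" "card A = nat (vb_degree (*) C L + 2)"
      using infinite_arbitrarily_large by blast
    have "int (card A) \<le> vb_degree (*) C L + 1"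
      by (rule independent_card[OF s A(2)]) (use A B pw.independent_mono in blast)+
    then show False using A(3) by linarith
  qed
  then show ?thesis using that B by (simp add: h0_def H0_def)
qed

lemma h0_upper:
  assumes s: "\<sigma> \<in> L C" "\<sigma> \<noteq> 0" shows "int (h0 C L) \<le> vb_degree (*) C L + 1"
proof -
  obtain B where B: "B \<subseteq> L C" "pw.independent B" "L C \<subseteq> pw.span B" "card B = h0 C L" "finite B"
    by (rule h0_basis[OF s])
  show ?thesis using independent_card[OF s B(5,1,2)] B(4) by simp
qed

lemma h0_lower_vindep:
  assumes s: "\<sigma> \<in> L C" "\<sigma> \<noteq> 0" and t: "vindep pointwise_scale m \<tau>" "\<And>i. i < m \<Longrightarrow> \<tau> i \<in> L C"
  shows "m \<le> h0 C L"
proof -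
  obtain B where B: "B \<subseteq> L C" "pw.independent B" "L C \<subseteq> pw.span B" "card B = h0 C L" "finite B"
    by (rule h0_basis[OF s])
  obtain b where b: "bij_betw b {..<card B} B" using finite_bij_nat[OF B(5)] by blast
  have "m \<le> card B"
    by (rule vindep_card_le[OF pw_vs t(1), of "card B" b]) (use t(2) B(3) span_finite_vspan[OF b] in blast)
  then show ?thesis using B(4) by simp
qed

lemma h0_lower:
  assumes s: "\<sigma> \<in> L C" "\<sigma> \<noteq> 0" and I: "finite I" "lin_indep I \<phi>" "\<forall>i\<in>I. Lsp (sdiv \<sigma>) (\<phi> i)"
  shows "card I \<le> h0 C L"
proof -
  have "\<forall>i\<in>I. \<exists>t. t \<in> L C \<and> t \<simeq> (\<lambda>q. \<phi> i q * \<sigma> q)"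
  proof
    fix i assume "i \<in> I"
    have "rgl p (\<lambda>q. \<phi> i q * \<sigma> q / \<l> p q)" if "p \<in> C" for p
      by (rule iffD1[OF rgl_sdiv_iff[OF s that]]) (use I(3) \<open>i \<in> I\<close> that in \<open>simp add: Lsp_def\<close>)
    from section_extend[OF this] show "\<exists>t. t \<in> L C \<and> t \<simeq> (\<lambda>q. \<phi> i q * \<sigma> q)" by blast
  qed
  from bchoice[OF this] obtain t where t: "\<forall>i\<in>I. t i \<in> L C \<and> t i \<simeq> (\<lambda>q. \<phi> i q * \<sigma> q)" ..
  obtain f where f: "bij_betw f {..<card I} I" using finite_bij_nat[OF I(1)] by blast
  have fI: "f i \<in> I" if "i < card I" for i using bij_betwE[OF f] that by blast
  have "vindep pointwise_scale (card I) (\<lambda>i. t (f i))"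
    unfolding vindep_def
  proof (intro allI impI)
    fix c i assume c: "(\<Sum>i<card I. pointwise_scale (c i) (t (f i))) = 0" and i: "i < card I"
    define c' where "c' j = c (the_inv_into {..<card I} f j)" for j
    have c': "c' (f i) = c i" if "i < card I" for i
      using the_inv_into_f_f[OF bij_betw_imp_inj_on[OF f]] that by (simp add: c'_def)
    have "eventually (\<lambda>q. \<forall>i\<in>I. t i q = \<phi> i q * \<sigma> q) gen"
      using t I(1) by (intro eventually_ball_finite) (auto simp: aeq_def)
    then have "(\<lambda>q. \<Sum>j\<in>I. c' j * \<phi> j q) \<simeq> (\<lambda>_. 0)" unfolding aeq_def using section_gen[OF s]
    proof eventually_elim
      case (elim q)
      have "0 = (\<Sum>i<card I. pointwise_scale (c i) (t (f i))) q" using c by simp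
      also have "\<dots> = (\<Sum>i<card I. c' (f i) * t (f i) q)" by (simp add: sum_fun_app pointwise_scale_def c')
      also have "\<dots> = (\<Sum>j\<in>I. c' j * t j q)" by (rule sum.reindex_bij_betw[OF f])
      also have "\<dots> = (\<Sum>j\<in>I. c' j * \<phi> j q * \<sigma> q)" using elim(1) by (intro sum.cong) auto
      also have "\<dots> = (\<Sum>j\<in>I. c' j * \<phi> j q) * \<sigma> q" by (simp add: sum_distrib_right)
      finally show ?case using elim(2) by simp
    qed
    from lin_indepD[OF I(2) this fI[OF i]] show "c i = 0" using c' i by simp
  qed
  then show ?thesis by (rule h0_lower_vindep[OF s]) (use t fI in blast)
qed

text \<open>Comparison with a fixed index p0 turns a cocycle f into the principal parts
  \<open>f p0 p / \<sigma>\<close>, taken modulo O(div \<sigma>). If \<phi> realizes a combination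
  of these, the functions \<open>S p - \<phi> * \<sigma>\<close> extend to sections near p whose
  differences give back the combination of cocycles.\<close>

theorem riemann_roch_cech:
  assumes s: "\<sigma> \<in> L C" "\<sigma> \<noteq> 0"
    and U: "open_cover C U" and T: "finite T" "\<forall>f\<in>T. cocycle C L U f"
    and ind: "\<And>c. zero_class C L U (\<lambda>p q x. \<Sum>f\<in>T. c f * f p q x) \<Longrightarrow> \<forall>f\<in>T. c f = 0"
  shows "int (card T) + vb_degree (*) C L + 1 \<le> int (h0 C L) + int g"
proof -
  let ?D = "sdiv \<sigma>"
  obtain p0 where p0: "p0 \<in> C" using X_ex by blast
  have Uo: "open_on C (U p)" "p \<in> U p" if "p \<in> C" for p using U that by (auto simp: open_cover_def)
  \<comment> \<open>For p in \<open>U p0\<close> the section \<open>f p0 p\<close> is regular at p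
    and contributes no principal part. Only the finitely many points outside \<open>U p0\<close>
    remain.\<close>
  define Y where "Y f p x = (if p \<in> U p0 then 0 else f p0 p x / \<sigma> x)" for f :: "('n, 'k) point \<Rightarrow> ('n, 'k) point \<Rightarrow> ('n, 'k) point \<Rightarrow> 'k" and p x
  have fL: "f p q \<in> L (U p \<inter> U q)" if "f \<in> T" "p \<in> C" "q \<in> C" for f p q using T(2) that by (auto simp: cocycle_def)
  have ratf: "rat (\<lambda>x. f p0 p x / \<sigma> x)" if f: "f \<in> T" and p: "p \<in> C" for f p
  proof -
    have "eventually (\<lambda>q. q \<in> C \<and> q \<in> U p0 \<and> q \<in> U p) gen"
      using gen_X open_gen[OF Uo[OF p0]] open_gen[OF Uo[OF p]] by eventually_elim simp
    then obtain q where q: "q \<in> C" "q \<in> U p0 \<inter> U p" using gen_nonbot eventually_happens by blast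
    have "reg_at q (\<lambda>x. f p0 p x / \<l> q x)" using section_iff[OF open_Int[OF Uo(1)[OF p0] Uo(1)[OF p]]] fL[OF f p0 p] q(2) by blast
    then have "rat (\<lambda>x. (f p0 p x / \<l> q x) / (\<sigma> x / \<l> q x))"
      using rat_divide rat_rgl[OF q(1) rgl_rg] section_reg[OF s(1) q(1)] by blast
    moreover have "(\<lambda>x. (f p0 p x / \<l> q x) / (\<sigma> x / \<l> q x)) \<simeq> (\<lambda>x. f p0 p x / \<sigma> x)"
      using l_gen[OF q(1)] unfolding aeq_def by eventually_elim simp
    ultimately show ?thesis by (rule rat_cong)
  qed
  have ppsY: "pps (Y f)" if f: "f \<in> T" for f
    unfolding pps_def
  proof (intro conjI ballI)
    show "rat (Y f p)" if p: "p \<in> C" for p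
      using ratf[OF f p] rat_const[of 0] by (cases "p \<in> U p0") (simp_all add: Y_def[abs_def])
    have "{p \<in> C. Y f p \<noteq> (\<lambda>_. 0)} \<subseteq> C - U p0" by (auto simp: Y_def[abs_def])
    then show "finite {p \<in> C. Y f p \<noteq> (\<lambda>_. 0)}" using open_cofinite[OF Uo[OF p0]] finite_subset by blast
  qed
  have "pps_indep ?D T Y"
    unfolding pps_indep_def
  proof (intro allI impI)
    fix c assume "\<exists>\<phi>. realizable ?D (\<lambda>p q. \<Sum>f\<in>T. c f * Y f p q) \<phi>"
    then obtain \<phi> where \<phi>: "realizable ?D (\<lambda>p q. \<Sum>f\<in>T. c f * Y f p q) \<phi>" by blast
    define S where "S p x = (\<Sum>f\<in>T. c f * f p0 p x)" for p x
    have rS: "rgl p (\<lambda>x. (S p x - \<phi> x * \<sigma> x) / \<l> p x)" if p: "p \<in> C" for p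
    proof -
      have "rgl p (\<lambda>x. ((\<Sum>f\<in>T. c f * Y f p x) - \<phi> x) * unif p x ^ ?D p)" using \<phi> p by (simp add: realizable_def)
      then have 1: "rgl p (\<lambda>x. ((\<Sum>f\<in>T. c f * Y f p x) - \<phi> x) * \<sigma> x / \<l> p x)" by (rule iffD1[OF rgl_sdiv_iff[OF s p]])
      show ?thesis
      proof (cases "p \<in> U p0")
        case True
        have "reg_at p (\<lambda>x. f p0 p x / \<l> p x)" if "f \<in> T" for f
          using section_iff[OF open_Int[OF Uo(1)[OF p0] Uo(1)[OF p]]] fL[OF that p0 p] True Uo(2)[OF p] by blast
        then have "rgl p (\<lambda>x. \<Sum>f\<in>T. c f * (f p0 p x / \<l> p x))" by (intro rgl_sum[OF p] rgl_cmult[OF p] rgl_rg)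
        from rgl_add[OF p this 1] have "rgl p (\<lambda>x. (\<Sum>f\<in>T. c f * (f p0 p x / \<l> p x)) + ((\<Sum>f\<in>T. c f * Y f p x) - \<phi> x) * \<sigma> x / \<l> p x)" .
        moreover have "(\<Sum>f\<in>T. c f * (f p0 p x / \<l> p x)) + ((\<Sum>f\<in>T. c f * Y f p x) - \<phi> x) * \<sigma> x / \<l> p x
            = (S p x - \<phi> x * \<sigma> x) / \<l> p x" for x
          using True by (simp add: Y_def S_def diff_divide_distrib sum_divide_distrib)
        ultimately show ?thesis by simp
      next
        case False
        have "(\<lambda>x. ((\<Sum>f\<in>T. c f * Y f p x) - \<phi> x) * \<sigma> x / \<l> p x) \<simeq> (\<lambda>x. (S p x - \<phi> x * \<sigma> x) / \<l> p x)"
          using section_gen[OF s] unfolding aeq_def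
        proof eventually_elim
          case (elim x)
          have "(\<Sum>f\<in>T. c f * Y f p x) * \<sigma> x = S p x"
            unfolding S_def sum_distrib_right by (rule sum.cong) (use elim False in \<open>auto simp: Y_def\<close>)
          then show ?case by (simp add: left_diff_distrib)
        qed
        with 1 show ?thesis by (rule rgl_cong)
      qed
    qed
    have "\<forall>p\<in>C. \<exists>h. reg_at p h \<and> (\<lambda>x. (S p x - \<phi> x * \<sigma> x) / \<l> p x) \<simeq> h"
      using rS unfolding rgl_def by blast
    from bchoice[OF this] obtain h where h: "\<forall>p\<in>C. reg_at p (h p) \<and> (\<lambda>x. (S p x - \<phi> x * \<sigma> x) / \<l> p x) \<simeq> h p" ..
    define W where "W p = insert p {x \<in> C. x \<in> U p \<and> x \<in> N p \<and> reg_at x (h p)}" for p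
    define \<gamma> where "\<gamma> p x = (if x \<in> W p then h p x * \<l> p x else 0)" for p x
    have Wo: "open_on C (W p)" if p: "p \<in> C" for p
    proof -
      have "eventually (\<lambda>x. reg_at x (h p)) gen" using rg_gen[OF p] h p by blast
      with open_gen[OF Uo[OF p]] open_gen[OF No[OF p] pN[OF p]]
      have "eventually (\<lambda>x. x \<in> U p \<and> x \<in> N p \<and> reg_at x (h p)) gen" by eventually_elim simp
      then show ?thesis unfolding W_def by (rule gen_open[OF p])
    qed
    have WU: "W p \<subseteq> U p" "W p \<subseteq> N p" "p \<in> W p" if "p \<in> C" for p using Uo(2)[OF that] pN[OF that] by (auto simp: W_def)
    have Wr: "reg_at x (h p)" "x \<in> C" if "p \<in> C" "x \<in> W p" for p x using h that by (auto simp: W_def)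
    have \<gamma>L: "\<gamma> p \<in> L (W p)" if p: "p \<in> C" for p
      unfolding section_iff[OF Wo[OF p]]
    proof (intro conjI allI impI ballI)
      fix x assume x: "x \<in> W p"
      note xC = Wr[OF p x]
      show "reg_at x (\<lambda>q. \<gamma> p q / \<l> x q)"
      proof (rule reg_at_cong_on[OF Wo[OF p] x])
        show "reg_at x (\<lambda>q. h p q * (\<l> p q / \<l> x q))"
          using xC x WU[OF p] pN[OF xC(2)] by (intro rg_mult l_quotient p) auto
      qed (simp add: \<gamma>_def)
    qed (simp add: \<gamma>_def)
    have "zero_class C L U (\<lambda>p q x. \<Sum>f\<in>T. c f * f p q x)"
      unfolding zero_class_def
    proof (intro exI[of _ W] exI[of _ \<gamma>] conjI ballI)
      show "open_cover C W" using Wo WU by (auto simp: open_cover_def)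
      show "W p \<subseteq> U p" "\<gamma> p \<in> L (W p)" if "p \<in> C" for p using WU \<gamma>L that by auto
      fix p q x assume p: "p \<in> C" and q: "q \<in> C" and x: "x \<in> W p \<inter> W q"
      let ?V = "W p \<inter> W q"
      have V: "open_on C ?V" by (rule open_Int[OF Wo[OF p] Wo[OF q]])
      \<comment> \<open>The coboundary equation is first checked at a general point. G is its
        defect, a section over the overlap, and a section that vanishes generically vanishes at
        every point.\<close>
      define G where "G y = (if y \<in> ?V then (\<Sum>f\<in>T. c f * f p q y) - (\<gamma> q y - \<gamma> p y) else 0)" for y
      have "G \<in> L ?V" unfolding section_iff[OF V]
      proof (intro conjI allI impI ballI)
        fix y assume y: "y \<in> ?V"
        have yC: "y \<in> C" using Wr(2)[OF p] y by blast
        have "reg_at y (\<lambda>z. f p q z / \<l> y z)" if "f \<in> T" for f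
          using section_iff[OF open_Int[OF Uo(1)[OF p] Uo(1)[OF q]]] fL[OF that p q] y WU(1)[OF p] WU(1)[OF q] by blast
        moreover have "reg_at y (\<lambda>z. \<gamma> q z / \<l> y z)" "reg_at y (\<lambda>z. \<gamma> p z / \<l> y z)"
          using section_iff[OF Wo[OF p]] section_iff[OF Wo[OF q]] \<gamma>L[OF p] \<gamma>L[OF q] y by blast+
        ultimately have r: "reg_at y (\<lambda>z. (\<Sum>f\<in>T. c f * (f p q z / \<l> y z)) - (\<gamma> q z / \<l> y z - \<gamma> p z / \<l> y z))"
          using yC by (intro rg_diff rg_sum rg_mult rg_const) auto
        show "reg_at y (\<lambda>z. G z / \<l> y z)"
          by (rule reg_at_cong_on[OF V y _ r]) (simp add: G_def diff_divide_distrib sum_divide_distrib)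
      qed (auto simp: G_def)
      moreover have "G \<simeq> (\<lambda>_. 0)"
        unfolding aeq_def
        using open_gen[OF Wo[OF p] WU(3)[OF p]] open_gen[OF Wo[OF q] WU(3)[OF q]] open_gen[OF Uo[OF p0]]
          h[rule_format, OF p, THEN conjunct2, unfolded aeq_def] h[rule_format, OF q, THEN conjunct2, unfolded aeq_def] l_gen[OF p] l_gen[OF q]
      proof eventually_elim
        case (elim y)
        have y: "y \<in> U p0 \<inter> U p \<inter> U q" using elim WU(1)[OF p] WU(1)[OF q] by blast
        have "f p0 p y + f p q y = f p0 q y" if "f \<in> T" for f
          using T(2) that p0 p q y unfolding cocycle_def by blast
        then have d: "f p q y = f p0 q y - f p0 p y" if "f \<in> T" for f using that by (simp add: eq_diff_eq add.commute)
        have "(\<Sum>f\<in>T. c f * f p q y) = (\<Sum>f\<in>T. c f * f p0 q y - c f * f p0 p y)"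
        proof (rule sum.cong[OF refl])
          fix f assume "f \<in> T"
          from d[OF this] show "c f * f p q y = c f * f p0 q y - c f * f p0 p y" by (simp add: right_diff_distrib)
        qed
        then have "(\<Sum>f\<in>T. c f * f p q y) = S q y - S p y" by (simp add: S_def sum_subtractf)
        moreover have "\<gamma> p y = S p y - \<phi> y * \<sigma> y" "\<gamma> q y = S q y - \<phi> y * \<sigma> y"
          using elim by (simp_all add: \<gamma>_def field_simps)
        ultimately show ?case by (simp add: G_def)
      qed
      ultimately have "G x = 0" using section_zero[OF V] by blast
      then show "(\<Sum>f\<in>T. c f * f p q x) = \<gamma> q x - \<gamma> p x" using x by (simp add: G_def)
    qed
    then show "\<forall>f\<in>T. c f = 0" by (rule ind)
  qed
  from riemann_roch_lower[OF section_degree(1)[OF s] T(1) ppsY this]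
  obtain I :: "((('n, 'k) point \<Rightarrow> ('n, 'k) point \<Rightarrow> ('n, 'k) point \<Rightarrow> 'k) + ('n, 'k) point \<times> nat) option set" and \<psi>
    where I: "finite I" "lin_indep I \<psi>" "\<forall>i\<in>I. Lsp ?D (\<psi> i)"
      "card T + (\<Sum>p\<in>{p \<in> C. ?D p \<noteq> 0}. ?D p) + 1 \<le> card I + g" by blast
  have "card I \<le> h0 C L" by (rule h0_lower[OF s I(1,2,3)])
  then show ?thesis using I(4) section_degree(2)[OF s] by linarith
qed

end

subsection \<open>The kernel bundle\<close>

text \<open>Only the identity permutation contributes: any other one has an index j different from k
  that is the image of some i different from j, and the entry at (i, j) is 0.\<close>

lemma det_identity_replaced_col:
  fixes x :: "nat \<Rightarrow> 'a::comm_ring_1"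
  assumes "k < n"
  shows "det (mat n n (\<lambda>(i, j). if j = k then x i else if i = j then 1 else 0)) = x k"
proof -
  let ?A = "mat n n (\<lambda>(i, j). if j = k then x i else if i = j then 1 else 0)"
  have zero: "signof \<pi> * (\<Prod>i = 0..<n. ?A $$ (i, \<pi> i)) = 0" if \<pi>: "\<pi> permutes {0..<n}" "\<pi> \<noteq> id" for \<pi>
  proof -
    have "\<exists>j\<in>{0..<n}. j \<noteq> k \<and> Hilbert_Choice.inv \<pi> j \<noteq> j"
    proof (rule ccontr)
      assume no: "\<not> ?thesis"
      have ip: "Hilbert_Choice.inv \<pi> permutes {0..<n}" by (rule permutes_inv[OF \<pi>(1)])
      have fxd: "Hilbert_Choice.inv \<pi> j = j" if "j \<noteq> k" for j
        using no that permutes_not_in[OF ip, of j] by (cases "j \<in> {0..<n}") auto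
      have "Hilbert_Choice.inv \<pi> k = k"
      proof (rule ccontr)
        assume "Hilbert_Choice.inv \<pi> k \<noteq> k"
        then have "Hilbert_Choice.inv \<pi> (Hilbert_Choice.inv \<pi> k) = Hilbert_Choice.inv \<pi> k" by (rule fxd)
        then show False using permutes_inj[OF ip] \<open>Hilbert_Choice.inv \<pi> k \<noteq> k\<close> by (auto dest: injD)
      qed
      have "Hilbert_Choice.inv \<pi> x = id x" for x
        using fxd[of x] \<open>Hilbert_Choice.inv \<pi> k = k\<close> by (cases "x = k") simp_all
      then have "Hilbert_Choice.inv \<pi> = id" by (rule ext)
      then have "\<pi> = id" using permutes_inv_inv[OF \<pi>(1)] by simp
      then show False using \<pi>(2) by simp
    qed
    then obtain j where j: "j \<in> {0..<n}" "j \<noteq> k" "Hilbert_Choice.inv \<pi> j \<noteq> j" by blast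
    let ?i = "Hilbert_Choice.inv \<pi> j"
    have i: "?i \<in> {0..<n}" using permutes_in_image[OF permutes_inv[OF \<pi>(1)]] j(1) by blast
    have "\<pi> ?i = j" using permutes_inverses(1)[OF \<pi>(1)] .
    then have "?A $$ (?i, \<pi> ?i) = 0" using i j by simp
    then have "(\<Prod>i = 0..<n. ?A $$ (i, \<pi> i)) = 0" using i by (intro prod_zero) auto
    then show ?thesis by simp
  qed
  have "det ?A = (\<Sum>\<pi>\<in>{\<pi>. \<pi> permutes {0..<n}}. signof \<pi> * (\<Prod>i = 0..<n. ?A $$ (i, \<pi> i)))"
    by (rule det_def') simp
  also have "\<dots> = (\<Sum>\<pi>\<in>{id}. signof \<pi> * (\<Prod>i = 0..<n. ?A $$ (i, \<pi> i)))"
    by (rule sum.mono_neutral_right) (use zero in \<open>auto simp: finite_permutations permutes_id\<close>)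
  also have "\<dots> = (\<Prod>i = 0..<n. ?A $$ (i, i))" by (simp only: sum.insert finite.emptyI empty_iff sum.empty not_False_eq_True sign_id id_apply of_int_1 mult_1 add_0_right)
  also have "(\<Prod>i = 0..<n. ?A $$ (i, i)) = (\<Prod>i = 0..<n. if i = k then x k else 1)"
    by (rule prod.cong) auto
  also have "\<dots> = x k" using assms by (simp add: prod.delta)
  finally show ?thesis .
qed

lemma det_identity_replaced_row:
  fixes x :: "nat \<Rightarrow> 'a::comm_ring_1"
  assumes "k < n"
  shows "det (mat n n (\<lambda>(i, j). if i = k then x j else if i = j then 1 else 0)) = x k"
proof -
  let ?A = "mat n n (\<lambda>(i, j). if j = k then x i else if i = j then 1 else 0)"
  have "mat n n (\<lambda>(i, j). if i = k then x j else if i = j then 1 else 0) = transpose_mat ?A"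
    by (rule eq_matI) auto
  then show ?thesis using det_transpose[of ?A n] det_identity_replaced_col[OF assms, of x] by simp
qed

text \<open>Cramer's rule: replacing the k-th basis vector by v multiplies the wedge product by the
  k-th coordinate of v.\<close>

lemma crd_cramer:
  assumes vs: "vector_space sc" and f: "vindep sc n f" and e: "vindep sc n e"
    and fe: "\<And>i. i < n \<Longrightarrow> f i \<in> vspan sc n e" and v: "v \<in> vspan sc n f" and k: "k < n"
  shows "crd sc n f v k * fdet sc n f e = fdet sc n (f(k := v)) e"
proof -
  have "fdet sc n (f(k := v)) e = fdet sc n (f(k := v)) f * fdet sc n f e"
  proof (rule fdet_mult[OF vs e _ fe])
    show "(f(k := v)) i \<in> vspan sc n f" if "i < n" for i using v vspan_base[OF vs that] by simp
  qed
  also have "fdet sc n (f(k := v)) f = crd sc n f v k"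
  proof -
    have "mat n n (\<lambda>(i, j). crd sc n f ((f(k := v)) i) j) =
       mat n n (\<lambda>(i, j). if i = k then crd sc n f v j else if i = j then 1 else 0)"
      by (rule eq_matI) (auto simp: crd_base[OF vs f])
    then show ?thesis unfolding fdet_def using det_identity_replaced_row[OF k] by simp
  qed
  finally show ?thesis by (simp add: fun_upd_def)
qed

lemma crd_lincomb:
  assumes vs: "vector_space sc" and b: "vindep sc n b" and x: "\<And>i. i < m \<Longrightarrow> x i \<in> vspan sc n b" and j: "j < n"
  shows "crd sc n b (\<Sum>i<m. sc (c i) (x i)) j = (\<Sum>i<m. c i * crd sc n b (x i) j)"
proof (rule crd_eq[OF vs b _ j])
  interpret vs: vector_space sc by fact
  have "(\<Sum>i<m. sc (c i) (x i)) = (\<Sum>i<m. sc (c i) (\<Sum>j<n. sc (crd sc n b (x i) j) (b j)))"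
    by (rule sum.cong[OF refl]) (use crd_sum[OF x] in simp)
  also have "\<dots> = (\<Sum>i<m. \<Sum>j<n. sc (c i * crd sc n b (x i) j) (b j))"
    by (simp add: vs.scale_sum_right)
  also have "\<dots> = (\<Sum>j<n. \<Sum>i<m. sc (c i * crd sc n b (x i) j) (b j))" by (rule sum.swap)
  finally show "(\<Sum>i<m. sc (c i) (x i)) = (\<Sum>j<n. sc (\<Sum>i<m. c i * crd sc n b (x i) j) (b j))"
    by (simp add: vs.scale_sum_left)
qed

locale kernel_data = good_line C g L N e
  for C :: "('n::finite, 'k::field) point set" and g L N e +
  fixes r :: nat and b :: "nat \<Rightarrow> ('n, 'k) point \<Rightarrow> 'k"
  assumes gg: "globally_generated C L" and r: "r \<ge> 1"
    and b_indep: "vindep pointwise_scale (Suc r) b"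
    and b_span: "L C = vspan pointwise_scale (Suc r) b"
begin

abbreviation "M \<equiv> kernel_bundle C L"
abbreviation cb where "cb \<equiv> crd pointwise_scale (Suc r) b"

lemma b_in: "m \<le> r \<Longrightarrow> b m \<in> L C" using vspan_base[OF pw_vs, of m "Suc r" b] b_span by simp

lemma b_nonzero: assumes "m \<le> r" shows "b m \<noteq> 0"
proof
  assume "b m = 0"
  then have "(\<Sum>i<Suc r. pointwise_scale (if i = m then 1 else 0) (b i)) = 0"
    by (intro sum.neutral) (auto simp: pointwise_scale_def)
  from vindepD[OF b_indep this, of m] assms show False by simp
qed

lemma cb_sum: "v \<in> L C \<Longrightarrow> v = (\<Sum>m<Suc r. pointwise_scale (cb v m) (b m))"
  using crd_sum[of v pointwise_scale "Suc r" b] b_span by simp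

lemma cb_apply: "v \<in> L C \<Longrightarrow> v q = (\<Sum>m<Suc r. cb v m * b m q)"
  using fun_cong[OF cb_sum, of v q] by (simp only: sum_fun_app pointwise_scale_def)

lemma tensor_iff:
  assumes U: "open_on C U"
  shows "\<phi> \<in> H0_tensor_O C L U \<longleftrightarrow> (\<forall>p. p \<notin> U \<longrightarrow> \<phi> p = 0) \<and> (\<forall>p\<in>U. \<phi> p \<in> L C) \<and>
    (\<forall>m<Suc r. \<forall>p\<in>U. reg_at p (\<lambda>q. cb (\<phi> q) m))"
proof
  assume "\<phi> \<in> H0_tensor_O C L U"
  then have "\<exists>(n::nat) f s. \<phi> = (\<lambda>p q. \<Sum>j<n. f j p * s j q) \<and> (\<forall>j<n. f j \<in> regular C U \<and> s j \<in> L C)"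
    unfolding H0_tensor_O_def H0_def mem_Collect_eq .
  then obtain n :: nat and f s where \<phi>: "\<phi> = (\<lambda>p q. \<Sum>j<n. f j p * s j q)" and fs: "\<forall>j<n. f j \<in> regular C U \<and> s j \<in> L C"
    by (elim exE conjE) (rule that; assumption)
  have \<phi>p: "\<phi> p = (\<Sum>j<n. pointwise_scale (f j p) (s j))" for p
    by (rule ext) (simp add: \<phi> sum_fun_app pointwise_scale_def)
  have s: "s j \<in> vspan pointwise_scale (Suc r) b" if "j < n" for j using fs b_span that by blast
  have cbp: "cb (\<phi> p) m = (\<Sum>j<n. f j p * cb (s j) m)" if "m < Suc r" for p m
    unfolding \<phi>p by (rule crd_lincomb[OF pw_vs b_indep s that])
  show "(\<forall>p. p \<notin> U \<longrightarrow> \<phi> p = 0) \<and> (\<forall>p\<in>U. \<phi> p \<in> L C) \<and> (\<forall>m<Suc r. \<forall>p\<in>U. reg_at p (\<lambda>q. cb (\<phi> q) m))"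
  proof (intro conjI allI impI ballI)
    fix p assume "p \<notin> U"
    then have "f j p = 0" if "j < n" for j using fs regular_iff[OF U] that by blast
    then show "\<phi> p = 0" by (auto simp: \<phi> fun_eq_iff)
  next
    fix p assume "p \<in> U"
    show "\<phi> p \<in> L C" unfolding \<phi>p
      by (intro pw.subspace_sum[OF global_subspace] pw.subspace_scale[OF global_subspace]) (use fs in auto)
  next
    fix m p assume m: "m < Suc r" and p: "p \<in> U"
    have pC: "p \<in> C" using open_cofinite[OF U p] p by blast
    show "reg_at p (\<lambda>q. cb (\<phi> q) m)" unfolding cbp[OF m]
      by (intro rg_sum[OF pC] rg_mult[OF pC] rg_const[OF pC]) (use fs regular_reg_at[OF U _ p] in auto)
  qed
next
  assume \<phi>: "(\<forall>p. p \<notin> U \<longrightarrow> \<phi> p = 0) \<and> (\<forall>p\<in>U. \<phi> p \<in> L C) \<and> (\<forall>m<Suc r. \<forall>p\<in>U. reg_at p (\<lambda>q. cb (\<phi> q) m))"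
  define f where "f m = restrict_to U (\<lambda>q. cb (\<phi> q) m)" for m
  have "f m \<in> regular C U" if "m < Suc r" for m unfolding f_def by (rule restrict_regular[OF U]) (use \<phi> that in blast)
  moreover have "\<phi> = (\<lambda>p q. \<Sum>m<Suc r. f m p * b m q)"
  proof (intro ext)
    fix p q show "\<phi> p q = (\<Sum>m<Suc r. f m p * b m q)"
    proof (cases "p \<in> U")
      case True
      then have "\<phi> p \<in> L C" using \<phi> by blast
      from cb_apply[OF this, of q] True show ?thesis by (simp add: f_def restrict_to_def)
    next
      case False
      then show ?thesis using \<phi> by (simp add: f_def restrict_to_def)
    qed
  qed
  moreover have "\<forall>m<Suc r. b m \<in> H0 C L" using b_in by (simp add: H0_def)
  ultimately show "\<phi> \<in> H0_tensor_O C L U" unfolding H0_tensor_O_def mem_Collect_eq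
    by (intro exI[of _ "Suc r"] exI[of _ f] exI[of _ b]) auto
qed

lemma kernel_iff:
  assumes U: "open_on C U"
  shows "\<phi> \<in> M U \<longleftrightarrow> (\<forall>p. p \<notin> U \<longrightarrow> \<phi> p = 0) \<and> (\<forall>p\<in>U. \<phi> p \<in> L C \<and> \<phi> p p = 0) \<and>
    (\<forall>m<Suc r. \<forall>p\<in>U. reg_at p (\<lambda>q. cb (\<phi> q) m))"
  unfolding kernel_bundle_def mem_Collect_eq tensor_iff[OF U] by blast

lemma kernel_sheaf: "is_fun_sheaf C M"
  unfolding is_fun_sheaf_def
proof (intro conjI allI impI)
  fix U f p assume "open_on C U \<and> f \<in> M U" "p \<notin> U"
  then show "f p = 0" using kernel_iff by blast
next
  fix U V f assume *: "open_on C U \<and> open_on C V \<and> V \<subseteq> U \<and> f \<in> M U"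
  then have U: "open_on C U" and V: "open_on C V" and VU: "V \<subseteq> U" and f: "f \<in> M U" by auto
  show "restrict_to V f \<in> M V"
    unfolding kernel_iff[OF V]
  proof (intro conjI allI impI ballI)
    fix p assume p: "p \<in> V"
    show "restrict_to V f p \<in> L C" "restrict_to V f p p = 0"
      using f VU p unfolding kernel_iff[OF U] by (auto simp: restrict_to_def)
    fix m assume "m < Suc r"
    then have "reg_at p (\<lambda>q. cb (f q) m)" using f VU p unfolding kernel_iff[OF U] by blast
    then show "reg_at p (\<lambda>q. cb (restrict_to V f q) m)"
      by (rule reg_at_cong_on[OF V p, rotated]) (simp add: restrict_to_def)
  qed (simp add: restrict_to_def)
next
  fix U f assume *: "open_on C U \<and> (\<forall>p. p \<notin> U \<longrightarrow> f p = 0) \<and>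
        (\<forall>p\<in>U. \<exists>V. open_on C V \<and> p \<in> V \<and> V \<subseteq> U \<and> restrict_to V f \<in> M V)"
  then have U: "open_on C U" by blast
  show "f \<in> M U" unfolding kernel_iff[OF U]
  proof (intro conjI allI impI ballI)
    show "f p = 0" if "p \<notin> U" for p using * that by blast
    fix p assume p: "p \<in> U"
    then obtain V where V: "open_on C V" "p \<in> V" "restrict_to V f \<in> M V" using * by blast
    show "f p \<in> L C" "f p p = 0" using V(2,3) unfolding kernel_iff[OF V(1)] by (auto simp: restrict_to_def)
    fix m assume "m < Suc r"
    then have "reg_at p (\<lambda>q. cb (restrict_to V f q) m)" using V(2,3) unfolding kernel_iff[OF V(1)] by blast
    then show "reg_at p (\<lambda>q. cb (f q) m)"
      by (rule reg_at_cong_on[OF V(1,2), rotated]) (simp add: restrict_to_def)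
  qed
qed

text \<open>Enumerates the indices up to r except k, with slot k taken over by the index r. Since
  only this slot changes, the transition matrix between the frames for k and for r is an identity
  matrix with one column replaced.\<close>

definition jj :: "nat \<Rightarrow> nat \<Rightarrow> nat" where "jj k i = (if i = k then r else i)"

text \<open>Where \<open>b k q\<close> is nonzero, these vectors form a basis of the sections
  vanishing at q, the fibre of the kernel bundle.\<close>

definition kf :: "nat \<Rightarrow> nat \<Rightarrow> ('n, 'k) point \<Rightarrow> ('n, 'k) point \<Rightarrow> 'k" where
  "kf k i q = b (jj k i) - pointwise_scale (b (jj k i) q / b k q) (b k)"

lemma jj_bij: assumes "k \<le> r" shows "bij_betw (jj k) {..<r} ({..<Suc r} - {k})"
proof (rule bij_betw_imageI)
  show "inj_on (jj k) {..<r}" by (auto simp: inj_on_def jj_def)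
  show "jj k ` {..<r} = {..<Suc r} - {k}"
  proof (intro equalityI subsetI)
    fix m assume m: "m \<in> {..<Suc r} - {k}"
    show "m \<in> jj k ` {..<r}"
      using m assms by (cases "m = r") (auto simp: jj_def image_iff intro!: bexI[of _ k] bexI[of _ m])
  qed (use assms in \<open>auto simp: jj_def\<close>)
qed

lemma kf_in: assumes "k \<le> r" "i < r" shows "kf k i q \<in> L C"
  unfolding kf_def
  by (intro pw.subspace_diff[OF global_subspace] pw.subspace_scale[OF global_subspace] b_in) (use assms in \<open>auto simp: jj_def\<close>)

lemma kf_vanish: "b k q \<noteq> 0 \<Longrightarrow> kf k i q q = 0"
  by (simp add: kf_def pointwise_scale_def)

lemma cb_kf: assumes "k \<le> r" "i < r" "m \<le> r"
  shows "cb (kf k i q) m = (if m = jj k i then 1 else if m = k then - (b (jj k i) q / b k q) else 0)"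
proof -
  have jk: "jj k i \<noteq> k" "jj k i \<le> r" using assms by (auto simp: jj_def)
  let ?c = "\<lambda>m. if m = jj k i then 1 else if m = k then - (b (jj k i) q / b k q) else 0 :: 'k"
  have "(\<Sum>m<Suc r. pointwise_scale (?c m) (b m)) = (\<Sum>m\<in>{jj k i, k}. pointwise_scale (?c m) (b m))"
    by (rule sum.mono_neutral_right) (use assms jk in \<open>auto simp: pointwise_scale_def zero_fun_def\<close>)
  also have "\<dots> = kf k i q" using jk by (simp add: kf_def pw.scale_minus_left pw.scale_one)
  finally have "kf k i q = (\<Sum>m<Suc r. pointwise_scale (?c m) (b m))" by simp
  from crd_eq[OF pw_vs b_indep this, of m] assms(3) show ?thesis by simp
qed

text \<open>The equation \<open>v q = 0\<close> determines the coefficient of \<open>b k\<close>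
  from the others; substituting it leaves a combination of the vectors
  \<open>kf k i q\<close>.\<close>

lemma kf_expand:
  assumes k: "k \<le> r" "b k q \<noteq> 0" and v: "v \<in> L C" "v q = 0"
  shows "v = (\<Sum>i<r. pointwise_scale (cb v (jj k i)) (kf k i q))"
proof -
  let ?S = "{..<Suc r} - {k}"
  have kS: "k \<in> {..<Suc r}" using k by simp
  have "0 = (\<Sum>m<Suc r. cb v m * b m q)" using cb_apply[OF v(1), of q] v(2) by simp
  also have "\<dots> = cb v k * b k q + (\<Sum>m\<in>?S. cb v m * b m q)"
    by (rule sum.remove) (use kS in auto)
  finally have vk: "cb v k = - (\<Sum>m\<in>?S. cb v m * (b m q / b k q))"
    using k(2) by (simp add: sum_divide_distrib[symmetric] field_simps eq_neg_iff_add_eq_0)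
  have "v = (\<Sum>m<Suc r. pointwise_scale (cb v m) (b m))" by (rule cb_sum[OF v(1)])
  also have "\<dots> = pointwise_scale (cb v k) (b k) + (\<Sum>m\<in>?S. pointwise_scale (cb v m) (b m))"
    by (rule sum.remove) (use kS in auto)
  also have "pointwise_scale (cb v k) (b k) = - (\<Sum>m\<in>?S. pointwise_scale (cb v m) (pointwise_scale (b m q / b k q) (b k)))"
    unfolding vk by (simp add: pw.scale_minus_left pw.scale_sum_left)
  also have "- (\<Sum>m\<in>?S. pointwise_scale (cb v m) (pointwise_scale (b m q / b k q) (b k))) + (\<Sum>m\<in>?S. pointwise_scale (cb v m) (b m))
     = (\<Sum>m\<in>?S. pointwise_scale (cb v m) (b m - pointwise_scale (b m q / b k q) (b k)))"
    by (simp only: pw.scale_right_diff_distrib sum_subtractf) simp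
  also have "\<dots> = (\<Sum>i<r. pointwise_scale (cb v (jj k i)) (b (jj k i) - pointwise_scale (b (jj k i) q / b k q) (b k)))"
    by (rule sum.reindex_bij_betw[OF jj_bij[OF k(1)], symmetric])
  finally show ?thesis unfolding kf_def .
qed

lemma kf_indep: assumes k: "k \<le> r" shows "vindep pointwise_scale r (\<lambda>i. kf k i q)"
  unfolding vindep_def
proof (intro allI impI)
  fix c i assume c: "(\<Sum>i<r. pointwise_scale (c i) (kf k i q)) = 0" and i: "i < r"
  have jr: "jj k i < Suc r" by (use i in \<open>simp add: jj_def\<close>)
  have inj: "jj k i = jj k i' \<longleftrightarrow> i' = i" if "i' < r" for i'
    using bij_betw_imp_inj_on[OF jj_bij[OF k]] i that by (auto simp: inj_on_def)
  have jk: "jj k i \<noteq> k" using k i by (auto simp: jj_def)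
  have "cb (\<Sum>i<r. pointwise_scale (c i) (kf k i q)) (jj k i) = (\<Sum>i'<r. c i' * cb (kf k i' q) (jj k i))"
    by (rule crd_lincomb[OF pw_vs b_indep _ jr]) (use kf_in[OF k] b_span in blast)
  also have "\<dots> = (\<Sum>i'<r. if i' = i then c i' else 0)"
    by (rule sum.cong) (use inj jk jr in \<open>auto simp: cb_kf[OF k]\<close>)
  also have "\<dots> = c i" using i by simp
  finally have "c i = cb 0 (jj k i)" using c by simp
  also have "\<dots> = 0"
    by (rule crd_eq[OF pw_vs b_indep _ jr, of _ "\<lambda>_. 0"]) (simp add: pw.scale_zero_left)
  finally show "c i = 0" .
qed

lemma crd_kf:
  assumes k: "k \<le> r" "b k q \<noteq> 0" and v: "v \<in> L C" "v q = 0" and i: "i < r"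
  shows "crd pointwise_scale r (\<lambda>i. kf k i q) v i = cb v (jj k i)"
  by (rule crd_eq[OF pw_vs kf_indep[OF k(1)] kf_expand[OF k v] i])

definition nonvan :: "nat \<Rightarrow> ('n, 'k) point set" where "nonvan k = {q \<in> C. b k q \<noteq> 0}"

lemma D_open: assumes "k \<le> r" shows "open_on C (nonvan k)"
proof -
  have "eventually (\<lambda>q. b k q \<noteq> 0) gen" by (rule section_gen[OF b_in[OF assms] b_nonzero[OF assms]])
  then have "finite {q \<in> C. \<not> b k q \<noteq> 0}" by (simp add: eventually_gen)
  moreover have "C - nonvan k = {q \<in> C. \<not> b k q \<noteq> 0}" by (auto simp: nonvan_def)
  ultimately show ?thesis by (intro cofinite_open) (auto simp: nonvan_def)
qed

lemma b_quotient_reg: assumes "k \<le> r" "m \<le> r" "p \<in> nonvan k" shows "reg_at p (\<lambda>q. b m q / b k q)"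
proof -
  have pC: "p \<in> C" "b k p \<noteq> 0" using assms(3) by (auto simp: nonvan_def)
  have rm: "reg_at p (\<lambda>q. b m q / \<l> p q)" and rk: "reg_at p (\<lambda>q. b k q / \<l> p q)"
    using section_reg b_in assms pC by blast+
  have "b k p / \<l> p p \<noteq> 0" using pC l_nonzero[OF pC(1) pN[OF pC(1)]] by simp
  from rg_mult[OF pC(1) rm rg_inverse[OF pC(1) rk this]]
  have r: "reg_at p (\<lambda>q. (b m q / \<l> p q) * inverse (b k q / \<l> p q))" .
  show ?thesis
    by (rule reg_at_cong_on[OF No[OF pC(1)] pN[OF pC(1)] _ r]) (use l_nonzero[OF pC(1)] in simp)
qed

lemma kernel_frame: assumes k: "k \<le> r" shows "local_frame pointwise_scale C r M (nonvan k) (kf k)"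
  unfolding local_frame_def
proof (intro conjI allI impI ballI)
  show "open_on C (nonvan k)" by (rule D_open[OF k])
  show "c i = 0" if "(\<Sum>i<r. pointwise_scale (c i) (kf k i q)) = 0" "i < r" for q c i
    using vindepD[OF kf_indep[OF k] that] .
  fix V assume V': "open_on C V \<and> V \<subseteq> nonvan k"
  then have V: "open_on C V" "V \<subseteq> nonvan k" by auto
  have VC: "q \<in> C" "b k q \<noteq> 0" if "q \<in> V" for q using V(2) that by (auto simp: nonvan_def)
  show "M V = {(\<lambda>q. \<Sum>i<r. pointwise_scale (f i q) (kf k i q)) |f. \<forall>i<r. f i \<in> regular C V}"
  proof (intro equalityI subsetI)
    fix \<phi> assume \<phi>: "\<phi> \<in> M V"
    define f where "f i = restrict_to V (\<lambda>q. cb (\<phi> q) (jj k i))" for i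
    have "\<forall>i<r. f i \<in> regular C V"
    proof (intro allI impI)
      fix i assume "i < r"
      then have "jj k i < Suc r" by (simp add: jj_def)
      then show "f i \<in> regular C V" unfolding f_def
        by (intro restrict_regular[OF V(1)]) (use \<phi> kernel_iff[OF V(1)] in blast)
    qed
    moreover have "\<phi> = (\<lambda>q. \<Sum>i<r. pointwise_scale (f i q) (kf k i q))"
    proof
      fix q show "\<phi> q = (\<Sum>i<r. pointwise_scale (f i q) (kf k i q))"
      proof (cases "q \<in> V")
        case True
        then have "\<phi> q \<in> L C" "\<phi> q q = 0" using \<phi> kernel_iff[OF V(1)] by blast+
        from kf_expand[OF k VC(2)[OF True] this] True show ?thesis by (simp add: f_def restrict_to_def)
      next
        case False
        then have "\<phi> q = 0" using \<phi> kernel_iff[OF V(1)] by blast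
        then show ?thesis using False by (simp add: f_def restrict_to_def pw.scale_zero_left)
      qed
    qed
    ultimately show "\<phi> \<in> {(\<lambda>q. \<Sum>i<r. pointwise_scale (f i q) (kf k i q)) |f. \<forall>i<r. f i \<in> regular C V}"
      unfolding mem_Collect_eq by (intro exI[of _ f] conjI)
  next
    fix \<phi> assume "\<phi> \<in> {(\<lambda>q. \<Sum>i<r. pointwise_scale (f i q) (kf k i q)) |f. \<forall>i<r. f i \<in> regular C V}"
    then obtain f where \<phi>: "\<phi> = (\<lambda>q. \<Sum>i<r. pointwise_scale (f i q) (kf k i q))" and f: "\<forall>i<r. f i \<in> regular C V"
      unfolding mem_Collect_eq by (elim exE conjE)
    show "\<phi> \<in> M V" unfolding kernel_iff[OF V(1)]
    proof (intro conjI allI impI ballI)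
      fix q assume "q \<notin> V"
      then have "f i q = 0" if "i < r" for i using f regular_iff[OF V(1)] that by blast
      then show "\<phi> q = 0" unfolding \<phi> by (intro sum.neutral) (simp add: pw.scale_zero_left)
    next
      fix q assume q: "q \<in> V"
      show "\<phi> q \<in> L C" unfolding \<phi>
        by (intro pw.subspace_sum[OF global_subspace] pw.subspace_scale[OF global_subspace] kf_in k) auto
      show "\<phi> q q = 0" unfolding \<phi> using kf_vanish[OF VC(2)[OF q]] by (simp add: sum_fun_app pointwise_scale_def)
      fix m assume m: "m < Suc r"
      have "cb (\<phi> x) m = (\<Sum>i<r. f i x * cb (kf k i x) m)" for x unfolding \<phi>
        by (rule crd_lincomb[OF pw_vs b_indep _ m]) (use kf_in[OF k] b_span in blast)
      moreover have "reg_at q (\<lambda>x. f i x * cb (kf k i x) m)" if i: "i < r" for i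
      proof (rule rg_mult[OF VC(1)[OF q]])
        show "reg_at q (f i)" using regular_reg_at[OF V(1) _ q] f i by blast
        have "reg_at q (\<lambda>x. 0 - b (jj k i) x / b k x)"
          by (rule rg_diff[OF VC(1)[OF q] rg_const[OF VC(1)[OF q]] b_quotient_reg]) (use k i q V(2) in \<open>auto simp: jj_def\<close>)
        then show "reg_at q (\<lambda>x. cb (kf k i x) m)"
          using m rg_const[OF VC(1)[OF q]] by (cases "m = jj k i"; cases "m = k") (simp_all add: cb_kf[OF k i])
      qed
      moreover from this have "reg_at q (\<lambda>x. \<Sum>i<r. f i x * cb (kf k i x) m)"
        by (intro rg_sum[OF VC(1)[OF q]]) auto
      ultimately show "reg_at q (\<lambda>x. cb (\<phi> x) m)" by simp
    qed
  qed
qed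

text \<open>The local generator at p is the image of a local section of H^0(L) \<otimes> O, so some
  basis element is nonzero at p.\<close>

lemma b_nonvanishing: assumes p: "p \<in> C" shows "\<exists>k\<le>r. b k p \<noteq> 0"
proof -
  have s: "(\<lambda>q. if q \<in> N p then e p 0 q else 0) \<in> L (N p)"
    by (rule frame_elem[OF vector_space_mult Fr[OF p] No[OF p]]) auto
  obtain V \<phi> where V: "open_on C V" "p \<in> V" "V \<subseteq> N p" "\<phi> \<in> H0_tensor_O C L V"
    "\<forall>q\<in>V. \<phi> q q = (if q \<in> N p then e p 0 q else 0)"
    using gg[unfolded globally_generated_def, rule_format, OF conjI[OF No[OF p] conjI[OF s pN[OF p]]]] by blast
  have "\<phi> p p \<noteq> 0" using V(2,3,5) l_nonzero[OF p pN[OF p]] pN[OF p] by (simp add: \<l>_def)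
  moreover have "\<phi> p \<in> L C" using V(2,4) tensor_iff[OF V(1)] by blast
  ultimately have "(\<Sum>m<Suc r. cb (\<phi> p) m * b m p) \<noteq> 0" using cb_apply by simp
  then obtain m where "m < Suc r" "cb (\<phi> p) m * b m p \<noteq> 0" by (meson sum.not_neutral_contains_not_neutral lessThan_iff)
  then show ?thesis by (intro exI[of _ m]) auto
qed

lemma kernel_vector_bundle: "vector_bundle pointwise_scale C r M"
  unfolding vector_bundle_def
proof (intro conjI kernel_sheaf ballI)
  fix p assume p: "p \<in> C"
  obtain k where "k \<le> r" "b k p \<noteq> 0" using b_nonvanishing[OF p] by blast
  then show "\<exists>N e. p \<in> N \<and> local_frame pointwise_scale C r M N e"
    using kernel_frame p by (intro exI[of _ "nonvan k"] exI[of _ "kf k"]) (auto simp: nonvan_def)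
qed

lemma kernel_rank: "vb_rank pointwise_scale C M = r"
  by (rule vb_rank_eq[OF pw_vs kernel_vector_bundle])

lemma kernel_nonzero: "nonzero_bundle C M"
proof -
  have "eventually (\<lambda>q. q \<in> C \<and> b r q \<noteq> 0) gen"
    using gen_X section_gen[OF b_in[OF order_refl] b_nonzero[OF order_refl]] by eventually_elim simp
  then obtain q where q: "q \<in> C" "b r q \<noteq> 0" using gen_nonbot eventually_happens by blast
  have qD: "q \<in> nonvan r" using q by (simp add: nonvan_def)
  have "(\<lambda>x. if x \<in> nonvan r then kf r 0 x else 0) \<in> M (nonvan r)"
    by (rule frame_elem[OF pw_vs kernel_frame[OF order_refl] D_open[OF order_refl]]) (use r in auto)
  moreover have "kf r 0 q \<noteq> 0"
  proof
    assume z: "kf r 0 q = 0"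
    have "cb (kf r 0 q) 0 = 1" using cb_kf[of r 0 0 q] r by (simp add: jj_def)
    moreover have "cb 0 0 = 0" by (rule crd_eq[OF pw_vs b_indep, of _ "\<lambda>_. 0"]) (auto simp: pw.scale_zero_left)
    ultimately show False using z by simp
  qed
  ultimately show ?thesis unfolding nonzero_bundle_def
    using D_open[OF order_refl] qD by (intro exI[of _ "nonvan r"] exI[of _ "\<lambda>x. if x \<in> nonvan r then kf r 0 x else 0"] exI[of _ q]) auto
qed

text \<open>The frame with index r is compared with a frame valid at p. If the latter has index k
  \<noteq> r, the determinant of the transition is \<open>- (b k q / b r q)\<close>; since
  \<open>b k\<close> does not vanish at p, its order is minus that of \<open>b r\<close>. Summation
  gives minus the degree of the section \<open>b r\<close>.\<close>

lemma kernel_degree: "vb_degree pointwise_scale C M = - vb_degree (*) C L"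
proof -
  \<comment> \<open>The index r is preferred so that the reference point p0, a general one, carries
    the frame with index r; at all points with this frame both orders are 0.\<close>
  define \<kappa> where "\<kappa> p = (if b r p \<noteq> 0 then r else SOME k. k \<le> r \<and> b k p \<noteq> 0)" for p
  have \<kappa>: "\<kappa> p \<le> r" "b (\<kappa> p) p \<noteq> 0" if p: "p \<in> C" for p
    using someI_ex[OF b_nonvanishing[OF p]] by (auto simp: \<kappa>_def)
  have "eventually (\<lambda>q. q \<in> C \<and> b r q \<noteq> 0) gen"
    using gen_X section_gen[OF b_in[OF order_refl] b_nonzero[OF order_refl]] by eventually_elim simp
  then obtain p0 where p0: "p0 \<in> C" "b r p0 \<noteq> 0" using gen_nonbot eventually_happens by blast
  have \<kappa>0: "\<kappa> p0 = r" using p0 by (simp add: \<kappa>_def)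
  have fr: "p \<in> nonvan (\<kappa> p) \<and> local_frame pointwise_scale C r M (nonvan (\<kappa> p)) (kf (\<kappa> p))" if "p \<in> C" for p
    using \<kappa>[OF that] that kernel_frame by (auto simp: nonvan_def)
  note df = degree_formula(2)[OF pw_vs kernel_vector_bundle fr p0(1)]
  define h where "h p q = fdet pointwise_scale r (\<lambda>i. kf (\<kappa> p0) i q) (\<lambda>i. kf (\<kappa> p) i q)" for p q
  have br: "b r \<in> L C" "b r \<noteq> 0" using b_in b_nonzero by auto
  have eq: "ordr p (h p) = - int (sdiv (b r) p)" if p: "p \<in> C" for p
  proof (cases "\<kappa> p = r")
    case True
    have "(\<lambda>_. 1) \<simeq> h p" unfolding aeq_def h_def \<kappa>0 True
      by (intro always_eventually allI) (simp add: fdet_self[OF pw_vs kf_indep])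
    then have "ordr p (h p) = 0" using ordr_cong[OF p nz_const] ordr_const[OF p] by (metis zero_neq_one)
    moreover have "unit p (\<lambda>q. b r q / \<l> p q)"
      unfolding unit_def using rgl_rg[OF section_reg[OF br(1) p]] val_rg[OF p section_reg[OF br(1) p]]
        \<kappa>(2)[OF p] True l_nonzero[OF p pN[OF p]] by simp
    then have "int (sdiv (b r) p) = 0" using unit_iff_ordr[OF p section_nz[OF br p]] sdiv[OF br p] by simp
    ultimately show ?thesis by simp
  next
    case False
    let ?k = "\<kappa> p"
    have k: "?k < r" using \<kappa>(1)[OF p] False by simp
    have bk: "b ?k \<in> L C" "b ?k \<noteq> 0" using b_in b_nonzero \<kappa>(1)[OF p] by auto
    have eqh: "(\<lambda>q. - (b ?k q / b r q)) \<simeq> h p"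
      unfolding aeq_def using section_gen[OF br] section_gen[OF bk]
    proof eventually_elim
      case (elim q)
      have "crd pointwise_scale r (\<lambda>i. kf ?k i q) (kf r i q) j =
          (if j = ?k then - (b i q / b r q) else if i = j then 1 else 0)" if ij: "i < r" "j < r" for i j
        using crd_kf[OF less_imp_le[OF k] elim(2) kf_in[OF order_refl ij(1)] kf_vanish[OF elim(1)] ij(2)]
          cb_kf[OF order_refl ij(1), of "jj ?k j" q] ij by (auto simp: jj_def)
      then have "mat r r (\<lambda>(i, j). crd pointwise_scale r (\<lambda>i. kf ?k i q) (kf r i q) j) =
          mat r r (\<lambda>(i, j). if j = ?k then - (b i q / b r q) else if i = j then 1 else 0)"
        by (intro eq_matI) auto
      then show ?case unfolding h_def fdet_def \<kappa>0 using det_identity_replaced_col[OF k, of "\<lambda>i. - (b i q / b r q)"] by simp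
    qed
    have c: "(\<lambda>q. - 1 * ((b ?k q / \<l> p q) * inverse (b r q / \<l> p q))) \<simeq> (\<lambda>q. - (b ?k q / b r q))"
      unfolding aeq_def using l_gen[OF p] by eventually_elim (simp add: field_simps)
    have "unit p (\<lambda>q. b ?k q / \<l> p q)"
      unfolding unit_def using rgl_rg[OF section_reg[OF bk(1) p]] val_rg[OF p section_reg[OF bk(1) p]]
        \<kappa>(2)[OF p] l_nonzero[OF p pN[OF p]] by simp
    then have "has_ord p (\<lambda>q. b ?k q / \<l> p q) 0" using has_ord_0[OF p] by simp
    moreover have "has_ord p (\<lambda>q. b r q / \<l> p q) (int (sdiv (b r) p))"
      using nz_has_ord[OF p section_nz[OF br p]] sdiv[OF br p] by simp
    moreover have "has_ord p (\<lambda>_. - 1) 0" using has_ord_0[OF p] unit_const[OF p, of "- 1"] by simp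
    ultimately have "has_ord p (\<lambda>q. - 1 * ((b ?k q / \<l> p q) * inverse (b r q / \<l> p q))) (0 + (0 + - int (sdiv (b r) p)))"
      by (intro has_ord_mult[OF p] has_ord_inverse[OF p])
    then have "has_ord p (h p) (- int (sdiv (b r) p))" using has_ord_cong[OF has_ord_cong[OF _ c] eqh] by simp
    then show ?thesis by (rule ordr_eq[OF p])
  qed
  have S: "{p \<in> C. ordr p (h p) \<noteq> 0} = {p \<in> C. sdiv (b r) p \<noteq> 0}" using eq by auto
  have "vb_degree pointwise_scale C M = (\<Sum>p\<in>{p \<in> C. ordr p (h p) \<noteq> 0}. ordr p (h p))"
    using df unfolding h_def[abs_def] .
  also have "\<dots> = (\<Sum>p\<in>{p \<in> C. sdiv (b r) p \<noteq> 0}. - int (sdiv (b r) p))" unfolding S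
    by (rule sum.cong) (use eq in auto)
  also have "\<dots> = - vb_degree (*) C L" using section_degree(2)[OF br] by (simp add: sum_negf)
  finally show ?thesis .
qed

end

subsection \<open>Linear functionals\<close>

interpretation pwf: vector_space_pair "pointwise_scale :: 'k::field \<Rightarrow> ('a \<Rightarrow> 'k) \<Rightarrow> 'a \<Rightarrow> 'k"
    "(*) :: 'k \<Rightarrow> 'k \<Rightarrow> 'k"
  by (intro vector_space_pair.intro pw_vs vector_space_mult)

abbreviation functional :: "(('a \<Rightarrow> 'k::field) \<Rightarrow> 'k) \<Rightarrow> bool" where
  "functional \<equiv> Vector_Spaces.linear pointwise_scale (*)"

lemma separating_functional:
  assumes K: "pw.subspace K" and v: "v \<notin> K"
  shows "\<exists>\<Lambda>. functional \<Lambda> \<and> (\<forall>x\<in>K. \<Lambda> x = 0) \<and> \<Lambda> v = 1"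
proof -
  obtain B where B: "B \<subseteq> K" "pw.independent B" "K \<subseteq> pw.span B" "card B = pw.dim K"
    by (rule pw.basis_exists[of K])
  have "pw.span B \<subseteq> K" by (rule pw.span_minimal[OF B(1) K])
  then have "v \<notin> pw.span B" using v by blast
  then have "pw.independent (insert v B)" using B(2) by (intro pw.independent_insertI)
  from pwf.linear_independent_extend[OF this, of "\<lambda>x. if x = v then 1 else 0"]
  obtain \<Lambda> where L: "functional \<Lambda>" "\<forall>x\<in>insert v B. \<Lambda> x = (if x = v then 1 else 0)" by blast
  have "\<Lambda> x = 0" if "x \<in> B" for x using L(2) that v B(1) by auto
  then have "\<forall>x\<in>K. \<Lambda> x = 0" using pwf.linear_eq_0_on_span[OF L(1)] B(3) by blast
  then show ?thesis using L by (intro exI[of _ \<Lambda>]) simp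
qed

lemma functional_sum: "functional \<Lambda> \<Longrightarrow> \<Lambda> (\<Sum>i\<in>A. pointwise_scale (c i) (v i)) = (\<Sum>i\<in>A. c i * \<Lambda> (v i))"
  by (simp add: pwf.linear_sum pwf.linear_scale)

lemma vspan_subspace: "pw.subspace (vspan pointwise_scale n x)"
  unfolding pw.subspace_def
proof (intro conjI ballI allI)
  show "0 \<in> vspan pointwise_scale n x" by (rule vspanI[of _ _ "\<lambda>_. 0"]) (simp add: pw.scale_zero_left)
next
  fix v w assume "v \<in> vspan pointwise_scale n x" "w \<in> vspan pointwise_scale n x"
  then obtain c d where "v = (\<Sum>j<n. pointwise_scale (c j) (x j))" "w = (\<Sum>j<n. pointwise_scale (d j) (x j))"
    unfolding vspan_def by blast
  then have "v + w = (\<Sum>j<n. pointwise_scale (c j + d j) (x j))" by (simp add: pw.scale_left_distrib sum.distrib)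
  then show "v + w \<in> vspan pointwise_scale n x" by (rule vspanI)
next
  fix a v assume "v \<in> vspan pointwise_scale n x"
  then obtain c where "v = (\<Sum>j<n. pointwise_scale (c j) (x j))" unfolding vspan_def by blast
  then have "pointwise_scale a v = (\<Sum>j<n. pointwise_scale (a * c j) (x j))" by (simp add: pw.scale_sum_right)
  then show "pointwise_scale a v \<in> vspan pointwise_scale n x" by (rule vspanI)
qed

lemma vindep_extend:
  assumes vs: "vector_space sc" and b: "vindep sc n b" and v: "v \<notin> vspan sc n b"
  shows "vindep sc (Suc n) (b(n := v))"
  unfolding vindep_def
proof (rule allI, rule impI)
  interpret vs: vector_space sc by fact
  fix c assume "(\<Sum>i<Suc n. sc (c i) ((b(n := v)) i)) = 0"
  then have s: "(\<Sum>i<n. sc (c i) (b i)) + sc (c n) v = 0" by simp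
  have cn: "c n = 0"
  proof (rule ccontr)
    assume z: "c n \<noteq> 0"
    have "sc (c n) v = - (\<Sum>i<n. sc (c i) (b i))" using s by (simp add: eq_neg_iff_add_eq_0 add.commute)
    then have "sc (inverse (c n)) (sc (c n) v) = sc (inverse (c n)) (- (\<Sum>i<n. sc (c i) (b i)))" by (rule arg_cong)
    also have "sc (inverse (c n)) (sc (c n) v) = v" by (simp only: vs.scale_scale left_inverse[OF z] vs.scale_one)
    also have "sc (inverse (c n)) (- (\<Sum>i<n. sc (c i) (b i))) = (\<Sum>i<n. sc (- (inverse (c n) * c i)) (b i))"
      by (simp only: vs.scale_minus_right vs.scale_sum_right vs.scale_scale vs.scale_minus_left sum_negf)
    finally have "v \<in> vspan sc n b" by (rule vspanI)
    then show False using v by simp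
  qed
  then have "(\<Sum>i<n. sc (c i) (b i)) = 0" using s by simp
  from vindepD[OF b this] cn show "\<forall>i<Suc n. c i = 0" by (simp add: less_Suc_eq)
qed

lemma vindep_span_full:
  assumes vs: "vector_space sc" and b: "vindep sc n b" and s: "\<And>i. i < n \<Longrightarrow> b i \<in> vspan sc n b'"
    and v: "v \<in> vspan sc n b'"
  shows "v \<in> vspan sc n b"
proof (rule ccontr)
  assume "v \<notin> vspan sc n b"
  from vindep_extend[OF vs b this] have "vindep sc (Suc n) (b(n := v))" .
  moreover have "(b(n := v)) i \<in> vspan sc n b'" if "i < Suc n" for i using s v that by (auto simp: less_Suc_eq)
  ultimately have "Suc n \<le> n" by (rule vindep_card_le[OF vs])
  then show False by simp
qed

text \<open>The value of the alternating form \<Lambda> 0 \<and> ... \<and> \<Lambda> (s - 1) on the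
  vectors x.\<close>

definition ldet :: "nat \<Rightarrow> (nat \<Rightarrow> 'v \<Rightarrow> 'k::field) \<Rightarrow> (nat \<Rightarrow> 'v) \<Rightarrow> 'k" where
  "ldet s \<Lambda> x = det (mat s s (\<lambda>(a, i). \<Lambda> a (x i)))"

lemma ldet_change:
  assumes \<Lambda>: "\<And>a. a < s \<Longrightarrow> functional (\<Lambda> a)" and x: "\<And>i. i < s \<Longrightarrow> x i \<in> vspan pointwise_scale s y"
  shows "ldet s \<Lambda> x = ldet s \<Lambda> y * fdet pointwise_scale s x y"
proof -
  let ?B = "mat s s (\<lambda>(a, j). \<Lambda> a (y j))" and ?G = "mat s s (\<lambda>(i, j). crd pointwise_scale s y (x i) j)"
  have "mat s s (\<lambda>(a, i). \<Lambda> a (x i)) = ?B * transpose_mat ?G"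
  proof (rule eq_matI)
    fix a i assume "a < dim_row (?B * transpose_mat ?G)" "i < dim_col (?B * transpose_mat ?G)"
    then have ai: "a < s" "i < s" by auto
    have "\<Lambda> a (x i) = \<Lambda> a (\<Sum>j<s. pointwise_scale (crd pointwise_scale s y (x i) j) (y j))"
      using crd_sum[OF x[OF ai(2)]] by simp
    also have "\<dots> = (\<Sum>j<s. crd pointwise_scale s y (x i) j * \<Lambda> a (y j))" by (rule functional_sum[OF \<Lambda>[OF ai(1)]])
    finally have e: "\<Lambda> a (x i) = (\<Sum>j = 0..<s. \<Lambda> a (y j) * crd pointwise_scale s y (x i) j)"
      by (simp add: mult.commute lessThan_atLeast0)
    show "mat s s (\<lambda>(a, i). \<Lambda> a (x i)) $$ (a, i) = (?B * transpose_mat ?G) $$ (a, i)"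
      using ai by (simp add: e scalar_prod_def)
  qed auto
  then have "ldet s \<Lambda> x = det ?B * det (transpose_mat ?G)"
    unfolding ldet_def using det_mult[of ?B s "transpose_mat ?G"] by simp
  also have "det (transpose_mat ?G) = det ?G" by (rule det_transpose[of _ s]) simp
  finally show ?thesis by (simp add: ldet_def fdet_def)
qed

text \<open>The coefficients of the dual vectors are the columns of the inverse of the matrix of
  values \<open>\<Lambda> a (x i)\<close>, obtained from the adjugate.\<close>

lemma dual_vectors:
  assumes \<Lambda>: "\<And>a. a < s \<Longrightarrow> functional (\<Lambda> a)" and nz: "ldet s \<Lambda> x \<noteq> 0"
  shows "\<exists>y. \<forall>j<s. y j \<in> vspan pointwise_scale s x \<and> (\<forall>a<s. \<Lambda> a (y j) = (if a = j then 1 else 0))"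
proof -
  let ?A = "mat s s (\<lambda>(a, i). \<Lambda> a (x i))"
  let ?D = "det ?A"
  have A: "?A \<in> carrier_mat s s" by simp
  have D: "?D \<noteq> 0" using nz by (simp add: ldet_def)
  define y where "y j = (\<Sum>i<s. pointwise_scale (adj_mat ?A $$ (i, j) / ?D) (x i))" for j
  show ?thesis
  proof (intro exI[of _ y] allI impI conjI)
    fix j assume j: "j < s"
    show "y j \<in> vspan pointwise_scale s x" unfolding y_def vspan_def mem_Collect_eq
      by (rule exI[of _ "\<lambda>i. adj_mat ?A $$ (i, j) / ?D"]) simp
    fix a assume a: "a < s"
    have "(?A * adj_mat ?A) $$ (a, j) = (\<Sum>i = 0..<s. \<Lambda> a (x i) * adj_mat ?A $$ (i, j))"
      using a j adj_mat(1)[OF A] by (simp add: scalar_prod_def)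
    moreover have "(?A * adj_mat ?A) $$ (a, j) = (if a = j then ?D else 0)"
      unfolding adj_mat(2)[OF A] using a j by simp
    ultimately have e: "(\<Sum>i = 0..<s. \<Lambda> a (x i) * adj_mat ?A $$ (i, j)) = (if a = j then ?D else 0)" by simp
    have "\<Lambda> a (y j) = (\<Sum>i<s. adj_mat ?A $$ (i, j) / ?D * \<Lambda> a (x i))" unfolding y_def by (rule functional_sum[OF \<Lambda>[OF a]])
    also have "\<dots> = (\<Sum>i = 0..<s. \<Lambda> a (x i) * adj_mat ?A $$ (i, j)) / ?D"
      unfolding sum_divide_distrib lessThan_atLeast0 by (rule sum.cong) simp_all
    finally show "\<Lambda> a (y j) = (if a = j then 1 else 0)" using D by (simp add: e)
  qed
qed

lemma dual_basis:
  fixes x :: "nat \<Rightarrow> 'a \<Rightarrow> 'k::field"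
  assumes x: "vindep pointwise_scale s x"
  shows "\<exists>\<Lambda>. (\<forall>a<s. functional (\<Lambda> a)) \<and> ldet s \<Lambda> x = 1"
proof -
  have "\<exists>\<Lambda>. functional \<Lambda> \<and> (\<forall>i<s. \<Lambda> (x i) = (if a = i then 1 else 0))" if a: "a < s" for a
  proof -
    let ?c = "crd pointwise_scale s x"
    \<comment> \<open>The hyperplane of the span where the a-th coordinate is 0: a functional that
      vanishes on it and is 1 at \<open>x a\<close> is the a-th dual functional.\<close>
    let ?K = "{v \<in> vspan pointwise_scale s x. ?c v a = 0}"
    have K: "pw.subspace ?K"
      unfolding pw.subspace_def
    proof (intro conjI ballI allI)
      have z: "(0 :: 'a \<Rightarrow> 'k) = (\<Sum>j<s. pointwise_scale 0 (x j))" by (simp add: pw.scale_zero_left)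
      show "0 \<in> ?K" unfolding mem_Collect_eq
        by (rule conjI[OF pw.subspace_0[OF vspan_subspace] crd_eq[OF pw_vs x z a]])
    next
      fix v w assume v: "v \<in> ?K" "w \<in> ?K"
      have "v + w = (\<Sum>j<s. pointwise_scale (?c v j) (x j)) + (\<Sum>j<s. pointwise_scale (?c w j) (x j))"
        by (rule arg_cong2[where f = "(+)"]; rule crd_sum) (use v in simp_all)
      then have "v + w = (\<Sum>j<s. pointwise_scale (?c v j + ?c w j) (x j))" by (simp add: pw.scale_left_distrib sum.distrib)
      from crd_eq[OF pw_vs x this a] have "?c (v + w) a = ?c v a + ?c w a" .
      then have "?c (v + w) a = 0" using v by (simp only: mem_Collect_eq add_0_left)
      moreover have "v + w \<in> vspan pointwise_scale s x" by (rule pw.subspace_add[OF vspan_subspace]) (use v in simp_all)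
      ultimately show "v + w \<in> ?K" unfolding mem_Collect_eq by (intro conjI)
    next
      fix k v assume v: "v \<in> ?K"
      have "pointwise_scale k v = pointwise_scale k (\<Sum>j<s. pointwise_scale (?c v j) (x j))"
        by (rule arg_cong[where f = "pointwise_scale k"], rule crd_sum) (use v in simp)
      then have "pointwise_scale k v = (\<Sum>j<s. pointwise_scale (k * ?c v j) (x j))" by (simp add: pw.scale_sum_right)
      from crd_eq[OF pw_vs x this a] have "?c (pointwise_scale k v) a = k * ?c v a" .
      then have "?c (pointwise_scale k v) a = 0" using v by (simp only: mem_Collect_eq mult_zero_right)
      moreover have "pointwise_scale k v \<in> vspan pointwise_scale s x" by (rule pw.subspace_scale[OF vspan_subspace]) (use v in simp)
      ultimately show "pointwise_scale k v \<in> ?K" unfolding mem_Collect_eq by (intro conjI)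
    qed
    have "x a \<notin> ?K" using crd_base[OF pw_vs x a a] by simp
    from separating_functional[OF K this] obtain \<Lambda> where L: "functional \<Lambda>" "\<forall>v\<in>?K. \<Lambda> v = 0" "\<Lambda> (x a) = 1" by blast
    have "\<Lambda> (x i) = 0" if "i < s" "i \<noteq> a" for i
      using L(2) crd_base[OF pw_vs x that(1) a] vspan_base[OF pw_vs that(1), of x] that(2) by auto
    then show ?thesis using L by (intro exI[of _ \<Lambda>]) auto
  qed
  then have "\<forall>a\<in>{..<s}. \<exists>\<Lambda>. functional \<Lambda> \<and> (\<forall>i<s. \<Lambda> (x i) = (if a = i then 1 else 0))" by simp
  from bchoice[OF this] obtain \<Lambda> where L: "\<forall>a\<in>{..<s}. functional (\<Lambda> a) \<and> (\<forall>i<s. \<Lambda> a (x i) = (if a = i then 1 else 0))" ..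
  have "mat s s (\<lambda>(a, i). \<Lambda> a (x i)) = 1\<^sub>m s" by (rule eq_matI) (use L in auto)
  then have "ldet s \<Lambda> x = 1" by (simp add: ldet_def)
  then show ?thesis using L by (intro exI[of _ \<Lambda>]) simp
qed

text \<open>On the dual vectors y the new tuple has an identity matrix with row k replaced, of
  determinant \<open>\<mu> (y k)\<close>. By \<open>ldet_change\<close> this is a multiple of the
  value on x, which is therefore nonzero.\<close>

lemma ldet_replace:
  assumes \<Lambda>: "\<And>a. a < s \<Longrightarrow> functional (\<Lambda> a)" and nz: "ldet s \<Lambda> x \<noteq> 0"
    and \<mu>: "functional \<mu>" and k: "k < s"
    and y: "\<And>j. j < s \<Longrightarrow> y j \<in> vspan pointwise_scale s x"
      "\<And>j a. j < s \<Longrightarrow> a < s \<Longrightarrow> \<Lambda> a (y j) = (if a = j then 1 else 0)" and nzk: "\<mu> (y k) \<noteq> 0"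
  shows "ldet s (\<Lambda>(k := \<mu>)) x \<noteq> 0"
proof -
  have "mat s s (\<lambda>(a, i). (\<Lambda>(k := \<mu>)) a (y i)) = mat s s (\<lambda>(a, i). if a = k then \<mu> (y i) else if a = i then 1 else 0)"
    by (rule eq_matI) (auto simp: y(2))
  then have "ldet s (\<Lambda>(k := \<mu>)) y = \<mu> (y k)"
    unfolding ldet_def using det_identity_replaced_row[OF k, of "\<lambda>i. \<mu> (y i)"] by simp
  moreover have "ldet s (\<Lambda>(k := \<mu>)) y = ldet s (\<Lambda>(k := \<mu>)) x * fdet pointwise_scale s y x"
    by (rule ldet_change[OF _ y(1)]) (use \<Lambda> \<mu> in auto)
  ultimately show ?thesis using nzk by auto
qed

text \<open>
  \<open>J\<close> is the set of indices at which the functionals may still be changed.  In the step, the dual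
  vector \<open>v\<close> of \<open>\<Lambda> b0\<close> at \<open>q0\<close> is not in the fibre at a general point \<open>q'\<close>, so \<open>\<Lambda> b0\<close> can be replaced by
  a functional \<open>\<mu>\<close> with \<open>\<mu> v = 1\<close> that makes every tuple with the same values outside \<open>J\<close>
  degenerate at \<open>q'\<close>; there only the original tuple does not vanish.
\<close>

lemma paranjape_ramanan:
  fixes x :: "'p \<Rightarrow> nat \<Rightarrow> 'a \<Rightarrow> 'k::field" and F :: "'p filter" and X :: "'p set" and s :: nat
  defines "\<tau> \<equiv> \<lambda>\<Lambda> q. if q \<in> X then ldet s \<Lambda> (x q) else 0"
  assumes H1: "\<And>\<Lambda> q0. (\<And>a. a < s \<Longrightarrow> functional (\<Lambda> a)) \<Longrightarrow> \<tau> \<Lambda> q0 \<noteq> 0 \<Longrightarrow> eventually (\<lambda>q. \<tau> \<Lambda> q \<noteq> 0) F"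
    and H2: "\<And>q0 v. q0 \<in> X \<Longrightarrow> v \<in> vspan pointwise_scale s (x q0) \<Longrightarrow> v \<noteq> 0 \<Longrightarrow>
      eventually (\<lambda>q. v \<notin> vspan pointwise_scale s (x q)) F"
    and F: "F \<noteq> bot"
    and J: "finite J" "J \<subseteq> {..<s}"
    and \<Lambda>: "\<forall>a<s. functional (\<Lambda> a)" and nz: "\<tau> \<Lambda> q0 \<noteq> 0"
  shows "\<exists>T. (\<forall>j<Suc (card J). \<forall>a<s. functional (T j a)) \<and>
      (\<forall>j<Suc (card J). \<forall>a\<in>{..<s} - J. T j a = \<Lambda> a) \<and>
      vindep pointwise_scale (Suc (card J)) (\<lambda>j. \<tau> (T j))"
  using J \<Lambda> nz
proof (induction J arbitrary: \<Lambda> q0 rule: finite_induct)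
  case empty
  have "vindep pointwise_scale (Suc 0) (\<lambda>j. \<tau> \<Lambda>)"
    unfolding vindep_def
  proof (intro allI impI)
    fix c :: "nat \<Rightarrow> 'k" and i :: nat assume c: "(\<Sum>i<Suc 0. pointwise_scale (c i) (\<tau> \<Lambda>)) = 0" and i: "i < Suc 0"
    have "c 0 * \<tau> \<Lambda> q0 = 0" using fun_cong[OF c, of q0] by (simp add: pointwise_scale_def)
    then show "c i = 0" using i empty(3) by simp
  qed
  then show ?case using empty(2) by (intro exI[of _ "\<lambda>_. \<Lambda>"]) simp
next
  case (insert b0 J)
  note \<Lambda> = insert.prems(2)[rule_format]
  have b0: "b0 < s" using insert.prems(1) by simp
  have q0: "q0 \<in> X" "ldet s \<Lambda> (x q0) \<noteq> 0" using insert.prems(3) by (auto simp: \<tau>_def split: if_splits)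
  from dual_vectors[OF \<Lambda> q0(2)]
  obtain y where y: "\<forall>j<s. y j \<in> vspan pointwise_scale s (x q0) \<and> (\<forall>a<s. \<Lambda> a (y j) = (if a = j then 1 else 0))" ..
  define v where "v = y b0"
  have v: "v \<in> vspan pointwise_scale s (x q0)" "\<Lambda> a v = (if a = b0 then 1 else 0)" if "a < s" for a
    using y b0 that by (simp_all add: v_def)
  have "v \<noteq> 0" using v(2)[OF b0] pwf.linear_0[OF \<Lambda>[OF b0]] by auto
  then have "eventually (\<lambda>q. v \<notin> vspan pointwise_scale s (x q)) F" by (rule H2[OF q0(1) v(1)[OF b0]])
  moreover have "eventually (\<lambda>q. \<tau> \<Lambda> q \<noteq> 0) F" by (rule H1[OF _ insert.prems(3)]) (rule \<Lambda>)
  ultimately have "eventually (\<lambda>q. v \<notin> vspan pointwise_scale s (x q) \<and> \<tau> \<Lambda> q \<noteq> 0) F" by eventually_elim simp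
  from eventually_happens'[OF F this]
  obtain q' where q': "v \<notin> vspan pointwise_scale s (x q')" "\<tau> \<Lambda> q' \<noteq> 0" by blast
  \<comment> \<open>A functional vanishing on K is, on the fibre at q', a combination of the
    \<open>\<Lambda> a\<close> with a outside \<open>insert b0 J\<close>. With such a \<mu> in
    position b0 the tuple is dependent at q' whatever is put at the indices in J.\<close>
  define K where "K = {w \<in> vspan pointwise_scale s (x q'). \<forall>a\<in>{..<s} - insert b0 J. \<Lambda> a w = 0}"
  have K: "pw.subspace K"
    unfolding pw.subspace_def
  proof (intro conjI ballI allI)
    show "0 \<in> K" unfolding K_def using pw.subspace_0[OF vspan_subspace] pwf.linear_0[OF \<Lambda>] by auto
    show "u + w \<in> K" if "u \<in> K" "w \<in> K" for u w
      using that pw.subspace_add[OF vspan_subspace] pwf.linear_add[OF \<Lambda>] unfolding K_def by auto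
    show "pointwise_scale c w \<in> K" if "w \<in> K" for c w
      using that pw.subspace_scale[OF vspan_subspace] pwf.linear_scale[OF \<Lambda>] unfolding K_def by auto
  qed
  have "v \<notin> K" using q'(1) by (simp add: K_def)
  from separating_functional[OF K this] obtain \<mu> where \<mu>: "functional \<mu>" "\<forall>w\<in>K. \<mu> w = 0" "\<mu> v = 1" by blast
  let ?\<Lambda> = "\<Lambda>(b0 := \<mu>)"
  have \<Lambda>': "\<forall>a<s. functional (?\<Lambda> a)" using \<Lambda> \<mu>(1) by simp
  have "ldet s ?\<Lambda> (x q0) \<noteq> 0"
    by (rule ldet_replace[OF \<Lambda> q0(2) \<mu>(1) b0, of y]) (use y \<mu>(3) in \<open>auto simp: v_def\<close>)
  then have nz': "\<tau> ?\<Lambda> q0 \<noteq> 0" using q0(1) by (simp add: \<tau>_def)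
  have "J \<subseteq> {..<s}" using insert.prems(1) by simp
  from insert.IH[OF this \<Lambda>' nz'] obtain T
    where T: "\<forall>j<Suc (card J). \<forall>a<s. functional (T j a)"
      "\<forall>j<Suc (card J). \<forall>a\<in>{..<s} - J. T j a = ?\<Lambda> a"
      "vindep pointwise_scale (Suc (card J)) (\<lambda>j. \<tau> (T j))" by (elim exE conjE)
  \<comment> \<open>If \<open>T j\<close> were nondegenerate at q', the vector dual to the index b0
    would lie in K, where \<mu> is 0, although \<mu> takes the value 1 on it.\<close>
  have sing: "\<tau> (T j) q' = 0" if j: "j < Suc (card J)" for j
  proof (rule ccontr)
    assume "\<tau> (T j) q' \<noteq> 0"
    then have n: "ldet s (T j) (x q') \<noteq> 0" by (auto simp: \<tau>_def split: if_splits)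
    have "\<And>a. a < s \<Longrightarrow> functional (T j a)" using T(1) j by simp
    from dual_vectors[OF this n] obtain z
      where z: "\<forall>i<s. z i \<in> vspan pointwise_scale s (x q') \<and> (\<forall>a<s. T j a (z i) = (if a = i then 1 else 0))" ..
    have TJ: "T j a = ?\<Lambda> a" if "a \<in> {..<s} - J" for a using T(2) j that by blast
    have "\<Lambda> a (z b0) = 0" if a: "a \<in> {..<s} - insert b0 J" for a
    proof -
      have "T j a = \<Lambda> a" using TJ[of a] a by simp
      moreover have "T j a (z b0) = 0" using z b0 a by simp
      ultimately show ?thesis by simp
    qed
    then have "z b0 \<in> K" using z b0 by (simp add: K_def)
    then have "\<mu> (z b0) = 0" using \<mu>(2) by blast
    moreover have "T j b0 = \<mu>" using TJ[of b0] b0 insert.hyps(2) by simp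
    moreover have "T j b0 (z b0) = 1" using z b0 by simp
    ultimately show False by simp
  qed
  define T' where "T' j = (case j of 0 \<Rightarrow> \<Lambda> | Suc i \<Rightarrow> T i)" for j
  have card: "card (insert b0 J) = Suc (card J)" using insert.hyps by simp
  have "vindep pointwise_scale (Suc (Suc (card J))) (\<lambda>j. \<tau> (T' j))"
    unfolding vindep_def
  proof (rule allI, rule impI)
    fix c assume c: "(\<Sum>j<Suc (Suc (card J)). pointwise_scale (c j) (\<tau> (T' j))) = 0"
    then have e: "pointwise_scale (c 0) (\<tau> \<Lambda>) + (\<Sum>j<Suc (card J). pointwise_scale (c (Suc j)) (\<tau> (T j))) = 0"
      unfolding sum.lessThan_Suc_shift[of _ "Suc (card J)"] by (simp only: T'_def nat.case)
    have "c 0 * \<tau> \<Lambda> q' + (\<Sum>j<Suc (card J). c (Suc j) * \<tau> (T j) q') = 0"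
      using fun_cong[OF e, of q'] by (simp only: plus_fun_apply sum_fun_app pointwise_scale_def zero_fun_apply)
    moreover have "(\<Sum>j<Suc (card J). c (Suc j) * \<tau> (T j) q') = 0" by (rule sum.neutral) (use sing in auto)
    ultimately have c0: "c 0 = 0" using q'(2) by simp
    then have "(\<Sum>j<Suc (card J). pointwise_scale (c (Suc j)) (\<tau> (T j))) = 0"
      using e by (simp only: pw.scale_zero_left add_0_left)
    from vindepD[OF T(3) this] c0 show "\<forall>i<Suc (Suc (card J)). c i = 0" by (auto simp: less_Suc_eq_0_disj)
  qed
  moreover have "\<forall>j<Suc (Suc (card J)). \<forall>a<s. functional (T' j a)"
    using T(1) \<Lambda> by (auto simp: T'_def split: nat.splits)
  moreover have "T' j a = \<Lambda> a" if "j < Suc (Suc (card J))" "a \<in> {..<s} - insert b0 J" for j a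
  proof (cases j)
    case (Suc i)
    then have "T i a = ?\<Lambda> a" using T(2) that by simp
    then show ?thesis using Suc that by (simp add: T'_def)
  qed (simp add: T'_def)
  ultimately show ?case unfolding card by (intro exI[of _ T'] conjI allI impI ballI) auto
qed

subsection \<open>Line bundles from transition functions\<close>

context smooth_curve begin

text \<open>A converse to \<open>section_iff\<close>: nowhere vanishing functions \<open>l p\<close>
  with regular quotients become the generators of a line bundle, whether or not they are regular
  themselves.\<close>

lemma glued_line_bundle:
  assumes N: "\<And>p. p \<in> C \<Longrightarrow> open_on C (N p) \<and> p \<in> N p"
    and l: "\<And>p q. p \<in> C \<Longrightarrow> q \<in> N p \<Longrightarrow> l p q \<noteq> 0"
    and reg: "\<And>p p' q. p \<in> C \<Longrightarrow> p' \<in> C \<Longrightarrow> q \<in> N p \<Longrightarrow> q \<in> N p' \<Longrightarrow> reg_at q (\<lambda>x. l p x / l p' x)"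
  defines "A \<equiv> \<lambda>U. {h. (\<forall>q. q \<notin> U \<longrightarrow> h q = 0) \<and> (\<forall>p\<in>U. reg_at p (\<lambda>x. h x / l p x))}"
  shows "p \<in> C \<Longrightarrow> local_frame (*) C 1 A (N p) (\<lambda>_. l p)" and "line_bundle C A"
proof -
  have NC: "q \<in> C" if "p \<in> C" "q \<in> N p" for p q using open_cofinite[of "N p" q] N that by blast
  show fr: "local_frame (*) C 1 A (N p) (\<lambda>_. l p)" if p: "p \<in> C" for p
    unfolding local_frame_def
  proof (intro conjI allI impI ballI)
    show "open_on C (N p)" using N p by blast
    show "c i = 0" if "q \<in> N p" "(\<Sum>i<1. c i * l p q) = 0" "i < 1" for q c and i :: nat
      using that l[OF p that(1)] by simp
    fix V assume "open_on C V \<and> V \<subseteq> N p"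
    then have V: "open_on C V" "V \<subseteq> N p" by auto
    show "A V = {(\<lambda>q. \<Sum>i<(1::nat). f i q * l p q) |f. \<forall>i<1. f i \<in> regular C V}"
    proof (intro equalityI subsetI)
      fix h assume h: "h \<in> A V"
      have "restrict_to V (\<lambda>x. h x / l p x) \<in> regular C V"
      proof (rule restrict_regular[OF V(1)])
        fix q assume q: "q \<in> V"
        then have qN: "q \<in> N p" and qC: "q \<in> C" using V NC p by auto
        have r: "reg_at q (\<lambda>x. h x / l q x)" using h q by (simp add: A_def)
        have r': "reg_at q (\<lambda>x. h x / l q x * (l q x / l p x))"
          using qN qC N[OF qC] by (intro rg_mult r reg p) auto
        show "reg_at q (\<lambda>x. h x / l p x)"
        proof (rule reg_at_cong_on[OF _ _ _ r'])
          show "open_on C (N p \<inter> N q)" using N p qC open_Int by blast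
          show "q \<in> N p \<inter> N q" using N qC qN by blast
          show "h x / l q x * (l q x / l p x) = h x / l p x" if "x \<in> N p \<inter> N q" for x using l[OF qC, of x] that by simp
        qed
      qed
      moreover have "h = (\<lambda>q. \<Sum>i<(1::nat). restrict_to V (\<lambda>x. h x / l p x) q * l p q)"
        using h l[OF p] V(2) by (auto simp: fun_eq_iff restrict_to_def A_def)
      ultimately show "h \<in> {(\<lambda>q. \<Sum>i<(1::nat). f i q * l p q) |f. \<forall>i<1. f i \<in> regular C V}"
        unfolding mem_Collect_eq by (intro exI[of _ "\<lambda>_. restrict_to V (\<lambda>x. h x / l p x)"] conjI) auto
    next
      fix h assume "h \<in> {(\<lambda>q. \<Sum>i<(1::nat). f i q * l p q) |f. \<forall>i<1. f i \<in> regular C V}"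
      then have "\<exists>f. h = (\<lambda>q. \<Sum>i<(1::nat). f i q * l p q) \<and> (\<forall>i<(1::nat). f i \<in> regular C V)" by simp
      then obtain f where f: "h = (\<lambda>q. \<Sum>i<(1::nat). f i q * l p q)" "\<forall>i<(1::nat). f i \<in> regular C V" by (elim exE conjE)
      have f0: "f 0 \<in> regular C V" using f(2) by simp
      have h: "h = (\<lambda>q. f 0 q * l p q)" using f(1) by simp
      show "h \<in> A V" unfolding A_def mem_Collect_eq
      proof (intro conjI allI impI ballI)
        show "h q = 0" if "q \<notin> V" for q using f0 regular_iff[OF V(1)] that by (simp add: h)
        fix q assume q: "q \<in> V"
        then have qN: "q \<in> N p" and qC: "q \<in> C" using V NC p by auto
        have "reg_at q (\<lambda>x. f 0 x * (l p x / l q x))"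
          using qN qC N[OF qC] by (intro rg_mult regular_reg_at[OF V(1) f0 q] reg p) auto
        then show "reg_at q (\<lambda>x. h x / l q x)" by (simp add: h)
      qed
    qed
  qed
  have cong: "reg_at p (\<lambda>x. k x / l p x)" if "open_on C V" "p \<in> V" "\<And>q. q \<in> V \<Longrightarrow> h q = k q" "reg_at p (\<lambda>x. h x / l p x)" for V p h k
    by (rule reg_at_cong_on[OF that(1,2) _ that(4)]) (simp add: that(3))
  have "is_fun_sheaf C A"
    unfolding is_fun_sheaf_def
  proof (intro conjI allI impI)
    show "f p = 0" if "open_on C U \<and> f \<in> A U" "p \<notin> U" for U f p using that by (simp add: A_def)
    show "restrict_to V f \<in> A V" if h: "open_on C U \<and> open_on C V \<and> V \<subseteq> U \<and> f \<in> A U" for U V f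
    proof -
      have "reg_at p (\<lambda>x. restrict_to V f x / l p x)" if "p \<in> V" for p
        by (rule cong[of V _ f]) (use h that in \<open>auto simp: A_def restrict_to_def\<close>)
      then show ?thesis by (simp add: A_def restrict_to_def)
    qed
    show "f \<in> A U" if h: "open_on C U \<and> (\<forall>p. p \<notin> U \<longrightarrow> f p = 0) \<and>
        (\<forall>p\<in>U. \<exists>V. open_on C V \<and> p \<in> V \<and> V \<subseteq> U \<and> restrict_to V f \<in> A V)" for U f
    proof -
      have "reg_at p (\<lambda>x. f x / l p x)" if pU: "p \<in> U" for p
      proof -
        from h[THEN conjunct2, THEN conjunct2, THEN bspec, OF pU]
        obtain V where V: "open_on C V" "p \<in> V" "V \<subseteq> U" "restrict_to V f \<in> A V" by (elim exE conjE)
        from V(4) have "reg_at p (\<lambda>x. restrict_to V f x / l p x)" using V(2) by (simp add: A_def)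
        then show ?thesis by (rule cong[OF V(1,2), rotated]) (simp add: restrict_to_def)
      qed
      then show ?thesis using h[THEN conjunct2, THEN conjunct1] by (simp add: A_def)
    qed
  qed
  moreover have "\<forall>p\<in>C. \<exists>M e. p \<in> M \<and> local_frame (*) C 1 A M e"
  proof
    fix p assume p: "p \<in> C"
    have "p \<in> N p \<and> local_frame (*) C 1 A (N p) (\<lambda>_. l p)" by (rule conjI[OF conjunct2[OF N[OF p]] fr[OF p]])
    then have "\<exists>e. p \<in> N p \<and> local_frame (*) C 1 A (N p) e" by (rule exI[of _ "\<lambda>_. l p"])
    then show "\<exists>M e. p \<in> M \<and> local_frame (*) C 1 A M e" by (rule exI[of _ "N p"])
  qed
  ultimately show "line_bundle C A" unfolding line_bundle_def vector_bundle_def by (rule conjI)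
qed

end

subsection \<open>The dual determinant of a subbundle of the kernel bundle\<close>

locale sub_data = kernel_data C g L N e r b
  for C :: "('n::finite, 'k::field) point set" and g L N e r b +
  fixes S :: "('n, 'k, ('n, 'k) point \<Rightarrow> 'k) fun_sheaf" and s :: nat
    and NS :: "('n, 'k) point \<Rightarrow> ('n, 'k) point set"
    and f :: "('n, 'k) point \<Rightarrow> nat \<Rightarrow> ('n, 'k) point \<Rightarrow> ('n, 'k) point \<Rightarrow> 'k"
  assumes S_vb: "vector_bundle pointwise_scale C s S"
    and S_fr: "\<And>p. p \<in> C \<Longrightarrow> p \<in> NS p \<and> local_frame pointwise_scale C s S (NS p) (f p)"
    and S_M: "\<And>U. open_on C U \<Longrightarrow> S U \<subseteq> M U"
begin

lemma pNS: "p \<in> C \<Longrightarrow> p \<in> NS p" and FrS: "p \<in> C \<Longrightarrow> local_frame pointwise_scale C s S (NS p) (f p)"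
  using S_fr by auto

lemma NSo: "p \<in> C \<Longrightarrow> open_on C (NS p)" using frame_open[OF FrS] .

lemma NSC: "p \<in> C \<Longrightarrow> q \<in> NS p \<Longrightarrow> q \<in> C" using open_cofinite[OF NSo] by blast

lemma frame_in_kernel:
  assumes p: "p \<in> C" and q: "q \<in> NS p" and i: "i < s"
  shows "f p i q \<in> L C" and "f p i q q = 0" and "m < Suc r \<Longrightarrow> reg_at q (\<lambda>x. cb (f p i x) m)"
proof -
  have "(\<lambda>x. if x \<in> NS p then f p i x else 0) \<in> M (NS p)"
    using frame_elem[OF pw_vs FrS[OF p] NSo[OF p] order_refl i] S_M[OF NSo[OF p]] by (rule rev_subsetD)
  note M = this[unfolded kernel_iff[OF NSo[OF p]]]
  show "f p i q \<in> L C" using M[THEN conjunct2, THEN conjunct1, rule_format, OF q] q by simp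
  show "f p i q q = 0" using M[THEN conjunct2, THEN conjunct1, rule_format, OF q] q by simp
  assume m: "m < Suc r"
  show "reg_at q (\<lambda>x. cb (f p i x) m)"
    by (rule reg_at_cong_on[OF NSo[OF p] q _ M[THEN conjunct2, THEN conjunct2, rule_format, OF m q]]) simp
qed

lemma frame_in_kf:
  assumes p: "p \<in> C" and q: "q \<in> NS p" and i: "i < s" and k: "k \<le> r" "b k q \<noteq> 0"
  shows "f p i q \<in> vspan pointwise_scale r (\<lambda>j. kf k j q)"
  using kf_expand[OF k frame_in_kernel(1,2)[OF p q i]] by (rule vspanI)

lemma rank_le: "s \<le> r"
proof -
  obtain p where p: "p \<in> C" using X_ex by blast
  obtain k where k: "k \<le> r" "b k p \<noteq> 0" using b_nonvanishing[OF p] by blast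
  show ?thesis
    by (rule vindep_card_le[OF pw_vs frame_indep[OF FrS[OF p] pNS[OF p]] frame_in_kf[OF p pNS[OF p] _ k]])
qed

lemma full_rank_frame:
  assumes sr: "s = r" and p: "p \<in> C" and q: "q \<in> NS p" and k: "k \<le> r" "b k q \<noteq> 0"
  shows "w \<in> vspan pointwise_scale r (\<lambda>j. kf k j q) \<Longrightarrow> w \<in> vspan pointwise_scale r (\<lambda>i. f p i q)"
    and "fdet pointwise_scale r (\<lambda>i. f p i q) (\<lambda>j. kf k j q) \<noteq> 0"
proof -
  have fi: "vindep pointwise_scale r (\<lambda>i. f p i q)" using frame_indep[OF FrS[OF p] q] sr by simp
  have fk: "f p i q \<in> vspan pointwise_scale r (\<lambda>j. kf k j q)" if "i < r" for i
    using frame_in_kf[OF p q _ k] that sr by simp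
  show full: "w \<in> vspan pointwise_scale r (\<lambda>i. f p i q)" if "w \<in> vspan pointwise_scale r (\<lambda>j. kf k j q)" for w
    by (rule vindep_span_full[OF pw_vs fi fk that])
  have "fdet pointwise_scale r (\<lambda>i. kf k i q) (\<lambda>i. kf k i q) =
      fdet pointwise_scale r (\<lambda>i. kf k i q) (\<lambda>i. f p i q) * fdet pointwise_scale r (\<lambda>i. f p i q) (\<lambda>j. kf k j q)"
    by (rule fdet_mult[OF pw_vs kf_indep[OF k(1)] full fk]) (rule vspan_base[OF pw_vs])
  then show "fdet pointwise_scale r (\<lambda>i. f p i q) (\<lambda>j. kf k j q) \<noteq> 0"
    using fdet_self[OF pw_vs kf_indep[OF k(1)]] by auto
qed

text \<open>By Cramer's rule the coordinates of a section of M in a frame of S are quotients of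
  determinants with regular entries. The denominator vanishes nowhere because the frame of S is
  independent at every point, so the coordinates are regular.\<close>

lemma full_rank_eq:
  assumes sr: "s = r" and U: "open_on C U"
  shows "S U = M U"
proof (intro equalityI S_M[OF U] subsetI)
  fix \<phi> assume \<phi>: "\<phi> \<in> M U"
  note M = \<phi>[unfolded kernel_iff[OF U]]
  show "\<phi> \<in> S U"
  proof (rule bundle_glue[OF S_vb U])
    show "\<phi> p = 0" if "p \<notin> U" for p using M that by blast
    fix p assume p: "p \<in> U"
    have pC: "p \<in> C" using open_cofinite[OF U p] p by blast
    obtain k where k: "k \<le> r" "b k p \<noteq> 0" using b_nonvanishing[OF pC] by blast
    define V where "V = U \<inter> NS p \<inter> nonvan k"
    have V: "open_on C V" unfolding V_def using open_Int[OF open_Int[OF U NSo[OF pC]] D_open[OF k(1)]] .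
    have pV: "p \<in> V" using p pC k pNS[OF pC] by (simp add: V_def nonvan_def)
    let ?f = "\<lambda>q i. f p i q" and ?e = "\<lambda>q j. kf k j q"
    have Vq: "q \<in> U" "q \<in> NS p" "q \<in> C" "b k q \<noteq> 0" if "q \<in> V" for q using that by (auto simp: V_def nonvan_def)
    have \<phi>q: "\<phi> q \<in> L C" "\<phi> q q = 0" if "q \<in> V" for q using M Vq(1)[OF that] by auto
    have \<phi>s: "\<phi> q \<in> vspan pointwise_scale r (?f q)" if "q \<in> V" for q
    proof -
      have "\<phi> q \<in> vspan pointwise_scale r (?e q)"
        using kf_expand[OF k(1) Vq(4)[OF that] \<phi>q[OF that]] by (rule vspanI)
      then show ?thesis by (rule full_rank_frame(1)[OF sr pC Vq(2)[OF that] k(1) Vq(4)[OF that]])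
    qed
    have crd_reg: "reg_at q (\<lambda>x. crd pointwise_scale r (?f x) (\<phi> x) i)" if q: "q \<in> V" and i: "i < r" for q i
    proof -
      have qC: "q \<in> C" by (rule Vq(3)[OF q])
      have jr: "jj k j < Suc r" if "j < r" for j using that by (simp add: jj_def)
      \<comment> \<open>The numerator matrix in Cramer's rule: coordinates, in a frame of the kernel
        bundle, of the frame of S with its i-th vector replaced by \<phi>.\<close>
      define a where "a i' j x = (if i' = i then cb (\<phi> x) (jj k j) else cb (f p i' x) (jj k j))" for i' j x
      have ra: "reg_at q (a i' j)" if "i' < r" "j < r" for i' j
      proof (cases "i' = i")
        case True
        then show ?thesis using M Vq(1)[OF q] jr[OF that(2)] by (simp add: a_def[abs_def])
      next
        case False
        then show ?thesis using frame_in_kernel(3)[OF pC Vq(2)[OF q] _ jr[OF that(2)]] that(1) sr by (simp add: a_def[abs_def])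
      qed
      have num: "fdet pointwise_scale r ((?f x)(i := \<phi> x)) (?e x) = det (mat r r (\<lambda>(i', j). a i' j x))" if x: "x \<in> V" for x
      proof -
        have "crd pointwise_scale r (?e x) (((?f x)(i := \<phi> x)) i') j = a i' j x" if "i' < r" "j < r" for i' j
        proof (cases "i' = i")
          case True
          then show ?thesis using crd_kf[OF k(1) Vq(4)[OF x] \<phi>q[OF x] that(2)] by (simp add: a_def)
        next
          case False
          have "i' < s" using that sr by simp
          from crd_kf[OF k(1) Vq(4)[OF x] frame_in_kernel(1,2)[OF pC Vq(2)[OF x] this] that(2)] False
          show ?thesis by (simp add: a_def)
        qed
        then have "mat r r (\<lambda>(i', j). crd pointwise_scale r (?e x) (((?f x)(i := \<phi> x)) i') j) = mat r r (\<lambda>(i', j). a i' j x)"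
          by (intro eq_matI) auto
        then show ?thesis by (simp add: fdet_def)
      qed
      have den: "fdet pointwise_scale r (?f x) (?e x) = det (mat r r (\<lambda>(i', j). cb (f p i' x) (jj k j)))" if x: "x \<in> V" for x
      proof -
        have "crd pointwise_scale r (?e x) (f p i' x) j = cb (f p i' x) (jj k j)" if "i' < r" "j < r" for i' j
          using crd_kf[OF k(1) Vq(4)[OF x] frame_in_kernel(1,2)[OF pC Vq(2)[OF x]] that(2)] that(1) sr by simp
        then have "mat r r (\<lambda>(i', j). crd pointwise_scale r (?e x) (f p i' x) j) = mat r r (\<lambda>(i', j). cb (f p i' x) (jj k j))"
          by (intro eq_matI) auto
        then show ?thesis by (simp add: fdet_def)
      qed
      have r1: "reg_at q (\<lambda>x. det (mat r r (\<lambda>(i', j). a i' j x)))" by (rule reg_det[OF qC ra])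
      have r2: "reg_at q (\<lambda>x. det (mat r r (\<lambda>(i', j). cb (f p i' x) (jj k j))))"
        by (rule reg_det[OF qC]) (use frame_in_kernel(3)[OF pC Vq(2)[OF q]] jr sr in simp)
      have "det (mat r r (\<lambda>(i', j). cb (f p i' q) (jj k j))) \<noteq> 0"
        using full_rank_frame(2)[OF sr pC Vq(2)[OF q] k(1) Vq(4)[OF q]] den[OF q] by simp
      from rg_mult[OF qC r1 rg_inverse[OF qC r2 this]]
      have r3: "reg_at q (\<lambda>x. det (mat r r (\<lambda>(i', j). a i' j x)) * inverse (det (mat r r (\<lambda>(i', j). cb (f p i' x) (jj k j)))))" .
      show ?thesis
      proof (rule reg_at_cong_on[OF V q _ r3])
        fix x assume x: "x \<in> V"
        have fi: "vindep pointwise_scale r (?f x)" using frame_indep[OF FrS[OF pC] Vq(2)[OF x]] sr by simp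
        have fk: "?f x i \<in> vspan pointwise_scale r (?e x)" if "i < r" for i
          using frame_in_kf[OF pC Vq(2)[OF x] _ k(1) Vq(4)[OF x]] that sr by simp
        have "crd pointwise_scale r (?f x) (\<phi> x) i * fdet pointwise_scale r (?f x) (?e x) = fdet pointwise_scale r ((?f x)(i := \<phi> x)) (?e x)"
          by (rule crd_cramer[OF pw_vs fi kf_indep[OF k(1)] fk \<phi>s[OF x] i])
        moreover have "fdet pointwise_scale r (?f x) (?e x) \<noteq> 0"
          by (rule full_rank_frame(2)[OF sr pC Vq(2)[OF x] k(1) Vq(4)[OF x]])
        ultimately show "det (mat r r (\<lambda>(i', j). a i' j x)) * inverse (det (mat r r (\<lambda>(i', j). cb (f p i' x) (jj k j)))) =
            crd pointwise_scale r (?f x) (\<phi> x) i"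
          unfolding num[OF x] den[OF x] by (simp add: field_simps)
      qed
    qed
    have "(\<lambda>q. if q \<in> V then \<Sum>i<s. pointwise_scale (crd pointwise_scale r (?f q) (\<phi> q) i) (f p i q) else 0) \<in> S V"
      by (rule frame_combination[OF pw_vs FrS[OF pC] V, of "\<lambda>i q. crd pointwise_scale r (?f q) (\<phi> q) i"])
        (use crd_reg sr in \<open>auto simp: V_def\<close>)
    moreover have "(\<lambda>q. if q \<in> V then \<Sum>i<s. pointwise_scale (crd pointwise_scale r (?f q) (\<phi> q) i) (f p i q) else 0) = restrict_to V \<phi>"
    proof
      fix q show "(if q \<in> V then \<Sum>i<s. pointwise_scale (crd pointwise_scale r (?f q) (\<phi> q) i) (f p i q) else 0) = restrict_to V \<phi> q"
        using crd_sum[OF \<phi>s, of q] sr by (simp add: restrict_to_def)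
    qed
    ultimately have SV: "restrict_to V \<phi> \<in> S V" by simp
    have "V \<subseteq> U" by (auto simp: V_def)
    then show "\<exists>V. open_on C V \<and> p \<in> V \<and> V \<subseteq> U \<and> restrict_to V \<phi> \<in> S V"
      using V pV SV by (intro exI[of _ V] conjI)
  qed
qed

lemma full_rank_degree:
  assumes sr: "s = r" shows "vb_degree pointwise_scale C S = vb_degree pointwise_scale C M"
proof -
  obtain p0 where p0: "p0 \<in> C" using X_ex by blast
  have "p \<in> NS p \<and> local_frame pointwise_scale C s M (NS p) (f p)" if p: "p \<in> C" for p
    using S_fr[OF p] full_rank_eq[OF sr] unfolding local_frame_def by auto
  from degree_formula(2)[OF pw_vs kernel_vector_bundle[folded sr] this p0] degree_formula(2)[OF pw_vs S_vb S_fr p0]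
  show ?thesis by simp
qed

text \<open>
  The fibre at \<open>q\<close> is identified with \<open>'k\<close> by the frame \<open>f q\<close> chosen at \<open>q\<close> itself; \<open>\<delta> p\<close> is the
  local generator dual to the wedge product of the frame \<open>f p\<close>.
\<close>

definition \<delta> :: "('n, 'k) point \<Rightarrow> ('n, 'k) point \<Rightarrow> 'k" where
  "\<delta> p q = fdet pointwise_scale s (\<lambda>i. f q i q) (\<lambda>i. f p i q)"

definition det_dual :: "('n, 'k, 'k) fun_sheaf" where
  "det_dual U = {h. (\<forall>q. q \<notin> U \<longrightarrow> h q = 0) \<and> (\<forall>p\<in>U. reg_at p (\<lambda>x. h x / \<delta> p x))}"

lemma \<delta>_nonzero: assumes "p \<in> C" "q \<in> NS p" shows "\<delta> p q \<noteq> 0"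
  unfolding \<delta>_def using NSC[OF assms] assms by (intro frames_fdet(2)[OF pw_vs FrS FrS] pNS)

lemma \<delta>_mult:
  assumes "p \<in> C" "p' \<in> C" "q \<in> NS p" "q \<in> NS p'"
  shows "\<delta> p q = \<delta> p' q * fdet pointwise_scale s (\<lambda>i. f p' i q) (\<lambda>i. f p i q)"
proof -
  have q: "q \<in> C" by (rule NSC[OF assms(1,3)])
  show ?thesis unfolding \<delta>_def
    by (rule fdet_mult[OF pw_vs frame_indep[OF FrS[OF assms(1)] assms(3)]])
      (rule frames_span(1)[OF pw_vs FrS[OF q] FrS[OF assms(2)] pNS[OF q] assms(4)], assumption,
       rule frames_span(1)[OF pw_vs FrS[OF assms(2)] FrS[OF assms(1)] assms(4,3)], assumption)
qed

lemma \<delta>_quotient: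
  assumes "p \<in> C" "p' \<in> C" "q \<in> NS p" "q \<in> NS p'"
  shows "\<delta> p q / \<delta> p' q = fdet pointwise_scale s (\<lambda>i. f p' i q) (\<lambda>i. f p i q)"
  using \<delta>_mult[OF assms] \<delta>_nonzero[OF assms(2,4)] by simp

lemma \<delta>_reg:
  assumes "p \<in> C" "p' \<in> C" "q \<in> NS p" "q \<in> NS p'" shows "reg_at q (\<lambda>x. \<delta> p x / \<delta> p' x)"
proof (rule reg_at_cong_on[OF open_Int[OF NSo[OF assms(1)] NSo[OF assms(2)]] _ _
      frames_fdet(1)[OF pw_vs FrS[OF assms(2)] FrS[OF assms(1)] assms(4,3)]])
  show "q \<in> NS p \<inter> NS p'" using assms by simp
  fix x assume "x \<in> NS p \<inter> NS p'"
  then show "fdet pointwise_scale s (\<lambda>i. f p' i x) (\<lambda>i. f p i x) = \<delta> p x / \<delta> p' x"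
    using \<delta>_quotient[OF assms(1,2), of x] by simp
qed

lemma det_dual_line: "line_bundle C det_dual"
  and det_dual_frame: "p \<in> C \<Longrightarrow> local_frame (*) C 1 det_dual (NS p) (\<lambda>_. \<delta> p)"
proof -
  have N: "open_on C (NS p) \<and> p \<in> NS p" if "p \<in> C" for p using NSo[OF that] pNS[OF that] by simp
  show "line_bundle C det_dual" unfolding det_dual_def[abs_def]
    by (rule glued_line_bundle(2)[where N = NS and l = \<delta>])
      (rule N \<delta>_nonzero \<delta>_reg; assumption)+
  show "local_frame (*) C 1 det_dual (NS p) (\<lambda>_. \<delta> p)" if "p \<in> C" unfolding det_dual_def[abs_def]
    by (rule glued_line_bundle(1)[where N = NS and l = \<delta>])
      ((rule N \<delta>_nonzero \<delta>_reg; assumption) | rule that)+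
qed

lemma det_dual_data: "good_line C g det_dual NS (\<lambda>p _. \<delta> p)"
  by unfold_locales (use det_dual_line det_dual_frame pNS in auto)

text \<open>The transition functions of det S and of its dual are inverse to each other, so all
  orders change sign.\<close>

lemma det_dual_degree: "vb_degree (*) C det_dual = - vb_degree pointwise_scale C S"
proof -
  interpret A: good_line C g det_dual NS "\<lambda>p _. \<delta> p" by (rule det_dual_data)
  obtain p0 where p0: "p0 \<in> C" using X_ex by blast
  let ?h = "\<lambda>p q. fdet pointwise_scale s (\<lambda>i. f p0 i q) (\<lambda>i. f p i q)"
  have eq: "ordr p (?h p) = - ordr p (\<lambda>q. \<delta> p0 q / \<delta> p q)" if p: "p \<in> C" for p
  proof -
    have nz: "nz (\<lambda>q. \<delta> p0 q / \<delta> p q)" using A.l_quotient_nz[OF p0 p] unfolding A.\<l>_def .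
    have "(\<lambda>q. inverse (\<delta> p0 q / \<delta> p q)) \<simeq> ?h p"
      unfolding aeq_def using open_gen[OF NSo[OF p] pNS[OF p]] open_gen[OF NSo[OF p0] pNS[OF p0]]
    proof eventually_elim
      case (elim q)
      from \<delta>_quotient[OF p p0 elim] show ?case by simp
    qed
    from ordr_cong[OF p nz_inverse[OF nz] this] ordr_inverse[OF p nz] show ?thesis by simp
  qed
  have S: "{p \<in> C. ordr p (?h p) \<noteq> 0} = {p \<in> C. ordr p (\<lambda>q. \<delta> p0 q / \<delta> p q) \<noteq> 0}" using eq by auto
  have "vb_degree pointwise_scale C S = (\<Sum>p\<in>{p \<in> C. ordr p (?h p) \<noteq> 0}. ordr p (?h p))"
    by (rule degree_formula(2)[OF pw_vs S_vb S_fr p0])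
  also have "\<dots> = (\<Sum>p\<in>{p \<in> C. ordr p (\<lambda>q. \<delta> p0 q / \<delta> p q) \<noteq> 0}. - ordr p (\<lambda>q. \<delta> p0 q / \<delta> p q))"
    unfolding S by (rule sum.cong) (use eq in auto)
  also have "\<dots> = - vb_degree (*) C det_dual"
    using A.line_degree(2)[OF p0] unfolding A.\<l>_def by (simp add: sum_negf)
  finally show ?thesis by simp
qed

text \<open>The form \<Lambda> 0 \<and> ... \<and> \<Lambda> (s - 1) restricted to the fibre of S at
  q and read in the frame \<open>f q\<close> chosen there, in accordance with the fibres of
  \<open>det_dual\<close>.\<close>

definition \<tau> :: "(nat \<Rightarrow> (('n, 'k) point \<Rightarrow> 'k) \<Rightarrow> 'k) \<Rightarrow> ('n, 'k) point \<Rightarrow> 'k" where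
  "\<tau> \<Lambda> = (\<lambda>q. if q \<in> C then ldet s \<Lambda> (\<lambda>i. f q i q) else 0)"

text \<open>Relative to the generator \<open>\<delta> p\<close> the section is the determinant of
  the values \<open>\<Lambda> a (f p i x)\<close>. These are regular in x because the frame has
  regular coordinates in the fixed basis b and the functionals are constant.\<close>

lemma \<tau>_section:
  assumes \<Lambda>: "\<And>a. a < s \<Longrightarrow> functional (\<Lambda> a)" shows "\<tau> \<Lambda> \<in> det_dual C"
  unfolding det_dual_def mem_Collect_eq
proof (intro conjI allI impI ballI)
  show "\<tau> \<Lambda> q = 0" if "q \<notin> C" for q using that by (simp add: \<tau>_def)
  fix p assume p: "p \<in> C"
  have r: "reg_at p (\<lambda>x. det (mat s s (\<lambda>(a, i). \<Lambda> a (f p i x))))"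
  proof (rule reg_det[OF p])
    fix a i assume ai: "a < s" "i < s"
    have r: "reg_at p (\<lambda>x. \<Sum>m<Suc r. cb (f p i x) m * \<Lambda> a (b m))"
      by (intro rg_sum[OF p] rg_mult[OF p] rg_const[OF p] frame_in_kernel(3)[OF p pNS[OF p] ai(2)]) auto
    show "reg_at p (\<lambda>x. \<Lambda> a (f p i x))"
    proof (rule reg_at_cong_on[OF NSo[OF p] pNS[OF p] _ r])
      fix x assume x: "x \<in> NS p"
      have "\<Lambda> a (f p i x) = \<Lambda> a (\<Sum>m<Suc r. pointwise_scale (cb (f p i x) m) (b m))"
        using arg_cong[OF cb_sum[OF frame_in_kernel(1)[OF p x ai(2)]], of "\<Lambda> a"] .
      also have "\<dots> = (\<Sum>m<Suc r. cb (f p i x) m * \<Lambda> a (b m))" by (rule functional_sum[OF \<Lambda>[OF ai(1)]])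
      finally show "(\<Sum>m<Suc r. cb (f p i x) m * \<Lambda> a (b m)) = \<Lambda> a (f p i x)" by (rule sym)
    qed
  qed
  show "reg_at p (\<lambda>x. \<tau> \<Lambda> x / \<delta> p x)"
  proof (rule reg_at_cong_on[OF NSo[OF p] pNS[OF p] _ r])
    fix x assume x: "x \<in> NS p"
    have xC: "x \<in> C" by (rule NSC[OF p x])
    have "ldet s \<Lambda> (\<lambda>i. f x i x) = ldet s \<Lambda> (\<lambda>i. f p i x) * \<delta> p x"
      unfolding \<delta>_def
      by (rule ldet_change, rule \<Lambda>, assumption, rule frames_span(1)[OF pw_vs FrS[OF xC] FrS[OF p] pNS[OF xC] x], assumption)
    then show "det (mat s s (\<lambda>(a, i). \<Lambda> a (f p i x))) = \<tau> \<Lambda> x / \<delta> p x"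
      using \<delta>_nonzero[OF p x] xC by (simp add: \<tau>_def ldet_def)
  qed
qed

lemma det_dual_h0: "\<exists>\<sigma>\<in>det_dual C. \<sigma> \<noteq> 0 \<and> s + 1 \<le> h0 C det_dual"
proof -
  interpret A: good_line C g det_dual NS "\<lambda>p _. \<delta> p" by (rule det_dual_data)
  have H1: "eventually (\<lambda>q. (if q \<in> C then ldet s \<Lambda> (\<lambda>i. f q i q) else 0) \<noteq> 0) gen"
    if "\<And>a. a < s \<Longrightarrow> functional (\<Lambda> a)" "(if q0 \<in> C then ldet s \<Lambda> (\<lambda>i. f q0 i q0) else 0) \<noteq> 0" for \<Lambda> q0
  proof -
    have "\<tau> \<Lambda> q0 \<noteq> 0" using that(2) unfolding \<tau>_def .
    then have "\<tau> \<Lambda> \<noteq> 0" by auto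
    from A.section_gen[OF \<tau>_section[OF that(1)] this] show ?thesis by (simp add: \<tau>_def)
  qed
  have H2: "eventually (\<lambda>q. v \<notin> vspan pointwise_scale s (\<lambda>i. f q i q)) gen"
    if q0: "q0 \<in> C" and v: "v \<in> vspan pointwise_scale s (\<lambda>i. f q0 i q0)" "v \<noteq> 0" for q0 v
  proof -
    obtain c where "v = (\<Sum>i<s. pointwise_scale (c i) (f q0 i q0))" using v(1) unfolding vspan_def by blast
    then have "v \<in> L C" using frame_in_kernel(1)[OF q0 pNS[OF q0]]
      by (auto intro!: pw.subspace_sum[OF global_subspace] pw.subspace_scale[OF global_subspace])
    from section_gen[OF this v(2)] gen_X show ?thesis
    proof eventually_elim
      case (elim q)
      show ?case
      proof
        assume "v \<in> vspan pointwise_scale s (\<lambda>i. f q i q)"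
        then obtain c where "v = (\<Sum>i<s. pointwise_scale (c i) (f q i q))" unfolding vspan_def by blast
        then have "v q = 0" using frame_in_kernel(2)[OF elim(2) pNS[OF elim(2)]]
          by (simp add: sum_fun_app pointwise_scale_def)
        then show False using elim(1) by simp
      qed
    qed
  qed
  obtain p0 where p0: "p0 \<in> C" using X_ex by blast
  obtain \<Lambda> where \<Lambda>: "\<forall>a<s. functional (\<Lambda> a)" "ldet s \<Lambda> (\<lambda>i. f p0 i p0) = 1"
    using dual_basis[OF frame_indep[OF FrS[OF p0] pNS[OF p0]]] by (elim exE conjE)
  have nz: "(if p0 \<in> C then ldet s \<Lambda> (\<lambda>i. f p0 i p0) else 0) \<noteq> 0" using \<Lambda>(2) p0 by simp
  \<comment> \<open>With all s indices free to change, the induction yields s + 1 independent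
    sections.\<close>
  have "\<exists>T. (\<forall>j<Suc (card {..<s}). \<forall>a<s. functional (T j a)) \<and>
      (\<forall>j<Suc (card {..<s}). \<forall>a\<in>{..<s} - {..<s}. T j a = \<Lambda> a) \<and>
      vindep pointwise_scale (Suc (card {..<s})) (\<lambda>j. \<tau> (T j))"
    unfolding \<tau>_def
    by (rule paranjape_ramanan[where F = gen, OF H1 H2 gen_nonbot finite_lessThan order_refl \<Lambda>(1) nz]; assumption)
  then obtain T where T: "\<forall>j<Suc s. \<forall>a<s. functional (T j a)" "vindep pointwise_scale (Suc s) (\<lambda>j. \<tau> (T j))"
    unfolding card_lessThan by (elim exE conjE)
  have in_A: "\<tau> (T j) \<in> det_dual C" if "j < Suc s" for j by (rule \<tau>_section) (use T(1) that in blast)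
  have "\<tau> \<Lambda> p0 \<noteq> 0" using nz by (simp add: \<tau>_def)
  then have nz': "\<tau> \<Lambda> \<noteq> 0" by auto
  have in': "\<tau> \<Lambda> \<in> det_dual C" by (rule \<tau>_section) (use \<Lambda>(1) in blast)
  have "Suc s \<le> h0 C det_dual" by (rule A.h0_lower_vindep[OF in' nz' T(2) in_A])
  then show ?thesis using in' nz' by (intro bexI[of _ "\<tau> \<Lambda>"]) simp_all
qed

lemma rank_pos: assumes "nonzero_bundle C S" shows "s \<ge> 1"
proof (rule ccontr)
  assume "\<not> s \<ge> 1"
  then have s0: "s = 0" by simp
  obtain U h p where U: "open_on C U" "h \<in> S U" "h p \<noteq> 0" using assms unfolding nonzero_bundle_def by blast
  have p: "p \<in> U" using bundle_support[OF S_vb U(1,2)] U(3) by blast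
  have pC: "p \<in> C" using open_cofinite[OF U(1) p] p by blast
  let ?V = "U \<inter> NS p"
  have V: "open_on C ?V" "p \<in> ?V" using open_Int[OF U(1) NSo[OF pC]] p pNS[OF pC] by auto
  have "restrict_to ?V h \<in> S ?V" by (rule bundle_restrict[OF S_vb U(1,2) V(1)]) simp
  from section_coords(1)[OF pw_vs FrS[OF pC] V(1) _ this V(2)]
  have "restrict_to ?V h p \<in> vspan pointwise_scale s (\<lambda>j. f p j p)" by simp
  then have "h p = 0" using V(2) by (simp add: s0 vspan_def restrict_to_def)
  then show False using U(3) by simp
qed

text \<open>Generality is applied to the line bundle \<open>det_dual\<close> with k = s. Its
  condition that the degree be at least 1 comes from s + 1 \<le> \<open>h0 C det_dual\<close> \<le>
  degree + 1, together with s \<ge> 1.\<close>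

theorem brill_noether_bound:
  assumes BN: "brill_noether_general C" and nzS: "nonzero_bundle C S"
  shows "int s \<le> - vb_degree pointwise_scale C S"
    and "(int s + 1) * (int g + vb_degree pointwise_scale C S + int s) \<le> int g"
proof -
  interpret A: good_line C g det_dual NS "\<lambda>p _. \<delta> p" by (rule det_dual_data)
  obtain \<sigma> where \<sigma>: "\<sigma> \<in> det_dual C" "\<sigma> \<noteq> 0" "s + 1 \<le> h0 C det_dual" using det_dual_h0 by blast
  show deg: "int s \<le> - vb_degree pointwise_scale C S"
    using A.h0_upper[OF \<sigma>(1,2)] \<sigma>(3) det_dual_degree by linarith
  have "genus C = enat g \<and> line_bundle C det_dual \<and> vb_degree (*) C det_dual = vb_degree (*) C det_dual \<and>
      vb_degree (*) C det_dual \<ge> 1 \<and> s \<ge> 1 \<and> h0 C det_dual \<ge> s + 1"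
    using genus det_dual_line rank_pos[OF nzS] \<sigma>(3) deg det_dual_degree by simp
  from BN[unfolded brill_noether_general_def, rule_format, OF this]
  show "(int s + 1) * (int g + vb_degree pointwise_scale C S + int s) \<le> int g"
    unfolding det_dual_degree by simp
qed

end

subsection \<open>Semistability of the kernel bundle\<close>

context kernel_data begin

lemma subbundle_data:
  assumes S: "subbundle pointwise_scale C S M"
  shows "\<exists>s NS f. sub_data C g L N e r b S s NS f"
proof -
  obtain s where s: "vector_bundle pointwise_scale C s S" using S unfolding subbundle_def by blast
  have M: "S U \<subseteq> M U" if "open_on C U" for U using S that unfolding subbundle_def by blast
  have "\<forall>p\<in>C. \<exists>x. p \<in> fst x \<and> local_frame pointwise_scale C s S (fst x) (snd x)"
  proof
    fix p assume "p \<in> C"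
    then obtain N e where "p \<in> N" "local_frame pointwise_scale C s S N e" using s unfolding vector_bundle_def by blast
    then show "\<exists>x. p \<in> fst x \<and> local_frame pointwise_scale C s S (fst x) (snd x)" by (intro exI[of _ "(N, e)"]) simp
  qed
  from bchoice[OF this] obtain x where x: "\<forall>p\<in>C. p \<in> fst (x p) \<and> local_frame pointwise_scale C s S (fst (x p)) (snd (x p))" ..
  have "sub_data C g L N e r b S s (\<lambda>p. fst (x p)) (\<lambda>p. snd (x p))"
    by (intro sub_data.intro sub_data_axioms.intro kernel_data_axioms) (use s x M in auto)
  then show ?thesis by (intro exI)
qed

lemma h0_eq: "h0 C L = r + 1"
proof (rule antisym)
  have b0: "b 0 \<in> L C" "b 0 \<noteq> 0" using b_in[of 0] b_nonzero[of 0] by auto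
  show "r + 1 \<le> h0 C L" using h0_lower_vindep[OF b0 b_indep] b_in by simp
  obtain B where B: "B \<subseteq> L C" "pw.independent B" "L C \<subseteq> pw.span B" "card B = h0 C L" "finite B"
    by (rule h0_basis[OF b0])
  obtain \<beta> where \<beta>: "bij_betw \<beta> {..<card B} B" using finite_bij_nat[OF B(5)] by blast
  have "\<beta> i \<in> vspan pointwise_scale (Suc r) b" if "i < card B" for i
    using \<beta> B(1) b_span that bij_betwE by blast
  from vindep_card_le[OF pw_vs independent_lessThan[OF \<beta> B(2)] this] show "h0 C L \<le> r + 1" using B(4) by simp
qed

text \<open>The set T of independent classes gives the statement two uses: T empty bounds the
  degree, and once the degree attains that bound every T is empty, so that \<open>h1\<close> is
  0.\<close>

lemma degree_le:
  assumes U: "open_cover C U" and T: "finite T" "\<forall>f\<in>T. cocycle C L U f"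
    and ind: "\<And>c. zero_class C L U (\<lambda>p q x. \<Sum>f\<in>T. c f * f p q x) \<Longrightarrow> \<forall>f\<in>T. c f = 0"
  shows "int (card T) + vb_degree (*) C L \<le> int g + int r"
  using riemann_roch_cech[OF b_in[of 0] b_nonzero[of 0] U T ind] h0_eq by simp

lemma degree_le': "vb_degree (*) C L \<le> int g + int r"
  using degree_le[of "\<lambda>_. C" "{}"] C_open by (simp add: open_cover_def)

lemma h1_zero: assumes "vb_degree (*) C L = int g + int r" shows "h1 C L = 0"
proof -
  have "h1 C L \<le> 0" unfolding h1_def
  proof (rule Sup_least)
    fix x assume "x \<in> {enat (card T) |U T. open_cover C U \<and> finite T \<and> (\<forall>f\<in>T. cocycle C L U f) \<and>
     (\<forall>c. zero_class C L U (\<lambda>p q x. \<Sum>f\<in>T. c f * f p q x) \<longrightarrow> (\<forall>f\<in>T. c f = 0))}"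
    then obtain U and T :: "(('n, 'k) point \<Rightarrow> ('n, 'k) point \<Rightarrow> ('n, 'k) point \<Rightarrow> 'k) set"
      where x: "x = enat (card T)" and T: "open_cover C U" "finite T" "\<forall>f\<in>T. cocycle C L U f"
        "\<forall>c. zero_class C L U (\<lambda>p q x. \<Sum>f\<in>T. c f * f p q x) \<longrightarrow> (\<forall>f\<in>T. c f = 0)"
      unfolding mem_Collect_eq by (elim exE conjE)
    from degree_le[OF T(1-3) T(4)[THEN spec, THEN mp]] assms have "card T = 0" by simp
    then show "x \<le> 0" by (simp add: x zero_enat_def)
  qed
  then show ?thesis by simp
qed

end

section \<open>The numerical argument and the conclusion\<close>

lemma sandwich_eq:
  fixes x a b c y :: int
  assumes "x \<le> a + y" "a \<le> b" "b \<le> c" "x = c + y"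
  shows "x = a + y" "a = b" "b = c"
  using assms by linarith+

text \<open>The chain is s d \<le> s g + s r \<le> (s + 1)(e - s) + s r \<le> r (e - s) + s r = r e.
  Under equality, g > 0 gives e > s, so the last inequality forces r = s + 1; then s g = r (e - s)
  reads g = r (g - (e - s)).\<close>

lemma slope_inequality:
  fixes g r s e d :: int
  assumes "0 \<le> g" "0 < s" "s < r" "s \<le> e" "d \<le> g + r" and bn: "(s + 1) * (g - e + s) \<le> g"
  shows "s * d \<le> r * e"
    and "s * d = r * e \<Longrightarrow> 0 < g \<Longrightarrow> d = g + r \<and> r = s + 1 \<and> r dvd g"
proof -
  have a: "s * g \<le> (s + 1) * (e - s)" using bn by (simp add: algebra_simps)
  have b: "(s + 1) * (e - s) \<le> r * (e - s)" by (rule mult_right_mono) (use assms in auto)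
  have c: "s * d \<le> s * (g + r)" by (rule mult_left_mono) (use assms in auto)
  have e: "r * e = r * (e - s) + s * r" by (simp add: algebra_simps)
  have c': "s * (g + r) = s * g + s * r" by (simp add: algebra_simps)
  have "s * d \<le> (s + 1) * (e - s) + s * r" using order_trans[OF c[unfolded c'] add_right_mono[OF a]] .
  also have "\<dots> \<le> r * e" unfolding e by (rule add_right_mono[OF b])
  finally show "s * d \<le> r * e" .
  assume eq: "s * d = r * e" and g: "0 < g"
  have 1: "s * g = (s + 1) * (e - s)" "(s + 1) * (e - s) = r * (e - s)" "s * d = s * (g + r)"
  proof -
    note sq = sandwich_eq[OF c[unfolded c'] a b eq[unfolded e]]
    show "s * g = (s + 1) * (e - s)" "(s + 1) * (e - s) = r * (e - s)" by (rule sq)+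
    show "s * d = s * (g + r)" unfolding c' by (rule sq)
  qed
  have d: "d = g + r" using 1(3) assms(2) by simp
  have "s * g > 0" using assms(2) g by simp
  then have "e - s \<noteq> 0" using 1(1) by auto
  then have r: "r = s + 1" using 1(2) by simp
  have "g = r * (g - (e - s))" using 1(1) r by (simp add: algebra_simps)
  then show "d = g + r \<and> r = s + 1 \<and> r dvd g" using d r by (metis dvd_triv_left)
qed

theorem lemma4p1:
  fixes C :: "('n::finite, 'k::{alg_closed_field, field_char_0}) point set"
    and L :: "('n, 'k, 'k) fun_sheaf"
    and g r :: nat
    and d :: int
  assumes "smooth_projective_curve C"
    and "genus C = enat g" and "g \<ge> 2"
    and "brill_noether_general C"
    and "line_bundle C L"
    and "globally_generated C L"
    and "vb_degree (*) C L = d"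
    and "h0 C L = r + 1" and "r \<ge> 1"
  shows "semistable pointwise_scale C (kernel_bundle C L) \<and>
    (\<forall>S s. proper_subbundle pointwise_scale C S (kernel_bundle C L) \<and> nonzero_bundle C S \<and>
       vb_rank pointwise_scale C S = s \<and>
       slope pointwise_scale C S = slope pointwise_scale C (kernel_bundle C L) \<longrightarrow>
       h1 C L = 0 \<and> s = r - 1 \<and> d = int g + int r \<and> r dvd g)"
proof -
  have "\<forall>p\<in>C. \<exists>x. p \<in> fst x \<and> local_frame (*) C 1 L (fst x) (snd x)"
  proof
    fix p assume "p \<in> C"
    then obtain N e where "p \<in> N" "local_frame (*) C 1 L N e" using assms(5) unfolding line_bundle_def vector_bundle_def by blast
    then show "\<exists>x. p \<in> fst x \<and> local_frame (*) C 1 L (fst x) (snd x)" by (intro exI[of _ "(N, e)"]) simp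
  qed
  from bchoice[OF this] obtain x where x: "\<forall>p\<in>C. p \<in> fst (x p) \<and> local_frame (*) C 1 L (fst (x p)) (snd (x p))" ..
  let ?N = "\<lambda>p. fst (x p)" and ?e = "\<lambda>p. snd (x p)"
  \<comment> \<open>The sections of L come before \<open>good_curve\<close>, because constancy of
    regular functions, one of its assumptions, is itself deduced from
    \<open>h0 C L > 0\<close>.\<close>
  interpret line_data C L ?N ?e
    by (intro line_data.intro smooth_curve.intro line_data_axioms.intro) (use assms x in auto)
  have h: "h0 C L > 0" using assms(8) by simp
  have gc: "good_curve C g"
    by (intro good_curve.intro good_curve_axioms.intro smooth_curve_axioms assms(2) constants[OF h])
  obtain B where B: "B \<subseteq> L C" "pw.independent B" "L C \<subseteq> pw.span B" "card B = h0 C L" "finite B"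
    by (rule basis_finite_of_dim[OF h])
  obtain b where b0: "bij_betw b {..<card B} B" using finite_bij_nat[OF B(5)] by blast
  then have b: "bij_betw b {..<Suc r} B" using B(4) assms(8) by simp
  have "vspan pointwise_scale (Suc r) b \<subseteq> L C"
  proof
    fix v assume "v \<in> vspan pointwise_scale (Suc r) b"
    then obtain c where v: "v = (\<Sum>i<Suc r. pointwise_scale (c i) (b i))" unfolding vspan_def by blast
    have "b i \<in> L C" if "i \<in> {..<Suc r}" for i using bij_betwE[OF b] B(1) that by blast
    then show "v \<in> L C" unfolding v by (intro pw.subspace_sum[OF global_subspace] pw.subspace_scale[OF global_subspace])
  qed
  then have span: "L C = vspan pointwise_scale (Suc r) b" using span_finite_vspan[OF b] B(3) by blast
  interpret kernel_data C g L ?N ?e r b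
    by (intro kernel_data.intro good_line.intro kernel_data_axioms.intro gc line_data_axioms assms
      independent_lessThan[OF b B(2)] span)
  have slM: "slope pointwise_scale C M = - (of_int d / of_nat r)"
    by (simp add: slope_def kernel_rank kernel_degree assms(7))
  \<comment> \<open>Full rank is kept as a separate alternative: there S has the same sections as M
    and the same slope, which semistability admits and properness of S contradicts.\<close>
  have key: "(vb_rank pointwise_scale C S = r \<and> slope pointwise_scale C S = slope pointwise_scale C M \<and> (\<forall>U. open_on C U \<longrightarrow> S U = M U)) \<or>
      (slope pointwise_scale C S \<le> slope pointwise_scale C M \<and>
       (slope pointwise_scale C S = slope pointwise_scale C M \<longrightarrow>
         d = int g + int r \<and> int r = int (vb_rank pointwise_scale C S) + 1 \<and> int r dvd int g))"
    if S: "subbundle pointwise_scale C S M" "nonzero_bundle C S" for S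
  proof -
    obtain s NS f where sd: "sub_data C g L ?N ?e r b S s NS f" using subbundle_data[OF S(1)] by (elim exE)
    interpret sub_data C g L ?N ?e r b S s NS f by (rule sd)
    have rank: "vb_rank pointwise_scale C S = s" by (rule vb_rank_eq[OF pw_vs S_vb])
    show ?thesis
    proof (cases "s = r")
      case True
      show ?thesis using full_rank_eq[OF True] full_rank_degree[OF True] rank True
        by (simp add: slope_def kernel_rank)
    next
      case False
      define a where "a = - vb_degree pointwise_scale C S"
      have s: "0 < int s" "int s < int r" using rank_pos[OF S(2)] rank_le False by auto
      have bn: "int s \<le> a" "(int s + 1) * (int g - a + int s) \<le> int g"
        using brill_noether_bound[OF assms(4) S(2)] by (simp_all add: a_def)
      have dg: "d \<le> int g + int r" using degree_le' assms(7) by simp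
      note ineq = slope_inequality[OF _ s bn(1) dg bn(2)]
      have slS: "slope pointwise_scale C S = - (of_int a / of_nat s)" by (simp add: slope_def rank a_def)
      \<comment> \<open>Both slopes are negated quotients, so clearing denominators reverses the
        comparison into the integer inequality of \<open>slope_inequality\<close>.\<close>
      have le: "slope pointwise_scale C S \<le> slope pointwise_scale C M \<longleftrightarrow> of_int (int s * d) \<le> (of_int (int r * a) :: rat)"
        unfolding slS slM using s by (simp add: field_simps)
      have eq: "slope pointwise_scale C S = slope pointwise_scale C M \<longleftrightarrow> of_int (int s * d) = (of_int (int r * a) :: rat)"
        unfolding slS slM using s by (auto simp: field_simps)
      show ?thesis unfolding le eq of_int_le_iff of_int_eq_iff rank
        using ineq assms(3) by auto
    qed
  qed
  have "semistable pointwise_scale C M"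
    unfolding semistable_def
  proof (intro conjI allI impI)
    show "\<exists>n. vector_bundle pointwise_scale C n M" using kernel_vector_bundle by (rule exI)
    show "nonzero_bundle C M" by (rule kernel_nonzero)
    fix S assume "subbundle pointwise_scale C S M \<and> nonzero_bundle C S"
    then show "slope pointwise_scale C S \<le> slope pointwise_scale C M" using key[of S] by auto
  qed
  moreover have "h1 C L = 0 \<and> s = r - 1 \<and> d = int g + int r \<and> r dvd g"
    if S: "proper_subbundle pointwise_scale C S M \<and> nonzero_bundle C S \<and> vb_rank pointwise_scale C S = s \<and>
       slope pointwise_scale C S = slope pointwise_scale C M" for S s
  proof -
    have "d = int g + int r \<and> int r = int s + 1 \<and> int r dvd int g"
      using key[of S] S unfolding proper_subbundle_def by auto
    then show ?thesis using h1_zero assms(7) by auto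
  qed
  ultimately show ?thesis by blast
qed

end
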